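(* Let $\sigma\colon\Omega\to\Omega$ be an invertible measurable transformation and let $\mathbb P$ be an ergodic invariant probability measure for $\sigma$. Let $H$ be a separable Hilbert space and let $A\colon\Omega\to\mathsf{SHS}$ (measurable) be the generator of an operator cocycle satisfying $\int\log\|A_\omega\|_{\mathsf{SHS}}\,d\mathbb P(\omega)<\infty$. Let $\bar\Omega=\Omega\times\mathsf{SHS}^{\mathbb Z}$, $\bar\sigma=\sigma\times s$ and $\bar{\mathbb P}=\mathbb P\times\gamma^{\mathbb Z}$ be as defined in the context. For each $\epsilon>0$ define a new cocycle $A^\epsilon\colon\bar\Omega\to\mathsf{SHS}$ over $\bar\sigma$ with generator $A^\epsilon(\bar\omega)=A(\omega)+\epsilon\Delta_0$, where $\bar\omega=(\omega,(\Delta_n)_{n\in\mathbb Z})$. Then the Lyapunov exponents of $A^\epsilon$ (listed with multiplicity) converge to those of $A$ as $\epsilon\to0$; that is, for each $j\ge1$, $\mu_j(A^\epsilon)\to\mu_j(A)$ as $\epsilon\to 0$.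
   Context: $H$ is a separable infinite-dimensional real Hilbert space with orthonormal basis $e_1,e_2,\ldots$. For an operator $A$ on $H$, $\|A\|_{\mathsf{HS}}^2=\sum_{i,j}\langle Ae_i,e_j\rangle^2$ and $\|A\|_{\mathsf{SHS}}^2=\sum_{i,j}2^{2(i+j)}\langle Ae_i,e_j\rangle^2$; $\mathsf{HS}$ and $\mathsf{SHS}$ are the sets of operators for which the respective norm is finite. $\gamma$ is the probability measure on $\mathsf{SHS}$ that is the law of the random operator $\Delta$ whose matrix entries are independent normal random variables with mean $0$, the $(i,j)$ entry having standard deviation $3^{-(i+j)}$. The space $\bar\Omega=\Omega\times\mathsf{SHS}^{\mathbb Z}$ has points $\bar\omega=(\omega,(\Delta_n)_{n\in\mathbb Z})$; $s$ is the left shift on $\mathsf{SHS}^{\mathbb Z}$; $\bar\sigma=\sigma\times s$; $\bar{\mathbb P}=\mathbb P\times\gamma^{\mathbb Z}$ is invariant and ergodic under $\bar\sigma$. The cocycle with generator $A$ is $A^{(n)}_\omega=A_{\sigma^{n-1}\omega}\cdots A_\omega$; the perturbed cocycle is $A^{\epsilon\,(n)}_{\bar\omega}=(A_{\sigma^{n-1}\omega}+\epsilon\Delta_{n-1})\cdots(A_\omega+\epsilon\Delta_0)$. With $s_1(B)\ge s_2(B)\ge\cdots$ denoting the singular values of a compact operator $B$, the Lyapunov exponents with multiplicity $\mu_1\ge\mu_2\ge\cdots\ge-\infty$ of a cocycle are the almost surely constant limits $\mu_j=\lim_{n\to\infty}\frac1n\log s_j(A^{(n)}_\omega)\in[-\infty,\infty)$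 (and similarly for $A^\epsilon$). Convergence to $-\infty$ is understood in the extended real line. *)

theory Defs
  imports "HOL-Probability.Probability"
begin

definition orthonormal_seq :: "(nat \<Rightarrow> 'h::real_inner) \<Rightarrow> bool" where
  "orthonormal_seq e \<longleftrightarrow> (\<forall>i j. e i \<bullet> e j = (if i = j then 1 else 0))"

text \<open>Bases are indexed from 0, so \<open>e i\<close> plays the role of the basis vector with index \<open>i + 1\<close>;
  this is why \<open>Suc\<close> appears in the weights and standard deviations below.\<close>

definition orthonormal_basis :: "(nat \<Rightarrow> 'h::real_inner) \<Rightarrow> bool" where
  "orthonormal_basis e \<longleftrightarrow> orthonormal_seq e \<and> closure (span (range e)) = UNIV"

definition matrix_entry ::
    "(nat \<Rightarrow> 'h::real_inner) \<Rightarrow> nat \<times> nat \<Rightarrow> ('h \<Rightarrow>\<^sub>L 'h) \<Rightarrow> real" where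
  "matrix_entry e = (\<lambda>(i, j) B. blinfun_apply B (e i) \<bullet> e j)"

definition SHS_term ::
    "(nat \<Rightarrow> 'h::real_inner) \<Rightarrow> ('h \<Rightarrow>\<^sub>L 'h) \<Rightarrow> nat \<times> nat \<Rightarrow> real" where
  "SHS_term e B = (\<lambda>(i, j). 2 ^ (2 * (Suc i + Suc j)) * (matrix_entry e (i, j) B)\<^sup>2)"

definition SHS :: "(nat \<Rightarrow> 'h::real_inner) \<Rightarrow> ('h \<Rightarrow>\<^sub>L 'h) set" where
  "SHS e = {B. SHS_term e B summable_on UNIV}"

definition SHS_norm :: "(nat \<Rightarrow> 'h::real_inner) \<Rightarrow> ('h \<Rightarrow>\<^sub>L 'h) \<Rightarrow> real" where
  "SHS_norm e B = sqrt (\<Sum>\<^sub>\<infinity>p\<in>UNIV. SHS_term e B p)"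

text \<open>The Borel sigma-algebra of the SHS norm (not of the operator norm carried by the type).\<close>

definition SHS_space :: "(nat \<Rightarrow> 'h::real_inner) \<Rightarrow> ('h \<Rightarrow>\<^sub>L 'h) measure" where
  "SHS_space e =
     sigma (SHS e)
       {U. openin (Metric_space.mtopology (SHS e) (\<lambda>B C. SHS_norm e (B - C))) U}"

text \<open>The law \<open>\<gamma>\<close>. It is determined uniquely, since the matrix entries generate
  the sigma-algebra of \<^const>\<open>SHS_space\<close>.\<close>

definition gaussian_SHS_law ::
    "(nat \<Rightarrow> 'h::real_inner) \<Rightarrow> ('h \<Rightarrow>\<^sub>L 'h) measure \<Rightarrow> bool" where
  "gaussian_SHS_law e \<gamma> \<longleftrightarrow>
     prob_space \<gamma> \<and> space \<gamma> = SHS e \<and> sets \<gamma> = sets (SHS_space e) \<and>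
     prob_space.indep_vars \<gamma> (\<lambda>_. borel) (matrix_entry e) UNIV \<and>
     (\<forall>i j. distributed \<gamma> lborel (matrix_entry e (i, j))
              (normal_density 0 ((1 / 3) ^ (Suc i + Suc j))))"

definition invertible_measurable :: "'a measure \<Rightarrow> ('a \<Rightarrow> 'a) \<Rightarrow> bool" where
  "invertible_measurable M T \<longleftrightarrow>
     bij_betw T (space M) (space M) \<and> T \<in> M \<rightarrow>\<^sub>M M \<and> the_inv_into (space M) T \<in> M \<rightarrow>\<^sub>M M"

definition ergodic_invariant :: "'a measure \<Rightarrow> ('a \<Rightarrow> 'a) \<Rightarrow> bool" where
  "ergodic_invariant M T \<longleftrightarrow>
     prob_space M \<and> T \<in> M \<rightarrow>\<^sub>M M \<and> distr M M T = M \<and>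
     (\<forall>B\<in>sets M. T -` B \<inter> space M = B \<longrightarrow> measure M B = 0 \<or> measure M B = 1)"

definition perturbed_measure :: "'w measure \<Rightarrow> 'b measure \<Rightarrow> ('w \<times> (int \<Rightarrow> 'b)) measure" where
  "perturbed_measure P \<gamma> = P \<Otimes>\<^sub>M (\<Pi>\<^sub>M n\<in>UNIV. \<gamma>)"

definition perturbed_shift :: "('w \<Rightarrow> 'w) \<Rightarrow> 'w \<times> (int \<Rightarrow> 'b) \<Rightarrow> 'w \<times> (int \<Rightarrow> 'b)" where
  "perturbed_shift \<sigma> = (\<lambda>(\<omega>, \<Delta>). (\<sigma> \<omega>, \<lambda>n. \<Delta> (n + 1)))"

definition perturbed_generator ::
    "('w \<Rightarrow> 'h::real_normed_vector \<Rightarrow>\<^sub>L 'h) \<Rightarrow> real \<Rightarrow> 'w \<times> (int \<Rightarrow> 'h \<Rightarrow>\<^sub>L 'h) \<Rightarrow> 'h \<Rightarrow>\<^sub>L 'h" where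
  "perturbed_generator A \<epsilon> = (\<lambda>(\<omega>, \<Delta>). A \<omega> + \<epsilon> *\<^sub>R \<Delta> 0)"

fun cocycle ::
    "('a \<Rightarrow> 'a) \<Rightarrow> ('a \<Rightarrow> 'h::real_normed_vector \<Rightarrow>\<^sub>L 'h) \<Rightarrow> nat \<Rightarrow> 'a \<Rightarrow> 'h \<Rightarrow>\<^sub>L 'h" where
  "cocycle T A 0 \<omega> = id_blinfun"
| "cocycle T A (Suc n) \<omega> = A ((T ^^ n) \<omega>) o\<^sub>L cocycle T A n \<omega>"

text \<open>The square roots of the eigenvalues of \<open>B\<^sup>* B\<close>, in decreasing order with multiplicity. The
  vectors \<open>f k\<close> are the corresponding eigenvectors; the last clause says that no nonzero
  eigenvalue is left out. If \<open>B\<close> has finite rank, the list is padded with zeros. For a compact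
  operator on an infinite-dimensional Hilbert space exactly one such sequence exists.\<close>

definition singular_value_seq ::
    "('h::{real_inner,complete_space} \<Rightarrow>\<^sub>L 'h) \<Rightarrow> (nat \<Rightarrow> real) \<Rightarrow> bool" where
  "singular_value_seq B s \<longleftrightarrow>
     decseq s \<and> (\<forall>k. 0 \<le> s k) \<and>
     (\<exists>f. orthonormal_seq f \<and>
          (\<forall>k. adjoint (blinfun_apply B) (blinfun_apply B (f k)) = (s k)\<^sup>2 *\<^sub>R f k) \<and>
          (\<forall>x. (\<forall>k. x \<bullet> f k = 0) \<longrightarrow> blinfun_apply B x = 0))"

text \<open>Singular values and Lyapunov exponents are numbered from \<open>j = 1\<close>.\<close>

definition singular_value :: "nat \<Rightarrow> ('h::{real_inner,complete_space} \<Rightarrow>\<^sub>L 'h) \<Rightarrow> real" where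
  "singular_value j B = (THE s. singular_value_seq B s) (j - 1)"

text \<open>Logarithm of a nonnegative real with value \<open>-\<infinity>\<close> at 0 (whereas \<open>ln 0 = 0\<close>).\<close>

definition log_ext :: "real \<Rightarrow> ereal" where
  "log_ext x = (if x = 0 then - \<infinity> else ereal (ln x))"

text \<open>Integral of an extended real function as positive part minus negative part. As
  \<open>\<infinity> - \<infinity> = \<infinity>\<close> in \<^typ>\<open>ereal\<close>, the integral is less than \<open>\<infinity>\<close> iff the
  positive part has finite integral; the value \<open>-\<infinity>\<close> is allowed.\<close>

definition integral_ext :: "'a measure \<Rightarrow> ('a \<Rightarrow> ereal) \<Rightarrow> ereal" where
  "integral_ext M f =
     enn2ereal (\<integral>\<^sup>+ x. e2ennreal (f x) \<partial>M) - enn2ereal (\<integral>\<^sup>+ x. e2ennreal (- f x) \<partial>M)"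

definition has_lyapunov_exponent ::
    "'a measure \<Rightarrow> ('a \<Rightarrow> 'a) \<Rightarrow> ('a \<Rightarrow> 'h::{real_inner,complete_space} \<Rightarrow>\<^sub>L 'h) \<Rightarrow> nat \<Rightarrow> ereal \<Rightarrow> bool" where
  "has_lyapunov_exponent M T A j \<mu> \<longleftrightarrow>
     \<mu> < \<infinity> \<and>
     (AE \<omega> in M. (\<lambda>n. ereal (1 / real n) * log_ext (singular_value j (cocycle T A n \<omega>))) \<longlonglongrightarrow> \<mu>)"

definition lyapunov_exponent ::
    "'a measure \<Rightarrow> ('a \<Rightarrow> 'a) \<Rightarrow> ('a \<Rightarrow> 'h::{real_inner,complete_space} \<Rightarrow>\<^sub>L 'h) \<Rightarrow> nat \<Rightarrow> ereal" where
  "lyapunov_exponent M T A j = (THE \<mu>. has_lyapunov_exponent M T A j \<mu>)"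

end

theory Submission
 imports Defs "Jordan_Normal_Form.Determinant" "HOL-Real_Asymp.Real_Asymp"
  "HOL-Computational_Algebra.Fundamental_Theorem_Algebra"
begin

text \<open>The sum \<open>\<Lambda>\<^sub>k\<close> of the first \<open>k\<close> exponents is the growth rate of \<open>vol k\<close>, the norm of the \<open>k\<close>-th
 exterior power; it exists by Kingman's theorem, and the exponents are differences of consecutive
 sums. Upper semicontinuity of \<open>\<Lambda>\<^sub>k\<close> in \<open>\<epsilon>\<close>: \<open>\<Lambda>\<^sub>k\<close> is an infimum of block averages, each of which is
 upper semicontinuous by dominated convergence. Lower bound: on a block of length about
 \<open>M \<bar>ln \<epsilon>\<bar>\<close> the noise is switched on one factor at a time. Conditionally on the
 other factors, a determinant in the new Gaussian entries has bounded negative moments relative to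
 its noise-free value, so the expected total loss of \<open>ln vol k\<close> is of smaller order than the
 block. Noisy blocks are glued along \<open>k\<close> by \<open>k\<close> coordinate minors, at a cost
 \<open>O (\<bar>ln \<epsilon>\<bar>)\<close> each, which is negligible per step as \<open>M\<close> grows.\<close>

text \<open>The block length is squeezed from two sides. Switching on one factor costs, in the mean,
  a fraction of order 1 / |ln eps| of the gap between an a priori upper bound for ln vol and its
  current mean; by a Gronwall argument this gap stays under control only over O(|ln eps|) steps.
  Shorter blocks are too expensive, because the k noise entries that join two blocks each carry a
  factor eps. Hence M is fixed first and eps is made small afterwards. The operators need not be
  invertible and nothing bounds them from below, so losses are measured by moments of order
  -\<theta>, uniformly over all other factors: along one Gaussian direction a determinant is a
  polynomial of degree at most k, and rotation invariance reduces any number of noise entries to k *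
  k directions. The bases 2 of the weights and 3 of the noise meet in \<open>minor_lower\<close>:
  truncation at level m has error of order 2 ^ -m, while the noise there still has size of order 3 ^
  -m, a fixed power of it. All losses are thus powers of the conditioning of a product, and their
  logarithms are linear in it.\<close>

abbreviation (input) ap where "ap \<equiv> blinfun_apply"
notation (input) blinfun_compose (infixl "oL" 55)
notation (input) scaleR (infixr "*R" 75)
abbreviation (input) LIMSEQ' (infix "---->" 60) where "X ----> L \<equiv> X \<longlonglongrightarrow> L"
abbreviation (input) ev (binder "EV " 10) where "ev Q \<equiv> eventually Q sequentially"
abbreviation (input) ev_right (binder "ER " 10) where "ev_right Q \<equiv> eventually Q (at_right (0 :: real))"
type_synonym 'h op = "'h \<Rightarrow>\<^sub>L 'h"
lemmas int_add = Bochner_Integration.integrable_add and int_sum = Bochner_Integration.integrable_sum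
 and int_diff = Bochner_Integration.integrable_diff and integ_add = Bochner_Integration.integral_add

lemma INFM_Suc_iff: "(\<exists>\<^sub>\<infinity>n. Q (Suc n)) \<longleftrightarrow> (\<exists>\<^sub>\<infinity>n. Q n)"
 using eventually_sequentially_Suc[of "%n. \<not> Q n"]
 unfolding frequently_def cofinite_eq_sequentially by simp

section \<open>Subadditive and additive ergodic theorems\<close>

locale ergodic_system = prob_space M for M :: "'a measure" +
 fixes T :: "'a => 'a"
 assumes ergodic: "ergodic_invariant M T"
begin

lemma T_measurable [measurable]: "T \<in> M \<rightarrow>\<^sub>M M"
 and T_distr: "distr M M T = M"
 using ergodic by (auto simp: ergodic_invariant_def)

lemma iter_measurable [measurable]: "T ^^ n \<in> M \<rightarrow>\<^sub>M M"
 by (induction n) (auto simp: id_def intro: measurable_comp)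

lemma iter_distr: "distr M M (T ^^ n) = M"
proof (induction n)
 case (Suc n)
 have "distr M M (T ^^ Suc n) = distr (distr M M (T ^^ n)) M T"
  by (subst distr_distr) auto
 then show ?case using Suc T_distr by (simp only:)
qed (simp add: id_def distr_id2)

lemma AE_iter:
 assumes "AE x in M. Q x"
 shows "AE x in M. \<forall>n. Q ((T ^^ n) x)"
proof -
 have "AE x in M. Q ((T ^^ n) x)" for n
 proof -
  have "AE x in distr M M (T ^^ n). Q x" by (simp only: iter_distr assms)
  then show ?thesis by (rule AE_distrD[rotated]) simp
 qed
 then show ?thesis by (simp add: AE_all_countable)
qed

lemma integrable_iter: "integrable M f ==> integrable M (%x. f ((T ^^ n) x))"
 for f :: "'a => real"
 by (rule integrable_distr[OF iter_measurable]) (simp add: iter_distr)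

lemma integral_iter: "integrable M f ==> (\<integral>x. f ((T ^^ n) x) \<partial>M) = (\<integral>x. f x \<partial>M)"
 for f :: "'a => real"
 using integral_distr[OF iter_measurable, of f n] iter_distr[of n] by simp

lemma iter_space: "x \<in> space M ==> (T ^^ n) x \<in> space M"
 using measurable_space[OF iter_measurable] .

text \<open>Ergodicity speaks of strictly invariant sets. The points that visit \<open>B\<close>
  infinitely often form such a set, and since \<open>T\<close> preserves the measure, the one-sided
  inclusion already forces it to agree with \<open>B\<close> almost everywhere.\<close>

lemma ae_invariant_01:
 assumes B [measurable]: "B \<in> sets M" and inv: "AE x in M. T x \<in> B --> x \<in> B"
 shows "prob B = 0 \<or> prob B = 1"
proof -
 let ?B = "{x\<in>space M. \<exists>\<^sub>\<infinity>n. (T ^^ n) x \<in> B}"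
 have [measurable]: "?B \<in> sets M"
  unfolding INFM_nat by measurable
 have eq: "(\<exists>\<^sub>\<infinity>n. (T ^^ n) (T x) \<in> B) \<longleftrightarrow> (\<exists>\<^sub>\<infinity>n. (T ^^ n) x \<in> B)" for x
 proof -
  have "(\<exists>\<^sub>\<infinity>n. (T ^^ n) (T x) \<in> B) \<longleftrightarrow> (\<exists>\<^sub>\<infinity>n. (T ^^ Suc n) x \<in> B)"
   by (simp add: funpow_swap1)
  also have "... \<longleftrightarrow> (\<exists>\<^sub>\<infinity>n. (T ^^ n) x \<in> B)"
   by (rule INFM_Suc_iff)
  finally show ?thesis .
 qed
 have "T -` ?B \<inter> space M = ?B"
  using eq measurable_space[OF T_measurable] by auto
 then have 01: "prob ?B = 0 \<or> prob ?B = 1"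
  using ergodic \<open>?B \<in> sets M\<close> by (auto simp: ergodic_invariant_def)
 have TB: "prob (T -` B \<inter> space M) = prob B"
  using measure_distr[OF T_measurable B] T_distr by simp
 have "AE x in M. x \<in> B --> T x \<in> B"
 proof -
  have "prob (B - (T -` B \<inter> space M)) = 0"
  proof -
   have "prob (B - (T -` B \<inter> space M)) = prob (B \<union> (T -` B \<inter> space M)) - prob (T -` B \<inter> space M)"
    by (subst finite_measure_Diff[symmetric]) (auto intro!: arg_cong[where f=prob])
   also have "prob (B \<union> (T -` B \<inter> space M)) = prob B"
    by (rule finite_measure_eq_AE) (use inv in auto)
   finally show ?thesis using TB by simp
  qed
  then have "AE x in M. x \<notin> B - (T -` B \<inter> space M)"
   by (subst (asm) prob_eq_0) auto
  then show ?thesis using AE_space by eventually_elim auto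
 qed
 from AE_iter[OF this] AE_iter[OF inv]
 have "AE x in M. x \<in> ?B \<longleftrightarrow> x \<in> B"
  using AE_space
 proof eventually_elim
  case (elim x)
  have up: "(T ^^ n) x \<in> B --> (T ^^ Suc n) x \<in> B" and dn: "(T ^^ Suc n) x \<in> B --> (T ^^ n) x \<in> B" for n
   using elim by simp_all
  have "(T ^^ n) x \<in> B \<longleftrightarrow> x \<in> B" for n
   by (induction n) (use up dn in auto)
  then show ?case using elim(3) by (simp add: INFM_const)
 qed
 then have "prob ?B = prob B" by (intro finite_measure_eq_AE) auto
 then show ?thesis using 01 by simp
qed

text \<open>If the conclusion fails, almost every point starts a finite orbit segment along which \<open>g\<close> grows
 at most with slope below \<open>\<Lambda>\<close>. Covering long orbits greedily by such segments makes the mean of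
 \<open>g n\<close> too small.\<close>

lemma subadditive_greedy_bound:
 fixes g :: "nat => 'a => real"
 assumes sub: "\<And>i n m. 0 < n ==> 0 < m ==> g (n + m) ((T ^^ i) x) <= g n ((T ^^ i) x) + g m ((T ^^ (i + n)) x)"
  and good: "\<And>i. (T ^^ i) x \<notin> D ==> \<exists>m>0. m <= N \<and> g m ((T ^^ i) x) <= r * real m"
  and h: "\<And>y. h y = \<bar>g 1 y\<bar> + \<bar>r\<bar>"
  and n: "0 < n"
 shows "g n ((T ^^ i) x) <= r * real n + (\<Sum>j<n. h ((T ^^ (i + j)) x) * indicator D ((T ^^ (i + j)) x))
   + (\<Sum>j\<in>{n - N..<n}. h ((T ^^ (i + j)) x))"
 using n
proof (induction n arbitrary: i rule: less_induct)
 case (less n)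
 have h0: "h y \<ge> 0" for y by (simp add: h)
 let ?S = "%i n. (\<Sum>j<n. h ((T ^^ (i + j)) x) * indicator D ((T ^^ (i + j)) x))"
 let ?E = "%i n. (\<Sum>j\<in>{n - N..<n}. h ((T ^^ (i + j)) x))"
 have S0: "?S i n \<ge> 0" "?E i n \<ge> 0" for i n by (auto intro!: sum_nonneg simp: h0)
 have step: "g n ((T ^^ i) x) <= r * real n + ?S i n + ?E i n"
  if m: "0 < m" "m < n" and gm: "g m ((T ^^ i) x) <= r * real m + ?S i m" for m
 proof -
  have "g n ((T ^^ i) x) <= g m ((T ^^ i) x) + g (n - m) ((T ^^ (i + m)) x)"
   using sub[of m "n - m" i] m by simp
  also have "g (n - m) ((T ^^ (i + m)) x) <= r * real (n - m) + ?S (i + m) (n - m) + ?E (i + m) (n - m)"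
   using less.IH[of "n - m" "i + m"] m by simp
  also have "?S (i + m) (n - m) = (\<Sum>j\<in>{m..<n}. h ((T ^^ (i + j)) x) * indicator D ((T ^^ (i + j)) x))"
   by (rule sum.reindex_bij_witness[where i="%j. j - m" and j="%j. j + m"]) (auto simp: algebra_simps)
  also have "?E (i + m) (n - m) <= ?E i n"
  proof -
   have "?E (i + m) (n - m) = (\<Sum>j\<in>{n - m - N + m..<n}. h ((T ^^ (i + j)) x))"
    by (rule sum.reindex_bij_witness[where i="%j. j - m" and j="%j. j + m"]) (use m in \<open>auto simp: algebra_simps\<close>)
   also have "... <= ?E i n" by (rule sum_mono2) (use m in \<open>auto simp: h0\<close>)
   finally show ?thesis .
  qed
  also have "?S i m + (\<Sum>j\<in>{m..<n}. h ((T ^^ (i + j)) x) * indicator D ((T ^^ (i + j)) x)) = ?S i n"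
   using m by (subst sum.union_disjoint[symmetric]) (auto intro!: sum.cong simp: lessThan_atLeast0)
  then have "(\<Sum>j\<in>{m..<n}. h ((T ^^ (i + j)) x) * indicator D ((T ^^ (i + j)) x)) = ?S i n - ?S i m" by simp
  finally show ?thesis using gm m by (simp add: of_nat_diff algebra_simps)
 qed
 show ?case
 proof (cases "(T ^^ i) x \<in> D")
  case True
  have g1: "g 1 ((T ^^ i) x) <= r * real 1 + ?S i 1"
   using True by (simp add: h)
  show ?thesis
  proof (cases "n = 1")
   case True
   then show ?thesis using g1 S0(2)[of i 1] by simp
  next
   case False
   then show ?thesis using step[of 1] g1 less.prems by simp
  qed
 next
  case False
  then obtain m where m: "m > 0" "m <= N" "g m ((T ^^ i) x) <= r * real m" using good by blast
  show ?thesis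
  proof (cases "m < n")
   case True
   then show ?thesis using step[of m] m S0(1)[of i m] by simp
  next
   case False
   \<comment> \<open>The good segment would overrun the end, so \<open>n <= N\<close> and all
     positions lie in the final stretch, where \<open>h\<close> pays for steps of length 1.\<close>
   have lin: "g k ((T ^^ i) x) <= (\<Sum>j<k. g 1 ((T ^^ (i + j)) x))" if "0 < k" for k
    using that
   proof (induction k)
    case (Suc k)
    then show ?case
     using sub[of k 1 i] by (cases "k = 0") (auto simp: algebra_simps)
   qed simp
   have "g n ((T ^^ i) x) <= (\<Sum>j<n. g 1 ((T ^^ (i + j)) x))" using lin less.prems by simp
   also have "... <= (\<Sum>j<n. r + h ((T ^^ (i + j)) x))"
    by (rule sum_mono) (simp add: h abs_if)
   also have "... = r * real n + ?E i n"
    using False m by (simp add: sum.distrib lessThan_atLeast0)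
   finally show ?thesis using S0(1)[of i n] by simp
  qed
 qed
qed

text \<open>By \<open>ae_invariant_01\<close>, failure on a set of positive measure is failure
  almost everywhere; then long orbits can be covered by segments of small slope, against the lower
  bound on the means.\<close>

lemma subadditive_ergodic_lower:
 fixes g :: "nat => 'a => real"
 assumes int [measurable]: "\<And>n. 0 < n ==> integrable M (g n)"
  and sub: "\<And>n m. 0 < n ==> 0 < m ==> AE x in M. g (n + m) x <= g n x + g m ((T ^^ n) x)"
  and ge: "\<And>n. 0 < n ==> real n * L <= (\<integral>x. g n x \<partial>M)"
  and r: "r < L"
 shows "AE x in M. EV n. r * real n <= g n x"
proof -
 define r1 where "r1 = (r + L) / 2"
 have r1: "r < r1" "r1 < L" using r by (auto simp: r1_def)
 \<comment> \<open>The slopes \<open>q k\<close> increase strictly to \<open>r1\<close>: passing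
   from \<open>T x\<close> to \<open>x\<close> costs the constant \<open>g 1 x\<close>, which the
   next larger slope absorbs, so \<open>B\<close> is almost invariant.\<close>
 define q where "q k = r1 - 1 / real (Suc k)" for k
 define B where "B = {x\<in>space M. \<exists>k. \<exists>\<^sub>\<infinity>n. g (Suc n) x < q k * real (Suc n)}"
 have gm [measurable]: "g (Suc n) \<in> borel_measurable M" for n using int[of "Suc n"] by simp
 have [measurable]: "B \<in> sets M"
  unfolding B_def INFM_nat by measurable
 have "AE x in M. \<forall>n m. 0 < n --> 0 < m --> g (n + m) x <= g n x + g m ((T ^^ n) x)"
  using sub by (simp add: AE_all_countable)
 then have subA: "AE x in M. \<forall>i n m. 0 < n --> 0 < m -->
   g (n + m) ((T ^^ i) x) <= g n ((T ^^ i) x) + g m ((T ^^ (i + n)) x)"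
 proof -
  have "(T ^^ (i + n)) x = (T ^^ n) ((T ^^ i) x)" for i n x
   by (subst add.commute) (simp add: funpow_add)
  then show ?thesis using AE_iter[OF \<open>AE x in M. \<forall>n m. _ n m x\<close>] by simp
 qed
 have "AE x in M. T x \<in> B --> x \<in> B"
  using subA AE_space
 proof eventually_elim
  case (elim x)
  show ?case
  proof
   assume "T x \<in> B"
   then obtain k where k: "\<exists>\<^sub>\<infinity>n. g (Suc n) (T x) < q k * real (Suc n)" by (auto simp: B_def)
   have qk: "q k < q (Suc k)"
    unfolding q_def by (intro diff_strict_left_mono divide_strict_left_mono) auto
   have "LIM n sequentially. (q (Suc k) - q k) * real n :> at_top"
    using qk by (intro filterlim_tendsto_pos_mult_at_top[OF tendsto_const]) (auto simp: filterlim_real_sequentially)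
   then have "EV n. (q (Suc k) - q k) * real n \<ge> g 1 x - q (Suc k) * 2 + 2 * \<bar>q k\<bar> + 2 * \<bar>q (Suc k)\<bar>"
    by (simp add: filterlim_at_top)
   then have ev: "\<forall>\<^sub>F n in cofinite. (q (Suc k) - q k) * real n \<ge> g 1 x - q (Suc k) * 2 + 2 * \<bar>q k\<bar> + 2 * \<bar>q (Suc k)\<bar>"
    by (simp add: cofinite_eq_sequentially)
   have "\<exists>\<^sub>\<infinity>n. g (Suc (Suc n)) x < q (Suc k) * real (Suc (Suc n))"
   proof (rule frequently_rev_mp[OF k], rule eventually_mono[OF ev], rule impI)
    fix n assume a: "(q (Suc k) - q k) * real n \<ge> g 1 x - q (Suc k) * 2 + 2 * \<bar>q k\<bar> + 2 * \<bar>q (Suc k)\<bar>"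
     and b: "g (Suc n) (T x) < q k * real (Suc n)"
    have "g (1 + Suc n) x <= g 1 x + g (Suc n) (T x)"
     using elim(1)[rule_format, of 1 "Suc n" 0] by simp
    then show "g (Suc (Suc n)) x < q (Suc k) * real (Suc (Suc n))"
     using a b by (simp add: algebra_simps abs_if split: if_splits)
   qed
   then have "\<exists>\<^sub>\<infinity>n. g (Suc n) x < q (Suc k) * real (Suc n)"
    unfolding INFM_nat by (metis Suc_lessD lessI less_trans_Suc)
   then show "x \<in> B" using elim(2) by (auto simp: B_def)
  qed
 qed
 then have 01: "prob B = 0 \<or> prob B = 1" by (intro ae_invariant_01) auto
 have "prob B \<noteq> 1"
 proof
  assume "prob B = 1"
  then have AB: "AE x in M. x \<in> B" by (subst (asm) prob_eq_1) auto
  have ex: "AE x in M. \<exists>n. g (Suc n) x < r1 * real (Suc n)"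
   using AB
  proof eventually_elim
   case (elim x)
   then obtain k n where "g (Suc n) x < q k * real (Suc n)" by (auto simp: B_def INFM_nat)
   moreover have "q k * real (Suc n) <= r1 * real (Suc n)" by (intro mult_right_mono) (auto simp: q_def)
   ultimately show ?case by (intro exI[of _ n]) linarith
  qed
  define D where "D N = {x\<in>space M. \<forall>n<N. r1 * real (Suc n) < g (Suc n) x}" for N
  have [measurable]: "D N \<in> sets M" for N unfolding D_def by measurable
  define h where "h y = \<bar>g 1 y\<bar> + \<bar>r1\<bar>" for y
  have inth: "integrable M h" unfolding h_def using int[of 1] by auto
  have [measurable]: "h \<in> borel_measurable M" using inth by auto
  \<comment> \<open>\<open>D N\<close> collects the points without a good segment of length at most
    \<open>N\<close>. Almost every point leaves it eventually, so its mass under \<open>h\<close>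
    becomes negligible.\<close>
  have lim: "(%N. \<integral>x. h x * indicator (D N) x \<partial>M) ----> (\<integral>x. 0 \<partial>M)"
  proof (rule integral_dominated_convergence[where w=h])
   show "AE x in M. (%N. h x * indicator (D N) x) ----> 0"
    using ex
   proof eventually_elim
    case (elim x)
    then obtain n where n: "g (Suc n) x < r1 * real (Suc n)" by auto
    have "EV N. h x * indicator (D N) x = 0"
     using eventually_gt_at_top[of n]
     by eventually_elim (use n in \<open>auto simp: D_def indicator_def dest!: spec[of _ n]\<close>)
    then show ?case by (rule tendsto_eventually)
   qed
  qed (auto simp: inth h_def indicator_def)
  then have "EV N. (\<integral>x. h x * indicator (D N) x \<partial>M) < (L - r1) / 2"
   using r1 by (intro order_tendstoD(2)[OF lim]) auto
  then obtain N where N: "(\<integral>x. h x * indicator (D N) x \<partial>M) < (L - r1) / 2"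
   by (auto simp: eventually_sequentially)
  have inthD: "integrable M (%x. h x * indicator (D N) x)"
   using inth by (rule integrable_real_mult_indicator[rotated]) auto
  \<comment> \<open>The greedy bound in the mean: slope \<open>r1\<close> plus at most half of
    \<open>L - r1\<close>, plus a boundary term independent of \<open>n\<close>. Large
    \<open>n\<close> then contradicts growth at rate \<open>L\<close>.\<close>
  have key: "real n * (L - r1) / 2 <= real N * (\<integral>x. h x \<partial>M)" if "0 < n" for n
  proof -
   define u where "u x = h x * indicator (D N) x" for x
   have intu: "integrable M u" using inthD by (simp add: u_def[abs_def])
   let ?S = "%x. (\<Sum>j<n. u ((T ^^ j) x))"
   let ?E = "%x. (\<Sum>j\<in>{n - N..<n}. h ((T ^^ j) x))"
   have i1: "integrable M (%x. u ((T ^^ j) x))" "(\<integral>x. u ((T ^^ j) x) \<partial>M) = (\<integral>x. u x \<partial>M)" for j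
    using integrable_iter[OF intu] integral_iter[OF intu] by auto
   have i2: "integrable M (%x. h ((T ^^ j) x))" "(\<integral>x. h ((T ^^ j) x) \<partial>M) = (\<integral>x. h x \<partial>M)" for j
    using integrable_iter[OF inth] integral_iter[OF inth] by auto
   have "AE x in M. g n x <= r1 * real n + ?S x + ?E x"
    using subA AE_space
   proof eventually_elim
    case (elim x)
    have "g n ((T ^^ 0) x) <= r1 * real n + (\<Sum>j<n. h ((T ^^ (0 + j)) x) * indicator (D N) ((T ^^ (0 + j)) x))
      + (\<Sum>j\<in>{n - N..<n}. h ((T ^^ (0 + j)) x))"
    proof (rule subadditive_greedy_bound)
     show "\<exists>m>0. m <= N \<and> g m ((T ^^ i) x) <= r1 * real m" if notD: "(T ^^ i) x \<notin> D N" for i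
     proof -
      obtain n where "n < N" "g (Suc n) ((T ^^ i) x) <= r1 * real (Suc n)"
       using notD iter_space[OF elim(2)] by (auto simp: D_def not_less)
      then show ?thesis by (intro exI[of _ "Suc n"]) auto
     qed
    qed (use elim(1) that in \<open>auto simp: h_def\<close>)
    then show ?case by (simp add: u_def del: sum_mult_indicator)
   qed
   then have "(\<integral>x. g n x \<partial>M) <= (\<integral>x. r1 * real n + ?S x + ?E x \<partial>M)"
    using int[OF that] i1 i2 by (intro integral_mono_AE) auto
   also have "... = r1 * real n + real n * (\<integral>x. u x \<partial>M) + real (n - (n - N)) * (\<integral>x. h x \<partial>M)"
    using i1 i2 by (simp add: prob_space)
   also have "... <= r1 * real n + real n * ((L - r1) / 2) + real N * (\<integral>x. h x \<partial>M)"
    using N unfolding u_def by (intro add_mono mult_left_mono mult_right_mono integral_nonneg) (auto simp: h_def)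
   finally show ?thesis using ge[OF that] by (simp add: field_simps)
  qed
  obtain n0 where n0: "real n0 > (real N * (\<integral>x. h x \<partial>M)) / ((L - r1) / 2)"
   using reals_Archimedean2 by blast
  define n where "n = Suc n0"
  have n: "real n > (real N * (\<integral>x. h x \<partial>M)) / ((L - r1) / 2)" "n > 0"
   using n0 by (auto simp: n_def)
  then have "real n * ((L - r1) / 2) > real N * (\<integral>x. h x \<partial>M)"
   using r1 by (simp add: divide_less_eq)
  then show False using key[of n] n by simp
 qed
 then have "prob B = 0" using 01 by simp
 then have "AE x in M. x \<notin> B" by (subst (asm) prob_eq_0) auto
 then show ?thesis using AE_space
 proof eventually_elim
  case (elim x)
  obtain k where k: "1 / real (Suc k) < r1 - r" using r1 by (metis nat_approx_posE diff_gt_0_iff_gt)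
  have "\<not> (\<exists>\<^sub>\<infinity>n. g (Suc n) x < q k * real (Suc n))" using elim by (auto simp: B_def)
  then have "EV n. q k * real (Suc n) <= g (Suc n) x"
   by (simp add: not_frequently not_less cofinite_eq_sequentially)
  then have "EV n. q k * real n <= g n x"
   by (subst (asm) eventually_sequentially_Suc[of "%n. q k * real n <= g n x"])
  then show ?case
  proof eventually_elim
   case (elim n)
   have "r * real n <= q k * real n" using k by (intro mult_right_mono) (auto simp: q_def)
   then show ?case using elim by linarith
  qed
 qed
qed

end

context ergodic_system begin

text \<open>Negated Birkhoff sums are subadditive with exactly linear means, so their lower growth
  bound is the upper bound wanted here.\<close>

lemma birkhoff_upper:
 assumes f: "integrable M f" and s: "(\<integral>x. f x \<partial>M) < (s::real)"
 shows "AE x in M. EV n. (\<Sum>j<n. f ((T ^^ j) x)) <= s * real n"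
proof -
 have "AE x in M. EV n. (- s) * real n <= - (\<Sum>j<n. f ((T ^^ j) x))"
 proof (rule subadditive_ergodic_lower)
  show "- s < - (\<integral>x. f x \<partial>M)" using s by simp
  show "integrable M (%x. - (\<Sum>j<n. f ((T ^^ j) x)))" for n
   using integrable_iter[OF f] by simp
  show "real n * - (\<integral>x. f x \<partial>M) <= (\<integral>x. - (\<Sum>j<n. f ((T ^^ j) x)) \<partial>M)" for n
   using integrable_iter[OF f] integral_iter[OF f] by simp
  fix n m :: nat
  have "(\<Sum>j<n + m. f ((T ^^ j) x)) = (\<Sum>j<n. f ((T ^^ j) x)) + (\<Sum>j<m. f ((T ^^ j) ((T ^^ n) x)))" for x
  proof -
   have "(\<Sum>j<m. f ((T ^^ j) ((T ^^ n) x))) = (\<Sum>j\<in>{n..<n + m}. f ((T ^^ j) x))"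
    by (rule sum.reindex_bij_witness[where i="%j. j - n" and j="%j. j + n"])
     (auto simp: funpow_add)
   then show ?thesis
    by (simp add: lessThan_atLeast0 sum.atLeastLessThan_concat)
  qed
  then show "AE x in M. - (\<Sum>j<n + m. f ((T ^^ j) x)) <=
    - (\<Sum>j<n. f ((T ^^ j) x)) + - (\<Sum>j<m. f ((T ^^ j) ((T ^^ n) x)))"
   by simp
 qed
 then show ?thesis by simp
qed

lemma birkhoff:
 assumes f: "integrable M f"
 shows "AE x in M. (%n. (\<Sum>j<n. f ((T ^^ j) x)) / real n) ----> (\<integral>x. f x \<partial>M :: real)"
proof -
 have 1: "AE x in M. \<forall>k. EV n. (\<Sum>j<n. f ((T ^^ j) x)) <= ((\<integral>x. f x \<partial>M) + 1 / real (Suc k)) * real n"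
  unfolding AE_all_countable by (intro allI birkhoff_upper f) simp
 have 2: "AE x in M. \<forall>k. EV n. (\<Sum>j<n. - f ((T ^^ j) x)) <= (- (\<integral>x. f x \<partial>M) + 1 / real (Suc k)) * real n"
  unfolding AE_all_countable by (intro allI birkhoff_upper) (use f in auto)
 from 1 2 show ?thesis
 proof eventually_elim
  case (elim x)
  show ?case
  proof (rule LIMSEQ_I)
   fix r :: real assume "0 < r"
   then obtain k where k: "1 / real (Suc k) < r" using nat_approx_posE by blast
   have "EV n. norm ((\<Sum>j<n. f ((T ^^ j) x)) / real n - (\<integral>x. f x \<partial>M)) < r"
    using spec[OF elim(1), of k] spec[OF elim(2), of k] eventually_gt_at_top[of 0]
   proof eventually_elim
    case (elim n)
    have "(\<Sum>j<n. f ((T ^^ j) x)) / real n <= (\<integral>x. f x \<partial>M) + 1 / real (Suc k)"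
     using elim by (simp add: pos_divide_le_eq)
    moreover have "(\<Sum>j<n. f ((T ^^ j) x)) / real n \<ge> (\<integral>x. f x \<partial>M) - 1 / real (Suc k)"
    proof -
     have "((\<integral>x. f x \<partial>M) - 1 / real (Suc k)) * real n <= (\<Sum>j<n. f ((T ^^ j) x))"
      using elim(2) by (simp add: sum_negf algebra_simps)
     then show ?thesis using elim(3) by (metis pos_le_divide_eq of_nat_0_less_iff)
    qed
    ultimately show ?case using k by (simp only: real_norm_def)
   qed
   then show "\<exists>no. \<forall>n\<ge>no. norm ((\<Sum>j<n. f ((T ^^ j) x)) / real n - (\<integral>x. f x \<partial>M)) < r"
    by (simp add: eventually_sequentially)
  qed
 qed
qed

end

locale submult_process = ergodic_system +
 fixes D :: "nat => 'a => real"
 assumes D_measurable [measurable]: "\<And>n. D n \<in> borel_measurable M"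
  and D_nonneg: "\<And>n x. 0 <= D n x"
  and D_submult: "\<And>n m x. D (n + m) x <= D n x * D m ((T ^^ n) x)"
  and D_int: "integrable M (%x. ln (max 1 (D 1 x)))"
begin

definition Dh :: "'a => real" where "Dh x = ln (max 1 (D 1 x))"

lemma Dh_nonneg: "0 <= Dh x" by (simp add: Dh_def)

lemma Dh_int: "integrable M Dh" using D_int by (simp add: Dh_def[abs_def])

lemma Dh_meas [measurable]: "Dh \<in> borel_measurable M" using Dh_int by auto

lemma D_le_Dh:
 assumes "0 < n" shows "D n x <= exp (\<Sum>j<n. Dh ((T ^^ j) x))"
 using assms
proof (induction n)
 case (Suc n)
 have 1: "D 1 y <= exp (Dh y)" for y by (simp add: Dh_def)
 show ?case
 proof (cases "n = 0")
  case True then show ?thesis using 1[of x] by simp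
 next
  case False
  have "D (Suc n) x <= D n x * D 1 ((T ^^ n) x)" using D_submult[of n 1 x] by simp
  also have "... <= exp (\<Sum>j<n. Dh ((T ^^ j) x)) * exp (Dh ((T ^^ n) x))"
   using Suc.IH False 1 by (intro mult_mono D_nonneg) auto
  finally show ?thesis by (simp add: exp_add)
 qed
qed simp

text \<open>Truncation at \<open>- K\<close> keeps the logarithm integrable even where
  \<open>D m\<close> vanishes.\<close>

definition Dtr :: "nat => nat => 'a => real" where
 "Dtr m K x = ln (max (D m x) (exp (- real K)))"

lemma Dtr_meas [measurable]: "Dtr m K \<in> borel_measurable M"
 unfolding Dtr_def[abs_def] by measurable

lemma Dtr_ge: "- real K <= Dtr m K x"
proof -
 have "ln (exp (- real K)) <= Dtr m K x"
  unfolding Dtr_def by (rule ln_mono) auto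
 then show ?thesis by simp
qed

lemma D_le_Dtr: "D m x <= exp (Dtr m K x)"
 unfolding Dtr_def by (subst exp_ln) (auto simp: less_max_iff_disj)

lemma Dtr_le: "0 < m ==> Dtr m K x <= (\<Sum>j<m. Dh ((T ^^ j) x))"
proof -
 assume m: "0 < m"
 have 0: "0 <= (\<Sum>j<m. Dh ((T ^^ j) x))" by (intro sum_nonneg Dh_nonneg)
 have "max (D m x) (exp (- real K)) <= exp (\<Sum>j<m. Dh ((T ^^ j) x))"
  using D_le_Dh[OF m, of x] 0 by (simp add: order_trans[of _ 0])
 then have "ln (max (D m x) (exp (- real K))) <= ln (exp (\<Sum>j<m. Dh ((T ^^ j) x)))"
  by (subst ln_le_cancel_iff) (auto simp: less_max_iff_disj)
 then show ?thesis by (simp add: Dtr_def)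
qed

lemma Dtr_int: assumes "0 < m" shows "integrable M (Dtr m K)"
proof (rule Bochner_Integration.integrable_bound)
 show "integrable M (%x. (\<Sum>j<m. Dh ((T ^^ j) x)) + real K)"
  using integrable_iter[OF Dh_int] by simp
 show "AE x in M. norm (Dtr m K x) <= norm ((\<Sum>j<m. Dh ((T ^^ j) x)) + real K)"
 proof (rule AE_I2)
  fix x
  have 0: "0 <= (\<Sum>j<m. Dh ((T ^^ j) x))" by (intro sum_nonneg Dh_nonneg)
  show "norm (Dtr m K x) <= norm ((\<Sum>j<m. Dh ((T ^^ j) x)) + real K)"
   using Dtr_ge[of K m x] Dtr_le[OF assms, of K x] 0 unfolding real_norm_def by linarith
 qed
qed simp

text \<open>Averaging the block decompositions over the \<open>m\<close> possible offsets turns the sum over block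
 starting points into a full Birkhoff sum for \<open>T\<close>, so that ergodicity of \<open>T ^^ m\<close> is not needed.\<close>

lemma D_block_average:
 assumes m: "0 < m" and n: "2 * m <= n" and pos: "0 < D n x"
 defines "N \<equiv> (n div m - 1) * m"
 shows "real m * ln (D n x) <= real m * (\<Sum>j<m. Dh ((T ^^ j) x)) + (\<Sum>j<N. Dtr m K ((T ^^ j) x))
   + real m * (\<Sum>j\<in>{N..<n}. Dh ((T ^^ j) x))"
proof -
 define q where "q = n div m - 1"
 define E where "E l x = (if l = 0 then 1 else D l x)" for l x
 have E_sub: "E (a + b) y <= E a y * E b ((T ^^ a) y)" for a b y
  using D_submult[of a b y] by (auto simp: E_def)
 have E0: "0 <= E a y" for a y by (auto simp: E_def D_nonneg)
 have E_h: "E l y <= exp (\<Sum>j<l. Dh ((T ^^ j) y))" for l y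
  using D_le_Dh[of l y] by (auto simp: E_def)
 have qm: "N = q * m" by (simp add: N_def q_def)
 have qmn: "N + m <= n"
 proof -
  have "1 <= n div m" using m n by (simp add: Suc_leI div_greater_zero_iff)
  then have "N + m = n div m * m" by (simp add: N_def algebra_simps)
  then show ?thesis by simp
 qed
 have blk: "E (s + i * m) x <= exp ((\<Sum>j<s. Dh ((T ^^ j) x)) + (\<Sum>j<i. Dtr m K ((T ^^ (s + j * m)) x)))" for s i
 proof (induction i)
  case 0
  then show ?case using E_h[of s x] by simp
 next
  case (Suc i)
  have "E (s + Suc i * m) x = E ((s + i * m) + m) x" by (simp add: algebra_simps)
  also have "... <= E (s + i * m) x * E m ((T ^^ (s + i * m)) x)" by (rule E_sub)
  also have "... <= exp ((\<Sum>j<s. Dh ((T ^^ j) x)) + (\<Sum>j<i. Dtr m K ((T ^^ (s + j * m)) x))) *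
    exp (Dtr m K ((T ^^ (s + i * m)) x))"
   using Suc m D_le_Dtr[of m "(T ^^ (s + i * m)) x" K] by (intro mult_mono E0) (auto simp: E_def)
  finally show ?case by (simp add: exp_add algebra_simps)
 qed
 have off: "ln (D n x) <= (\<Sum>j<m. Dh ((T ^^ j) x)) + (\<Sum>i<q. Dtr m K ((T ^^ (s + i * m)) x))
   + (\<Sum>j\<in>{N..<n}. Dh ((T ^^ j) x))" if s: "s < m" for s
 proof -
  have sn: "s + q * m <= n" using s qmn qm by simp
  have "D n x <= E (s + q * m) x * E (n - (s + q * m)) ((T ^^ (s + q * m)) x)"
   using E_sub[of "s + q * m" "n - (s + q * m)" x] sn n m by (simp add: E_def split: if_splits)
  also have "... <= exp ((\<Sum>j<s. Dh ((T ^^ j) x)) + (\<Sum>i<q. Dtr m K ((T ^^ (s + i * m)) x))) *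
    exp (\<Sum>j<n - (s + q * m). Dh ((T ^^ j) ((T ^^ (s + q * m)) x)))"
   by (intro mult_mono blk E_h E0) simp
  also have "(\<Sum>j<n - (s + q * m). Dh ((T ^^ j) ((T ^^ (s + q * m)) x))) = (\<Sum>j\<in>{s + q * m..<n}. Dh ((T ^^ j) x))"
   by (rule sum.reindex_bij_witness[where i="%j. j - (s + q * m)" and j="%j. j + (s + q * m)"])
    (auto simp: funpow_add)
  also have "exp ((\<Sum>j<s. Dh ((T ^^ j) x)) + (\<Sum>i<q. Dtr m K ((T ^^ (s + i * m)) x))) *
    exp (\<Sum>j\<in>{s + q * m..<n}. Dh ((T ^^ j) x)) <=
    exp ((\<Sum>j<m. Dh ((T ^^ j) x)) + (\<Sum>i<q. Dtr m K ((T ^^ (s + i * m)) x)) + (\<Sum>j\<in>{N..<n}. Dh ((T ^^ j) x)))"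
   unfolding exp_add[symmetric] exp_le_cancel_iff
   by (intro add_mono sum_mono2 order_refl) (use s qm in \<open>auto simp: Dh_nonneg\<close>)
  finally show ?thesis using pos by (simp add: ln_le_cancel_iff[symmetric] del: ln_le_cancel_iff)
 qed
 have "real m * ln (D n x) = (\<Sum>s<m. ln (D n x))" by simp
 also have "... <= (\<Sum>s<m. (\<Sum>j<m. Dh ((T ^^ j) x)) + (\<Sum>i<q. Dtr m K ((T ^^ (s + i * m)) x))
   + (\<Sum>j\<in>{N..<n}. Dh ((T ^^ j) x)))"
  by (intro sum_mono off) simp
 also have "... = real m * (\<Sum>j<m. Dh ((T ^^ j) x)) + (\<Sum>s<m. \<Sum>i<q. Dtr m K ((T ^^ (s + i * m)) x))
   + real m * (\<Sum>j\<in>{N..<n}. Dh ((T ^^ j) x))"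
  by (simp add: sum.distrib)
 also have "(\<Sum>s<m. \<Sum>i<q. Dtr m K ((T ^^ (s + i * m)) x)) = (\<Sum>i<q. \<Sum>s<m. Dtr m K ((T ^^ (s + i * m)) x))"
  by (rule sum.swap)
 also have "... = (\<Sum>i<q. \<Sum>j\<in>{i * m..<i * m + m}. Dtr m K ((T ^^ j) x))"
 proof (rule sum.cong[OF refl])
  fix i
  show "(\<Sum>s<m. Dtr m K ((T ^^ (s + i * m)) x)) = (\<Sum>j\<in>{i * m..<i * m + m}. Dtr m K ((T ^^ j) x))"
   by (rule sum.reindex_bij_witness[where i="%j. j - i * m" and j="%j. j + i * m"]) auto
 qed
 also have "... = (\<Sum>j<N. Dtr m K ((T ^^ j) x))"
  unfolding qm by (rule sum.nat_group)
 finally show ?thesis .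
qed

text \<open>Birkhoff's theorem for the truncated block function, applied to the offset average in
  \<open>D_block_average\<close>; the boundary terms there are o(n).\<close>

lemma D_upper:
 assumes m: "0 < m" and s: "(\<integral>x. Dtr m K x \<partial>M) / real m < s"
 shows "AE x in M. EV n. D n x <= exp (s * real n)"
 using birkhoff[OF Dtr_int[OF m, of K]] birkhoff[OF Dh_int]
proof eventually_elim
 case (elim x)
 let ?S = "%n. \<Sum>j<n. Dtr m K ((T ^^ j) x)" and ?H = "%n. \<Sum>j<n. Dh ((T ^^ j) x)"
 define N where "N n = (n div m - 1) * m" for n
 have Nle: "N n <= n" for n
  unfolding N_def by (metis diff_le_self div_times_less_eq_dividend mult_le_mono1 order_trans)
 have Nge: "real n - 2 * real m <= real (N n)" for n
 proof -
  have "n = n div m * m + n mod m" by simp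
  also have "... <= N n + m + m" using m mod_less_divisor[OF m, of n]
   by (cases "n div m") (auto simp: N_def)
  finally show ?thesis by linarith
 qed
 have Ntop: "filterlim N at_top sequentially"
 proof -
  have "filterlim (%n. real n - 2 * real m) at_top sequentially"
   by real_asymp
  then have "filterlim (%n. real (N n)) at_top sequentially"
   by (rule filterlim_at_top_mono) (simp add: Nge)
  then show ?thesis by (simp add: filterlim_sequentially_iff_filterlim_real)
 qed
 have Nn: "(%n. real (N n) / real n) ----> 1"
 proof (rule tendsto_sandwich[of "%n. 1 - 2 * real m / real n" _ _ "%_. 1"])
  show "EV n. 1 - 2 * real m / real n <= real (N n) / real n"
   using eventually_gt_at_top[of 0]
  proof eventually_elim
   case (elim n)
   have "1 - 2 * real m / real n = (real n - 2 * real m) / real n" using elim by (simp add: field_simps)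
   also have "... <= real (N n) / real n" using Nge by (intro divide_right_mono) auto
   finally show ?case .
  qed
  show "EV n. real (N n) / real n <= 1"
   using eventually_gt_at_top[of 0] by eventually_elim (simp add: Nle)
  show "(%n. 1 - 2 * real m / real n) ----> 1" by real_asymp
 qed simp
 have conv: "(%n. F (N n) / real n) ----> c" if "(%n. F n / real n) ----> c" for F :: "nat => real" and c
 proof -
  have "(%n. F (N n) / real (N n) * (real (N n) / real n)) ----> c * 1"
   by (intro tendsto_mult Nn filterlim_compose[OF that Ntop])
  moreover have "EV n. F (N n) / real (N n) * (real (N n) / real n) = F (N n) / real n"
   using eventually_compose_filterlim[OF eventually_gt_at_top[of 0] Ntop] by eventually_elim simp
  ultimately have "(%n. F (N n) / real n) ----> c * 1" by (rule Lim_transform_eventually)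
  then show ?thesis by simp
 qed
 define R where "R n = real m * ?H m + ?S (N n) + real m * (?H n - ?H (N n))" for n
 have "(%n. real m * (?H m / real n) + ?S (N n) / real n + real m * (?H n / real n - ?H (N n) / real n))
   ----> real m * 0 + (\<integral>x. Dtr m K x \<partial>M) + real m * ((\<integral>x. Dh x \<partial>M) - (\<integral>x. Dh x \<partial>M))"
  by (intro tendsto_intros conv elim lim_const_over_n)
 then have "(%n. R n / real n) ----> (\<integral>x. Dtr m K x \<partial>M)"
  by (simp add: R_def add_divide_distrib diff_divide_distrib right_diff_distrib)
 moreover have "(\<integral>x. Dtr m K x \<partial>M) < real m * s" using s m by (simp add: field_simps)
 ultimately have "EV n. R n / real n < real m * s" by (rule order_tendstoD)
 then show ?case
  using eventually_ge_at_top[of "2 * m"] eventually_gt_at_top[of 0]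
 proof eventually_elim
  case (elim n)
  show ?case
  proof (cases "D n x = 0")
   case False
   then have pos: "0 < D n x" using D_nonneg[of n x] by simp
   have "real m * ln (D n x) <= real m * ?H m + ?S (N n) + real m * (\<Sum>j\<in>{N n..<n}. Dh ((T ^^ j) x))"
    using D_block_average[OF m elim(2) pos, of K] by (simp add: N_def)
   also have "(\<Sum>j\<in>{N n..<n}. Dh ((T ^^ j) x)) = ?H n - ?H (N n)"
    using Nle[of n] by (simp add: lessThan_atLeast0 sum_diff_nat_ivl)
   also have "real m * ?H m + ?S (N n) + real m * (?H n - ?H (N n)) = R n" by (simp add: R_def)
   also have "R n <= real m * s * real n" using elim by (simp add: divide_less_eq)
   finally have "ln (D n x) <= s * real n" using m by (simp add: mult.assoc)
   then show ?thesis using pos by (metis exp_le_cancel_iff exp_ln)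
  qed simp
 qed
qed

text \<open>All the truncated means are finite; the value \<open>- \<infinity>\<close> can arise
  only through the infimum.\<close>

definition lyap :: ereal where
 "lyap = (INF p\<in>{0<..} \<times> UNIV. ereal ((\<integral>x. Dtr (fst p) (snd p) x \<partial>M) / real (fst p)))"

lemma lyap_le: "0 < m ==> lyap <= ereal ((\<integral>x. Dtr m K x \<partial>M) / real m)"
 unfolding lyap_def by (rule INF_lower2[of "(m, K)"]) auto

lemma lyap_less_iff: "lyap < c \<longleftrightarrow> (\<exists>m>0. \<exists>K. ereal ((\<integral>x. Dtr m K x \<partial>M) / real m) < c)"
 unfolding lyap_def INF_less_iff by auto

lemma lyap_less_top: "lyap < \<infinity>"
 using lyap_le[of 1 0] by (auto simp: less_top[symmetric] top_ereal_def)

lemma Dtr_mono: "K <= K' ==> Dtr m K' x <= Dtr m K x"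
 unfolding Dtr_def by (rule ln_mono) (auto simp: less_max_iff_disj intro: max.coboundedI2)

text \<open>A finite lower bound of the infimum bounds the truncated means uniformly in
  \<open>K\<close>. Monotone convergence in \<open>K\<close> then excludes zeros of
  \<open>D m\<close> and makes its logarithm integrable.\<close>

lemma finite_lyap:
 assumes fin: "ereal L <= lyap" and m: "0 < m"
 shows "AE x in M. 0 < D m x" "integrable M (%x. ln (D m x))" "real m * L <= (\<integral>x. ln (D m x) \<partial>M)"
proof -
 have low: "real m * L <= (\<integral>x. Dtr m K x \<partial>M)" for K
  using order_trans[OF fin lyap_le[OF m, of K]] m by (simp add: field_simps)
 define u where "u K x = Dtr m 0 x - Dtr m K x" for K x
 have u0: "0 <= u K x" for K x using Dtr_mono[of 0 K m x] by (simp add: u_def)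
 have ui: "integrable M (u K)" for K unfolding u_def[abs_def] using Dtr_int[OF m] by auto
 have [measurable]: "u K \<in> borel_measurable M" for K using ui by auto
 define C where "C = (\<integral>x. Dtr m 0 x \<partial>M) - real m * L"
 have uC: "(\<integral>x. u K x \<partial>M) <= C" for K
  using low[of K] Dtr_int[OF m] by (simp add: u_def C_def)
 have "(\<integral>\<^sup>+x. (SUP K. ennreal (u K x)) \<partial>M) = (SUP K. \<integral>\<^sup>+x. ennreal (u K x) \<partial>M)"
 proof (rule nn_integral_monotone_convergence_SUP)
  show "incseq (%K x. ennreal (u K x))"
   by (auto intro!: incseq_SucI le_funI ennreal_leI diff_left_mono Dtr_mono simp: u_def)
 qed simp
 also have "... <= ennreal C"
  using uC by (intro SUP_least) (simp add: nn_integral_eq_integral[OF ui] u0 ennreal_leI)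
 finally have fin': "(\<integral>\<^sup>+x. (SUP K. ennreal (u K x)) \<partial>M) \<noteq> \<infinity>"
  by (auto simp: top_unique)
 have "AE x in M. (SUP K. ennreal (u K x)) \<noteq> \<infinity>"
  by (rule nn_integral_PInf_AE[OF _ fin']) measurable
 then show pos: "AE x in M. 0 < D m x"
 proof eventually_elim
  case (elim x)
  show ?case
  proof (rule ccontr)
   assume "\<not> 0 < D m x"
   then have "D m x = 0" using D_nonneg[of m x] by simp
   then have uK: "u K x = real K" for K
    by (simp add: u_def Dtr_def max_def)
   have "(SUP K. ennreal (u K x)) = \<infinity>"
    unfolding uK by (simp add: ennreal_of_nat_eq_real_of_nat[symmetric] ennreal_SUP_of_nat_eq_top)
   then show False using elim by simp
  qed
 qed
 have lim: "AE x in M. (%K. Dtr m K x) ----> ln (D m x)"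
  using pos
 proof eventually_elim
  case (elim x)
  obtain K0 where K0: "real K0 > - ln (D m x)" using reals_Archimedean2 by blast
  have "EV K. Dtr m K x = ln (D m x)"
   using eventually_ge_at_top[of K0]
  proof eventually_elim
   case (elim K)
   have "exp (- real K) <= exp (ln (D m x))" using elim K0 by (simp del: exp_ln)
   then have "exp (- real K) <= D m x" using \<open>0 < D m x\<close> by simp
   then show ?case by (simp add: Dtr_def max_def)
  qed
  then show ?case by (rule tendsto_eventually)
 qed
 have "(%K. - (\<integral>x. Dtr m K x \<partial>M)) ----> - (INF K. \<integral>x. Dtr m K x \<partial>M)"
 proof (intro tendsto_minus LIMSEQ_decseq_INF)
  show "bdd_below (range (%K. \<integral>x. Dtr m K x \<partial>M))" using low by (auto intro!: bdd_belowI)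
  show "decseq (%K. \<integral>x. Dtr m K x \<partial>M)"
   using Dtr_int[OF m] by (auto intro!: decseq_SucI integral_mono Dtr_mono)
 qed
 then have lim': "(%K. \<integral>x. - Dtr m K x \<partial>M) ----> - (INF K. \<integral>x. Dtr m K x \<partial>M)"
  using Dtr_int[OF m] by simp
 note mc = integrable_monotone_convergence[where f="%K x. - Dtr m K x" and u="%x. - ln (D m x)", OF _ _ _ lim']
  integral_monotone_convergence[where f="%K x. - Dtr m K x" and u="%x. - ln (D m x)", OF _ _ _ lim']
 have i: "integrable M (%x. - ln (D m x))"
  by (rule mc(1)) (use Dtr_int[OF m] lim in \<open>auto intro!: monoI Dtr_mono tendsto_minus\<close>)
 then show "integrable M (%x. ln (D m x))" by simp
 have "(\<integral>x. - ln (D m x) \<partial>M) = - (INF K. \<integral>x. Dtr m K x \<partial>M)"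
  by (rule mc(2)) (use Dtr_int[OF m] lim in \<open>auto intro!: monoI Dtr_mono tendsto_minus\<close>)
 then have "(\<integral>x. ln (D m x) \<partial>M) = (INF K. \<integral>x. Dtr m K x \<partial>M)" using i by simp
 also have "... \<ge> real m * L" by (intro cINF_greatest low) auto
 finally show "real m * L <= (\<integral>x. ln (D m x) \<partial>M)" .
qed

lemma lyap_ge:
 assumes "\<And>m. 0 < m ==> AE x in M. 0 < D m x" "\<And>m. 0 < m ==> integrable M (%x. ln (D m x))"
  "\<And>m. 0 < m ==> real m * L <= (\<integral>x. ln (D m x) \<partial>M)"
 shows "ereal L <= lyap"
 unfolding lyap_def
proof (rule INF_greatest, clarsimp)
 fix m K :: nat assume m: "0 < m"
 have "real m * L <= (\<integral>x. ln (D m x) \<partial>M)" by (rule assms(3)[OF m])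
 also have "... <= (\<integral>x. Dtr m K x \<partial>M)"
  using assms(1)[OF m] by (intro integral_mono_AE assms(2) Dtr_int m) (auto simp: Dtr_def elim: eventually_mono)
 finally show "L <= (\<integral>x. Dtr m K x \<partial>M) / real m" using m by (simp add: field_simps)
qed

text \<open>\<open>D_upper\<close> gives the upper half in all cases. The lower half needs
  integrable logarithms, which \<open>finite_lyap\<close> supplies when the infimum is finite;
  otherwise the upper half already forces \<open>- \<infinity>\<close>.\<close>

theorem kingman: "AE x in M. (%n. ereal (1 / real n) * log_ext (D n x)) ----> lyap"
proof -
 have up: "AE x in M. EV n. ereal (1 / real n) * log_ext (D n x) <= ereal s"
  if s: "lyap < ereal s" for s
 proof -
  obtain m K where mK: "0 < m" "(\<integral>x. Dtr m K x \<partial>M) / real m < s"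
   using s unfolding lyap_less_iff by auto
  show ?thesis using D_upper[OF mK]
  proof eventually_elim
   case (elim x)
   then show ?case using eventually_gt_at_top[of 0]
   proof eventually_elim
    case (elim n)
    show ?case
    proof (cases "D n x = 0")
     case True
     then show ?thesis using elim by (simp add: log_ext_def)
    next
     case False
     then have "0 < D n x" using D_nonneg[of n x] by simp
     then have "ln (D n x) <= s * real n" using elim by (metis exp_le_cancel_iff exp_ln)
     then show ?thesis using elim False by (simp add: log_ext_def divide_simps mult.commute)
    qed
   qed
  qed
 qed
 show ?thesis
 proof (cases lyap)
  case (real L)
  have "AE x in M. \<forall>k. EV n. ereal (1 / real n) * log_ext (D n x) <= ereal (L + 1 / real (Suc k))"
   unfolding AE_all_countable using real by (intro allI up) auto
  moreover have "AE x in M. \<forall>k. EV n. (L - 1 / real (Suc k)) * real n <= ln (D n x)"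
   unfolding AE_all_countable
  proof (intro allI subadditive_ergodic_lower[where L=L])
   have L: "ereal L <= lyap" using real by simp
   show "integrable M (%x. ln (D n x))" "real n * L <= (\<integral>x. ln (D n x) \<partial>M)" if "0 < n" for n
    using finite_lyap[OF L that] by auto
   fix n m :: nat assume n: "0 < n" "0 < m"
   have 3: "AE x in M. \<forall>i. 0 < D m ((T ^^ i) x)" by (rule AE_iter[OF finite_lyap(1)[OF L n(2)]])
   have "0 < n + m" using n by simp
   show "AE x in M. ln (D (n + m) x) <= ln (D n x) + ln (D m ((T ^^ n) x))"
    using finite_lyap(1)[OF L \<open>0 < n + m\<close>] finite_lyap(1)[OF L n(1)] 3
   proof eventually_elim
    case (elim x)
    then show ?case using D_submult[of n m x]
     by (metis ln_mult_pos ln_mono)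
   qed
  qed simp
  moreover have "AE x in M. \<forall>n. 0 < D (Suc n) x"
   unfolding AE_all_countable using finite_lyap(1)[where L=L] real by auto
  ultimately show ?thesis
  proof eventually_elim
   case (elim x)
   have "(%n. ln (D n x) / real n) ----> L"
   proof (rule LIMSEQ_I)
    fix r :: real assume "0 < r"
    then obtain k where k: "1 / real (Suc k) < r" using nat_approx_posE by blast
    have "EV n. norm (ln (D n x) / real n - L) < r"
     using spec[OF elim(1), of k] spec[OF elim(2), of k] eventually_gt_at_top[of 0]
    proof eventually_elim
     case (elim n)
     have "D n x \<noteq> 0" using \<open>\<forall>n. 0 < D (Suc n) x\<close> elim(3) by (metis gr0_implies_Suc less_irrefl)
     then have "ln (D n x) / real n <= L + 1 / real (Suc k)" using elim(1) by (simp add: log_ext_def)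
     moreover have "L - 1 / real (Suc k) <= ln (D n x) / real n"
      using elim(2,3) by (simp add: pos_le_divide_eq)
     ultimately show ?case using k by (simp only: real_norm_def)
    qed
    then show "\<exists>no. \<forall>n\<ge>no. norm (ln (D n x) / real n - L) < r"
     by (simp add: eventually_sequentially)
   qed
   then have "(%n. ereal (ln (D n x) / real n)) ----> lyap" using real by simp
   moreover have "EV n. ereal (ln (D n x) / real n) = ereal (1 / real n) * log_ext (D n x)"
    using eventually_gt_at_top[of 0]
   proof eventually_elim
    case (elim n)
    have "D n x \<noteq> 0" using \<open>\<forall>n. 0 < D (Suc n) x\<close> elim by (metis gr0_implies_Suc less_irrefl)
    then show ?case by (simp add: log_ext_def)
   qed
   ultimately show ?case by (rule Lim_transform_eventually)
  qed
 next
  case MInf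
  have "AE x in M. \<forall>k. EV n. ereal (1 / real n) * log_ext (D n x) <= ereal (- real k)"
   unfolding AE_all_countable using MInf by (intro allI up) auto
  then show ?thesis
  proof eventually_elim
   case (elim x)
   show ?case unfolding MInf tendsto_MInfty
   proof
    fix r :: real
    obtain k where "real k > - r" using reals_Archimedean2 by blast
    then have "ereal (- real k) < ereal r" by simp
    then show "EV n. ereal (1 / real n) * log_ext (D n x) < ereal r"
     using spec[OF elim, of k] by (auto elim!: eventually_mono intro: le_less_trans)
   qed
  qed
 qed (use lyap_less_top in simp)
qed

end

section \<open>Ergodicity of the perturbed shift\<close>

text \<open>The sets along which \<open>u\<close> tends to 0 form a Dynkin system: the bound by
  \<open>K * prob B\<close> makes the tail of a disjoint union small uniformly in \<open>m\<close>,
  so that limit and countable sum may be exchanged.\<close>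

lemma (in prob_space) dynkin_tendsto_zero:
 fixes u :: "nat => 'a set => real"
 assumes gen: "sets M = sigma_sets (space M) G" and stable: "Int_stable G" and G: "G \<subseteq> Pow (space M)"
  and add: "\<And>m B C. B \<in> sets M ==> C \<in> sets M ==> B \<inter> C = {} ==> u m (B \<union> C) = u m B + u m C"
  and bound: "\<And>m B. B \<in> sets M ==> \<bar>u m B\<bar> <= K * prob B"
  and sp: "(%m. u m (space M)) ----> 0"
  and base: "\<And>B. B \<in> G ==> (%m. u m B) ----> 0"
  and B: "B \<in> sets M"
 shows "(%m. u m B) ----> 0"
proof -
 have u0: "u m {} = 0" for m using add[of "{}" "{}" m] by simp
 have B': "B \<in> sigma_sets (space M) G" using B gen by simp
 show ?thesis
  using stable G B'
 proof (induct rule: sigma_sets_induct_disjoint)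
  case (basic A)
  then show ?case by (rule base)
 next
  case empty
  then show ?case by (simp add: u0)
 next
  case (compl A)
  have A: "A \<in> sets M" using compl gen by simp
  have "u m (space M - A) = u m (space M) - u m A" for m
  proof -
   have "A \<union> (space M - A) = space M" using sets.sets_into_space[OF A] by auto
   then show ?thesis using add[of A "space M - A" m] A by auto
  qed
  then show ?case using tendsto_diff[OF sp compl(2)] by simp
 next
  case (union A)
  have A: "A i \<in> sets M" for i using union(2) gen by auto
  define R where "R k = (\<Union>i. A (i + k))" for k
  have [measurable]: "R k \<in> sets M" for k using A by (auto simp: R_def)
  have split: "u m (\<Union>(range A)) = (\<Sum>i<k. u m (A i)) + u m (R k)" for m k
  proof (induction k)
   case 0
   then show ?case by (simp add: R_def)
  next
   case (Suc k)
   have "R k = A k \<union> R (Suc k)"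
   proof (intro Set.set_eqI iffI)
    fix x assume "x \<in> R k"
    then obtain i where "x \<in> A (i + k)" by (auto simp: R_def)
    then show "x \<in> A k \<union> R (Suc k)" by (cases i) (auto simp: R_def)
   next
    fix x assume "x \<in> A k \<union> R (Suc k)"
    then show "x \<in> R k"
    proof
     assume "x \<in> A k" then have "x \<in> A (0 + k)" by simp
     then show ?thesis unfolding R_def by blast
    next
     assume "x \<in> R (Suc k)"
     then obtain i where "x \<in> A (Suc i + k)" by (auto simp: R_def)
     then show ?thesis unfolding R_def by blast
    qed
   qed
   moreover have "A k \<inter> R (Suc k) = {}"
   proof -
    have "A k \<inter> A (i + Suc k) = {}" for i
     by (rule disjoint_family_onD[OF union(1)]) auto
    then show ?thesis unfolding R_def by blast
   qed
   ultimately have "u m (R k) = u m (A k) + u m (R (Suc k))"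
    using add[of "A k" "R (Suc k)" m] A by simp
   then show ?case using Suc by simp
  qed
  have Rlim: "(%k. prob (R k)) ----> 0"
  proof -
   have "(%k. prob (R k)) ----> prob (\<Inter>k. R k)"
   proof (rule finite_Lim_measure_decseq)
    show "decseq R"
    proof (rule decseq_SucI, rule subsetI)
     fix k x assume "x \<in> R (Suc k)"
     then obtain i where "x \<in> A (Suc i + k)" by (auto simp: R_def)
     then show "x \<in> R k" unfolding R_def by blast
    qed
   qed auto
   moreover have "(\<Inter>k. R k) = {}"
   proof (rule ccontr)
    assume "(\<Inter>k. R k) \<noteq> {}"
    then obtain x where x: "\<And>k. x \<in> R k" by blast
    obtain i where i: "x \<in> A i" using x[of 0] by (auto simp: R_def)
    obtain j where "x \<in> A (j + Suc i)" using x[of "Suc i"] by (auto simp: R_def)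
    moreover have "A i \<inter> A (j + Suc i) = {}"
     by (rule disjoint_family_onD[OF union(1)]) auto
    ultimately show False using i by blast
   qed
   ultimately show ?thesis by simp
  qed
  show ?case
  proof (rule LIMSEQ_I)
   fix r :: real assume r: "0 < r"
   have "(%k. \<bar>K\<bar> * prob (R k)) ----> \<bar>K\<bar> * 0" by (intro tendsto_intros Rlim)
   then have "EV k. \<bar>K\<bar> * prob (R k) < r / 2"
    using r by (intro order_tendstoD) auto
   then obtain k where k: "\<bar>K\<bar> * prob (R k) < r / 2" by (auto simp: eventually_sequentially)
   have "(%m. \<Sum>i<k. u m (A i)) ----> (\<Sum>i<k. 0)" by (intro tendsto_sum union)
   from tendstoD[OF this, of "r / 2"]
   have "EV m. norm ((\<Sum>i<k. u m (A i)) - 0) < r / 2"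
    using r by (simp add: dist_norm)
   then have "EV m. norm (u m (\<Union>(range A)) - 0) < r"
   proof eventually_elim
    case (elim m)
    have "\<bar>u m (R k)\<bar> <= K * prob (R k)" by (rule bound) simp
    also have "... <= \<bar>K\<bar> * prob (R k)" by (intro mult_right_mono) auto
    finally show ?case using elim k split[of m k] by simp
   qed
   then show "\<exists>no. \<forall>m\<ge>no. norm (u m (\<Union>(range A)) - 0) < r" by (simp add: eventually_sequentially)
  qed
 qed
qed

locale bernoulli_shift = prob_space \<gamma> for \<gamma> :: "'b measure"
begin

definition Q :: "(int => 'b) measure" where "Q = (\<Pi>\<^sub>M n\<in>UNIV. \<gamma>)"
definition S :: "nat => (int => 'b) => int => 'b" where "S m d = (%n. d (n + int m))"

abbreviation (input) SQ where "SQ m C \<equiv> S m -` C \<inter> space Q"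

sublocale Q: prob_space Q
 unfolding Q_def by (intro prob_space_PiM prob_space_axioms)

lemma S_measurable [measurable]: "S m \<in> Q \<rightarrow>\<^sub>M Q"
 unfolding Q_def S_def by (rule measurable_PiM_single') (auto simp: space_PiM)

lemma S_distr: "distr Q Q (S m) = Q"
proof -
 have "distr (\<Pi>\<^sub>M n\<in>UNIV. \<gamma>) (\<Pi>\<^sub>M n\<in>UNIV. \<gamma>) (%d. \<lambda>n\<in>UNIV. d (n + int m)) = (\<Pi>\<^sub>M n\<in>UNIV. \<gamma>)"
  by (rule distr_PiM_reindex) (auto intro: prob_space_axioms simp: inj_on_def)
 then have "distr (\<Pi>\<^sub>M n\<in>UNIV. \<gamma>) (\<Pi>\<^sub>M n\<in>UNIV. \<gamma>) (S m) = (\<Pi>\<^sub>M n\<in>UNIV. \<gamma>)"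
  by (simp only: restrict_UNIV S_def[abs_def])
 then show ?thesis by (simp only: Q_def)
qed

lemma S_measure: "C \<in> sets Q ==> measure Q (SQ m C) = measure Q C"
 using measure_distr[OF S_measurable, of C m] by (simp add: S_distr)

definition cyl :: "int set => (int => 'b set) => (int => 'b) set" where
 "cyl J E = {d\<in>space Q. \<forall>i\<in>J. d i \<in> E i}"

lemma cyl_eq_emb: "cyl J E = prod_emb UNIV (%_. \<gamma>) J (Pi\<^sub>E J E)"
 by (auto simp: prod_emb_def cyl_def Q_def space_PiM PiE_iff)

lemma measure_cyl:
 assumes "finite J" "\<And>i. i \<in> J ==> E i \<in> sets \<gamma>"
 shows "measure Q (cyl J E) = (\<Prod>i\<in>J. prob (E i))"
proof -
 interpret product_prob_space "%_. \<gamma>" "UNIV :: int set" ..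
 show ?thesis
  using measure_PiM_emb[of J E] assms
  by (simp add: cyl_eq_emb Q_def)
qed

lemma Q_gen: "sets Q = sigma_sets (space Q) (prod_algebra UNIV (%_. \<gamma>))"
 unfolding Q_def sets_PiM space_PiM ..

lemma Q_gen_cyl:
 assumes "A \<in> prod_algebra (UNIV :: int set) (%_. \<gamma>)"
 obtains J E where "A = cyl J E" "finite J" "\<And>i. i \<in> J ==> E i \<in> sets \<gamma>"
proof -
 obtain J E where JE: "A = prod_emb UNIV (%_. \<gamma>) J (Pi\<^sub>E J E)" "finite J" "\<And>i. i \<in> J ==> E i \<in> sets \<gamma>"
  using assms by (rule prod_algebraE) blast
 show ?thesis
 proof (rule that[OF _ JE(2,3)])
  show "A = cyl J E"
   unfolding JE(1) cyl_eq_emb ..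
 qed
qed

lemma Q_gen_sub: "prod_algebra UNIV (%_. \<gamma>) \<subseteq> Pow (space Q)"
 using prod_algebra_sets_into_space unfolding Q_def space_PiM .

text \<open>Once \<open>m\<close> exceeds the spread of the two index sets, the shifted cylinder
  reads only coordinates beyond \<open>J\<close>, and independence is exact.\<close>

lemma mixing_cyl:
 assumes J: "finite J" "\<And>i. i \<in> J ==> E i \<in> sets \<gamma>" and J': "finite J'" "\<And>i. i \<in> J' ==> E' i \<in> sets \<gamma>"
 shows "EV m. measure Q (cyl J E \<inter> (SQ m (cyl J' E'))) = measure Q (cyl J E) * measure Q (cyl J' E')"
proof -
 obtain b where b: "\<And>i. i \<in> J ==> i <= b" using bdd_above_finite[OF J(1)] by (auto simp: bdd_above_def)
 obtain b' where b': "\<And>i. i \<in> J' ==> b' <= i" using bdd_below_finite[OF J'(1)] by (auto simp: bdd_below_def)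
 have "EV m. nat (b - b' + 1) <= m" by (rule eventually_ge_at_top)
 then show ?thesis
 proof eventually_elim
  case (elim m)
  let ?J = "(%i. i + int m) ` J'"
  have dis: "J \<inter> ?J = {}"
  proof (rule equals0I, elim IntE imageE)
   fix x y assume "x \<in> J" "y \<in> J'" "x = y + int m"
   then show False using b[of x] b'[of y] elim by linarith
  qed
  define F where "F i = (if i \<in> J then E i else E' (i - int m))" for i
  have F1: "F i = E i" if "i \<in> J" for i using that by (simp add: F_def)
  have F2: "F (i + int m) = E' i" if "i \<in> J'" for i using that dis by (auto simp: F_def)
  have "cyl J E \<inter> (SQ m (cyl J' E')) = cyl (J \<union> ?J) F"
   using measurable_space[OF S_measurable[of m]]
   by (auto simp: cyl_def F1 F2 ball_Un S_def)
  also have "measure Q ... = (\<Prod>i\<in>J \<union> ?J. prob (F i))"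
   using J J' by (intro measure_cyl) (auto simp: F_def)
  also have "... = (\<Prod>i\<in>J. prob (F i)) * (\<Prod>i\<in>?J. prob (F i))"
   using J J' dis by (intro prod.union_disjoint) auto
  also have "(\<Prod>i\<in>J. prob (F i)) = measure Q (cyl J E)"
   using J by (subst measure_cyl) (auto simp: F_def)
  also have "(\<Prod>i\<in>?J. prob (F i)) = (\<Prod>i\<in>J'. prob (F (i + int m)))"
   by (subst prod.reindex) auto
  also have "... = (\<Prod>i\<in>J'. prob (E' i))"
   using dis by (intro prod.cong) (auto simp: F_def)
  also have "... = measure Q (cyl J' E')" using J' by (simp add: measure_cyl)
  finally show ?case .
 qed
qed

text \<open>Two Dynkin arguments, first in \<open>C\<close> against a fixed cylinder, then in
  \<open>C'\<close>.\<close>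

lemma mixing:
 assumes C: "C \<in> sets Q" and C': "C' \<in> sets Q"
 shows "(%m. measure Q (C \<inter> (SQ m C')) - measure Q C * measure Q C') ----> 0"
proof -
 have sS: "SQ m B \<in> sets Q" if "B \<in> sets Q" for m B
  using measurable_sets[OF S_measurable that] .
 have 1: "(%m. measure Q (C \<inter> (SQ m C')) - measure Q C * measure Q C') ----> 0"
  if C: "C \<in> sets Q" and C': "C' \<in> prod_algebra UNIV (%_. \<gamma>)" for C C'
 proof (rule Q.dynkin_tendsto_zero[where u="%m C. measure Q (C \<inter> (SQ m C')) - measure Q C * measure Q C'"
    and K=2, OF Q_gen Int_stable_prod_algebra Q_gen_sub _ _ _ _ C])
  have C's: "C' \<in> sets Q" using C' by (auto simp: Q_gen)
  show "measure Q ((B \<union> D) \<inter> (SQ m C')) - measure Q (B \<union> D) * measure Q C' =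
    measure Q (B \<inter> (SQ m C')) - measure Q B * measure Q C' +
    (measure Q (D \<inter> (SQ m C')) - measure Q D * measure Q C')"
   if "B \<in> sets Q" "D \<in> sets Q" "B \<inter> D = {}" for m B D
  proof -
   have "(B \<union> D) \<inter> (SQ m C') = (B \<inter> (SQ m C')) \<union> (D \<inter> (SQ m C'))" by auto
   then have "measure Q ((B \<union> D) \<inter> (SQ m C')) =
     measure Q (B \<inter> (SQ m C')) + measure Q (D \<inter> (SQ m C'))"
    using that sS[OF C's] by (simp only:) (intro Q.finite_measure_Union, auto)
   then show ?thesis using that by (simp add: Q.finite_measure_Union algebra_simps)
  qed
  show "\<bar>measure Q (B \<inter> (SQ m C')) - measure Q B * measure Q C'\<bar> <= 2 * measure Q B"
   if B: "B \<in> sets Q" for B m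
  proof -
   have "measure Q (B \<inter> (SQ m C')) <= measure Q B"
    using B by (intro Q.finite_measure_mono) auto
   moreover have "measure Q B * measure Q C' <= measure Q B * 1" by (intro mult_left_mono) auto
   ultimately show ?thesis
    using measure_nonneg[of Q "B \<inter> (SQ m C')"] mult_nonneg_nonneg[OF measure_nonneg[of Q B] measure_nonneg[of Q C']]
    unfolding abs_le_iff by linarith
  qed
  have "space Q \<inter> (SQ m C') = SQ m C'" for m by auto
  then show "(%m. measure Q (space Q \<inter> (SQ m C')) - measure Q (space Q) * measure Q C') ----> 0"
   by (simp add: S_measure C's Q.prob_space)
  fix B assume "B \<in> prod_algebra (UNIV :: int set) (%_. \<gamma>)"
  then obtain J E where JE: "B = cyl J E" "finite J" "\<And>i. i \<in> J ==> E i \<in> sets \<gamma>" by (rule Q_gen_cyl) blast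
  obtain J' E' where JE': "C' = cyl J' E'" "finite J'" "\<And>i. i \<in> J' ==> E' i \<in> sets \<gamma>" using C' by (rule Q_gen_cyl) blast
  show "(%m. measure Q (B \<inter> (SQ m C')) - measure Q B * measure Q C') ----> 0"
   using mixing_cyl[OF JE(2,3) JE'(2,3)] unfolding JE(1) JE'(1)
   by (intro tendsto_eventually) (auto elim: eventually_mono)
 qed
 show ?thesis
 proof (rule Q.dynkin_tendsto_zero[where u="%m C'. measure Q (C \<inter> (SQ m C')) - measure Q C * measure Q C'"
    and K=2, OF Q_gen Int_stable_prod_algebra Q_gen_sub _ _ _ _ C'])
  show "measure Q (C \<inter> (SQ m (B \<union> D))) - measure Q C * measure Q (B \<union> D) =
    measure Q (C \<inter> (SQ m B)) - measure Q C * measure Q B +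
    (measure Q (C \<inter> (SQ m D)) - measure Q C * measure Q D)"
   if "B \<in> sets Q" "D \<in> sets Q" "B \<inter> D = {}" for m B D
  proof -
   have "C \<inter> (SQ m (B \<union> D)) = (C \<inter> (SQ m B)) \<union> (C \<inter> (SQ m D))" by auto
   then have "measure Q (C \<inter> (SQ m (B \<union> D))) =
     measure Q (C \<inter> (SQ m B)) + measure Q (C \<inter> (SQ m D))"
    using that sS C by (simp only:) (intro Q.finite_measure_Union, auto)
   then show ?thesis using that by (simp add: Q.finite_measure_Union algebra_simps)
  qed
  show "\<bar>measure Q (C \<inter> (SQ m B)) - measure Q C * measure Q B\<bar> <= 2 * measure Q B"
   if B: "B \<in> sets Q" for B m
  proof -
   have "measure Q (C \<inter> (SQ m B)) <= measure Q (SQ m B)"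
    using sS[OF B] by (intro Q.finite_measure_mono) auto
   moreover have "measure Q C * measure Q B <= 1 * measure Q B" by (intro mult_right_mono) auto
   ultimately show ?thesis
    using measure_nonneg[of Q "C \<inter> (SQ m B)"] mult_nonneg_nonneg[OF measure_nonneg[of Q C] measure_nonneg[of Q B]]
    unfolding abs_le_iff S_measure[OF B] by linarith
  qed
  have "C \<inter> (S m -` space Q \<inter> space Q) = C" for m
   using measurable_space[OF S_measurable[of m]] sets.sets_into_space[OF C] by auto
  then show "(%m. measure Q (C \<inter> (S m -` space Q \<inter> space Q)) - measure Q C * measure Q (space Q)) ----> 0"
   by (simp add: Q.prob_space)
 qed (rule 1[OF C])
qed

lemma perturbed_shift_iter: "(perturbed_shift \<sigma> ^^ m) (w, d) = ((\<sigma> ^^ m) w, S m d)"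
 by (induction m) (auto simp: perturbed_shift_def S_def algebra_simps)

text \<open>The base is ergodic but need not be mixing, so correlations are taken relative to it:
  \<open>g B\<close> is the measure of the fibres of \<open>B\<close>, and \<open>e m B B'\<close>
  compares the true correlation with that of the fibre measures along the base orbit. Mixing of the
  Bernoulli shift makes this defect tend to 0 on rectangles, hence on all sets. For an invariant
  \<open>B\<close> it says that almost all fibres have measure 0 or 1, and ergodicity of
  \<open>P\<close> decides which.\<close>

lemma perturbed_ergodic:
 assumes erg: "ergodic_invariant P \<sigma>"
 shows "ergodic_invariant (perturbed_measure P \<gamma>) (perturbed_shift \<sigma>)"
proof -
 interpret P: ergodic_system P \<sigma>
  using erg by (auto simp: ergodic_system_def ergodic_system_axioms_def ergodic_invariant_def)
 interpret PQ: pair_prob_space P Q ..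
 let ?M = "P \<Otimes>\<^sub>M Q" and ?T = "perturbed_shift \<sigma>"
 let ?V = "%m B. (?T ^^ m) -` B \<inter> space ?M" and ?W = "%m A. (\<sigma> ^^ m) -` A \<inter> space P"
 have pm: "perturbed_measure P \<gamma> = ?M" by (simp add: perturbed_measure_def Q_def)
 have Tm: "?T ^^ m = (%(w, d). ((\<sigma> ^^ m) w, S m d))" for m
  by (auto simp: fun_eq_iff perturbed_shift_iter)
 have Titer [measurable]: "?T ^^ m \<in> ?M \<rightarrow>\<^sub>M ?M" for m
  unfolding Tm by measurable
 have Tdistr: "distr ?M ?M (?T ^^ m) = ?M" for m
 proof -
  have "distr P P (\<sigma> ^^ m) \<Otimes>\<^sub>M distr Q Q (S m) = distr ?M (P \<Otimes>\<^sub>M Q) (%(w, d). ((\<sigma> ^^ m) w, S m d))"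
   by (rule pair_measure_distr) (auto simp: S_distr Q.sigma_finite_measure_axioms)
  then show ?thesis by (simp only: Tm P.iter_distr S_distr)
 qed
 have T1: "?T \<in> ?M \<rightarrow>\<^sub>M ?M" using Titer[of 1] by simp
 have Tmeas: "measure ?M (?V m B) = measure ?M B" if "B \<in> sets ?M" for m B
  using measure_distr[OF Titer that, of m] by (simp add: Tdistr)
 define g where "g B w = measure Q (Pair w -` B)" for B :: "('a \<times> (int => 'b)) set" and w
 have sec: "Pair w -` B \<in> sets Q" if "B \<in> sets ?M" for w and B :: "('a \<times> (int => 'b)) set"
  using sets_Pair1[OF that] .
 have gm [measurable]: "g B \<in> borel_measurable P" if "B \<in> sets ?M" for B
  unfolding g_def measure_def
  by (intro borel_measurable_enn2real Q.measurable_emeasure_Pair that)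
 have g01: "0 <= g B w" "g B w <= 1" for B w by (auto simp: g_def)
 have gi: "integrable P (g B)" if "B \<in> sets ?M" for B
  using gm[OF that] g01 by (intro P.integrable_const_bound[of _ 1]) auto
 have meas: "measure ?M B = (\<integral>w. g B w \<partial>P)" if B: "B \<in> sets ?M" for B
 proof -
  have "emeasure ?M B = (\<integral>\<^sup>+w. emeasure Q (Pair w -` B) \<partial>P)"
   by (rule Q.emeasure_pair_measure_alt[OF B])
  also have "... = (\<integral>\<^sup>+w. ennreal (g B w) \<partial>P)"
   by (simp add: g_def Q.emeasure_eq_measure)
  also have "... = ennreal (\<integral>w. g B w \<partial>P)"
   using gi[OF B] g01 by (intro nn_integral_eq_integral) auto
  finally show ?thesis
   by (simp add: measure_def g01 Bochner_Integration.integral_nonneg)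
 qed
 define R where "R = {a \<times> b | a b. a \<in> sets P \<and> b \<in> sets Q}"
 have Rgen: "sets ?M = sigma_sets (space ?M) R"
  unfolding R_def by (simp add: sets_pair_measure space_pair_measure)
 have Rst: "Int_stable R" unfolding R_def by (rule Int_stable_pair_measure_generator)
 have Rsub: "R \<subseteq> Pow (space ?M)" using sets.space_closed[of ?M] unfolding Rgen by auto
 define e where "e m B B' = measure ?M (B \<inter> (?V m B')) - (\<integral>w. g B w * g B' ((\<sigma> ^^ m) w) \<partial>P)" for m B B'
 have Tsets: "?V m B \<in> sets ?M" if "B \<in> sets ?M" for m B
  using measurable_sets[OF Titer that] .
 have gg: "integrable P (%w. g B w * g B' ((\<sigma> ^^ m) w))" if B: "B \<in> sets ?M" "B' \<in> sets ?M" for B B' m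
 proof -
  have [measurable]: "g B \<in> borel_measurable P" "g B' \<in> borel_measurable P" using gm B by auto
  show ?thesis using g01 by (intro P.integrable_const_bound[of _ 1]) (auto intro!: mult_le_one)
 qed
 have gUn: "g (B \<union> D) w = g B w + g D w" if "B \<in> sets ?M" "D \<in> sets ?M" "B \<inter> D = {}" for B D w
  unfolding g_def vimage_Un using that by (intro Q.finite_measure_Union sec) auto
 have e_add1: "e m (B \<union> D) B' = e m B B' + e m D B'"
  if B: "B \<in> sets ?M" "D \<in> sets ?M" "B \<inter> D = {}" "B' \<in> sets ?M" for m B D B'
 proof -
  have "(B \<union> D) \<inter> (?V m B') = (B \<inter> (?V m B')) \<union> (D \<inter> (?V m B'))" by auto
  then have "measure ?M ((B \<union> D) \<inter> (?V m B')) =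
    measure ?M (B \<inter> (?V m B')) + measure ?M (D \<inter> (?V m B'))"
   using B Tsets[of B' m] by (simp only:) (intro PQ.finite_measure_Union, auto)
  then show ?thesis using B gg by (simp add: e_def gUn distrib_right)
 qed
 have e_add2: "e m B (B' \<union> D) = e m B B' + e m B D"
  if B: "B' \<in> sets ?M" "D \<in> sets ?M" "B' \<inter> D = {}" "B \<in> sets ?M" for m B D B'
 proof -
  have "B \<inter> (?V m (B' \<union> D)) = (B \<inter> (?V m B')) \<union> (B \<inter> (?V m D))" by auto
  then have "measure ?M (B \<inter> (?V m (B' \<union> D))) =
    measure ?M (B \<inter> (?V m B')) + measure ?M (B \<inter> (?V m D))"
   using B Tsets[of B' m] Tsets[of D m] by (simp only:) (intro PQ.finite_measure_Union, auto)
  then show ?thesis using B gg by (simp add: e_def gUn distrib_left)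
 qed
 have e_bd1: "\<bar>e m B B'\<bar> <= measure ?M B" if B: "B \<in> sets ?M" "B' \<in> sets ?M" for m B B'
 proof -
  have "measure ?M (B \<inter> (?V m B')) <= measure ?M B"
   using B by (intro PQ.finite_measure_mono) auto
  moreover have "(\<integral>w. g B w * g B' ((\<sigma> ^^ m) w) \<partial>P) <= (\<integral>w. g B w \<partial>P)"
   using g01 by (intro integral_mono gg gi B) (auto intro: mult_left_le)
  moreover have "0 <= (\<integral>w. g B w * g B' ((\<sigma> ^^ m) w) \<partial>P)"
   using g01 by (intro Bochner_Integration.integral_nonneg) auto
  ultimately show ?thesis
   using measure_nonneg[of ?M "B \<inter> (?V m B')"]
   unfolding abs_le_iff e_def meas[OF B(1), symmetric] by linarith
 qed
 have e_bd2: "\<bar>e m B B'\<bar> <= measure ?M B'" if B: "B \<in> sets ?M" "B' \<in> sets ?M" for m B B'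
 proof -
  have "measure ?M (B \<inter> (?V m B')) <= measure ?M (?V m B')"
   using Tsets[OF B(2)] by (intro PQ.finite_measure_mono) auto
  moreover have "(\<integral>w. g B w * g B' ((\<sigma> ^^ m) w) \<partial>P) <= (\<integral>w. g B' ((\<sigma> ^^ m) w) \<partial>P)"
   using g01 by (intro integral_mono gg P.integrable_iter gi B) (auto intro: mult_right_le_one_le mult_left_le_one_le)
  moreover have "(\<integral>w. g B' ((\<sigma> ^^ m) w) \<partial>P) = measure ?M B'"
   using P.integral_iter[OF gi[OF B(2)]] meas[OF B(2)] by simp
  moreover have "0 <= (\<integral>w. g B w * g B' ((\<sigma> ^^ m) w) \<partial>P)"
   using g01 by (intro Bochner_Integration.integral_nonneg) auto
  ultimately show ?thesis
   using measure_nonneg[of ?M "B \<inter> (?V m B')"]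
   unfolding abs_le_iff e_def Tmeas[OF B(2)] by linarith
 qed
 have gsp: "g (space ?M) w = 1" if "w \<in> space P" for w
 proof -
  have "Pair w -` space ?M = space Q" using that by (auto simp: space_pair_measure)
  then show ?thesis by (simp add: g_def Q.prob_space)
 qed
 have e_sp1: "e m (space ?M) B' = 0" if B: "B' \<in> sets ?M" for m B'
 proof -
  have "(\<integral>w. g (space ?M) w * g B' ((\<sigma> ^^ m) w) \<partial>P) = (\<integral>w. g B' ((\<sigma> ^^ m) w) \<partial>P)"
   by (intro Bochner_Integration.integral_cong) (auto simp: gsp)
  moreover have "space ?M \<inter> (?V m B') = ?V m B'" by auto
  ultimately show ?thesis using P.integral_iter[OF gi[OF B]] Tmeas[OF B] meas[OF B] by (simp add: e_def)
 qed
 have e_sp2: "e m B (space ?M) = 0" if B: "B \<in> sets ?M" for m B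
 proof -
  have "(\<integral>w. g B w * g (space ?M) ((\<sigma> ^^ m) w) \<partial>P) = (\<integral>w. g B w \<partial>P)"
   by (intro Bochner_Integration.integral_cong) (auto simp: gsp P.iter_space)
  moreover have "B \<inter> ((?T ^^ m) -` space ?M \<inter> space ?M) = B"
   using sets.sets_into_space[OF B] measurable_space[OF Titer[of m]] by auto
  ultimately show ?thesis using meas[OF B] by (simp add: e_def)
 qed
 have e_R: "(%m. e m B B') ----> 0" if B: "B \<in> R" "B' \<in> R" for B B'
 proof -
  obtain A C where AC: "B = A \<times> C" "A \<in> sets P" "C \<in> sets Q" using B(1) by (auto simp: R_def)
  obtain A' C' where AC': "B' = A' \<times> C'" "A' \<in> sets P" "C' \<in> sets Q" using B(2) by (auto simp: R_def)
  have gx: "g (A \<times> C) w = indicator A w * measure Q C" for A C w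
   by (auto simp: g_def indicator_def)
  have "e m B B' = measure P (A \<inter> (?W m A')) * (measure Q (C \<inter> (SQ m C')) - measure Q C * measure Q C')" for m
  proof -
   have "B \<inter> (?V m B') = (A \<inter> (?W m A')) \<times> (C \<inter> (SQ m C'))"
    by (auto simp: AC AC' Tm space_pair_measure)
   then have 1: "measure ?M (B \<inter> (?V m B')) = measure P (A \<inter> (?W m A')) * measure Q (C \<inter> (SQ m C'))"
    using AC AC' by (simp add: measure_def Q.emeasure_pair_measure_Times enn2real_mult)
   have "(\<integral>w. g B w * g B' ((\<sigma> ^^ m) w) \<partial>P) = (\<integral>w. indicator (A \<inter> (?W m A')) w * (measure Q C * measure Q C') \<partial>P)"
    by (intro Bochner_Integration.integral_cong) (auto simp: AC AC' gx indicator_def)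
   also have "... = measure P (A \<inter> (?W m A')) * (measure Q C * measure Q C')"
   proof -
    have "A \<inter> (?W m A') \<in> sets P" using AC AC' by auto
    moreover have "A \<inter> (?W m A') \<inter> space P = A \<inter> (?W m A')" by auto
    ultimately show ?thesis by simp
   qed
   finally show ?thesis using 1 by (simp add: e_def right_diff_distrib)
  qed
  moreover have "(%m. measure P (A \<inter> (?W m A')) * (measure Q (C \<inter> (SQ m C')) - measure Q C * measure Q C')) ----> 0"
  proof (rule Lim_null_comparison[OF _ tendsto_norm_zero[OF mixing[OF AC(3) AC'(3)]]])
   show "EV m. norm (measure P (A \<inter> (?W m A')) * (measure Q (C \<inter> (SQ m C')) - measure Q C * measure Q C'))
     <= norm (measure Q (C \<inter> (SQ m C')) - measure Q C * measure Q C')"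
    by (intro always_eventually allI) (simp add: abs_mult mult_left_le_one_le)
  qed
  ultimately show ?thesis by simp
 qed
 have R_sets: "B \<in> sets ?M" if "B \<in> R" for B using that by (auto simp: R_def)
 have e_mid: "(%m. e m B B') ----> 0" if B: "B \<in> sets ?M" "B' \<in> R" for B B'
  by (rule PQ.dynkin_tendsto_zero[where u="%m B. e m B B'" and K=1, OF Rgen Rst Rsub _ _ _ _ B(1)])
   (use B R_sets in \<open>auto intro: e_add1 e_bd1 e_R simp: e_sp1\<close>)
 have e_lim: "(%m. e m B B') ----> 0" if B: "B \<in> sets ?M" "B' \<in> sets ?M" for B B'
  by (rule PQ.dynkin_tendsto_zero[where u="%m B'. e m B B'" and K=1, OF Rgen Rst Rsub _ _ _ _ B(2)])
   (use B in \<open>auto intro: e_add2 e_bd2 e_mid simp: e_sp2\<close>)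
 have "measure ?M B = 0 \<or> measure ?M B = 1" if B: "B \<in> sets ?M" and inv: "?T -` B \<inter> space ?M = B" for B
 proof -
  have Bsp: "B \<subseteq> space ?M" by (rule sets.sets_into_space[OF B])
  have invm: "?V m B = B" for m
  proof (induction m)
   case 0 then show ?case using Bsp by auto
  next
   case (Suc m)
   have "(?T ^^ Suc m) -` B \<inter> space ?M = ?V m (?T -` B \<inter> space ?M)"
    using measurable_space[OF Titer[of m]] by auto
   then show ?case by (simp only: inv Suc)
  qed
  have ginv: "g B ((\<sigma> ^^ m) w) = g B w" if w: "w \<in> space P" for m w
  proof -
   have "Pair w -` B = Pair w -` (?V m B)" by (simp only: invm)
   also have "... = S m -` (Pair ((\<sigma> ^^ m) w) -` B) \<inter> space Q"
    using w by (auto simp: Tm space_pair_measure)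
   finally show ?thesis using S_measure[OF sec[OF B], of m "(\<sigma> ^^ m) w"] by (simp add: g_def)
  qed
  have eB: "e m B B = (\<integral>w. g B w \<partial>P) - (\<integral>w. g B w * g B w \<partial>P)" for m
  proof -
   have "(\<integral>w. g B w * g B ((\<sigma> ^^ m) w) \<partial>P) = (\<integral>w. g B w * g B w \<partial>P)"
    by (intro Bochner_Integration.integral_cong) (auto simp: ginv)
   then show ?thesis by (simp add: e_def invm meas[OF B])
  qed
  \<comment> \<open>The defect of an invariant set does not depend on \<open>m\<close>, hence is 0;
    as \<open>g B\<close> lies between 0 and 1, this forces \<open>g B\<close> to equal its own
    square almost everywhere.\<close>
  have "(\<integral>w. g B w \<partial>P) - (\<integral>w. g B w * g B w \<partial>P) = 0"
   by (rule LIMSEQ_unique[OF _ e_lim[OF B B]]) (simp add: eB)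
  then have "(\<integral>w. g B w - g B w * g B w \<partial>P) = 0"
   using gi[OF B] gg[OF B B, of 0] by simp
  then have "AE w in P. g B w - g B w * g B w = 0"
   using gi[OF B] gg[OF B B, of 0] g01[of B]
   by (subst (asm) integral_nonneg_eq_0_iff_AE) (auto simp: mult_left_le)
  then have AE01: "AE w in P. g B w = indicator {w\<in>space P. g B w = 1} w"
   using AE_space by eventually_elim (auto simp: indicator_def algebra_simps)
  have [measurable]: "{w\<in>space P. g B w = 1} \<in> sets P" using gm[OF B] by measurable
  have "measure ?M B = (\<integral>w. indicator {w\<in>space P. g B w = 1} w \<partial>P)"
   unfolding meas[OF B] using AE01 gm[OF B] by (intro integral_cong_AE) auto
  also have "... = measure P {w\<in>space P. g B w = 1}"
  proof -
   have "{w\<in>space P. g B w = 1} \<inter> space P = {w\<in>space P. g B w = 1}" by auto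
   then show ?thesis by simp
  qed
  finally have "measure ?M B = measure P {w\<in>space P. g B w = 1}" .
  moreover have "\<sigma> -` {w\<in>space P. g B w = 1} \<inter> space P = {w\<in>space P. g B w = 1}"
   using ginv[of _ 1] measurable_space[OF P.T_measurable] by auto
  then have "measure P {w\<in>space P. g B w = 1} = 0 \<or> measure P {w\<in>space P. g B w = 1} = 1"
   using erg by (auto simp: ergodic_invariant_def)
  ultimately show ?thesis by simp
 qed
 then show ?thesis
  unfolding ergodic_invariant_def pm using T1 Tdistr[of 1] PQ.prob_space_axioms by auto
qed

end

section \<open>Determinants of index functions\<close>

text \<open>Entries come from a function on all indices of which only those below \<open>k\<close>
  are read, so determinants of different sizes can share one entry function.\<close>

definition dt :: "nat => (nat => nat => 'a::comm_ring_1) => 'a" where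
 "dt k M = Determinant.det (mat k k (%(i, j). M i j))"

lemma permutes_lt: "p permutes {0..<k::nat} ==> i < k ==> p i < k"
 using permutes_in_image[of p "{0..<k}" i] by simp

lemma dt_leibniz: "dt k M = (\<Sum>p | p permutes {0..<k}. of_int (sign p) * (\<Prod>i = 0..<k. M i (p i)))"
 unfolding dt_def
 by (subst det_def'[of _ k]) (auto intro!: sum.cong prod.cong simp: permutes_lt)

lemma dt_cong: "(\<And>i j. i < k ==> j < k ==> M i j = N i j) ==> dt k M = dt k N"
 unfolding dt_def by (rule arg_cong[where f=Determinant.det]) (rule cong_mat, auto)

lemma dt_0 [simp]: "dt 0 M = 1"
 by (simp add: dt_def)

lemma dt_transpose: "dt k (%i j. M j i) = dt k M"
proof -
 have "mat k k (%(i, j). M j i) = (mat k k (%(i, j). M i j))\<^sup>T"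
  by (rule eq_matI) auto
 then show ?thesis unfolding dt_def by (simp add: Determinant.det_transpose[of _ k])
qed

lemma dt_mult: "dt k (%i j. \<Sum>l<k. A i l * B l j) = dt k A * dt k B"
proof -
 have "mat k k (%(i, j). \<Sum>l<k. A i l * B l j) = mat k k (%(i, j). A i j) * mat k k (%(i, j). B i j)"
  by (rule eq_matI) (auto simp: scalar_prod_def lessThan_atLeast0)
 then show ?thesis unfolding dt_def by (simp add: Determinant.det_mult[of _ k])
qed

lemma dt_diag: "dt k (%i j. if i = j then d i else 0) = (\<Prod>i<k. d i)"
proof -
 have "dt k (%i j. if i = j then d i else 0) = prod_list (diag_mat (mat k k (%(i, j). if i = j then d i else 0)))"
  unfolding dt_def by (rule det_lower_triangular[of k]) auto
 also have "... = (\<Prod>i<k. d i)"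
  by (simp add: prod_list_diag_prod lessThan_atLeast0)
 finally show ?thesis .
qed

lemma dt_row_sum:
 assumes r: "r < k"
 shows "dt k (%i j. if i = r then \<Sum>s\<in>S. c s * N s j else M i j)
  = (\<Sum>s\<in>S. c s * dt k (%i j. if i = r then N s j else M i j))"
proof -
 have split: "(\<Prod>i = 0..<k. if i = r then u (p i) else M i (p i)) = u (p r) * (\<Prod>i\<in>{0..<k} - {r}. M i (p i))"
  for u :: "nat => 'a" and p
  using r by (subst prod.remove[of _ r]) (auto intro!: prod.cong)
 have "(\<Prod>i = 0..<k. if i = r then \<Sum>s\<in>S. c s * N s (p i) else M i (p i)) =
   (\<Sum>s\<in>S. c s * (\<Prod>i = 0..<k. if i = r then N s (p i) else M i (p i)))" for p
  using split[of "%x. \<Sum>s\<in>S. c s * N s x" p] split[of "N _" p]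
  by (simp add: sum_distrib_right mult.assoc)
 then show ?thesis
  unfolding dt_leibniz sum_distrib_left
  by (subst sum.swap) (simp add: sum_distrib_left mult_ac)
qed

lemma dt_col_sum:
 assumes r: "r < k"
 shows "dt k (%i j. if j = r then \<Sum>s\<in>S. c s * N s i else M i j)
  = (\<Sum>s\<in>S. c s * dt k (%i j. if j = r then N s i else M i j))"
proof -
 have "dt k (%i j. if j = r then \<Sum>s\<in>S. c s * N s i else M i j)
   = dt k (%i j. if i = r then \<Sum>s\<in>S. c s * N s j else M j i)"
  by (rule dt_transpose)
 also have "... = (\<Sum>s\<in>S. c s * dt k (%i j. if i = r then N s j else M j i))"
  by (rule dt_row_sum[OF r])
 also have "... = (\<Sum>s\<in>S. c s * dt k (%i j. if j = r then N s i else M i j))"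
  by (intro sum.cong refl arg_cong2[where f="(*)"]) (rule dt_transpose)
 finally show ?thesis .
qed

lemma dt_eq_cols:
 assumes "a < k" "b < k" "a \<noteq> b" "\<And>i. i < k ==> M i a = M i b"
 shows "dt k M = 0"
 unfolding dt_def
 by (rule det_identical_columns[of _ k a b]) (use assms in \<open>auto intro!: eq_vecI\<close>)

lemma dt_scale_cols: "dt k (%i j. m j * M i j) = (\<Prod>j<k. m j) * dt k M"
proof -
 have "dt k (%i j. m j * M i j) = dt k (%i j. \<Sum>l<k. M i l * (if l = j then m l else 0))"
  by (rule dt_cong) (simp add: if_distrib[of "%x. _ * x"] sum.delta' cong: if_cong)
 then show ?thesis by (simp add: dt_mult dt_diag)
qed

lemma dt_scale_rows: "dt k (%i j. m i * M i j) = (\<Prod>j<k. m j) * dt k M"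
 using dt_scale_cols[of k m "%i j. M j i"] by (subst (1 2) dt_transpose[symmetric]) simp

lemma dt_bound:
 fixes M :: "nat => nat => real"
 assumes "\<And>i j. i < k ==> j < k ==> \<bar>M i j\<bar> <= B"
 shows "\<bar>dt k M\<bar> <= fact k * B ^ k"
proof -
 have "\<bar>dt k M\<bar> <= (\<Sum>p | p permutes {0..<k}. \<bar>of_int (sign p) * (\<Prod>i = 0..<k. M i (p i))\<bar>)"
  unfolding dt_leibniz by (rule sum_abs)
 also have "... <= (\<Sum>p | p permutes {0..<k}. B ^ k)"
 proof (rule sum_mono)
  fix p assume "p \<in> {p. p permutes {0..<k}}"
  then have p: "p permutes {0..<k}" by simp
  have "\<bar>of_int (sign p) * (\<Prod>i = 0..<k. M i (p i))\<bar> = (\<Prod>i = 0..<k. \<bar>M i (p i)\<bar>)"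
   by (simp add: abs_mult abs_prod sign_def)
  also have "... <= (\<Prod>i = 0..<k. B)"
   using assms permutes_lt[OF p] by (intro prod_mono) auto
  finally show "\<bar>of_int (sign p) * (\<Prod>i = 0..<k. M i (p i))\<bar> <= B ^ k" by simp
 qed
 also have "... = fact k * B ^ k"
  by (simp add: card_permutations[OF refl])
 finally show ?thesis .
qed

lemma dt_measurable [measurable]:
 fixes M :: "nat => nat => 'a => real"
 assumes [measurable]: "\<And>i j. M i j \<in> borel_measurable N"
 shows "(%x. dt k (%i j. M i j x)) \<in> borel_measurable N"
 unfolding dt_leibniz by measurable

lemma tendsto_dt:
 fixes M :: "'b => nat => nat => real"
 assumes "\<And>i j. i < k ==> j < k ==> ((%n. M n i j) \<longlongrightarrow> L i j) F"
 shows "((%n. dt k (M n)) \<longlongrightarrow> dt k L) F"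
 unfolding dt_leibniz
 by (intro tendsto_sum tendsto_mult tendsto_const tendsto_prod assms) (auto simp: permutes_lt)

lemma dt_laplace_col:
 assumes b: "b < Suc k"
 shows "dt (Suc k) M = (\<Sum>i<Suc k. M i b * ((-1) ^ (i + b) *
  dt k (%i' j'. M (if i' < i then i' else Suc i') (if j' < b then j' else Suc j'))))"
proof -
 let ?A = "mat (Suc k) (Suc k) (%(i, j). M i j)"
 have "dt (Suc k) M = (\<Sum>i<Suc k. ?A $$ (i, b) * cofactor ?A i b)"
  unfolding dt_def by (rule laplace_expansion_column[of _ "Suc k"]) (use b in auto)
 also have "... = (\<Sum>i<Suc k. M i b * ((-1) ^ (i + b) *
   dt k (%i' j'. M (if i' < i then i' else Suc i') (if j' < b then j' else Suc j'))))"
 proof (rule sum.cong[OF refl])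
  fix i assume i: "i \<in> {..<Suc k}"
  have "mat_delete ?A i b = mat k k (%(i', j'). M (if i' < i then i' else Suc i') (if j' < b then j' else Suc j'))"
   by (rule eq_matI) (use i b in \<open>auto simp: mat_delete_def\<close>)
  then show "?A $$ (i, b) * cofactor ?A i b = M i b * ((-1) ^ (i + b) *
   dt k (%i' j'. M (if i' < i then i' else Suc i') (if j' < b then j' else Suc j')))"
   using i b by (simp add: cofactor_def dt_def)
 qed
 finally show ?thesis .
qed

text \<open>Serves to integrate out diagonal noise: the determinant is affine in its last diagonal
  entry, with slope the next smaller determinant.\<close>

lemma dt_add_last_diag:
 "dt (Suc k) (%i j. M i j + (if i = k \<and> j = k then d else 0)) = dt (Suc k) M + d * dt k M"
proof -
 have eq: "dt k (%i' j'. M (if i' < i then i' else Suc i') (if j' < k then j' else Suc j') +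
   (if (if i' < i then i' else Suc i') = k \<and> (if j' < k then j' else Suc j') = k then d else 0))
  = dt k (%i' j'. M (if i' < i then i' else Suc i') (if j' < k then j' else Suc j'))" for i
  by (rule dt_cong) auto
 have "dt (Suc k) (%i j. M i j + (if i = k \<and> j = k then d else 0)) =
  (\<Sum>i<Suc k. (M i k + (if i = k then d else 0)) * ((-1) ^ (i + k) *
  dt k (%i' j'. M (if i' < i then i' else Suc i') (if j' < k then j' else Suc j'))))"
  by (subst dt_laplace_col[of k]) (simp_all add: eq)
 also have "... = dt (Suc k) M + (\<Sum>i<Suc k. (if i = k then d else 0) * ((-1) ^ (i + k) *
  dt k (%i' j'. M (if i' < i then i' else Suc i') (if j' < k then j' else Suc j'))))"
  by (subst dt_laplace_col[of k k M]) (simp_all add: distrib_right sum.distrib)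
 also have "(\<Sum>i<Suc k. (if i = k then d else 0) * ((-1) ^ (i + k) *
  dt k (%i' j'. M (if i' < i then i' else Suc i') (if j' < k then j' else Suc j'))))
  = d * dt k (%i' j'. M (if i' < k then i' else Suc i') (if j' < k then j' else Suc j'))"
  by (simp add: power_add[symmetric] mult_2[symmetric] if_distrib[of "%x. x * _"] sum.delta cong: if_cong)
 also have "dt k (%i' j'. M (if i' < k then i' else Suc i') (if j' < k then j' else Suc j')) = dt k M"
  by (rule dt_cong) auto
 finally show ?thesis .
qed

text \<open>\<open>k\<close> homogeneous equations in \<open>k + 1\<close> unknowns; a zero row
  completes them to a singular square matrix.\<close>

lemma kernel_vector:
 fixes M :: "nat => nat => real"
 shows "\<exists>c. (\<exists>b\<le>k. c b \<noteq> 0) \<and> (\<forall>i<k. (\<Sum>b\<le>k. c b * M b i) = 0)"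
proof -
 let ?A = "mat (Suc k) (Suc k) (%(i, b). if i = k then 0 else M b i)"
 have c: "?A \<in> carrier_mat (Suc k) (Suc k)" by simp
 have "dt (Suc k) (%i j. 0 * (if i = k then 1 else M j i)) = (0::real)"
  by (subst dt_scale_rows) simp
 have "Determinant.det ?A = dt (Suc k) (%i j. (if i = k then 0 else 1) * M j i)"
  unfolding dt_def by (rule arg_cong[where f=Determinant.det]) (rule cong_mat, auto)
 also have "... = 0" by (subst dt_scale_rows) simp
 finally obtain v where v: "v \<in> carrier_vec (Suc k)" "v \<noteq> 0\<^sub>v (Suc k)" "?A *\<^sub>v v = 0\<^sub>v (Suc k)"
  using det_0_iff_vec_prod_zero_field[OF c] by auto
 have "\<exists>b\<le>k. vec_index v b \<noteq> 0"
 proof (rule ccontr)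
  assume "\<not> ?thesis"
  then have "v = 0\<^sub>v (Suc k)" using v(1) by (intro eq_vecI) (auto simp: less_Suc_eq_le)
  then show False using v(2) by simp
 qed
 moreover have "(\<Sum>b\<le>k. vec_index v b * M b i) = 0" if i: "i < k" for i
 proof -
  have "vec_index (?A *\<^sub>v v) i = 0" using v(3) i by simp
  moreover have "vec_index (?A *\<^sub>v v) i = (\<Sum>b\<le>k. vec_index v b * M b i)"
   using i v(1) by (simp add: scalar_prod_def atLeast0LessThan lessThan_Suc_atMost mult.commute)
  ultimately show ?thesis by simp
 qed
 ultimately show ?thesis by (intro exI[of _ "vec_index v"]) blast
qed

section \<open>Volumes: norms of exterior powers and their perturbation\<close>

definition mdet :: "nat => ('h::real_inner \<Rightarrow>\<^sub>L 'h) => (nat => 'h) => (nat => 'h) => real" where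
 "mdet k B x y = dt k (%a b. inner (x a) (ap B (y b)))"

definition unit_tuples :: "((nat => 'h::real_normed_vector) \<times> (nat => 'h)) set" where
 "unit_tuples = {(x, y). (\<forall>a. norm (x a) <= 1) \<and> (\<forall>a. norm (y a) <= 1)}"

text \<open>The norm of the \<open>k\<close>-th exterior power of \<open>B\<close>.\<close>

definition vol :: "nat => ('h::real_inner \<Rightarrow>\<^sub>L 'h) => real" where
 "vol k B = (SUP (x, y)\<in>unit_tuples. \<bar>mdet k B x y\<bar>)"

lemma mdet_cong:
 "(\<And>a. a < k ==> x a = x' a) ==> (\<And>a. a < k ==> ap B (y a) = ap B' (y' a))
  ==> mdet k B x y = mdet k B' x' y'"
 unfolding mdet_def by (rule dt_cong) simp

lemma mdet_bound:
 assumes "\<And>a. a < k ==> norm (x a) <= 1" "\<And>a. a < k ==> norm (y a) <= 1"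
 shows "\<bar>mdet k B x y\<bar> <= fact k * norm B ^ k"
 unfolding mdet_def
proof (rule dt_bound)
 fix i j assume ij: "i < k" "j < k"
 have "\<bar>inner (x i) (ap B (y j))\<bar> <= norm (x i) * norm (ap B (y j))"
  by (rule Cauchy_Schwarz_ineq2)
 also have "... <= 1 * (norm B * norm (y j))"
  using ij assms by (intro mult_mono norm_blinfun) auto
 also have "... <= norm B" using ij assms by (simp add: mult_left_le)
 finally show "\<bar>inner (x i) (ap B (y j))\<bar> <= norm B" .
qed

lemma vol_bdd: "bdd_above ((%(x, y). \<bar>mdet k B x y\<bar>) ` unit_tuples)"
 by (rule bdd_aboveI[of _ "fact k * norm B ^ k"]) (auto simp: unit_tuples_def intro!: mdet_bound)

lemma unit_tuples_nonempty: "unit_tuples \<noteq> {}"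
 by (auto simp: unit_tuples_def intro!: exI[of _ "%_. 0"])

lemma vol_upper:
 assumes "\<And>a. a < k ==> norm (x a) <= 1" "\<And>a. a < k ==> norm (y a) <= 1"
 shows "\<bar>mdet k B x y\<bar> <= vol k B"
proof -
 let ?x = "%a. if a < k then x a else 0" and ?y = "%a. if a < k then y a else 0"
 have "\<bar>mdet k B x y\<bar> = \<bar>mdet k B ?x ?y\<bar>"
  by (subst mdet_cong[of k x ?x B y B ?y]) auto
 also have "... <= vol k B"
  unfolding vol_def by (rule cSUP_upper2[OF vol_bdd, of "(?x, ?y)"]) (use assms in \<open>auto simp: unit_tuples_def\<close>)
 finally show ?thesis .
qed

lemma vol_nonneg: "0 <= vol k B"
 using vol_upper[of k "%_. 0" "%_. 0" B] by simp

lemma vol_least: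
 assumes "\<And>x y. (\<And>a. norm (x a) <= 1) ==> (\<And>a. norm (y a) <= 1) ==> \<bar>mdet k B x y\<bar> <= c"
 shows "vol k B <= c"
 unfolding vol_def by (rule cSUP_least[OF unit_tuples_nonempty]) (use assms in \<open>auto simp: unit_tuples_def\<close>)

lemma vol_le: "vol k B <= fact k * norm B ^ k"
 by (rule vol_least) (rule mdet_bound)

lemma vol_le_power: "norm B <= R ==> vol k B <= fact k * R ^ k"
 by (rule order_trans[OF vol_le]) (auto intro!: mult_left_mono power_mono)

lemma vol_id_le: "vol k (id_blinfun :: 'h::real_inner \<Rightarrow>\<^sub>L 'h) <= fact k"
 using vol_le_power[OF norm_blinfun_id_le] by simp

lemma vol_approx:
 "c < vol k B ==> \<exists>x y. (\<forall>a. norm (x a) <= 1) \<and> (\<forall>a. norm (y a) <= 1) \<and> c < \<bar>mdet k B x y\<bar>"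
 unfolding vol_def less_cSUP_iff[OF unit_tuples_nonempty vol_bdd]
 by (auto simp: unit_tuples_def)

lemma vol_0 [simp]: "vol 0 B = 1"
 by (intro antisym vol_least) (use vol_upper[of 0 "%_. 0" "%_. 0" B] in \<open>auto simp: mdet_def\<close>)

lemma mdet_hom:
 assumes "\<And>a. a < k ==> norm (x a) <= 1"
 shows "\<bar>mdet k B x y\<bar> <= vol k B * (\<Prod>b<k. norm (y b))"
proof -
 have "mdet k B x y = dt k (%a b. norm (y b) * inner (x a) (ap B (sgn (y b))))"
  unfolding mdet_def
 proof (rule dt_cong)
  fix a b
  have "y b = norm (y b) *R sgn (y b)" by (cases "y b = 0") (simp_all add: sgn_div_norm)
  then show "inner (x a) (ap B (y b)) = norm (y b) * inner (x a) (ap B (sgn (y b)))"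
   by (metis blinfun.scaleR_right inner_scaleR_right)
 qed
 also have "... = (\<Prod>b<k. norm (y b)) * mdet k B x (%b. sgn (y b))"
  by (subst dt_scale_cols) (simp add: mdet_def)
 also have "\<bar>...\<bar> = (\<Prod>b<k. norm (y b)) * \<bar>mdet k B x (%b. sgn (y b))\<bar>"
  by (simp add: abs_mult abs_prod)
 also have "... <= (\<Prod>b<k. norm (y b)) * vol k B"
  by (intro mult_left_mono vol_upper assms prod_nonneg) (auto simp: norm_sgn)
 finally show ?thesis by (simp add: mult.commute)
qed

text \<open>Gram-Schmidt orthonormalisation, with \<open>0\<close> in the places of linearly dependent vectors.\<close>

lemma gram_schmidt:
 fixes z :: "nat => 'h::real_inner"
 shows "\<exists>w. (\<forall>c. norm (w c) <= 1) \<and> (\<forall>b<k. z b = (\<Sum>c<k. inner (w c) (z b) *R w c))"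
proof -
 have "\<exists>w. (\<forall>c. norm (w c) <= 1) \<and> (\<forall>b<k. z b = (\<Sum>c<k. inner (w c) (z b) *R w c)) \<and>
   (\<forall>c<k. \<forall>d<k. c \<noteq> d --> inner (w c) (w d) = 0) \<and> (\<forall>c<k. w c = 0 \<or> norm (w c) = 1)"
 proof (induction k)
  case 0
  then show ?case by (auto intro!: exI[of _ "%_. 0"])
 next
  case (Suc k)
  then obtain w where W: "(\<forall>c. norm (w c) <= 1) \<and> (\<forall>b<k. z b = (\<Sum>c<k. inner (w c) (z b) *R w c)) \<and>
   (\<forall>c<k. \<forall>d<k. c \<noteq> d --> inner (w c) (w d) = 0) \<and> (\<forall>c<k. w c = 0 \<or> norm (w c) = 1)"
   by (rule exE)
  have w: "norm (w c) <= 1" for c using W by simp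
  have w2: "z b = (\<Sum>c<k. inner (w c) (z b) *R w c)" if "b < k" for b
   using conjunct1[OF conjunct2[OF W], rule_format, OF that] .
  have w3: "inner (w c) (w d) = 0" if "c < k" "d < k" "c \<noteq> d" for c d
   using conjunct1[OF conjunct2[OF conjunct2[OF W]]] that by simp
  have w4: "w c = 0 \<or> norm (w c) = 1" if "c < k" for c
   using conjunct2[OF conjunct2[OF conjunct2[OF W]]] that by simp
  define u where "u = z k - (\<Sum>c<k. inner (w c) (z k) *R w c)"
  define w' where "w' = w(k := sgn u)"
  have w'k: "w' k = sgn u" and w'c: "\<And>c. c < k ==> w' c = w c" by (auto simp: w'_def)
  have orth: "inner (w c) u = 0" if c: "c < k" for c
  proof -
   have "inner (w c) (\<Sum>d<k. inner (w d) (z k) *R w d) = (\<Sum>d<k. inner (w d) (z k) * inner (w c) (w d))"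
    by (simp add: inner_sum_right)
   also have "... = (\<Sum>d<k. if d = c then inner (w c) (z k) * inner (w c) (w c) else 0)"
    using c w3 by (intro sum.cong) auto
   also have "... = inner (w c) (z k) * inner (w c) (w c)" using c by simp
   also have "... = inner (w c) (z k)"
    using w4[OF c] by (auto simp: dot_square_norm)
   finally show ?thesis by (simp add: u_def inner_diff_right)
  qed
  have orth': "inner (sgn u) (w c) = 0" "inner (w c) (sgn u) = 0" if "c < k" for c
   using orth[OF that] by (auto simp: sgn_div_norm inner_commute)
  have span: "z b = (\<Sum>c<Suc k. inner (w' c) (z b) *R w' c)" if b: "b < Suc k" for b
  proof (cases "b = k")
   case True
   have "inner (sgn u) (z k) = inner (sgn u) (u + (\<Sum>c<k. inner (w c) (z k) *R w c))" by (simp add: u_def)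
   also have "... = inner (sgn u) u" by (simp add: inner_add_right inner_sum_right orth')
   also have "... = norm u"
    by (cases "u = 0") (auto simp: sgn_div_norm dot_square_norm power2_eq_square)
   finally have "inner (sgn u) (z k) *R sgn u = u" by (cases "u = 0") (simp_all add: sgn_div_norm)
   then show ?thesis using True by (simp add: w'k w'c u_def)
  next
   case False
   then have bk: "b < k" using b by simp
   have "inner (sgn u) (z b) = 0"
    by (subst w2[OF bk]) (simp add: inner_sum_right orth')
   then show ?thesis using w2[OF bk] by (simp add: w'k w'c)
  qed
  show ?case
  proof (intro exI[of _ w'] conjI allI impI)
   show "norm (w' c) <= 1" for c using w by (simp add: w'_def norm_sgn)
   show "inner (w' c) (w' d) = 0" if "c < Suc k" "d < Suc k" "c \<noteq> d" for c d
    using that w3 orth' by (auto simp: w'_def less_Suc_eq)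
   show "w' c = 0 \<or> norm (w' c) = 1" if "c < Suc k" for c
    using that w4 by (auto simp: w'_def less_Suc_eq norm_sgn sgn_zero_iff)
  qed (rule span)
 qed
 then show ?thesis by (elim exE conjE) (intro exI conjI, assumption+)
qed

text \<open>A Cauchy-Binet formula with a single term, because all the images \<open>C (y b)\<close>
  lie in the span of the \<open>k\<close> vectors \<open>w\<close>.\<close>

lemma mdet_factor:
 assumes "\<And>b. b < k ==> ap C (y b) = (\<Sum>c<k. inner (w c) (ap C (y b)) *R w c)"
 shows "mdet k (B oL C) x y = mdet k B x w * mdet k C w y"
proof -
 have "mdet k (B oL C) x y =
  dt k (%a b. \<Sum>c<k. inner (x a) (ap B (w c)) * inner (w c) (ap C (y b)))"
  unfolding mdet_def
 proof (rule dt_cong)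
  fix a b assume b: "b < k"
  show "inner (x a) (ap (B oL C) (y b)) =
    (\<Sum>c<k. inner (x a) (ap B (w c)) * inner (w c) (ap C (y b)))"
   by (simp, subst assms[OF b])
    (simp add: blinfun.sum_right blinfun.scaleR_right inner_sum_right mult.commute)
 qed
 then show ?thesis by (simp add: dt_mult mdet_def)
qed

lemma vol_mult: "vol k (B oL C) <= vol k B * vol k C"
proof (rule vol_least)
 fix x y :: "nat => 'a" assume x: "\<And>a. norm (x a) <= 1" and y: "\<And>a. norm (y a) <= 1"
 obtain w where w: "\<And>c. norm (w c) <= 1"
   "\<And>b. b < k ==> ap C (y b) = (\<Sum>c<k. inner (w c) (ap C (y b)) *R w c)"
  using gram_schmidt[of k "%b. ap C (y b)"] by blast
 have "\<bar>mdet k (B oL C) x y\<bar> = \<bar>mdet k B x w\<bar> * \<bar>mdet k C w y\<bar>"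
  by (subst mdet_factor[OF w(2)]) (auto simp: abs_mult)
 also have "... <= vol k B * vol k C"
  by (intro mult_mono vol_upper x y w vol_nonneg) auto
 finally show "\<bar>mdet k (B oL C) x y\<bar> <= vol k B * vol k C" .
qed

lemma dt_telescope:
 fixes M N :: "nat => nat => real"
 shows "dt k M - dt k N = (\<Sum>r<k. dt k (%i j. if j < r then N i j else if j = r then M i j - N i j else M i j))"
proof -
 define F where "F r = dt k (%i j. if j < r then N i j else M i j)" for r
 have "F r - F (Suc r) = dt k (%i j. if j < r then N i j else if j = r then M i j - N i j else M i j)"
  if r: "r < k" for r
 proof -
  let ?c = "%s::nat. if s = 0 then 1 else -1 :: real"
  have "dt k (%i j. if j < r then N i j else if j = r then M i j - N i j else M i j) =
    dt k (%i j. if j = r then \<Sum>s\<in>{0, 1}. ?c s * (if s = 0 then M i r else N i r)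
     else if j < r then N i j else M i j)"
   by (rule dt_cong) auto
  also have "... = (\<Sum>s\<in>{0, 1}. ?c s * dt k (%i j. if j = r then (if s = 0 then M i r else N i r)
     else if j < r then N i j else M i j))"
   by (rule dt_col_sum[OF r])
  also have "... = dt k (%i j. if j = r then M i r else if j < r then N i j else M i j) -
    dt k (%i j. if j = r then N i r else if j < r then N i j else M i j)" by (simp cong: if_cong)
  also have "dt k (%i j. if j = r then M i r else if j < r then N i j else M i j) = F r"
   unfolding F_def by (rule dt_cong) auto
  also have "dt k (%i j. if j = r then N i r else if j < r then N i j else M i j) = F (Suc r)"
   unfolding F_def by (rule dt_cong) auto
  finally show ?thesis by simp
 qed
 then have "(\<Sum>r<k. dt k (%i j. if j < r then N i j else if j = r then M i j - N i j else M i j)) = (\<Sum>r<k. F r - F (Suc r))"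
  by (intro sum.cong) auto
 also have "... = F 0 - F k" by (rule sum_lessThan_telescope')
 also have "F 0 = dt k M" by (simp add: F_def)
 also have "F k = dt k N" unfolding F_def by (rule dt_cong) auto
 finally show ?thesis by simp
qed

text \<open>Columns are exchanged one at a time; in each difference one vector carries
  \<open>norm (B' - B)\<close> and the other \<open>k - 1\<close> are bounded by \<open>S\<close>.
  Splitting off \<open>R\<close> by Gram-Schmidt first keeps the bound in terms of
  \<open>vol k L\<close> and \<open>vol k R\<close>; powers of the operator norms of long products
  would be too crude.\<close>

lemma mdet_perturb:
 assumes x: "\<And>a. norm (x a) <= 1" and y: "\<And>a. norm (y a) <= 1" and S: "norm B <= S" "norm B' <= S"
 shows "\<bar>mdet k (L oL B' oL R) x y - mdet k (L oL B oL R) x y\<bar> <=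
  real k * vol k L * vol k R * norm (B' - B) * S ^ (k - 1)"
proof -
 have S0: "0 <= S" using S(1) norm_ge_zero order_trans by blast
 obtain w where w: "\<And>c. norm (w c) <= 1"
   "\<And>b. b < k ==> ap R (y b) = (\<Sum>c<k. inner (w c) (ap R (y b)) *R w c)"
  using gram_schmidt[of k "%b. ap R (y b)"] by blast
 have eq: "mdet k (L oL B oL R) x y = mdet k (L oL B) x w * mdet k R w y" for B
  by (rule mdet_factor) (rule w(2))
 have col: "\<bar>dt k (%i j. if j < r then inner (x i) (ap (L oL B) (w j))
    else if j = r then inner (x i) (ap (L oL B') (w j)) - inner (x i) (ap (L oL B) (w j))
    else inner (x i) (ap (L oL B') (w j)))\<bar> <= vol k L * (norm (B' - B) * S ^ (k - 1))"
  (is "\<bar>?d\<bar> <= _") if r: "r < k" for r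
 proof -
  define z where "z j = (if j < r then ap B (w j) else if j = r then ap (B' - B) (w j) else ap B' (w j))" for j
  have "?d = mdet k L x z"
   unfolding mdet_def by (rule dt_cong) (auto simp: z_def blinfun.diff_left blinfun.diff_right inner_diff_right)
  then have "\<bar>?d\<bar> <= vol k L * (\<Prod>j<k. norm (z j))" using mdet_hom[of k x L z] x by simp
  also have "(\<Prod>j<k. norm (z j)) = norm (z r) * (\<Prod>j\<in>{..<k} - {r}. norm (z j))"
   using r by (subst prod.remove[of _ r]) auto
  also have "... <= norm (B' - B) * (\<Prod>j\<in>{..<k} - {r}. S)"
  proof (intro mult_mono prod_mono prod_nonneg conjI)
   have bd: "norm (ap C (w j)) <= norm C" for C :: "'a \<Rightarrow>\<^sub>L 'a" and j
    using norm_blinfun[of C "w j"] mult_left_le[of "norm (w j)" "norm C"] w(1)[of j] by simp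
   show "norm (z r) <= norm (B' - B)" by (simp add: z_def bd)
   show "norm (z j) <= S" if "j \<in> {..<k} - {r}" for j
    using that bd[of B j] bd[of B' j] S by (auto simp: z_def)
  qed auto
  also have "(\<Prod>j\<in>{..<k} - {r}. S) = S ^ (k - 1)" using r by simp
  finally show ?thesis by (simp add: mult_left_mono vol_nonneg)
 qed
 have "\<bar>mdet k (L oL B') x w - mdet k (L oL B) x w\<bar> <= (\<Sum>r<k. vol k L * (norm (B' - B) * S ^ (k - 1)))"
  unfolding mdet_def by (subst dt_telescope) (intro order_trans[OF sum_abs] sum_mono col, simp)
 also have "... = real k * vol k L * norm (B' - B) * S ^ (k - 1)" by simp
 finally have "\<bar>mdet k (L oL B') x w - mdet k (L oL B) x w\<bar> * \<bar>mdet k R w y\<bar> <=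
   real k * vol k L * norm (B' - B) * S ^ (k - 1) * vol k R"
  by (intro mult_mono vol_upper w y mult_nonneg_nonneg vol_nonneg) (auto simp: S0 vol_nonneg)
 then show ?thesis
  unfolding eq abs_mult[symmetric] left_diff_distrib by (simp only: mult_ac)
qed

lemma vol_perturb:
 assumes S: "norm B <= S" "norm B' <= S"
 shows "vol k (L oL B' oL R) <= vol k (L oL B oL R) + real k * vol k L * vol k R * norm (B' - B) * S ^ (k - 1)"
proof (rule vol_least)
 fix x y :: "nat => 'a" assume xy: "\<And>a. norm (x a) <= 1" "\<And>a. norm (y a) <= 1"
 show "\<bar>mdet k (L oL B' oL R) x y\<bar> <= vol k (L oL B oL R) + real k * vol k L * vol k R * norm (B' - B) * S ^ (k - 1)"
 proof -
  have "\<bar>mdet k (L oL B' oL R) x y - mdet k (L oL B oL R) x y\<bar> <=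
    real k * vol k L * vol k R * norm (B' - B) * S ^ (k - 1)"
   by (rule mdet_perturb) (use xy S in auto)
  moreover have "\<bar>mdet k (L oL B oL R) x y\<bar> <= vol k (L oL B oL R)"
   by (rule vol_upper) (use xy in auto)
  ultimately show ?thesis by linarith
 qed
qed

lemma tendsto_vol:
 fixes X :: "'b => 'h::real_inner \<Rightarrow>\<^sub>L 'h"
 assumes X: "(X \<longlongrightarrow> B) F"
 shows "((%n. vol k (X n)) \<longlongrightarrow> vol k B) F"
proof -
 let ?c = "real k * vol k (id_blinfun :: 'h op) * vol k (id_blinfun :: 'h op)"
 have id: "id_blinfun oL C oL id_blinfun = C" for C :: "'h op" by (rule blinfun_eqI) simp
 have le: "\<bar>vol k (X n) - vol k B\<bar> <= ?c * norm (X n - B) * (norm B + norm (X n)) ^ (k - 1)" for n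
  using vol_perturb[of B "norm B + norm (X n)" "X n" k id_blinfun id_blinfun]
   vol_perturb[of "X n" "norm B + norm (X n)" B k id_blinfun id_blinfun]
  unfolding id norm_minus_commute[of B] abs_le_iff by (simp add: algebra_simps)
 have "((%n. ?c * norm (X n - B) * (norm B + norm (X n)) ^ (k - 1)) \<longlongrightarrow> ?c * norm (B - B) * (norm B + norm B) ^ (k - 1)) F"
  by (intro tendsto_intros X)
 then have lim: "((%n. ?c * norm (X n - B) * (norm B + norm (X n)) ^ (k - 1)) \<longlongrightarrow> 0) F" by simp
 have "((%n. vol k (X n) - vol k B) \<longlongrightarrow> 0) F"
  by (rule Lim_null_comparison[OF _ lim]) (simp only: real_norm_def le eventually_True)
 then show ?thesis by (simp add: LIM_zero_iff)
qed

lemma abs_signed_mult_le: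
 fixes a d :: real
 assumes "\<bar>a\<bar> <= A" "\<bar>d\<bar> <= D"
 shows "\<bar>a * ((-1) ^ n * d)\<bar> <= A * D"
 using assms by (simp add: abs_mult power_abs mult_mono')

text \<open>Some combination \<open>v\<close> of \<open>k + 1\<close> vectors is orthogonal to all
  \<open>f i\<close>. It can take the place of one column without changing the determinant, and
  Laplace expansion along that column gains the factor \<open>t\<close>. With singular vectors for
  \<open>f\<close>, the next singular value serves as \<open>t\<close>.\<close>

lemma vol_Suc_le:
 fixes f :: "nat => 'h::real_inner"
 assumes t: "0 <= t"
  and f: "\<And>y. (\<forall>i<k. inner y (f i) = 0) ==> norm (ap B y) <= t * norm y"
 shows "vol (Suc k) B <= (real (Suc k))\<^sup>2 * t * vol k B"
proof (rule vol_least)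
 fix x y :: "nat => 'h" assume xy: "\<And>a. norm (x a) <= 1" "\<And>a. norm (y a) <= 1"
 obtain c0 where C: "(\<exists>b\<le>k. c0 b \<noteq> 0) \<and> (\<forall>i<k. (\<Sum>b\<le>k. c0 b * inner (y b) (f i)) = 0)"
  using kernel_vector[of k "%b i. inner (y b) (f i)"] by (rule exE)
 obtain b0 where b0: "b0 <= k" "c0 b0 \<noteq> 0" using conjunct1[OF C] by auto
 note c0 = b0 conjunct2[OF C, rule_format]
 \<comment> \<open>Dividing by a coefficient of largest modulus bounds all coefficients by 1 and
   gives \<open>y m\<close> the coefficient 1: so \<open>norm v <= Suc k\<close>, and putting
   \<open>v\<close> into column \<open>m\<close> preserves the determinant.\<close>
 have "Max ((%b. \<bar>c0 b\<bar>) ` {..k}) \<in> (%b. \<bar>c0 b\<bar>) ` {..k}" by (rule Max_in) auto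
 then obtain m where m0: "Max ((%b. \<bar>c0 b\<bar>) ` {..k}) = \<bar>c0 m\<bar>" "m \<in> {..k}" by (rule imageE)
 have m: "m <= k" using m0(2) by simp
 have m2: "\<bar>c0 b\<bar> <= \<bar>c0 m\<bar>" if "b <= k" for b
  unfolding m0(1)[symmetric] by (rule Max_ge) (use that in auto)
 have cm: "c0 m \<noteq> 0" using m2[OF c0(1)] c0(2) by auto
 define c where "c b = c0 b / c0 m" for b
 have c1: "c m = 1" "\<And>b. b <= k ==> \<bar>c b\<bar> <= 1"
  using cm m2 by (auto simp: c_def abs_divide divide_le_eq_1)
 define v where "v = (\<Sum>b\<le>k. c b *R y b)"
 have "inner v (f i) = 0" if "i < k" for i
 proof -
  have "inner v (f i) = (\<Sum>b\<le>k. c0 b * inner (y b) (f i)) / c0 m"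
   by (simp add: v_def inner_sum_left c_def sum_divide_distrib)
  then show ?thesis using c0(3)[OF that] by simp
 qed
 then have Bv: "norm (ap B v) <= t * norm v" by (intro f) auto
 have nv: "norm v <= real (Suc k)"
 proof -
  have "norm v <= (\<Sum>b\<le>k. norm (c b *R y b))" unfolding v_def by (rule norm_sum)
  also have "... <= (\<Sum>b\<le>k. 1)" using c1 xy by (intro sum_mono) (auto intro!: mult_le_one)
  finally show ?thesis by simp
 qed
 have mk: "m < Suc k" using m by simp
 let ?M = "%a b. if b = m then inner (x a) (ap B v) else inner (x a) (ap B (y b))"
 have "dt (Suc k) ?M = dt (Suc k) (%a b. if b = m then \<Sum>s\<le>k. c s * inner (x a) (ap B (y s)) else inner (x a) (ap B (y b)))"
  by (rule dt_cong) (simp add: v_def blinfun.sum_right blinfun.scaleR_right inner_sum_right)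
 also have "... = (\<Sum>s\<le>k. c s * dt (Suc k) (%a b. if b = m then inner (x a) (ap B (y s)) else inner (x a) (ap B (y b))))"
  by (rule dt_col_sum[OF mk])
 also have "... = (\<Sum>s\<le>k. if s = m then mdet (Suc k) B x y else 0)"
 proof (rule sum.cong[OF refl])
  fix s assume s: "s \<in> {..k}"
  show "c s * dt (Suc k) (%a b. if b = m then inner (x a) (ap B (y s)) else inner (x a) (ap B (y b)))
   = (if s = m then mdet (Suc k) B x y else 0)"
  proof (cases "s = m")
   case True
   have "dt (Suc k) (%a b. if b = m then inner (x a) (ap B (y s)) else inner (x a) (ap B (y b)))
     = mdet (Suc k) B x y"
    unfolding mdet_def by (rule dt_cong) (use True in auto)
   then show ?thesis using True c1(1) by simp
  next
   case False
   have "dt (Suc k) (%a b. if b = m then inner (x a) (ap B (y s)) else inner (x a) (ap B (y b))) = 0"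
    by (rule dt_eq_cols[of m _ s]) (use False s mk in auto)
   then show ?thesis using False by simp
  qed
 qed
 also have "... = mdet (Suc k) B x y" using m by simp
 finally have e1: "mdet (Suc k) B x y = dt (Suc k) ?M" by simp
 define d where "d i = dt k (%i' j'. ?M (if i' < i then i' else Suc i') (if j' < m then j' else Suc j'))" for i
 have d: "d i = mdet k B (%a. x (if a < i then a else Suc a)) (%b. y (if b < m then b else Suc b))" for i
  unfolding mdet_def d_def
 proof (rule dt_cong)
  fix i' j' :: nat
  have "(if j' < m then j' else Suc j') \<noteq> m" by simp
  then show "?M (if i' < i then i' else Suc i') (if j' < m then j' else Suc j') =
    inner (x (if i' < i then i' else Suc i')) (ap B (y (if j' < m then j' else Suc j')))"
   by (rule if_not_P)
 qed
 have "dt (Suc k) ?M = (\<Sum>i<Suc k. ?M i m * ((-1) ^ (i + m) * d i))"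
  unfolding d_def by (rule dt_laplace_col[OF mk, of ?M])
 also have "... = (\<Sum>i<Suc k. inner (x i) (ap B v) * ((-1) ^ (i + m) * d i))"
  by (simp only: simp_thms if_True)
 finally have "mdet (Suc k) B x y = (\<Sum>i<Suc k. inner (x i) (ap B v) * ((-1) ^ (i + m) * d i))"
  using e1 by (simp only:)
 then have "\<bar>mdet (Suc k) B x y\<bar> <= (\<Sum>i<Suc k. \<bar>inner (x i) (ap B v) * ((-1) ^ (i + m) * d i)\<bar>)"
  by (simp only: sum_abs)
 also have "... <= (\<Sum>i<Suc k. (t * norm v) * vol k B)"
 proof (rule sum_mono)
  fix i
  have "\<bar>inner (x i) (ap B v)\<bar> <= norm (x i) * norm (ap B v)" by (rule Cauchy_Schwarz_ineq2)
  also have "... <= 1 * (t * norm v)" using xy Bv by (intro mult_mono) auto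
  finally have 1: "\<bar>inner (x i) (ap B v)\<bar> <= t * norm v" by simp
  have 2: "\<bar>d i\<bar> <= vol k B" unfolding d by (rule vol_upper) (use xy in auto)
  show "\<bar>inner (x i) (ap B v) * ((-1) ^ (i + m) * d i)\<bar> <= (t * norm v) * vol k B"
   using 1 2 by (rule abs_signed_mult_le)
 qed
 also have "... = real (Suc k) * (t * norm v) * vol k B" by simp
 also have "... <= real (Suc k) * (t * real (Suc k)) * vol k B"
  using nv t by (intro mult_right_mono mult_left_mono vol_nonneg) auto
 finally show "\<bar>mdet (Suc k) B x y\<bar> <= (real (Suc k))\<^sup>2 * t * vol k B" by (simp add: power2_eq_square mult_ac)
qed

section \<open>Orthonormal systems, the SHS norm and its truncations\<close>

lemma
 fixes f :: "nat => 'h::real_inner"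
 assumes f: "orthonormal_seq f"
 shows inner_sum_orthonormal: "finite S ==> inner (\<Sum>i\<in>S. c i *R f i) (\<Sum>i\<in>S. d i *R f i) = (\<Sum>i\<in>S. c i * d i)"
  and inner_sum_orthonormal_single: "finite S ==> inner (\<Sum>i\<in>S. c i *R f i) (f j) = (if j \<in> S then c j else 0)"
proof -
 have ff: "inner (f i) (f j) = (if i = j then 1 else 0)" for i j using f by (simp add: orthonormal_seq_def)
 show s: "inner (\<Sum>i\<in>S. c i *R f i) (f j) = (if j \<in> S then c j else 0)" if "finite S" for S c j
  using that by (simp add: inner_sum_left ff if_distrib[of "%x. _ * x"] sum.delta cong: if_cong)
 show "inner (\<Sum>i\<in>S. c i *R f i) (\<Sum>i\<in>S. d i *R f i) = (\<Sum>i\<in>S. c i * d i)" if "finite S"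
  using that by (subst inner_sum_right) (simp add: s mult.commute)
qed

lemma norm_sum_orthonormal:
 assumes "orthonormal_seq f" "finite S"
 shows "(norm (\<Sum>i\<in>S. c i *R f i))\<^sup>2 = (\<Sum>i\<in>S. (c i)\<^sup>2)"
 unfolding power2_norm_eq_inner by (simp add: inner_sum_orthonormal[OF assms] power2_eq_square)

lemma bessel:
 assumes f: "orthonormal_seq f"
 shows "(\<Sum>i<n. (inner x (f i))\<^sup>2) <= (norm x)\<^sup>2"
proof -
 define p where "p = (\<Sum>i<n. inner x (f i) *R f i)"
 have pp: "(norm p)\<^sup>2 = (\<Sum>i<n. (inner x (f i))\<^sup>2)"
  unfolding p_def by (rule norm_sum_orthonormal[OF f]) simp
 have "inner x p = (\<Sum>i<n. (inner x (f i))\<^sup>2)"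
  unfolding p_def by (simp add: inner_sum_right power2_eq_square)
 then have "(norm p)\<^sup>2 <= norm x * norm p"
  using pp norm_cauchy_schwarz[of x p] by simp
 then have "norm p <= norm x"
 proof (cases "norm p = 0")
  case False
  then show ?thesis
   using \<open>(norm p)\<^sup>2 <= norm x * norm p\<close> by (intro mult_right_le_imp_le[of "norm p" "norm p" "norm x"]) (simp_all add: power2_eq_square)
 qed simp
 then show ?thesis unfolding pp[symmetric] by (simp add: power_mono)
qed

lemma orthonormal_expansion:
 fixes f :: "nat => 'h::{real_inner,complete_space}"
 assumes f: "orthonormal_seq f"
 obtains r where "(%n. \<Sum>i<n. inner x (f i) *R f i) ----> x - r" "\<And>i. inner r (f i) = 0"
proof -
 let ?p = "%n. \<Sum>i<n. inner x (f i) *R f i"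
 have "summable (%i. (inner x (f i))\<^sup>2)"
  by (rule summableI_nonneg_bounded[of _ "(norm x)\<^sup>2"]) (use bessel[OF f] in auto)
 then have cau: "\<exists>N. \<forall>m\<ge>N. \<forall>n. norm (\<Sum>i = m..<n. (inner x (f i))\<^sup>2) < e" if "0 < e" for e
  using that by (simp add: summable_Cauchy)
 have "Cauchy ?p"
 proof (rule CauchyI')
  fix e :: real assume e: "0 < e"
  have "0 < e\<^sup>2" using e by simp
  from cau[OF this] obtain N where N: "\<forall>m\<ge>N. \<forall>n. norm (\<Sum>i = m..<n. (inner x (f i))\<^sup>2) < e\<^sup>2"
   by (rule exE)
  show "\<exists>N. \<forall>m\<ge>N. \<forall>n>m. dist (?p m) (?p n) < e"
  proof (intro exI[of _ N] allI impI)
   fix m n :: nat assume mn: "N <= m" "m < n"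
   have "?p n - ?p m = (\<Sum>i = m..<n. inner x (f i) *R f i)"
    using mn by (simp add: lessThan_atLeast0 sum_diff_nat_ivl)
   then have d: "dist (?p m) (?p n) = norm (\<Sum>i = m..<n. inner x (f i) *R f i)"
    by (subst dist_commute) (simp only: dist_norm)
   have "(\<Sum>i = m..<n. (inner x (f i))\<^sup>2) < e\<^sup>2" using N[rule_format, OF mn(1), of n] unfolding real_norm_def by linarith
   then have "(norm (\<Sum>i = m..<n. inner x (f i) *R f i))\<^sup>2 < e\<^sup>2"
    by (subst norm_sum_orthonormal[OF f]) auto
   then show "dist (?p m) (?p n) < e"
    unfolding d by (rule power2_less_imp_less) (use e in simp)
  qed
 qed
 then have "convergent ?p" by (rule Cauchy_convergent)
 then obtain s where s: "?p ----> s" unfolding convergent_def by (rule exE)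
 have "inner (x - s) (f i) = 0" for i
 proof -
  have "(%n. inner (?p n) (f i)) ----> inner s (f i)" by (intro tendsto_intros s)
  moreover have "EV n. inner (?p n) (f i) = inner x (f i)"
   using eventually_gt_at_top[of i] by eventually_elim (simp add: inner_sum_orthonormal_single[OF f])
  then have "(%n. inner (?p n) (f i)) ----> inner x (f i)" by (rule tendsto_eventually)
  ultimately have "inner s (f i) = inner x (f i)" by (rule LIMSEQ_unique)
  then show ?thesis by (simp add: inner_diff_left)
 qed
 then show ?thesis using that[of "x - s"] s by simp
qed

locale onb =
 fixes e :: "nat => 'h::{real_inner,complete_space}"
 assumes basis: "orthonormal_basis e"
begin

lemma orth: "orthonormal_seq e" using basis by (simp add: orthonormal_basis_def)

lemma inner_e: "inner (e i) (e j) = (if i = j then 1 else 0)"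
 using orth by (simp add: orthonormal_seq_def)

lemma norm_e [simp]: "norm (e i) = 1" by (simp add: norm_eq_sqrt_inner inner_e)

lemma orthogonal_zero:
 assumes "\<And>i. inner r (e i) = 0" shows "r = 0"
proof -
 have sp: "inner r y = 0" if "y \<in> span (range e)" for y
  using that by (induction rule: span_induct_alt) (auto simp: inner_add_right assms)
 have "r \<in> closure (span (range e))" using basis by (simp add: orthonormal_basis_def)
 then obtain y where y: "\<And>n. y n \<in> span (range e)" "y ----> r" by (auto simp: closure_sequential)
 have "(%n. inner r (y n)) ----> inner r r" by (intro tendsto_intros y)
 then have "(%n. 0 :: real) ----> inner r r" using sp[OF y(1)] by simp
 then show ?thesis by (simp add: LIMSEQ_const_iff)
qed

lemma expansion: "(%n. \<Sum>i<n. inner x (e i) *R e i) ----> x"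
proof -
 obtain r where r: "(%n. \<Sum>i<n. inner x (e i) *R e i) ----> x - r" "\<And>i. inner r (e i) = 0"
  using orthonormal_expansion[OF orth, of x] by auto
 then show ?thesis using orthogonal_zero[of r] by simp
qed

definition proj :: "nat => 'h op" where
 "proj n = Blinfun (%x. \<Sum>i<n. inner x (e i) *R e i)"

lemma proj_apply: "ap (proj n) x = (\<Sum>i<n. inner x (e i) *R e i)"
 unfolding proj_def
 by (subst bounded_linear_Blinfun_apply)
  (auto intro!: bounded_linear_sum bounded_linear_scaleR_const bounded_linear_inner_left)

lemma proj_tendsto: "(%n. ap (proj n) x) ----> x"
 unfolding proj_apply by (rule expansion)

lemma norm_proj_le: "norm (ap (proj n) x) <= norm x"
proof -
 have "(norm (ap (proj n) x))\<^sup>2 <= (norm x)\<^sup>2"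
  unfolding proj_apply norm_sum_orthonormal[OF orth finite_lessThan] by (rule bessel[OF orth])
 then show ?thesis by (rule power2_le_imp_le) simp
qed

lemma norm_proj: "norm (proj n) <= 1"
 by (rule norm_blinfun_bound) (auto simp: norm_proj_le)

lemma apply_expansion: "(%n. \<Sum>i<n. inner x (e i) *R ap B (e i)) ----> ap B x"
proof -
 have "(%n. ap B (\<Sum>i<n. inner x (e i) *R e i)) ----> ap B x"
  by (rule bounded_linear.tendsto[OF blinfun.bounded_linear_right expansion])
 then show ?thesis by (simp add: blinfun.sum_right blinfun.scaleR_right)
qed

text \<open>The Hilbert-Schmidt norm dominates the operator norm. Finite rectangles of entries
  suffice, since projections and the basis expansion reach every vector in the limit.\<close>

lemma hs_bound:
 assumes K: "0 <= K" and bd: "\<And>n m. (\<Sum>i<n. \<Sum>j<m. (inner (ap B (e i)) (e j))\<^sup>2) <= K\<^sup>2"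
 shows "norm B <= K"
proof (rule norm_blinfun_bound[OF K])
 fix x
 have "norm (ap (proj m) (\<Sum>i<n. inner x (e i) *R ap B (e i))) <= K * norm x" for m n
 proof -
  let ?z = "\<Sum>i<n. inner x (e i) *R ap B (e i)"
  have "(norm (ap (proj m) ?z))\<^sup>2 = (\<Sum>j<m. (inner ?z (e j))\<^sup>2)"
   unfolding proj_apply by (rule norm_sum_orthonormal[OF orth]) simp
  also have "... <= (\<Sum>j<m. (norm x)\<^sup>2 * (\<Sum>i<n. (inner (ap B (e i)) (e j))\<^sup>2))"
  proof (rule sum_mono)
   fix j
   have "(inner ?z (e j))\<^sup>2 = (\<Sum>i<n. inner x (e i) * inner (ap B (e i)) (e j))\<^sup>2"
    by (simp add: inner_sum_left)
   also have "... <= (\<Sum>i<n. (inner x (e i))\<^sup>2) * (\<Sum>i<n. (inner (ap B (e i)) (e j))\<^sup>2)"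
    by (rule Cauchy_Schwarz_ineq_sum)
   also have "... <= (norm x)\<^sup>2 * (\<Sum>i<n. (inner (ap B (e i)) (e j))\<^sup>2)"
    by (intro mult_right_mono bessel[OF orth] sum_nonneg) auto
   finally show "(inner ?z (e j))\<^sup>2 <= (norm x)\<^sup>2 * (\<Sum>i<n. (inner (ap B (e i)) (e j))\<^sup>2)" .
  qed
  also have "... = (norm x)\<^sup>2 * (\<Sum>i<n. \<Sum>j<m. (inner (ap B (e i)) (e j))\<^sup>2)"
   by (simp only: sum_distrib_left[symmetric] sum.swap[of _ "{..<m}"])
  also have "... <= (norm x)\<^sup>2 * K\<^sup>2" by (intro mult_left_mono bd) simp
  finally have "(norm (ap (proj m) ?z))\<^sup>2 <= (K * norm x)\<^sup>2" by (simp add: power_mult_distrib mult.commute)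
  then show ?thesis by (rule power2_le_imp_le) (use K in simp)
 qed
 then have "norm (\<Sum>i<n. inner x (e i) *R ap B (e i)) <= K * norm x" for n
  by (intro LIMSEQ_le_const2[OF tendsto_norm[OF proj_tendsto]]) auto
 then show "norm (ap B x) <= K * norm x"
  by (intro LIMSEQ_le_const2[OF tendsto_norm[OF apply_expansion]]) auto
qed

text \<open>The square root of the SHS weight, which turns the SHS norm into an l2 norm of weighted
  entries.\<close>

definition wt :: "nat \<times> nat => real" where "wt = (%(i, j). 2 ^ (Suc i + Suc j))"

lemma SHS_term_eq: "SHS_term e B p = (wt p * matrix_entry e p B)\<^sup>2"
 by (cases p) (simp add: SHS_term_def wt_def power_mult_distrib power_mult[symmetric] mult.commute)

lemma SHS_term_nonneg: "0 <= SHS_term e B p" by (simp add: SHS_term_eq)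

lemma SHS_norm_nonneg: "0 <= SHS_norm e B"
 by (simp add: SHS_norm_def infsum_nonneg SHS_term_nonneg)

lemma SHS_norm_sq: "(SHS_norm e B)\<^sup>2 = (\<Sum>\<^sub>\<infinity>p. SHS_term e B p)"
 by (simp add: SHS_norm_def infsum_nonneg SHS_term_nonneg)

lemma SHS_sum_le: "B \<in> SHS e ==> finite F ==> (\<Sum>p\<in>F. SHS_term e B p) <= (SHS_norm e B)\<^sup>2"
 unfolding SHS_norm_sq by (rule finite_sum_le_infsum) (auto simp: SHS_def SHS_term_nonneg)

lemma SHS_I:
 assumes "\<And>F. finite F ==> (\<Sum>p\<in>F. SHS_term e B p) <= K\<^sup>2" and K: "0 <= K"
 shows "B \<in> SHS e" "SHS_norm e B <= K"
proof -
 have s: "SHS_term e B summable_on UNIV"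
  by (rule nonneg_bdd_above_summable_on) (auto simp: SHS_term_nonneg intro!: bdd_aboveI[of _ "K\<^sup>2"] assms)
 then show "B \<in> SHS e" by (simp add: SHS_def)
 have "(SHS_norm e B)\<^sup>2 <= K\<^sup>2"
  unfolding SHS_norm_sq by (rule infsum_le_finite_sums[OF s]) (rule assms)
 then show "SHS_norm e B <= K" by (rule power2_le_imp_le[OF _ K])
qed

text \<open>Common source of the norm comparison and of the tail bounds: an entrywise comparison
  with factor \<open>c\<close> passes to square sums.\<close>

lemma SHS_rect_le:
 assumes B: "B \<in> SHS e" and c: "\<And>i j. i < n ==> j < m ==> \<bar>v i j\<bar> <= c * wt (i, j) * \<bar>matrix_entry e (i, j) B\<bar>"
 shows "(\<Sum>i<n. \<Sum>j<m. (v i j)\<^sup>2) <= (c * SHS_norm e B)\<^sup>2"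
proof -
 have "(\<Sum>i<n. \<Sum>j<m. (v i j)\<^sup>2) = (\<Sum>p\<in>{..<n}\<times>{..<m}. (v (fst p) (snd p))\<^sup>2)"
  by (simp add: sum.cartesian_product split_def)
 also have "... <= (\<Sum>p\<in>{..<n}\<times>{..<m}. c\<^sup>2 * SHS_term e B p)"
 proof (rule sum_mono)
  fix p assume p: "p \<in> {..<n}\<times>{..<m}"
  have "\<bar>v (fst p) (snd p)\<bar> <= c * wt p * \<bar>matrix_entry e p B\<bar>"
   using c[of "fst p" "snd p"] p by auto
  then have "\<bar>v (fst p) (snd p)\<bar>\<^sup>2 <= (c * wt p * \<bar>matrix_entry e p B\<bar>)\<^sup>2" by (rule power_mono) simp
  then show "(v (fst p) (snd p))\<^sup>2 <= c\<^sup>2 * SHS_term e B p"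
   by (simp add: SHS_term_eq power_mult_distrib mult.assoc)
 qed
 also have "... <= c\<^sup>2 * (SHS_norm e B)\<^sup>2"
  unfolding sum_distrib_left[symmetric] by (intro mult_left_mono SHS_sum_le B) auto
 finally show ?thesis by (simp add: power_mult_distrib)
qed

lemma wt_ge: "1 <= wt (i, j)" "2 ^ i <= wt (i, j)" "2 ^ j <= wt (i, j)"
proof -
 have ab: "1 <= (2::real) ^ i" "1 <= (2::real) ^ j" by simp_all
 have "(2::real) ^ i * 1 <= 2 ^ i * 2 ^ j" "1 * (2::real) ^ j <= 2 ^ i * 2 ^ j"
  using ab by (auto intro: mult_left_mono mult_right_mono simp del: one_le_power)
 moreover have "wt (i, j) = 4 * (2 ^ i * 2 ^ j)" by (simp add: wt_def power_add)
 ultimately show "1 <= wt (i, j)" "2 ^ i <= wt (i, j)" "2 ^ j <= wt (i, j)" using ab by linarith+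
qed

lemma norm_le_SHS_norm: assumes B: "B \<in> SHS e" shows "norm B <= SHS_norm e B"
proof (rule hs_bound[OF SHS_norm_nonneg])
 fix n m
 have "(\<Sum>i<n. \<Sum>j<m. (inner (ap B (e i)) (e j))\<^sup>2) <= (1 * SHS_norm e B)\<^sup>2"
 proof (rule SHS_rect_le[OF B])
  fix i j
  have "1 * \<bar>matrix_entry e (i, j) B\<bar> <= wt (i, j) * \<bar>matrix_entry e (i, j) B\<bar>"
   by (intro mult_right_mono wt_ge) simp
  then show "\<bar>inner (ap B (e i)) (e j)\<bar> <= 1 * wt (i, j) * \<bar>matrix_entry e (i, j) B\<bar>"
   by (simp add: matrix_entry_def)
 qed
 then show "(\<Sum>i<n. \<Sum>j<m. (inner (ap B (e i)) (e j))\<^sup>2) <= (SHS_norm e B)\<^sup>2" by simp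
qed

lemma inv_wt_bound: "m <= i \<or> m <= j ==> \<bar>x\<bar> <= 1 / 2 ^ m * wt (i, j) * \<bar>x\<bar>"
proof -
 assume "m <= i \<or> m <= j"
 then have "(2::real) ^ m <= wt (i, j)"
 proof
  assume "m <= i"
  then have "(2::real) ^ m <= 2 ^ i" by (intro power_increasing) auto
  then show ?thesis using wt_ge(2)[of i j] by linarith
 next
  assume "m <= j"
  then have "(2::real) ^ m <= 2 ^ j" by (intro power_increasing) auto
  then show ?thesis using wt_ge(3)[of j i] by linarith
 qed
 then have "1 <= 1 / 2 ^ m * wt (i, j)" by (simp add: field_simps)
 then have "1 * \<bar>x\<bar> <= 1 / 2 ^ m * wt (i, j) * \<bar>x\<bar>" by (intro mult_right_mono) auto
 then show ?thesis by simp
qed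

text \<open>Only entries with second index at least \<open>m\<close> survive, and their weight is at
  least \<open>2 ^ m\<close>. This exponential decay is why a truncation level logarithmic in the
  conditioning suffices in \<open>minor_lower\<close>.\<close>

lemma SHS_tail_left: assumes B: "B \<in> SHS e" shows "norm ((proj m oL B) - B) <= SHS_norm e B / 2 ^ m"
proof (rule hs_bound)
 fix n l
 have "(\<Sum>i<n. \<Sum>j<l. (inner (ap ((proj m oL B) - B) (e i)) (e j))\<^sup>2) <= (1 / 2 ^ m * SHS_norm e B)\<^sup>2"
 proof (rule SHS_rect_le[OF B])
  fix i j
  have "inner (ap ((proj m oL B) - B) (e i)) (e j) = (if j < m then 0 else - matrix_entry e (i, j) B)"
   by (simp add: blinfun.diff_left inner_diff_left proj_apply inner_sum_orthonormal_single[OF orth] matrix_entry_def)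
  then show "\<bar>inner (ap ((proj m oL B) - B) (e i)) (e j)\<bar> <= 1 / 2 ^ m * wt (i, j) * \<bar>matrix_entry e (i, j) B\<bar>"
   using inv_wt_bound[of m i j "matrix_entry e (i, j) B"] wt_ge(1)[of i j] by auto
 qed
 then show "(\<Sum>i<n. \<Sum>j<l. (inner (ap ((proj m oL B) - B) (e i)) (e j))\<^sup>2) <= (SHS_norm e B / 2 ^ m)\<^sup>2" by simp
qed (simp add: SHS_norm_nonneg)

lemma proj_e: "ap (proj m) (e i) = (if i < m then e i else 0)"
 by (simp add: proj_apply inner_e if_distrib[of "%c. c *R _"] sum.delta' cong: if_cong)

lemma SHS_tail_right: assumes B: "B \<in> SHS e" shows "norm ((B oL proj m) - B) <= SHS_norm e B / 2 ^ m"
proof (rule hs_bound)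
 fix n l
 have "(\<Sum>i<n. \<Sum>j<l. (inner (ap ((B oL proj m) - B) (e i)) (e j))\<^sup>2) <= (1 / 2 ^ m * SHS_norm e B)\<^sup>2"
 proof (rule SHS_rect_le[OF B])
  fix i j
  have "inner (ap ((B oL proj m) - B) (e i)) (e j) = (if i < m then 0 else - matrix_entry e (i, j) B)"
   by (simp add: blinfun.diff_left inner_diff_left proj_e matrix_entry_def blinfun.zero_right)
  then show "\<bar>inner (ap ((B oL proj m) - B) (e i)) (e j)\<bar> <= 1 / 2 ^ m * wt (i, j) * \<bar>matrix_entry e (i, j) B\<bar>"
   using inv_wt_bound[of m i j "matrix_entry e (i, j) B"] wt_ge(1)[of i j] by auto
 qed
 then show "(\<Sum>i<n. \<Sum>j<l. (inner (ap ((B oL proj m) - B) (e i)) (e j))\<^sup>2) <= (SHS_norm e B / 2 ^ m)\<^sup>2" by simp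
qed (simp add: SHS_norm_nonneg)

lemma SHS_col_norm: assumes B: "B \<in> SHS e" shows "norm (ap B (e i)) <= SHS_norm e B / 2 ^ i"
proof -
 have "ap B (e i) = - ap ((B oL proj i) - B) (e i)"
  by (simp add: blinfun.diff_left proj_e blinfun.zero_right)
 then have "norm (ap B (e i)) = norm (ap ((B oL proj i) - B) (e i))" by simp
 also have "... <= norm ((B oL proj i) - B) * norm (e i)" by (rule norm_blinfun)
 also have "... <= SHS_norm e B / 2 ^ i" using SHS_tail_right[OF B, of i] by simp
 finally show ?thesis .
qed

lemma matrix_entry_add: "matrix_entry e p (B + C) = matrix_entry e p B + matrix_entry e p C"
 by (cases p) (simp add: matrix_entry_def blinfun.add_left inner_add_left)

lemma matrix_entry_scaleR: "matrix_entry e p (c *R B) = c * matrix_entry e p B"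
 by (cases p) (simp add: matrix_entry_def blinfun.scaleR_left)

lemma
 assumes B: "B \<in> SHS e" and C: "C \<in> SHS e"
 shows SHS_add_mem: "B + C \<in> SHS e" and SHS_triangle: "SHS_norm e (B + C) <= SHS_norm e B + SHS_norm e C"
proof -
 have "(\<Sum>p\<in>F. SHS_term e (B + C) p) <= (SHS_norm e B + SHS_norm e C)\<^sup>2" if F: "finite F" for F
 proof -
  have L: "L2_set (%p. wt p * matrix_entry e p D) F <= SHS_norm e D" if D: "D \<in> SHS e" for D
   using SHS_sum_le[OF D F] unfolding L2_set_def SHS_term_eq
   by (intro real_le_lsqrt SHS_norm_nonneg sum_nonneg) auto
  have "L2_set (%p. wt p * matrix_entry e p (B + C)) F <= SHS_norm e B + SHS_norm e C"
   using L2_set_triangle_ineq[of "%p. wt p * matrix_entry e p B" "%p. wt p * matrix_entry e p C" F] L[OF B] L[OF C]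
   by (simp add: matrix_entry_add distrib_left)
  then have "(L2_set (%p. wt p * matrix_entry e p (B + C)) F)\<^sup>2 <= (SHS_norm e B + SHS_norm e C)\<^sup>2"
   by (rule power_mono) (simp add: L2_set_nonneg)
  then show ?thesis by (simp add: L2_set_def SHS_term_eq sum_nonneg)
 qed
 from SHS_I[OF this] show "B + C \<in> SHS e" "SHS_norm e (B + C) <= SHS_norm e B + SHS_norm e C"
  using SHS_norm_nonneg by auto
qed

lemma SHS_norm_scaleR: "SHS_norm e (c *R B) = \<bar>c\<bar> * SHS_norm e B"
proof -
 have "SHS_term e (c *R B) = (%p. c\<^sup>2 * SHS_term e B p)"
  by (auto simp: SHS_term_eq matrix_entry_scaleR power_mult_distrib)
 then show ?thesis by (simp add: SHS_norm_def infsum_cmult_right' real_sqrt_mult)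
qed

lemma SHS_scaleR: "B \<in> SHS e ==> c *R B \<in> SHS e"
proof -
 have "SHS_term e (c *R B) = (%p. c\<^sup>2 * SHS_term e B p)"
  by (auto simp: SHS_term_eq matrix_entry_scaleR power_mult_distrib)
 then show "B \<in> SHS e ==> c *R B \<in> SHS e" by (simp add: SHS_def summable_on_cmult_right)
qed

lemma SHS_diff: "B \<in> SHS e ==> C \<in> SHS e ==> B - C \<in> SHS e"
 using SHS_add_mem[of B "(-1) *R C"] SHS_scaleR[of C "-1"] by simp

lemma SHS_norm_minus: "SHS_norm e (B - C) = SHS_norm e (C - B)"
 using SHS_norm_scaleR[of "-1" "B - C"] by simp

sublocale M: Metric_space "SHS e" "%B C. SHS_norm e (B - C)"
proof
 fix B C D :: "'h op"
 show "SHS_norm e (B - C) = 0 \<longleftrightarrow> B = C" if "B \<in> SHS e" "C \<in> SHS e"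
 proof
  assume "SHS_norm e (B - C) = 0"
  then show "B = C" using norm_le_SHS_norm[OF SHS_diff[OF that]] by simp
 next
  assume "B = C"
  then show "SHS_norm e (B - C) = 0" using SHS_norm_scaleR[of 0 B] by simp
 qed
 show "SHS_norm e (B - D) <= SHS_norm e (B - C) + SHS_norm e (C - D)" if "B \<in> SHS e" "C \<in> SHS e" "D \<in> SHS e"
  using SHS_triangle[OF SHS_diff SHS_diff, of B C C D] that by simp
qed (auto simp: SHS_norm_nonneg SHS_norm_minus)

lemma space_SHS_space: "space (SHS_space e) = SHS e"
 unfolding SHS_space_def by (rule space_measure_of) (auto simp: M.openin_mtopology)

text \<open>The sigma-algebra is generated by the open sets of the SHS metric, so it is enough that
  preimages of open sets contain a small ball around each of their points.\<close>

lemma lipschitz_measurable: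
 fixes f :: "('h op) => real"
 assumes "\<And>B C. B \<in> SHS e ==> C \<in> SHS e ==> \<bar>f B - f C\<bar> <= K * SHS_norm e (B - C)"
 shows "f \<in> borel_measurable (SHS_space e)"
proof (rule borel_measurableI)
 fix U :: "real set" assume U: "open U"
 have "openin M.mtopology (f -` U \<inter> SHS e)"
  unfolding M.openin_mtopology
 proof (intro conjI allI impI)
  fix B assume B: "B \<in> f -` U \<inter> SHS e"
  then obtain r where r: "r > 0" "\<And>y. dist y (f B) < r ==> y \<in> U"
   using U by (auto simp: open_dist)
  define d where "d = r / (\<bar>K\<bar> + 1)"
  have d: "d > 0" using r by (simp add: d_def add_nonneg_pos)
  have "M.mball B d \<subseteq> f -` U \<inter> SHS e"
  proof
   fix C assume C: "C \<in> M.mball B d"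
   have "\<bar>f C - f B\<bar> <= K * SHS_norm e (C - B)" using C B by (intro assms) auto
   also have "... <= \<bar>K\<bar> * SHS_norm e (C - B)" by (intro mult_right_mono SHS_norm_nonneg) simp
   also have "... <= \<bar>K\<bar> * d" using C by (intro mult_left_mono) (auto simp: SHS_norm_minus[of C])
   also have "... < (\<bar>K\<bar> + 1) * d" using d by simp
   also have "... = r" by (simp add: d_def add_nonneg_pos)
   finally show "C \<in> f -` U \<inter> SHS e" using r C by (auto simp: dist_real_def)
  qed
  then show "\<exists>r>0. M.mball B r \<subseteq> f -` U \<inter> SHS e" using d by auto
 qed auto
 then have "f -` U \<inter> SHS e \<in> sets (SHS_space e)"
  unfolding SHS_space_def by (subst sets_measure_of) (auto simp: M.openin_mtopology)
 then show "f -` U \<inter> space (SHS_space e) \<in> sets (SHS_space e)" by (simp add: space_SHS_space)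
qed

lemma SHS_norm_measurable: "SHS_norm e \<in> borel_measurable (SHS_space e)"
proof (rule lipschitz_measurable[of _ 1])
 fix B C assume B: "B \<in> SHS e" "C \<in> SHS e"
 show "\<bar>SHS_norm e B - SHS_norm e C\<bar> <= 1 * SHS_norm e (B - C)"
  using SHS_triangle[OF SHS_diff[OF B] B(2)] SHS_triangle[OF SHS_diff[OF B(2) B(1)] B(1)]
  by (simp add: SHS_norm_minus[of C B] abs_le_iff)
qed

lemma inner_measurable: "(%B. inner x (ap B y)) \<in> borel_measurable (SHS_space e)"
proof (rule lipschitz_measurable[of _ "norm x * norm y"])
 fix B C assume B: "B \<in> SHS e" "C \<in> SHS e"
 have "\<bar>inner x (ap B y) - inner x (ap C y)\<bar> = \<bar>inner x (ap (B - C) y)\<bar>"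
  by (simp add: blinfun.diff_left inner_diff_right)
 also have "... <= norm x * norm (ap (B - C) y)" by (rule Cauchy_Schwarz_ineq2)
 also have "... <= norm x * (norm (B - C) * norm y)" by (intro mult_left_mono norm_blinfun) simp
 also have "... <= norm x * (SHS_norm e (B - C) * norm y)"
  by (intro mult_left_mono mult_right_mono norm_le_SHS_norm SHS_diff B) auto
 finally show "\<bar>inner x (ap B y) - inner x (ap C y)\<bar> <= norm x * norm y * SHS_norm e (B - C)"
  by (simp add: mult_ac)
qed

lemma tendsto_inner_comp:
 "(%n. \<Sum>i<n. inner (e i) (ap C y) * inner x (ap B (e i))) ----> inner x (ap (B oL C) y)"
proof -
 have "(%n. inner x (\<Sum>i<n. inner (ap C y) (e i) *R ap B (e i))) ----> inner x (ap B (ap C y))"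
  by (intro tendsto_intros apply_expansion)
 then show ?thesis by (simp add: inner_sum_right inner_commute[of _ "e _"])
qed

end

lemma eventually_sequentiallyE:
 assumes "EV n. Q n" obtains n where "Q n"
 using eventually_happens'[OF sequentially_bot assms] by blast

section \<open>Weak measurability of operator-valued functions and of volumes\<close>

text \<open>Measurability of the matrix coefficients is stable under sums and products and suffices
  for that of \<open>vol\<close>, without touching the Borel sets of the non-separable operator
  norm.\<close>

definition weakly_measurable :: "'a measure => ('a => 'h::real_inner \<Rightarrow>\<^sub>L 'h) => bool" where
 "weakly_measurable M F \<longleftrightarrow> (\<forall>x y. (%w. inner x (ap (F w) y)) \<in> borel_measurable M)"

lemma weakly_measurableD: "weakly_measurable M F ==> (%w. inner x (ap (F w) y)) \<in> borel_measurable M"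
 by (simp add: weakly_measurable_def)

lemma weakly_measurable_add:
 assumes "weakly_measurable M F" "weakly_measurable M G"
 shows "weakly_measurable M (%w. F w + G w)"
 using assms by (auto simp: weakly_measurable_def blinfun.add_left inner_add_right intro!: borel_measurable_add)

lemma weakly_measurable_scaleR:
 assumes "weakly_measurable M F"
 shows "weakly_measurable M (%w. c *R F w)"
 using assms by (auto simp: weakly_measurable_def blinfun.scaleR_left intro!: borel_measurable_times)

lemma weakly_measurable_const: "weakly_measurable M (%w. B)"
 by (auto simp: weakly_measurable_def)

lemma mdet_measurable:
 assumes "weakly_measurable M F"
 shows "(%w. mdet k (F w) x y) \<in> borel_measurable M"
 unfolding mdet_def by (rule dt_measurable) (rule weakly_measurableD[OF assms])

context onb begin

lemma weakly_measurable_comp: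
 fixes F G :: "'a => 'h op"
 assumes F: "weakly_measurable M F" and G: "weakly_measurable M G"
 shows "weakly_measurable M (%w. F w oL G w)"
 unfolding weakly_measurable_def
proof (intro allI)
 fix x y
 have [measurable]: "(%w. inner x (ap (F w) y)) \<in> borel_measurable M"
  "(%w. inner x (ap (G w) y)) \<in> borel_measurable M" for x y
  using F G by (auto simp: weakly_measurable_def)
 show "(%w. inner x (ap (F w oL G w) y)) \<in> borel_measurable M"
 proof (rule borel_measurable_LIMSEQ_real[where u="%n w. \<Sum>i<n. inner (e i) (ap (G w) y) * inner x (ap (F w) (e i))"])
  show "(%n. \<Sum>i<n. inner (e i) (ap (G w) y) * inner x (ap (F w) (e i)))
    ----> inner x (ap (F w oL G w) y)" for w
   by (rule tendsto_inner_comp)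
 qed measurable
qed

lemma weakly_measurable_SHS:
 assumes "F \<in> M \<rightarrow>\<^sub>M SHS_space e"
 shows "weakly_measurable M F"
 unfolding weakly_measurable_def
 using measurable_compose[OF assms inner_measurable] by simp

text \<open>Rational combinations of basis vectors, scaled back into the unit ball so that they are
  admissible in \<open>unit_tuples\<close>.\<close>

definition dense_ball :: "'h set" where
 "dense_ball = range (%qs. let z = (\<Sum>i<length qs. real_of_rat (qs ! i) *R e i) in (1 / max 1 (norm z)) *R z)"

lemma countable_dense_ball: "countable dense_ball"
 unfolding dense_ball_def by (rule countable_image) simp

lemma norm_dense_ball: "x \<in> dense_ball ==> norm x <= 1"
 by (auto simp: dense_ball_def Let_def max_def divide_simps)

lemma dense_ball_approx:
 assumes x: "norm x <= 1" and r: "0 < r"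
 shows "\<exists>y\<in>dense_ball. norm (x - y) < r"
proof -
 have "EV n. dist (\<Sum>i<n. inner x (e i) *R e i) x < r / 4"
  by (rule tendstoD[OF expansion]) (use r in simp)
 then obtain n where n: "dist (\<Sum>i<n. inner x (e i) *R e i) x < r / 4" by (rule eventually_sequentiallyE)
 have "\<forall>i. \<exists>q. \<bar>inner x (e i) - real_of_rat q\<bar> < r / (4 * real (Suc n))"
 proof
  fix i
  obtain q where "inner x (e i) < real_of_rat q" "real_of_rat q < inner x (e i) + r / (4 * real (Suc n))"
   using of_rat_dense[of "inner x (e i)" "inner x (e i) + r / (4 * real (Suc n))"] r by auto
  then show "\<exists>q. \<bar>inner x (e i) - real_of_rat q\<bar> < r / (4 * real (Suc n))" by (intro exI[of _ q]) linarith
 qed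
 then have "\<exists>q. \<forall>i. \<bar>inner x (e i) - real_of_rat (q i)\<bar> < r / (4 * real (Suc n))" by (rule choice)
 then obtain q where q: "\<forall>i. \<bar>inner x (e i) - real_of_rat (q i)\<bar> < r / (4 * real (Suc n))" by (rule exE)
 define z where "z = (\<Sum>i<n. real_of_rat (q i) *R e i)"
 have "norm ((\<Sum>i<n. inner x (e i) *R e i) - z) <= (\<Sum>i<n. r / (4 * real (Suc n)))"
  unfolding z_def sum_subtractf[symmetric] scaleR_left_diff_distrib[symmetric]
  by (rule sum_norm_le) (simp add: less_imp_le[OF q[rule_format]] del: of_nat_Suc)
 also have "... <= r / 4"
 proof -
  have "real n * (r / (4 * real (Suc n))) = (r / 4) * (real n / real (Suc n))" by simp
  also have "... <= (r / 4) * 1" using r by (intro mult_left_mono) auto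
  finally show ?thesis by simp
 qed
 finally have zx: "norm (x - z) < r / 2"
  using n norm_triangle_ineq[of "x - (\<Sum>i<n. inner x (e i) *R e i)" "(\<Sum>i<n. inner x (e i) *R e i) - z"]
  by (simp add: dist_norm norm_minus_commute)
 define y where "y = (1 / max 1 (norm z)) *R z"
 have "y \<in> dense_ball"
  unfolding dense_ball_def y_def z_def
  by (rule image_eqI[of _ _ "map q [0..<n]"]) (auto simp: Let_def)
 moreover have "norm (z - y) <= r / 2"
 proof (cases "norm z <= 1")
  case True
  then show ?thesis using r by (simp add: y_def max_def)
 next
  case False
  then have z0: "z \<noteq> 0" by auto
  from False have "z - y = (1 - 1 / norm z) *R z" by (simp add: y_def max_def scaleR_left_diff_distrib)
  then have "norm (z - y) = \<bar>1 - 1 / norm z\<bar> * norm z" by simp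
  also have "... = norm z - 1" using False z0 by (simp add: abs_if field_simps)
  also have "... <= norm (z - x)" using x norm_triangle_ineq2[of z x] by simp
  finally show ?thesis using zx by (simp add: norm_minus_commute)
 qed
 ultimately show ?thesis using zx norm_triangle_ineq[of "x - z" "z - y"]
  by (intro bexI[of _ y]) auto
qed

text \<open>The determinant is continuous in its vectors, so the supremum may run over lists from a
  countable dense set.\<close>

lemma vol_measurable:
 fixes F :: "'a => 'h op"
 assumes F: "weakly_measurable M F"
 shows "(%w. vol k (F w)) \<in> borel_measurable M"
 unfolding borel_measurable_iff_greater
proof
 fix c
 let ?L = "{xs. set xs \<subseteq> dense_ball \<and> length xs = k}"
 have cnt: "countable ?L"
  by (rule countable_subset[OF _ countable_lists[OF countable_dense_ball]]) (auto simp: lists_eq_set)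
 have iff: "c < vol k B \<longleftrightarrow> (\<exists>xs\<in>?L. \<exists>ys\<in>?L. c < \<bar>mdet k B (%a. xs ! a) (%a. ys ! a)\<bar>)" for B :: "'h op"
 proof
  assume "c < vol k B"
  from vol_approx[OF this] obtain x y where x: "\<forall>a. norm (x a) <= 1" and y: "\<forall>a. norm (y a) <= 1"
   and c: "c < \<bar>mdet k B x y\<bar>"
   by (elim exE conjE)
  note xy = x[rule_format] y[rule_format] c
  have ch: "\<exists>U. \<forall>a. \<forall>n. U a n \<in> dense_ball \<and> norm (x a - U a n) < 1 / real (Suc n)"
   if "\<And>a. norm (x a) <= 1" for x :: "nat => 'h"
  proof (rule choice, rule allI, rule choice, rule allI)
   fix a n
   show "\<exists>u. u \<in> dense_ball \<and> norm (x a - u) < 1 / real (Suc n)"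
    using dense_ball_approx[OF that[of a], of "1 / real (Suc n)"] by auto
  qed
  obtain U where "\<forall>a. \<forall>n. U a n \<in> dense_ball \<and> norm (x a - U a n) < 1 / real (Suc n)"
   using ch[OF xy(1)] by (rule exE)
  then have U: "U a n \<in> dense_ball" "norm (x a - U a n) < 1 / real (Suc n)" for a n by simp_all
  obtain V where "\<forall>a. \<forall>n. V a n \<in> dense_ball \<and> norm (y a - V a n) < 1 / real (Suc n)"
   using ch[OF xy(2)] by (rule exE)
  then have V: "V a n \<in> dense_ball" "norm (y a - V a n) < 1 / real (Suc n)" for a n by simp_all
  have lim: "(%n. U n) ----> x" if "\<And>n. norm (x - U n) < 1 / real (Suc n)" for x :: 'h and U
  proof (rule LIM_zero_cancel, rule Lim_null_comparison[OF always_eventually LIMSEQ_inverse_real_of_nat], rule allI)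
   show "norm (U n - x) <= inverse (real (Suc n))" for n
    using that[of n] by (simp add: norm_minus_commute inverse_eq_divide)
  qed
  have "(%n. mdet k B (%a. U a n) (%a. V a n)) ----> mdet k B x y"
   unfolding mdet_def
   by (intro tendsto_dt tendsto_inner lim U(2) bounded_linear.tendsto[OF blinfun.bounded_linear_right lim] V(2))
  then have "(%n. \<bar>mdet k B (%a. U a n) (%a. V a n)\<bar>) ----> \<bar>mdet k B x y\<bar>" by (rule tendsto_rabs)
  then have "EV n. c < \<bar>mdet k B (%a. U a n) (%a. V a n)\<bar>"
   using xy(3) by (rule order_tendstoD)
  then obtain n where n: "c < \<bar>mdet k B (%a. U a n) (%a. V a n)\<bar>" by (rule eventually_sequentiallyE)
  let ?xs = "map (%a. U a n) [0..<k]" and ?ys = "map (%a. V a n) [0..<k]"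
  have "mdet k B (%a. ?xs ! a) (%a. ?ys ! a) = mdet k B (%a. U a n) (%a. V a n)"
   by (rule mdet_cong) auto
  then show "\<exists>xs\<in>?L. \<exists>ys\<in>?L. c < \<bar>mdet k B (%a. xs ! a) (%a. ys ! a)\<bar>"
   using n U(1) V(1) by (intro bexI[of _ ?xs] bexI[of _ ?ys]) (auto simp only: set_map length_map length_upt mem_Collect_eq minus_nat.diff_0)
 next
  assume "\<exists>xs\<in>?L. \<exists>ys\<in>?L. c < \<bar>mdet k B (%a. xs ! a) (%a. ys ! a)\<bar>"
  then obtain xs ys where xs: "set xs \<subseteq> dense_ball" "length xs = k" "set ys \<subseteq> dense_ball" "length ys = k"
   "c < \<bar>mdet k B (%a. xs ! a) (%a. ys ! a)\<bar>" by auto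
  note xs(5)
  also have "\<bar>mdet k B (%a. xs ! a) (%a. ys ! a)\<bar> <= vol k B"
  proof (rule vol_upper)
   show "norm (xs ! a) <= 1" "norm (ys ! a) <= 1" if "a < k" for a
    using that xs nth_mem[of a xs] nth_mem[of a ys] by (auto intro!: norm_dense_ball)
  qed
  finally show "c < vol k B" .
 qed
 have [measurable]: "(%w. mdet k (F w) x y) \<in> borel_measurable M" for x y
  by (rule mdet_measurable[OF F])
 show "{w \<in> space M. c < vol k (F w)} \<in> sets M"
 proof -
  have "{w \<in> space M. c < vol k (F w)} =
    (\<Union>xs\<in>?L. \<Union>ys\<in>?L. {w \<in> space M. c < \<bar>mdet k (F w) (%a. xs ! a) (%a. ys ! a)\<bar>})"
   unfolding iff by blast
  also have "... \<in> sets M"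
   by (intro sets.countable_UN'' cnt) measurable
  finally show ?thesis .
 qed
qed

end

section \<open>Singular values and their products\<close>

context onb begin

text \<open>Absolutely summable columns in the fixed basis: SHS operators have them, left
  multiplication preserves them, and they yield the adjoint and compactness directly.\<close>

definition nuclear :: "('h op) => bool" where
 "nuclear B \<longleftrightarrow> summable (%i. norm (ap B (e i)))"

lemma nuclear_SHS: assumes B: "B \<in> SHS e" shows "nuclear B"
 unfolding nuclear_def
proof (rule summable_comparison_test')
 show "summable (%i. SHS_norm e B * (1 / 2) ^ i)" by (intro summable_mult summable_geometric) simp
 show "norm (norm (ap B (e i))) <= SHS_norm e B * (1 / 2) ^ i" for i
  using SHS_col_norm[OF B, of i] by (simp add: power_divide)
qed

lemma nuclear_comp: assumes C: "nuclear C" shows "nuclear (B oL C)"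
 unfolding nuclear_def
proof (rule summable_comparison_test')
 show "summable (%i. norm B * norm (ap C (e i)))"
  using C unfolding nuclear_def by (rule summable_mult)
 show "norm (norm (ap (B oL C) (e i))) <= norm B * norm (ap C (e i))" for i
  by (simp add: norm_blinfun)
qed

text \<open>The class of the Hilbert space is not \<open>banach\<close>, so absolute convergence is used through
 Cauchy sequences.\<close>

lemma abs_summable_convergent:
 fixes g :: "nat => 'h"
 assumes b: "summable b" and le: "\<And>i. norm (g i) <= b i"
 shows "convergent (%n. \<Sum>i<n. g i)"
proof (rule Cauchy_convergent, rule CauchyI')
 fix r :: real assume r: "0 < r"
 from b have "\<exists>N. \<forall>m\<ge>N. \<forall>n. norm (sum b {m..<n}) < r"
  unfolding summable_Cauchy using r by simp
 then obtain N where N: "\<forall>m\<ge>N. \<forall>n. norm (sum b {m..<n}) < r" by (rule exE)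
 show "\<exists>N. \<forall>m\<ge>N. \<forall>n>m. dist (\<Sum>i<m. g i) (\<Sum>i<n. g i) < r"
 proof (intro exI[of _ N] allI impI)
  fix m n :: nat assume mn: "N <= m" "m < n"
  have "(\<Sum>i<n. g i) - (\<Sum>i<m. g i) = (\<Sum>i = m..<n. g i)"
   using mn by (simp add: lessThan_atLeast0 sum_diff_nat_ivl)
  then have "dist (\<Sum>i<m. g i) (\<Sum>i<n. g i) = norm (\<Sum>i = m..<n. g i)"
   by (subst dist_commute) (simp only: dist_norm)
  also have "... <= sum b {m..<n}" by (rule sum_norm_le) (rule le)
  also have "... < r" using N[rule_format, OF mn(1), of n] unfolding real_norm_def by linarith
  finally show "dist (\<Sum>i<m. g i) (\<Sum>i<n. g i) < r" .
 qed
qed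

text \<open>Summable columns make the series with coefficients \<open>inner (ap B (e i)) y\<close>
  along the basis converge; its sum is the witness that the choice in \<open>adjoint\<close>
  needs.\<close>

lemma adjoint_inner:
 assumes B: "nuclear B"
 shows "inner (ap B x) y = inner x (adjoint (ap B) y)"
proof -
 have "\<exists>f'. \<forall>x y. inner (ap B x) y = inner x (f' y)"
 proof -
  have "\<exists>v. \<forall>x. inner (ap B x) y = inner x v" for y
  proof -
   have "convergent (%n. \<Sum>i<n. inner (ap B (e i)) y *R e i)"
   proof (rule abs_summable_convergent)
    show "summable (%i. norm (ap B (e i)) * norm y)"
     using B unfolding nuclear_def by (rule summable_mult2)
    show "norm (inner (ap B (e i)) y *R e i) <= norm (ap B (e i)) * norm y" for i
     by (simp add: Cauchy_Schwarz_ineq2)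
   qed
   then obtain v where v: "(%n. \<Sum>i<n. inner (ap B (e i)) y *R e i) ----> v"
    unfolding convergent_def by (rule exE)
   have "inner (ap B x) y = inner x v" for x
   proof (rule LIMSEQ_unique)
    show "(%n. inner (\<Sum>i<n. inner x (e i) *R ap B (e i)) y) ----> inner (ap B x) y"
     by (intro tendsto_intros apply_expansion)
    have "(%n. inner x (\<Sum>i<n. inner (ap B (e i)) y *R e i)) ----> inner x v"
     by (intro tendsto_intros v)
    moreover have "inner x (\<Sum>i<n. inner (ap B (e i)) y *R e i) =
      inner (\<Sum>i<n. inner x (e i) *R ap B (e i)) y" for n
     by (simp add: inner_sum_left inner_sum_right mult.commute)
    ultimately show "(%n. inner (\<Sum>i<n. inner x (e i) *R ap B (e i)) y) ----> inner x v" by simp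
   qed
   then show ?thesis by (intro exI[of _ v]) simp
  qed
  then have "\<exists>f'. \<forall>y. \<forall>x. inner (ap B x) y = inner x (f' y)" by (intro choice allI)
  then obtain f' where "\<forall>y. \<forall>x. inner (ap B x) y = inner x (f' y)" by (rule exE)
  then show ?thesis by (intro exI[of _ f']) simp
 qed
 then have "\<forall>x y. inner (ap B x) y = inner x (adjoint (ap B) y)"
  unfolding adjoint_def by (rule someI_ex)
 then show ?thesis by simp
qed

text \<open>Compactness of \<open>B\<close>. The coordinate sequences live in a compact product of
  intervals; along a coordinatewise convergent subsequence the images are Cauchy, because the tail
  of the columns is small uniformly on the unit ball.\<close>

lemma bounded_subseq:
 fixes x :: "nat => 'h"
 assumes B: "nuclear B" and x: "\<And>n. norm (x n) <= 1"
 shows "\<exists>r l. strict_mono r \<and> (%n. ap B (x (r n))) ----> l"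
proof -
 let ?K = "PiE UNIV (%_. {-1..1}) :: (nat => real) set"
 have "compactin (product_topology (%_. euclidean) UNIV) ?K"
  by (simp add: compactin_PiE)
 then have cK: "compact ?K" by (simp add: euclidean_product_topology)
 have inK: "(%i. inner (x n) (e i)) \<in> ?K" for n
 proof -
  have "\<bar>inner (x n) (e i)\<bar> <= 1" for i
   using Cauchy_Schwarz_ineq2[of "x n" "e i"] x[of n] by simp
  then show ?thesis by (auto simp: abs_le_iff)
 qed
 have "\<exists>l\<in>?K. \<exists>r. strict_mono r \<and> ((%n i. inner (x n) (e i)) \<circ> r) ----> l"
  by (rule cK[unfolded compact_def, THEN spec, of "%n i. inner (x n) (e i)", THEN mp]) (rule allI, rule inK)
 then obtain l r where r: "strict_mono r" and lim: "((%n i. inner (x n) (e i)) \<circ> r) ----> l" by blast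
 have lim_i: "(%n. inner (x (r n)) (e i)) ----> l i" for i
  using continuous_on_tendsto_compose[OF continuous_on_product_coordinates[of i] lim] by (simp add: o_def)
 have "Cauchy (%n. ap B (x (r n)))"
 proof (rule CauchyI')
  fix d :: real assume d: "0 < d"
  have sb: "summable (%i. norm (ap B (e i)))" using B by (simp add: nuclear_def)
  have "\<exists>N. \<forall>m\<ge>N. \<forall>n. norm (\<Sum>i = m..<n. norm (ap B (e i))) < d / 8"
   by (rule sb[unfolded summable_Cauchy, rule_format]) (use d in simp)
  then obtain N where N: "\<forall>m\<ge>N. \<forall>n. norm (\<Sum>i = m..<n. norm (ap B (e i))) < d / 8" by (rule exE)
  have "(%n. \<Sum>i<N. inner (x (r n)) (e i) *R ap B (e i)) ----> (\<Sum>i<N. l i *R ap B (e i))"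
   by (intro tendsto_intros lim_i)
  then have "EV n. dist (\<Sum>i<N. inner (x (r n)) (e i) *R ap B (e i)) (\<Sum>i<N. l i *R ap B (e i)) < d / 4"
   by (rule tendstoD) (use d in simp)
  then obtain N1 where N1: "\<forall>n\<ge>N1. dist (\<Sum>i<N. inner (x (r n)) (e i) *R ap B (e i)) (\<Sum>i<N. l i *R ap B (e i)) < d / 4"
   unfolding eventually_sequentially by (rule exE)
  have tail: "norm (ap B z - (\<Sum>i<N. inner z (e i) *R ap B (e i))) <= d / 8" if z: "norm z <= 1" for z
  proof (rule LIMSEQ_le_const2)
   show "(%n. norm ((\<Sum>i<n. inner z (e i) *R ap B (e i)) - (\<Sum>i<N. inner z (e i) *R ap B (e i))))
     ----> norm (ap B z - (\<Sum>i<N. inner z (e i) *R ap B (e i)))"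
    by (intro tendsto_intros apply_expansion)
   show "\<exists>M. \<forall>n\<ge>M. norm ((\<Sum>i<n. inner z (e i) *R ap B (e i)) - (\<Sum>i<N. inner z (e i) *R ap B (e i))) <= d / 8"
   proof (intro exI[of _ N] allI impI)
    fix n assume n: "N <= n"
    have "(\<Sum>i<n. inner z (e i) *R ap B (e i)) - (\<Sum>i<N. inner z (e i) *R ap B (e i))
     = (\<Sum>i = N..<n. inner z (e i) *R ap B (e i))"
     using n by (simp add: lessThan_atLeast0 sum_diff_nat_ivl)
    also have "norm ... <= (\<Sum>i = N..<n. norm (ap B (e i)))"
    proof (rule sum_norm_le)
     fix i
     have "\<bar>inner z (e i)\<bar> <= 1" using Cauchy_Schwarz_ineq2[of z "e i"] z by simp
     then show "norm (inner z (e i) *R ap B (e i)) <= norm (ap B (e i))"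
      by (simp add: mult_left_le_one_le)
    qed
    also have "... <= d / 8" using N[rule_format, of N n] unfolding real_norm_def by linarith
    finally show "norm ((\<Sum>i<n. inner z (e i) *R ap B (e i)) - (\<Sum>i<N. inner z (e i) *R ap B (e i))) <= d / 8" .
   qed
  qed
  show "\<exists>M. \<forall>m\<ge>M. \<forall>n>m. dist (ap B (x (r m))) (ap B (x (r n))) < d"
  proof (intro exI[of _ N1] allI impI)
   fix m n assume m: "N1 <= m" "m < n"
   let ?p = "%n. \<Sum>i<N. inner (x (r n)) (e i) *R ap B (e i)"
   let ?q = "\<Sum>i<N. l i *R ap B (e i)"
   have 1: "dist (ap B (x (r k))) (?p k) <= d / 8" for k
    unfolding dist_norm by (rule tail) (rule x)
   have 2: "dist (?p m) ?q < d / 4" "dist (?p n) ?q < d / 4" using N1[rule_format, of m] N1[rule_format, of n] m by simp_all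
   have "dist (ap B (x (r m))) (ap B (x (r n))) <=
    dist (ap B (x (r m))) (?p m) + dist (?p m) ?q + (dist (ap B (x (r n))) (?p n) + dist (?p n) ?q)"
    by (rule order_trans[OF dist_triangle2[of _ _ ?q]]) (intro add_mono dist_triangle)
   then show "dist (ap B (x (r m))) (ap B (x (r n))) < d"
    using 1[of m] 1[of n] 2 d by linarith
  qed
 qed
 then have "convergent (%n. ap B (x (r n)))" by (rule Cauchy_convergent)
 then show ?thesis using r unfolding convergent_def by blast
qed

text \<open>The key estimate for the maximum principle: a unit vector nearly maximising \<open>norm (B y)\<close> in a
 subspace that is invariant under the selfadjoint square is nearly an eigenvector.\<close>

lemma near_eigenvector:
 assumes B: "nuclear B" and s: "\<And>z. z \<in> V ==> norm (ap B z) <= s * norm z" "0 <= s"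
  and y: "y \<in> V" "norm y = 1" and T: "adjoint (ap B) (ap B y) \<in> V"
 shows "(norm (adjoint (ap B) (ap B y) - s\<^sup>2 *R y))\<^sup>2 <= s\<^sup>2 * (s\<^sup>2 - (norm (ap B y))\<^sup>2)"
proof -
 define t where "t = adjoint (ap B) (ap B y)"
 have ty: "inner t y = (norm (ap B y))\<^sup>2"
  unfolding t_def using adjoint_inner[OF B, of y "ap B y"] by (simp add: inner_commute power2_norm_eq_inner)
 have "(norm t)\<^sup>2 = inner (ap B t) (ap B y)"
  unfolding power2_norm_eq_inner adjoint_inner[OF B] t_def ..
 also have "... <= norm (ap B t) * norm (ap B y)" by (rule norm_cauchy_schwarz)
 also have "... <= (s * norm t) * norm (ap B y)"
  using s(1)[OF T] unfolding t_def by (rule mult_right_mono) simp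
 finally have "norm t * norm t <= norm t * (s * norm (ap B y))" by (simp add: power2_eq_square mult_ac)
 then have "norm t <= s * norm (ap B y)"
  by (cases "norm t = 0") (use s(2) in \<open>simp_all add: mult_le_cancel_left\<close>)
 then have t2: "(norm t)\<^sup>2 <= s\<^sup>2 * (norm (ap B y))\<^sup>2"
  by (subst power_mult_distrib[symmetric]) (rule power_mono, simp_all)
 have yy: "inner y y = 1" using y(2) by (simp add: norm_eq_sqrt_inner)
 have "(norm (t - s\<^sup>2 *R y))\<^sup>2 = (norm t)\<^sup>2 - 2 * s\<^sup>2 * inner t y + s\<^sup>2 * s\<^sup>2"
  by (simp add: power2_norm_eq_inner inner_diff_left inner_diff_right inner_commute[of y t] yy algebra_simps)
 also have "... <= s\<^sup>2 * (s\<^sup>2 - (norm (ap B y))\<^sup>2)"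
  using t2 by (simp add: ty algebra_simps)
 finally show ?thesis by (simp add: t_def)
qed

lemma orthogonal_unit_vector:
 fixes g :: "nat => 'h"
 shows "\<exists>v. norm v = 1 \<and> (\<forall>i<n. inner v (g i) = 0)"
proof -
 obtain c where C: "(\<exists>b\<le>n. c b \<noteq> 0) \<and> (\<forall>i<n. (\<Sum>b\<le>n. c b * inner (e b) (g i)) = 0)"
  using kernel_vector[of n "%b i. inner (e b) (g i)"] by (rule exE)
 obtain b0 where b0: "b0 <= n" "c b0 \<noteq> 0" using conjunct1[OF C] by auto
 define v where "v = (\<Sum>b\<in>{..n}. c b *R e b)"
 have "inner v (e b0) = c b0" unfolding v_def by (subst inner_sum_orthonormal_single[OF orth]) (use b0 in auto)
 then have v0: "v \<noteq> 0" using b0 by auto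
 have "inner v (g i) = 0" if "i < n" for i
  using conjunct2[OF C, rule_format, OF that] by (simp add: v_def inner_sum_left)
 then show ?thesis using v0 by (intro exI[of _ "sgn v"]) (simp add: norm_sgn sgn_div_norm)
qed

text \<open>Along a maximising sequence the images under \<open>B\<close> converge after passing to
  a subsequence. By \<open>near_eigenvector\<close> the sequence itself is close to
  \<open>1 / s^2\<close> times its image under the selfadjoint square, so it converges too, and the
  limit is a maximiser. That the \<open>g i\<close> are eigenvectors makes their orthogonal
  complement invariant. If the supremum is 0, every admissible unit vector will do.\<close>

lemma maximizer:
 fixes g :: "nat => 'h"
 assumes B: "nuclear B"
  and g: "\<And>i. i < n ==> adjoint (ap B) (ap B (g i)) = c i *R g i"
 shows "\<exists>v. norm v = 1 \<and> (\<forall>i<n. inner v (g i) = 0) \<and>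
  (\<forall>y. (\<forall>i<n. inner y (g i) = 0) --> norm (ap B y) <= norm (ap B v) * norm y)"
proof -
 define V where "V = {y. \<forall>i<n. inner y (g i) = 0}"
 let ?T = "%y. adjoint (ap B) (ap B y)"
 have TV: "?T y \<in> V" if "y \<in> V" for y
 proof -
  have "inner (?T y) (g i) = 0" if i: "i < n" for i
  proof -
   have "inner (?T y) (g i) = inner (ap B (g i)) (ap B y)"
    using adjoint_inner[OF B, of "g i" "ap B y"] by (simp add: inner_commute)
   also have "... = inner y (?T (g i))"
    using adjoint_inner[OF B, of y "ap B (g i)"] by (simp add: inner_commute)
   also have "... = 0" using g[OF i] \<open>y \<in> V\<close> i by (simp add: V_def)
   finally show ?thesis .
  qed
  then show ?thesis by (simp add: V_def)
 qed
 define S where "S = (%y. norm (ap B y)) ` {y\<in>V. norm y = 1}"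
 obtain v0 where v0: "norm v0 = 1" "\<forall>i<n. inner v0 (g i) = 0"
  using orthogonal_unit_vector[of n g] by (elim exE conjE)
 have Sne: "S \<noteq> {}" using v0 by (auto simp: S_def V_def)
 have Sbd: "bdd_above S"
  by (rule bdd_aboveI[of _ "norm B"]) (auto simp: S_def intro: order_trans[OF norm_blinfun])
 define s where "s = Sup S"
 have s_upper: "norm (ap B y) <= s" if "y \<in> V" "norm y = 1" for y
  unfolding s_def by (rule cSup_upper[OF _ Sbd]) (use that in \<open>auto simp: S_def\<close>)
 have s0: "0 <= s" using s_upper[of v0] v0 by (intro order_trans[OF norm_ge_zero[of "ap B v0"]]) (simp add: V_def)
 have s_bound: "norm (ap B y) <= s * norm y" if y: "y \<in> V" for y
 proof (cases "y = 0")
  case True then show ?thesis by (simp add: blinfun.zero_right)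
 next
  case False
  have "norm (ap B (sgn y)) <= s"
   by (rule s_upper) (use y False in \<open>auto simp: V_def sgn_div_norm norm_sgn\<close>)
  moreover have "norm (ap B (sgn y)) = norm (ap B y) / norm y"
   by (simp add: sgn_div_norm blinfun.scaleR_right divide_inverse mult.commute)
  ultimately show ?thesis using False by (simp add: divide_le_eq)
 qed
 have "\<exists>v. v \<in> V \<and> norm v = 1 \<and> norm (ap B v) = s"
 proof (cases "s = 0")
  case True
  have "norm (ap B v0) = 0" using s_upper[of v0] v0 True by (simp add: V_def)
  then show ?thesis using v0 True by (intro exI[of _ v0]) (simp add: V_def)
 next
  case False
  then have sp: "0 < s" using s0 by simp
  have "\<forall>m. \<exists>y. y \<in> V \<and> norm y = 1 \<and> s - inverse (real (Suc m)) < norm (ap B y)"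
  proof
   fix m
   have "s - inverse (real (Suc m)) < Sup S" unfolding s_def[symmetric] by simp
   then obtain t where "t \<in> S" "s - inverse (real (Suc m)) < t" unfolding less_cSup_iff[OF Sne Sbd] by (elim bexE)
   then show "\<exists>y. y \<in> V \<and> norm y = 1 \<and> s - inverse (real (Suc m)) < norm (ap B y)"
    by (auto simp: S_def)
  qed
  then have "\<exists>y. \<forall>m. y m \<in> V \<and> norm (y m) = 1 \<and> s - inverse (real (Suc m)) < norm (ap B (y m))" by (rule choice)
  then obtain y where Y: "\<forall>m. y m \<in> V \<and> norm (y m) = 1 \<and> s - inverse (real (Suc m)) < norm (ap B (y m))" by (rule exE)
  have y: "y m \<in> V" "norm (y m) = 1" "s - inverse (real (Suc m)) < norm (ap B (y m))" for m
   using Y by simp_all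
  have lim_s: "(%m. norm (ap B (y m))) ----> s"
  proof (rule tendsto_sandwich[OF always_eventually always_eventually _ tendsto_const])
   show "(%m. s - inverse (real (Suc m))) ----> s"
    using tendsto_diff[OF tendsto_const LIMSEQ_inverse_real_of_nat, of s] by simp
   show "\<forall>m. s - inverse (real (Suc m)) <= norm (ap B (y m))" using y(3) less_imp_le by blast
   show "\<forall>m. norm (ap B (y m)) <= s" using s_upper y by blast
  qed
  have "\<exists>r l. strict_mono r \<and> (%m. ap B (y (r m))) ----> l"
   by (rule bounded_subseq[OF B]) (simp add: y(2))
  then obtain r l where r: "strict_mono r" and l: "(%m. ap B (y (r m))) ----> l" by (elim exE conjE)
  have ev0: "(%m. ?T (y m) - s\<^sup>2 *R y m) ----> 0"
  proof -
   have "(%m. s\<^sup>2 * (s\<^sup>2 - (norm (ap B (y m)))\<^sup>2)) ----> s\<^sup>2 * (s\<^sup>2 - s\<^sup>2)"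
    by (intro tendsto_intros lim_s)
   then have lim0: "(%m. s\<^sup>2 * (s\<^sup>2 - (norm (ap B (y m)))\<^sup>2)) ----> 0" by simp
   have "(%m. (norm (?T (y m) - s\<^sup>2 *R y m))\<^sup>2) ----> 0"
   proof (rule tendsto_sandwich[OF always_eventually always_eventually tendsto_const lim0])
    show "\<forall>m. (norm (?T (y m) - s\<^sup>2 *R y m))\<^sup>2 <= s\<^sup>2 * (s\<^sup>2 - (norm (ap B (y m)))\<^sup>2)"
     by (rule allI) (rule near_eigenvector[OF B s_bound s0 y(1,2) TV[OF y(1)]])
   qed simp
   then have "(%m. sqrt ((norm (?T (y m) - s\<^sup>2 *R y m))\<^sup>2)) ----> sqrt 0" by (rule tendsto_real_sqrt)
   then show ?thesis by (simp add: tendsto_norm_zero_iff)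
  qed
  have adj_bl: "norm (adjoint (ap B) z) <= norm B * norm z" for z
  proof -
   have "(norm (adjoint (ap B) z))\<^sup>2 = inner (ap B (adjoint (ap B) z)) z"
    unfolding power2_norm_eq_inner adjoint_inner[OF B] ..
   also have "... <= norm (ap B (adjoint (ap B) z)) * norm z" by (rule norm_cauchy_schwarz)
   also have "... <= (norm B * norm (adjoint (ap B) z)) * norm z" by (intro mult_right_mono norm_blinfun) simp
   finally show ?thesis
    by (cases "norm (adjoint (ap B) z) = 0") (simp_all add: power2_eq_square mult_ac mult_le_cancel_left)
  qed
  have adj_diff: "adjoint (ap B) z - adjoint (ap B) z' = adjoint (ap B) (z - z')" for z z'
  proof -
   have "inner x (adjoint (ap B) z - adjoint (ap B) z' - adjoint (ap B) (z - z')) = 0" for x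
    by (simp only: inner_diff_right adjoint_inner[OF B, symmetric])
   then show ?thesis
    using inner_eq_zero_iff[of "adjoint (ap B) z - adjoint (ap B) z' - adjoint (ap B) (z - z')"] by simp
  qed
  have Tl: "(%m. ?T (y (r m))) ----> adjoint (ap B) l"
  proof (rule LIM_zero_cancel, rule Lim_null_comparison[OF always_eventually])
   show "\<forall>m. norm (?T (y (r m)) - adjoint (ap B) l) <= norm B * norm (ap B (y (r m)) - l)"
    unfolding adj_diff by (intro allI adj_bl)
   have "(%m. norm B * norm (ap B (y (r m)) - l)) ----> norm B * norm (l - l)" by (intro tendsto_intros l)
   then show "(%m. norm B * norm (ap B (y (r m)) - l)) ----> 0" by simp
  qed
  \<comment> \<open>The only possible limit of the sequence: its images under the square tend to
    \<open>adjoint (ap B) l\<close> and are nearly \<open>s^2\<close> times the sequence.\<close>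
  define v where "v = (1 / s\<^sup>2) *R adjoint (ap B) l"
  have yl: "(%m. y (r m)) ----> v"
  proof -
   have "(%m. ?T (y (r m)) - s\<^sup>2 *R y (r m)) ----> 0"
    using LIMSEQ_subseq_LIMSEQ[OF ev0 r] by (simp only: o_def)
   then have "(%m. (1 / s\<^sup>2) *R (?T (y (r m)) - (?T (y (r m)) - s\<^sup>2 *R y (r m)))) ----> (1 / s\<^sup>2) *R (adjoint (ap B) l - 0)"
    by (intro tendsto_intros Tl)
   then show ?thesis using sp by (simp add: v_def)
  qed
  have "inner v (g i) = 0" if i: "i < n" for i
  proof (rule LIMSEQ_unique)
   show "(%m. inner (y (r m)) (g i)) ----> inner v (g i)" by (intro tendsto_intros yl)
   show "(%m. inner (y (r m)) (g i)) ----> 0" using y(1) i by (simp add: V_def)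
  qed
  moreover have "norm v = 1"
  proof (rule LIMSEQ_unique)
   show "(%m. norm (y (r m))) ----> norm v" by (intro tendsto_intros yl)
   show "(%m. norm (y (r m))) ----> 1" using y(2) by simp
  qed
  moreover have "norm (ap B v) = s"
  proof (rule LIMSEQ_unique)
   show "(%m. norm (ap B (y (r m)))) ----> norm (ap B v)"
    by (intro tendsto_norm bounded_linear.tendsto[OF blinfun.bounded_linear_right yl])
   show "(%m. norm (ap B (y (r m)))) ----> s"
    using LIMSEQ_subseq_LIMSEQ[OF lim_s r] by (simp only: o_def)
  qed
  ultimately show ?thesis by (intro exI[of _ v]) (simp add: V_def)
 qed
 then obtain v where "v \<in> V" "norm v = 1" "norm (ap B v) = s" by (elim exE conjE)
 then show ?thesis using s_bound by (intro exI[of _ v]) (simp add: V_def)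
qed

definition sv_step :: "('h op) => 'h list => 'h => bool" where
 "sv_step B ws v \<longleftrightarrow> norm v = 1 \<and> (\<forall>i<length ws. inner v (ws ! i) = 0) \<and>
  (\<forall>y. (\<forall>i<length ws. inner y (ws ! i) = 0) --> norm (ap B y) <= norm (ap B v) * norm y)"

text \<open>Successive maximisation in orthogonal complements. That the choice always succeeds is
  shown together with the eigenvector property in \<open>sv_vec\<close>.\<close>

fun sv_vec :: "('h op) => nat => 'h" where
 "sv_vec B n = (SOME v. sv_step B (map (%i. sv_vec B i) [0..<n]) v)"

declare sv_vec.simps [simp del]

text \<open>Existence and the eigenvector property need one joint induction: the next maximiser
  exists because the earlier vectors are eigenvectors, and it is an eigenvector because the
  right-hand side of \<open>near_eigenvector\<close> is 0 at a maximiser.\<close>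

lemma sv_vec:
 assumes B: "nuclear B"
 shows "norm (sv_vec B n) = 1" "\<And>i. i < n ==> inner (sv_vec B n) (sv_vec B i) = 0"
  "\<And>y. (\<And>i. i < n ==> inner y (sv_vec B i) = 0) ==> norm (ap B y) <= norm (ap B (sv_vec B n)) * norm y"
  "adjoint (ap B) (ap B (sv_vec B n)) = (norm (ap B (sv_vec B n)))\<^sup>2 *R sv_vec B n"
proof -
 have step: "sv_step B (map (sv_vec B) [0..<n]) (sv_vec B n) \<and>
   adjoint (ap B) (ap B (sv_vec B n)) = (norm (ap B (sv_vec B n)))\<^sup>2 *R sv_vec B n" for n
 proof (induction n rule: less_induct)
  case (less n)
  have eig: "adjoint (ap B) (ap B (sv_vec B i)) = (norm (ap B (sv_vec B i)))\<^sup>2 *R sv_vec B i"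
   if "i < n" for i using less[OF that] by (rule conjunct2)
  have "\<exists>v. sv_step B (map (sv_vec B) [0..<n]) v"
   using maximizer[OF B eig, of n] by (simp add: sv_step_def)
  then have st: "sv_step B (map (sv_vec B) [0..<n]) (sv_vec B n)"
   unfolding sv_vec.simps[of B n] by (rule someI_ex)
  define V where "V = {y. \<forall>i<n. inner y (sv_vec B i) = 0}"
  have v: "norm (sv_vec B n) = 1" "sv_vec B n \<in> V"
   and mx: "\<And>y. y \<in> V ==> norm (ap B y) <= norm (ap B (sv_vec B n)) * norm y"
   using st by (simp_all add: sv_step_def V_def)
  have TV: "adjoint (ap B) (ap B (sv_vec B n)) \<in> V"
  proof -
   have "inner (adjoint (ap B) (ap B (sv_vec B n))) (sv_vec B i) = 0" if i: "i < n" for i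
   proof -
    have "inner (adjoint (ap B) (ap B (sv_vec B n))) (sv_vec B i) = inner (ap B (sv_vec B i)) (ap B (sv_vec B n))"
     by (subst inner_commute) (rule adjoint_inner[OF B, symmetric])
    also have "... = inner (sv_vec B n) (adjoint (ap B) (ap B (sv_vec B i)))"
     by (subst inner_commute) (rule adjoint_inner[OF B])
    also have "... = 0" using eig[OF i] v(2) i by (simp add: V_def)
    finally show ?thesis .
   qed
   then show ?thesis by (simp add: V_def)
  qed
  have "(norm (adjoint (ap B) (ap B (sv_vec B n)) - (norm (ap B (sv_vec B n)))\<^sup>2 *R sv_vec B n))\<^sup>2 <=
    (norm (ap B (sv_vec B n)))\<^sup>2 * ((norm (ap B (sv_vec B n)))\<^sup>2 - (norm (ap B (sv_vec B n)))\<^sup>2)"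
   by (rule near_eigenvector[OF B mx]) (use v TV in auto)
  then show ?case using st by simp
 qed
 have st: "sv_step B (map (sv_vec B) [0..<n]) (sv_vec B n)" using step by (rule conjunct1)
 show "norm (sv_vec B n) = 1" using st by (simp add: sv_step_def)
 show "inner (sv_vec B n) (sv_vec B i) = 0" if "i < n" for i using st that by (simp add: sv_step_def)
 show "norm (ap B y) <= norm (ap B (sv_vec B n)) * norm y" if "\<And>i. i < n ==> inner y (sv_vec B i) = 0" for y
  using st that by (simp add: sv_step_def)
 show "adjoint (ap B) (ap B (sv_vec B n)) = (norm (ap B (sv_vec B n)))\<^sup>2 *R sv_vec B n"
  using step by (rule conjunct2)
qed

lemma orthonormal_sv_vec: assumes B: "nuclear B" shows "orthonormal_seq (sv_vec B)"
 unfolding orthonormal_seq_def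
proof (intro allI)
 fix i j
 show "inner (sv_vec B i) (sv_vec B j) = (if i = j then 1 else 0)"
  using sv_vec(2)[OF B, of i j] sv_vec(2)[OF B, of j i] sv_vec(1)[OF B, of i]
  by (cases i j rule: linorder_cases) (auto simp: inner_commute norm_eq_sqrt_inner)
qed

lemma singular_value_seq_ex: assumes B: "nuclear B" shows "singular_value_seq B (%n. norm (ap B (sv_vec B n)))"
 unfolding singular_value_seq_def
proof (intro conjI allI exI[of _ "sv_vec B"] impI)
 let ?s = "%n. norm (ap B (sv_vec B n))"
 have on: "orthonormal_seq (sv_vec B)" by (rule orthonormal_sv_vec[OF B])
 have mono: "?s n <= ?s m" if "m <= n" for m n
 proof -
  have "norm (ap B (sv_vec B n)) <= norm (ap B (sv_vec B m)) * norm (sv_vec B n)"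
   by (rule sv_vec(3)[OF B]) (use that in \<open>auto intro: sv_vec(2)[OF B]\<close>)
  then show ?thesis using sv_vec(1)[OF B, of n] by simp
 qed
 then show "decseq ?s" by (simp add: decseq_def)
 fix x assume x: "\<forall>k. inner x (sv_vec B k) = 0"
 show "ap B x = 0"
 proof (rule ccontr)
  assume nz: "ap B x \<noteq> 0"
  then have x0: "x \<noteq> 0" by (auto simp: blinfun.zero_right)
  \<comment> \<open>If \<open>x\<close> is missed by all singular vectors and not killed by
    \<open>B\<close>, then \<open>c\<close> bounds every singular value from below. The images of
    the singular vectors are orthogonal, hence at mutual distance at least \<open>c\<close>, which
    contradicts compactness.\<close>
  define c where "c = norm (ap B x) / norm x"
  have c: "0 < c" using nz x0 by (simp add: c_def)
  have sc: "c <= ?s n" for n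
  proof -
   have "norm (ap B x) <= ?s n * norm x" by (rule sv_vec(3)[OF B]) (use x in auto)
   then show ?thesis using x0 by (simp add: c_def divide_le_eq)
  qed
  have "\<exists>r l. strict_mono r \<and> (%m. ap B (sv_vec B (r m))) ----> l"
   by (rule bounded_subseq[OF B]) (simp add: sv_vec(1)[OF B])
  then obtain r l where r: "strict_mono r" and l: "(%m. ap B (sv_vec B (r m))) ----> l" by (elim exE conjE)
  have "Cauchy (%m. ap B (sv_vec B (r m)))" using l by (rule LIMSEQ_imp_Cauchy)
  then obtain M where M: "\<forall>m\<ge>M. \<forall>n\<ge>M. norm (ap B (sv_vec B (r m)) - ap B (sv_vec B (r n))) < c"
   unfolding Cauchy_iff using c by (meson)
  have ne: "r M \<noteq> r (Suc M)" using r by (metis lessI less_irrefl strict_mono_less)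
  have "inner (ap B (sv_vec B (r M))) (ap B (sv_vec B (r (Suc M)))) = 0"
   using ne on by (simp add: adjoint_inner[OF B] sv_vec(4)[OF B] orthonormal_seq_def)
  then have "(norm (ap B (sv_vec B (r M)) - ap B (sv_vec B (r (Suc M)))))\<^sup>2 = (?s (r M))\<^sup>2 + (?s (r (Suc M)))\<^sup>2"
   by (simp add: power2_norm_eq_inner inner_diff_left inner_diff_right inner_commute)
  moreover have "c\<^sup>2 <= (?s (r M))\<^sup>2" using sc c by (intro power_mono) auto
  ultimately have "c\<^sup>2 <= (norm (ap B (sv_vec B (r M)) - ap B (sv_vec B (r (Suc M)))))\<^sup>2"
   using zero_le_power2[of "?s (r (Suc M))"] by linarith
  then have "c <= norm (ap B (sv_vec B (r M)) - ap B (sv_vec B (r (Suc M))))"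
   by (rule power2_le_imp_le) simp
  moreover have "norm (ap B (sv_vec B (r M)) - ap B (sv_vec B (r (Suc M)))) < c" using M by simp
  ultimately show False by simp
 qed
qed (use orthonormal_sv_vec[OF B] sv_vec[OF B] in auto)

text \<open>In the expansion of \<open>y\<close> only indices from \<open>k\<close> on occur, each
  with weight at most \<open>(s k)^2\<close>, and the part of \<open>y\<close> orthogonal to all
  \<open>f i\<close> is killed by \<open>B\<close>.\<close>

lemma singular_value_seq_bound:
 assumes B: "nuclear B" and f: "orthonormal_seq f"
  and eig: "\<And>k. adjoint (ap B) (ap B (f k)) = (s k)\<^sup>2 *R f k"
  and s: "decseq s" "\<And>k. 0 <= s k"
  and ker: "\<And>x. (\<And>k. inner x (f k) = 0) ==> ap B x = 0"
  and y: "\<And>i. i < k ==> inner y (f i) = 0"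
 shows "norm (ap B y) <= s k * norm y"
proof -
 obtain r where r: "(%n. \<Sum>i<n. inner y (f i) *R f i) ----> y - r" "\<And>i. inner r (f i) = 0"
  using orthonormal_expansion[OF f, of y] by auto
 have Br: "ap B r = 0" by (rule ker) (rule r(2))
 have "(%n. norm (ap B (\<Sum>i<n. inner y (f i) *R f i))) ----> norm (ap B (y - r))"
  by (intro tendsto_norm bounded_linear.tendsto[OF blinfun.bounded_linear_right r(1)])
 then have lim: "(%n. norm (ap B (\<Sum>i<n. inner y (f i) *R f i))) ----> norm (ap B y)"
  by (simp add: blinfun.diff_right Br)
 have "norm (ap B (\<Sum>i<n. inner y (f i) *R f i)) <= s k * norm y" for n
 proof (rule power2_le_imp_le)
  let ?p = "\<Sum>i<n. inner y (f i) *R f i"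
  have "inner ?p (adjoint (ap B) (ap B (f i))) = (s i)\<^sup>2 * (if i < n then inner y (f i) else 0)" for i
   by (simp add: eig inner_sum_orthonormal_single[OF f])
  then have bb: "inner (ap B ?p) (ap B (f i)) = (s i)\<^sup>2 * (if i < n then inner y (f i) else 0)" for i
   by (simp add: adjoint_inner[OF B])
  have "(norm (ap B ?p))\<^sup>2 = inner (ap B ?p) (\<Sum>i<n. inner y (f i) *R ap B (f i))"
   by (simp add: power2_norm_eq_inner blinfun.sum_right blinfun.scaleR_right)
  also have "... = (\<Sum>i<n. inner y (f i) * inner (ap B ?p) (ap B (f i)))"
   by (simp only: inner_sum_right inner_scaleR_right)
  also have "... = (\<Sum>i<n. (s i)\<^sup>2 * (inner y (f i))\<^sup>2)"
   by (intro sum.cong refl) (simp add: bb power2_eq_square)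
  also have "... <= (\<Sum>i<n. (s k)\<^sup>2 * (inner y (f i))\<^sup>2)"
  proof (rule sum_mono)
   fix i
   show "(s i)\<^sup>2 * (inner y (f i))\<^sup>2 <= (s k)\<^sup>2 * (inner y (f i))\<^sup>2"
   proof (cases "i < k")
    case False
    then have "s i <= s k" using s(1) by (simp add: decseq_def)
    then have "(s i)\<^sup>2 <= (s k)\<^sup>2" by (rule power_mono) (rule s(2))
    then show ?thesis by (rule mult_right_mono) simp
   qed (simp add: y)
  qed
  also have "... <= (s k)\<^sup>2 * (norm y)\<^sup>2"
   unfolding sum_distrib_left[symmetric] by (intro mult_left_mono bessel[OF f]) simp
  finally show "(norm (ap B ?p))\<^sup>2 <= (s k * norm y)\<^sup>2" by (simp add: power_mult_distrib)
 qed (simp add: s(2))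
 then show ?thesis by (intro LIMSEQ_le_const2[OF lim]) auto
qed

text \<open>The min-max argument: a nonzero vector in the span of the first \<open>k + 1\<close>
  eigenvectors belonging to \<open>s\<close> is orthogonal to the first \<open>k\<close> belonging
  to \<open>t\<close>, so \<open>B\<close> stretches it by at least \<open>s k\<close> and at most
  \<open>t k\<close>.\<close>

lemma singular_value_seq_unique_le:
 assumes B: "nuclear B" and s: "singular_value_seq B s" and t: "singular_value_seq B t"
 shows "s k <= t k"
proof (rule ccontr)
 assume "\<not> s k <= t k"
 then have lt: "t k < s k" by simp
 obtain f where f: "orthonormal_seq f" "\<forall>k. adjoint (ap B) (ap B (f k)) = (s k)\<^sup>2 *R f k"
   and sd: "decseq s" "\<forall>k. 0 <= s k"
  using s unfolding singular_value_seq_def by (elim conjE exE)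
 obtain g where g: "orthonormal_seq g" "\<forall>k. adjoint (ap B) (ap B (g k)) = (t k)\<^sup>2 *R g k"
   "\<forall>x. (\<forall>k. inner x (g k) = 0) --> ap B x = 0" and td: "decseq t" "\<forall>k. 0 <= t k"
  using t unfolding singular_value_seq_def by (elim conjE exE)
 obtain c where C: "(\<exists>b\<le>k. c b \<noteq> 0) \<and> (\<forall>i<k. (\<Sum>b\<le>k. c b * inner (f b) (g i)) = 0)"
  using kernel_vector[of k "%b i. inner (f b) (g i)"] by (rule exE)
 obtain b0 where b0: "b0 <= k" "c b0 \<noteq> 0" using conjunct1[OF C] by auto
 define y where "y = (\<Sum>b\<in>{..k}. c b *R f b)"
 have ny: "(norm y)\<^sup>2 = (\<Sum>b\<in>{..k}. (c b)\<^sup>2)" unfolding y_def by (rule norm_sum_orthonormal[OF f(1)]) simp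
 have "(\<Sum>b\<in>{..k}. (c b)\<^sup>2) > 0" by (rule sum_pos2[of _ b0]) (use b0 in auto)
 then have y0: "0 < (norm y)\<^sup>2" using ny by simp
 have "norm (ap B y) <= t k * norm y"
 proof (rule singular_value_seq_bound[OF B g(1)])
  show "inner y (g i) = 0" if "i < k" for i
   using conjunct2[OF C, rule_format, OF that] by (simp add: y_def inner_sum_left)
 qed (use g td in auto)
 then have "(norm (ap B y))\<^sup>2 <= (t k * norm y)\<^sup>2" by (rule power_mono) simp
 moreover have "(norm (ap B y))\<^sup>2 = (\<Sum>b\<in>{..k}. (s b)\<^sup>2 * (c b)\<^sup>2)"
 proof -
  have "(norm (ap B y))\<^sup>2 = inner (ap B y) (\<Sum>b\<in>{..k}. c b *R ap B (f b))"
   by (simp add: power2_norm_eq_inner y_def blinfun.sum_right blinfun.scaleR_right)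
  also have "... = (\<Sum>b\<in>{..k}. c b * inner y (adjoint (ap B) (ap B (f b))))"
   by (simp only: inner_sum_right inner_scaleR_right adjoint_inner[OF B])
  also have "... = (\<Sum>b\<in>{..k}. (s b)\<^sup>2 * (c b)\<^sup>2)"
   by (intro sum.cong refl) (simp add: f(2) y_def inner_sum_orthonormal_single[OF f(1)] power2_eq_square)
  finally show ?thesis .
 qed
 moreover have "(s k)\<^sup>2 * (norm y)\<^sup>2 <= (\<Sum>b\<in>{..k}. (s b)\<^sup>2 * (c b)\<^sup>2)"
  unfolding ny sum_distrib_left
 proof (rule sum_mono)
  fix b assume "b \<in> {..k}"
  then have "s k <= s b" using sd(1) by (simp add: decseq_def)
  then have "(s k)\<^sup>2 <= (s b)\<^sup>2" by (rule power_mono) (use sd in simp)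
  then show "(s k)\<^sup>2 * (c b)\<^sup>2 <= (s b)\<^sup>2 * (c b)\<^sup>2" by (rule mult_right_mono) simp
 qed
 ultimately have "(s k)\<^sup>2 * (norm y)\<^sup>2 <= (t k)\<^sup>2 * (norm y)\<^sup>2" by (simp add: power_mult_distrib)
 then have "(s k)\<^sup>2 <= (t k)\<^sup>2" using y0 by (rule mult_right_le_imp_le)
 then have "s k <= t k" by (rule power2_le_imp_le) (use td in simp)
 then show False using lt by simp
qed

definition sval :: "('h op) => nat => real" where "sval B = (%n. norm (ap B (sv_vec B n)))"

lemma singular_value_eq: assumes B: "nuclear B" shows "singular_value j B = sval B (j - 1)"
proof -
 have "(THE s. singular_value_seq B s) = sval B"
 proof (rule the_equality)
  show s: "singular_value_seq B (sval B)" unfolding sval_def by (rule singular_value_seq_ex[OF B])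
  show "t = sval B" if "singular_value_seq B t" for t
   by (rule ext) (intro antisym singular_value_seq_unique_le[OF B] that s)
 qed
 then show ?thesis by (simp add: singular_value_def)
qed

lemma sval_nonneg: "0 <= sval B n" by (simp add: sval_def)

lemma sval_antimono: "nuclear B ==> m <= n ==> sval B n <= sval B m"
 using singular_value_seq_ex[of B] by (simp add: singular_value_seq_def sval_def decseq_def)

lemma vol_le_prod_sval: assumes B: "nuclear B" shows "vol k B <= (fact k)\<^sup>2 * (\<Prod>i<k. sval B i)"
proof (induction k)
 case (Suc k)
 have "vol (Suc k) B <= (real (Suc k))\<^sup>2 * sval B k * vol k B"
 proof (rule vol_Suc_le[OF sval_nonneg])
  show "norm (ap B y) <= sval B k * norm y" if "\<forall>i<k. inner y (sv_vec B i) = 0" for y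
   unfolding sval_def by (rule sv_vec(3)[OF B]) (use that in simp)
 qed
 also have "... <= (real (Suc k))\<^sup>2 * sval B k * ((fact k)\<^sup>2 * (\<Prod>i<k. sval B i))"
  by (intro mult_left_mono Suc mult_nonneg_nonneg sval_nonneg) simp
 finally show ?case by (simp add: power_mult_distrib mult_ac)
qed simp

text \<open>The singular vectors and their normalised images are admissible and make the matrix in
  \<open>mdet\<close> diagonal.\<close>

lemma prod_sval_le_vol: assumes B: "nuclear B" shows "(\<Prod>i<k. sval B i) <= vol k B"
proof (cases "\<exists>i<k. sval B i = 0")
 case True
 then have "(\<Prod>i<k. sval B i) = 0" by (intro prod_zero) auto
 then show ?thesis by (simp only: vol_nonneg)
next
 case False
 then have pos: "sval B i \<noteq> 0" if "i < k" for i using that by simp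
 define x where "x a = (1 / sval B a) *R ap B (sv_vec B a)" for a
 have "mdet k B x (sv_vec B) = dt k (%a b. if a = b then sval B a else 0)"
  unfolding mdet_def
 proof (rule dt_cong)
  fix a b assume a: "a < k" "b < k"
  have "inner (ap B (sv_vec B a)) (ap B (sv_vec B b)) = (sval B b)\<^sup>2 * inner (sv_vec B a) (sv_vec B b)"
   by (simp add: adjoint_inner[OF B] sv_vec(4)[OF B] sval_def)
  then show "inner (x a) (ap B (sv_vec B b)) = (if a = b then sval B a else 0)"
   using orthonormal_sv_vec[OF B] pos[OF a(1)] by (simp add: x_def orthonormal_seq_def power2_eq_square)
 qed
 also have "... = (\<Prod>i<k. sval B i)" by (rule dt_diag)
 finally have "(\<Prod>i<k. sval B i) <= \<bar>mdet k B x (sv_vec B)\<bar>" by simp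
 also have "... <= vol k B"
 proof (rule vol_upper)
  show "norm (x a) <= 1" if "a < k" for a using pos[OF that] by (simp add: x_def sval_def)
 qed (simp add: sv_vec(1)[OF B])
 finally show ?thesis .
qed

end

section \<open>Negative moments of Gaussian polynomials in one variable\<close>

text \<open>Since \<open>0 powr a\<close> is 0, the value at 0 is set apart. With
  \<open>\<infinity>\<close> there, a finite integral of \<open>npow\<close> also shows that its
  argument is almost never 0.\<close>

definition npow :: "real => real => ennreal" where
 "npow q x = (if x = 0 then \<infinity> else ennreal (\<bar>x\<bar> powr (- q)))"

lemma npow_measurable [measurable]: "npow q \<in> borel_measurable borel"
 unfolding npow_def[abs_def] by measurable

lemma npow_mult: "npow q (x * y) = npow q x * npow q y"
 by (auto simp: npow_def ennreal_mult_top ennreal_top_mult abs_mult powr_mult ennreal_mult)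

lemma npow_1 [simp]: "npow q 1 = 1"
 by (simp add: npow_def)

lemma npow_minus [simp]: "npow q (- x) = npow q x"
 by (simp add: npow_def)

lemma npow_antimono: "0 < q ==> \<bar>x\<bar> <= \<bar>y\<bar> ==> npow q y <= npow q x"
 by (auto simp: npow_def intro!: ennreal_leI powr_mono2')

text \<open>One integrable singularity dominates all exponents up to 1/2; arguments of modulus above
  1 contribute at most 1.\<close>

lemma npow_le_half: assumes q: "0 <= q" "q <= 1/2" shows "npow q x <= 1 + npow (1/2) x * indicator {-1..1} x"
proof (cases "x = 0")
 case True then show ?thesis by (simp add: npow_def)
next
 case False
 show ?thesis
 proof (cases "\<bar>x\<bar> <= 1")
  case True
  have "\<bar>x\<bar> powr (- q) <= \<bar>x\<bar> powr (- (1/2))" using True False q by (intro powr_mono') auto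
  then have "npow q x <= npow (1/2) x" using False by (simp add: npow_def ennreal_leI)
  moreover have "indicator {-1..1} x = (1::ennreal)" using True by (auto simp: indicator_def)
  ultimately show ?thesis by (simp add: add_increasing)
 next
  case False
  have "\<bar>x\<bar> powr (- q) <= \<bar>x\<bar> powr 0" using False q by (intro powr_mono) auto
  then have "npow q x <= 1" using False by (auto simp: npow_def)
  then show ?thesis by (simp add: add_increasing2)
 qed
qed

definition N01 :: "real measure" where "N01 = density lborel std_normal_density"

lemma prob_space_N01: "prob_space N01"
 unfolding N01_def by (rule prob_space_normal_density) simp

interpretation N01: prob_space N01 by (rule prob_space_N01)

lemma sets_N01 [measurable_cong, simp]: "sets N01 = sets borel" by (simp add: N01_def)

lemma space_N01 [simp]: "space N01 = UNIV" by (simp add: N01_def)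

lemma nn_integral_N01: "f \<in> borel_measurable borel ==> (\<integral>\<^sup>+g. f g \<partial>N01) = (\<integral>\<^sup>+g. ennreal (std_normal_density g) * f g \<partial>lborel)"
 unfolding N01_def by (subst nn_integral_density) auto

lemma std_normal_density_le_1: "std_normal_density x <= 1"
proof -
 have "1 <= sqrt (2 * pi)" using pi_ge_two by (intro real_le_rsqrt) simp
 then have "1 / sqrt (2 * pi) <= 1" by simp
 moreover have "exp (- x\<^sup>2 / 2) <= 1" by simp
 ultimately have "1 / sqrt (2 * pi) * exp (- x\<^sup>2 / 2) <= 1 * 1" by (intro mult_mono) auto
 then show ?thesis by (simp add: normal_density_def)
qed

lemma std_normal_density_abs_le: "std_normal_density x * \<bar>x\<bar> <= 1"
proof -
 have "1 <= sqrt (2 * pi)" using pi_ge_two by (intro real_le_rsqrt) simp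
 then have 1: "1 / sqrt (2 * pi) <= 1" by simp
 have "\<bar>x\<bar> <= 1 + x\<^sup>2 / 2"
  using zero_le_power2[of "\<bar>x\<bar> - 1"] by (simp add: power2_diff)
 also have "... <= exp (x\<^sup>2 / 2)" by (rule exp_ge_add_one_self)
 finally have "exp (- x\<^sup>2 / 2) * \<bar>x\<bar> <= exp (- x\<^sup>2 / 2) * exp (x\<^sup>2 / 2)" by (intro mult_left_mono) auto
 also have "... = 1" by (simp add: exp_add[symmetric])
 finally have "1 / sqrt (2 * pi) * (exp (- x\<^sup>2 / 2) * \<bar>x\<bar>) <= 1 * 1" using 1 by (intro mult_mono) auto
 then show ?thesis by (simp add: normal_density_def)
qed

definition C1 :: ennreal where "C1 = (\<integral>\<^sup>+s. npow (1/2) s * indicator {-1..1} s \<partial>lborel)"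

lemma C1_finite: "C1 < \<infinity>"
proof -
 define h :: "real => real" where "h s = (if s \<in> {0..1} then s powr (-1/2) else 0)" for s
 have h0: "0 <= h s" for s by (simp add: h_def)
 have hm [measurable]: "h \<in> borel_measurable borel" unfolding h_def by measurable
 have "(h has_integral (1 powr (-1/2 + 1) / (-1/2 + 1))) UNIV"
  unfolding h_def by (subst has_integral_restrict_UNIV) (rule has_integral_powr_from_0, auto)
 from nn_integral_has_integral_lborel[OF hm h0 this]
 have I: "(\<integral>\<^sup>+s. ennreal (h s) \<partial>lborel) < \<infinity>" by simp
 have "(\<integral>\<^sup>+s. ennreal (h (0 + (-1) * s)) \<partial>lborel) = (\<integral>\<^sup>+s. ennreal (h s) \<partial>lborel)"
  by (subst (2) nn_integral_real_affine[where c="-1" and t=0]) auto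
 then have I': "(\<integral>\<^sup>+s. ennreal (h (- s)) \<partial>lborel) < \<infinity>" using I by simp
 have "C1 <= (\<integral>\<^sup>+s. ennreal (h s) + ennreal (h (- s)) \<partial>lborel)"
  unfolding C1_def
 proof (rule nn_integral_mono_AE)
  have "AE s in lborel. s \<noteq> (0::real)" by (rule AE_lborel_singleton)
  then show "AE s in lborel. npow (1/2) s * indicator {-1..1} s <= ennreal (h s) + ennreal (h (- s))"
   by eventually_elim (auto simp: npow_def h_def indicator_def abs_if)
 qed
 also have "... = (\<integral>\<^sup>+s. ennreal (h s) \<partial>lborel) + (\<integral>\<^sup>+s. ennreal (h (- s)) \<partial>lborel)"
  by (rule nn_integral_add) auto
 also have "... < \<infinity>" using I I' by (simp add: ennreal_add_less_top)
 finally show ?thesis .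
qed

text \<open>Scaling out \<open>b\<close> leaves a translate of the singularity, and as the density
  is at most 1, its position does not matter.\<close>

lemma nn_integral_npow_affine:
 assumes b: "b \<noteq> 0" and q: "0 <= q" "q <= 1/2"
 shows "(\<integral>\<^sup>+g. npow q (a + g * b) \<partial>N01) <= (1 + C1) * npow q b"
proof -
 have "(\<integral>\<^sup>+g. npow q (a / b + g) \<partial>N01) <= (\<integral>\<^sup>+g. 1 + npow (1/2) (a / b + g) * indicator {-1..1} (a / b + g) \<partial>N01)"
  by (intro nn_integral_mono npow_le_half q)
 also have "... = 1 + (\<integral>\<^sup>+g. npow (1/2) (a / b + g) * indicator {-1..1} (a / b + g) \<partial>N01)"
  by (subst nn_integral_add) (auto simp: N01.emeasure_space_1[simplified])
 also have "(\<integral>\<^sup>+g. npow (1/2) (a / b + g) * indicator {-1..1} (a / b + g) \<partial>N01) <=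
   (\<integral>\<^sup>+g. npow (1/2) (a / b + g) * indicator {-1..1} (a / b + g) \<partial>lborel)"
 proof (subst nn_integral_N01, measurable, rule nn_integral_mono)
  fix g
  have "ennreal (std_normal_density g) <= ennreal 1" by (intro ennreal_leI std_normal_density_le_1)
  then have "ennreal (std_normal_density g) * (npow (1/2) (a / b + g) * indicator {-1..1} (a / b + g)) <=
    1 * (npow (1/2) (a / b + g) * indicator {-1..1} (a / b + g))" by (intro mult_right_mono) simp_all
  then show "ennreal (std_normal_density g) * (npow (1/2) (a / b + g) * indicator {-1..1} (a / b + g)) <=
    npow (1/2) (a / b + g) * indicator {-1..1} (a / b + g)" by simp
 qed
 also have "... = C1"
  unfolding C1_def by (subst (2) nn_integral_real_affine[where c=1 and t="a / b"]) auto
 finally have 1: "(\<integral>\<^sup>+g. npow q (a / b + g) \<partial>N01) <= 1 + C1" by (simp add: add_left_mono)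
 have "(\<integral>\<^sup>+g. npow q (a + g * b) \<partial>N01) = (\<integral>\<^sup>+g. npow q (a / b + g) * npow q b \<partial>N01)"
  using b by (intro nn_integral_cong) (simp add: npow_mult[symmetric] distrib_right)
 also have "... = (\<integral>\<^sup>+g. npow q (a / b + g) \<partial>N01) * npow q b"
  by (rule nn_integral_multc) auto
 also have "... <= (1 + C1) * npow q b" by (intro mult_right_mono 1) simp
 finally show ?thesis .
qed

text \<open>Uniform in \<open>u\<close>. Near the zero of \<open>1 - g * u\<close> one has
  \<open>1/2 < \<bar>g * u\<bar>\<close>, so the density, at most \<open>1 / \<bar>g\<bar>\<close>,
  is below \<open>2 * \<bar>u\<bar>\<close>; this cancels the factor
  \<open>1 / \<bar>u\<bar>\<close> from the substitution. Elsewhere the integrand is at most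
  2.\<close>

lemma nn_integral_npow_root:
 "(\<integral>\<^sup>+g. npow (1/2) (1 - g * u) \<partial>N01) <= 2 + 2 * C1"
proof (cases "u = 0")
 case True
 then show ?thesis by (simp add: N01.emeasure_space_1[simplified] add_increasing2)
next
 case False
 have "npow (1/2) (1 - g * u) * ennreal (std_normal_density g) <=
   2 * ennreal (std_normal_density g) + ennreal (2 * \<bar>u\<bar>) * (npow (1/2) (1 - g * u) * indicator {-1..1} (1 - g * u))" for g
 proof (cases "\<bar>1 - g * u\<bar> < 1/2")
  case True
  have "1/2 < \<bar>g * u\<bar>" using True by linarith
  then have gu: "1/2 < \<bar>g\<bar> * \<bar>u\<bar>" by (simp only: abs_mult)
  then have g0: "g \<noteq> 0" by auto
  have "std_normal_density g * \<bar>g\<bar> <= 1 * (2 * (\<bar>g\<bar> * \<bar>u\<bar>))"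
   using std_normal_density_abs_le[of g] gu by linarith
  then have "std_normal_density g * \<bar>g\<bar> <= (2 * \<bar>u\<bar>) * \<bar>g\<bar>" by (simp add: mult_ac)
  then have le: "std_normal_density g <= 2 * \<bar>u\<bar>"
   by (rule mult_right_le_imp_le) (use g0 in simp)
  have ind: "indicator {-1..1} (1 - g * u) = (1::ennreal)" using True by (auto simp: indicator_def abs_if split: if_splits)
  have "npow (1/2) (1 - g * u) * ennreal (std_normal_density g) <= npow (1/2) (1 - g * u) * ennreal (2 * \<bar>u\<bar>)"
   by (intro mult_left_mono ennreal_leI le) simp
  also have "... = ennreal (2 * \<bar>u\<bar>) * (npow (1/2) (1 - g * u) * indicator {-1..1} (1 - g * u))"
   unfolding ind by (simp add: mult.commute)
  finally show ?thesis by (rule order_trans) (simp add: add_increasing)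
 next
  case False
  then have ge: "1/2 <= \<bar>1 - g * u\<bar>" by simp
  have "npow (1/2) (1 - g * u) <= npow (1/2) (1/4)"
   by (rule npow_antimono) (use ge in auto)
  also have "... = 2"
  proof -
   have "(1/4::real) powr (- (1/2)) = inverse (sqrt (1/4))" by (simp add: powr_minus powr_half_sqrt)
   also have "sqrt (1/4) = (1/2::real)" by (rule real_sqrt_unique) (auto simp: power2_eq_square)
   finally show ?thesis by (simp add: npow_def)
  qed
  finally have "npow (1/2) (1 - g * u) * ennreal (std_normal_density g) <= 2 * ennreal (std_normal_density g)"
   by (rule mult_right_mono) simp
  then show ?thesis by (rule order_trans) (simp add: add_increasing2)
 qed
 then have "(\<integral>\<^sup>+g. npow (1/2) (1 - g * u) \<partial>N01) <=
  (\<integral>\<^sup>+g. 2 * ennreal (std_normal_density g) + ennreal (2 * \<bar>u\<bar>) * (npow (1/2) (1 - g * u) * indicator {-1..1} (1 - g * u)) \<partial>lborel)"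
  by (subst nn_integral_N01, measurable) (intro nn_integral_mono, simp add: mult.commute)
 also have "... = (\<integral>\<^sup>+g. 2 * ennreal (std_normal_density g) \<partial>lborel) +
   (\<integral>\<^sup>+g. ennreal (2 * \<bar>u\<bar>) * (npow (1/2) (1 - g * u) * indicator {-1..1} (1 - g * u)) \<partial>lborel)"
  by (rule nn_integral_add) measurable
 also have "(\<integral>\<^sup>+g. 2 * ennreal (std_normal_density g) \<partial>lborel) = 2"
 proof -
  have "(\<integral>\<^sup>+g. ennreal (std_normal_density g) \<partial>lborel) = 1"
   using nn_integral_N01[of "%_. 1"] N01.emeasure_space_1 by simp
  then show ?thesis by (subst nn_integral_cmult) auto
 qed
 also have "(\<integral>\<^sup>+g. ennreal (2 * \<bar>u\<bar>) * (npow (1/2) (1 - g * u) * indicator {-1..1} (1 - g * u)) \<partial>lborel) = 2 * C1"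
 proof -
  have "C1 = ennreal \<bar>u\<bar> * (\<integral>\<^sup>+g. npow (1/2) (1 + (- u) * g) * indicator {-1..1} (1 + (- u) * g) \<partial>lborel)"
   unfolding C1_def using False by (subst nn_integral_real_affine[where c="- u" and t=1]) auto
  then have "2 * C1 = ennreal (2 * \<bar>u\<bar>) * (\<integral>\<^sup>+g. npow (1/2) (1 - g * u) * indicator {-1..1} (1 - g * u) \<partial>lborel)"
   by (simp add: ennreal_mult mult.assoc mult.commute[of u])
  also have "... = (\<integral>\<^sup>+g. ennreal (2 * \<bar>u\<bar>) * (npow (1/2) (1 - g * u) * indicator {-1..1} (1 - g * u)) \<partial>lborel)"
   by (rule nn_integral_cmult[symmetric]) measurable
  finally show ?thesis by simp
 qed
 finally show ?thesis .
qed

lemma mult_swap_mid: "(a * b) * (c * d) = (a * c) * (b * (d :: 'a::comm_semiring_1))"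
 by (simp only: mult_ac)

text \<open>Normalised at 0 and not by the leading coefficient, because the moments are compared
  with \<open>poly p 0\<close>; the \<open>w\<close> are the reciprocals of the roots.\<close>

lemma poly_factor:
 fixes p :: "complex poly"
 assumes "degree p <= k" "poly p 0 \<noteq> 0"
 shows "\<exists>ws. length ws <= k \<and> (\<forall>x. poly p x = poly p 0 * (\<Prod>w\<leftarrow>ws. 1 - x * w))"
 using assms
proof (induction k arbitrary: p)
 case 0
 then have "degree p = 0" by simp
 then obtain c where "p = [:c:]" by (rule degree_eq_zeroE)
 then show ?case by (intro exI[of _ "[]"]) simp
next
 case (Suc k)
 show ?case
 proof (cases "degree p = 0")
  case True
  then obtain c where "p = [:c:]" by (rule degree_eq_zeroE)
  then have "\<forall>x. poly p x = poly p 0 * (\<Prod>w\<leftarrow>[]. 1 - x * w)" by simp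
  moreover have "length ([] :: complex list) <= Suc k" by simp
  ultimately show ?thesis by (intro exI conjI)
 next
  case False
  then have "\<not> constant (poly p)" by (simp add: constant_degree)
  from fundamental_theorem_of_algebra[OF this] obtain z where z: "poly p z = 0" by (rule exE)
  then have z0: "z \<noteq> 0" using Suc.prems by auto
  have "[:-z, 1:] dvd p" using z by (simp only: poly_eq_0_iff_dvd)
  then obtain q where q: "p = [:-z, 1:] * q" by (rule dvdE)
  have pe: "poly p x = (x - z) * poly q x" for x unfolding q by (simp add: algebra_simps)
  have q0: "q \<noteq> 0" using pe[of 0] Suc.prems(2) by auto
  have "degree p = degree [:-z, 1:] + degree q" unfolding q by (rule degree_mult_eq) (simp_all add: q0)
  then have "degree q <= k" using Suc.prems by simp
  have "poly q 0 \<noteq> 0" using pe[of 0] Suc.prems(2) by auto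
  from Suc.IH[OF \<open>degree q <= k\<close> this] obtain ws where ws: "length ws <= k" "\<forall>x. poly q x = poly q 0 * (\<Prod>w\<leftarrow>ws. 1 - x * w)"
   by (elim exE conjE)
  have "poly p x = poly p 0 * (\<Prod>w\<leftarrow>(1 / z # ws). 1 - x * w)" for x
  proof -
   have xz: "x - z = (0 - z) * (1 - x * (1 / z))" using z0 by (simp add: field_simps)
   have "poly p x = ((0 - z) * (1 - x * (1 / z))) * (poly q 0 * (\<Prod>w\<leftarrow>ws. 1 - x * w))"
    unfolding pe[of x] ws(2)[rule_format, of x] xz ..
   also have "... = poly p 0 * (\<Prod>w\<leftarrow>(1 / z # ws). 1 - x * w)"
    unfolding pe[of 0] list.map prod_list.Cons by (rule mult_swap_mid)
   finally show ?thesis .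
  qed
  then have "\<forall>x. poly p x = poly p 0 * (\<Prod>w\<leftarrow>(1 / z # ws). 1 - x * w)" by (rule allI)
  moreover have "length (1 / z # ws) <= Suc k" using ws(1) by simp
  ultimately show ?thesis by (intro exI conjI)
 qed
qed

text \<open>A substitute for the Hoelder inequality: if \<open>m\<close>, at least 1, is the largest
  factor to the power 1/2, each factor is at most \<open>m powr (2 * t)\<close>, and the exponents
  add up to at most 1.\<close>

lemma prod_list_npow_le:
 assumes t: "0 <= t" and len: "real (length us) * t <= 1/2"
 shows "(\<Prod>u\<leftarrow>us. npow t u) <= 1 + (\<Sum>u\<leftarrow>us. npow (1/2) u)"
proof (cases "0 \<in> set us")
 case True
 then have "npow (1/2) 0 \<in> set (map (npow (1/2)) us)" by (metis image_eqI set_map)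
 then have "npow (1/2) 0 <= (\<Sum>u\<leftarrow>us. npow (1/2) u)" by (intro member_le_sum_list) auto
 then have "(\<Sum>u\<leftarrow>us. npow (1/2) u) = \<infinity>" by (simp add: npow_def top_unique)
 then show ?thesis by simp
next
 case False
 define m where "m = Max (insert 1 ((%u. \<bar>u\<bar> powr (- 1/2)) ` set us))"
 have m1: "1 <= m" unfolding m_def by (rule Max_ge) auto
 have m_ge: "\<bar>u\<bar> powr (- 1/2) <= m" if "u \<in> set us" for u
  unfolding m_def by (rule Max_ge) (use that in auto)
 have each: "npow t u <= ennreal (m powr (2 * t))" if u: "u \<in> set us" for u
 proof -
  have u0: "u \<noteq> 0" using u False by auto
  have "\<bar>u\<bar> powr (- t) = (\<bar>u\<bar> powr (- 1/2)) powr (2 * t)" by (simp add: powr_powr)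
  also have "... <= m powr (2 * t)" using m_ge[OF u] t by (intro powr_mono2) auto
  finally show ?thesis using u0 by (simp add: npow_def ennreal_leI)
 qed
 have "(\<Prod>u\<leftarrow>us'. npow t u) <= ennreal (m powr (real (length us') * (2 * t)))" if "set us' \<subseteq> set us" for us'
  using that
 proof (induction us')
  case (Cons u us')
  have "npow t u * (\<Prod>u\<leftarrow>us'. npow t u) <= ennreal (m powr (2 * t)) * ennreal (m powr (real (length us') * (2 * t)))"
   using Cons by (intro mult_mono each) auto
  also have "... = ennreal (m powr (real (length (u # us')) * (2 * t)))"
   by (simp add: ennreal_mult[symmetric] powr_add[symmetric] algebra_simps)
  finally show ?case by simp
 qed (use m1 in simp)
 from this[of us] have "(\<Prod>u\<leftarrow>us. npow t u) <= ennreal (m powr (real (length us) * (2 * t)))" by simp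
 also have "... <= ennreal (m powr 1)" using len m1 by (intro ennreal_leI powr_mono) auto
 also have "m powr 1 = m" using m1 by simp
 also have "ennreal m <= 1 + (\<Sum>u\<leftarrow>us. npow (1/2) u)"
 proof -
  have "m \<in> insert 1 ((%u. \<bar>u\<bar> powr (- 1/2)) ` set us)" unfolding m_def by (rule Max_in) auto
  then show ?thesis
  proof (elim insertE imageE)
   assume "m = 1" then show ?thesis by (simp add: add_increasing2)
  next
   fix u assume u: "m = \<bar>u\<bar> powr (- 1/2)" "u \<in> set us"
   then have "u \<noteq> 0" using False by auto
   then have "ennreal m = npow (1/2) u" using u by (simp add: npow_def)
   also have "... <= (\<Sum>u\<leftarrow>us. npow (1/2) u)"
    by (intro member_le_sum_list) (use u in auto)
   finally show ?thesis by (rule order_trans) (simp add: add_increasing)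
  qed
 qed
 finally show ?thesis .
qed

text \<open>For real \<open>g\<close> the modulus of \<open>1 - g * w\<close> is at least that of
  its real part, so complex roots reduce to real ones; the product over the roots is then dominated
  by a sum of terms treated in \<open>nn_integral_npow_root\<close>. Relative to
  \<open>poly p 0\<close> the bound depends on the degree only.\<close>

lemma nn_integral_npow_poly:
 fixes p :: "real poly"
 assumes deg: "degree p <= k" and t: "0 < t" "real k * t <= 1/2"
 shows "(\<integral>\<^sup>+g. npow t (poly p g) \<partial>N01) <= (1 + of_nat k * (2 + 2 * C1)) * npow t (poly p 0)"
proof (cases "poly p 0 = 0")
 case True
 have "(1 + of_nat k * (2 + 2 * C1)) \<noteq> 0" by (simp add: add_eq_0_iff_both_eq_0)
 then show ?thesis using True by (simp add: npow_def ennreal_mult_top)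
next
 case False
 define pc where "pc = (\<Sum>i\<le>degree p. monom (complex_of_real (coeff p i)) i)"
 have ev: "poly pc (complex_of_real x) = complex_of_real (poly p x)" for x
  unfolding pc_def poly_sum poly_monom poly_altdef[of p] by simp
 have "degree pc <= k"
  unfolding pc_def by (intro degree_sum_le order_trans[OF degree_monom_le]) (use deg in auto)
 moreover have "poly pc 0 \<noteq> 0" using ev[of 0] False by simp
 ultimately obtain ws where ws: "length ws <= k" "\<forall>x. poly pc x = poly pc 0 * (\<Prod>w\<leftarrow>ws. 1 - x * w)"
  using poly_factor by blast
 let ?us = "%g. map (%w. 1 - g * Re w) ws"
 have le: "npow t (poly p g) <= npow t (poly p 0) * (1 + (\<Sum>w\<leftarrow>ws. npow (1/2) (1 - g * Re w)))" for g
 proof -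
  have np: "cmod (\<Prod>w\<leftarrow>ws. 1 - complex_of_real g * w) = (\<Prod>w\<leftarrow>ws. cmod (1 - complex_of_real g * w))"
   by (induction ws) (simp_all add: norm_mult)
  have "\<bar>poly p g\<bar> = cmod (poly pc (complex_of_real g))" by (simp add: ev)
  also have "... = cmod (poly pc 0) * (\<Prod>w\<leftarrow>ws. cmod (1 - complex_of_real g * w))"
   by (subst ws(2)[rule_format]) (simp add: norm_mult np)
  also have "cmod (poly pc 0) = \<bar>poly p 0\<bar>" using ev[of 0] by simp
  finally have eq: "\<bar>poly p g\<bar> = \<bar>poly p 0\<bar> * (\<Prod>w\<leftarrow>ws. cmod (1 - complex_of_real g * w))" .
  have "(\<Prod>w\<leftarrow>ws. \<bar>1 - g * Re w\<bar>) <= (\<Prod>w\<leftarrow>ws. cmod (1 - complex_of_real g * w))"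
  proof (induction ws)
   case (Cons w ws)
   have "\<bar>1 - g * Re w\<bar> <= cmod (1 - complex_of_real g * w)"
    using abs_Re_le_cmod[of "1 - complex_of_real g * w"] by simp
   moreover have "0 <= (\<Prod>w\<leftarrow>ws. \<bar>1 - g * Re w\<bar>)" by (rule prod_list_nonneg) auto
   ultimately show ?case using Cons by (simp add: mult_mono)
  qed simp
  then have "\<bar>poly p 0\<bar> * (\<Prod>w\<leftarrow>ws. \<bar>1 - g * Re w\<bar>) <= \<bar>poly p g\<bar>" unfolding eq by (rule mult_left_mono) simp
  moreover have "(\<Prod>w\<leftarrow>ws. \<bar>1 - g * Re w\<bar>) = \<bar>\<Prod>w\<leftarrow>ws. 1 - g * Re w\<bar>"
   by (induction ws) (auto simp: abs_mult)
  ultimately have "\<bar>poly p 0 * (\<Prod>w\<leftarrow>ws. 1 - g * Re w)\<bar> <= \<bar>poly p g\<bar>" by (simp add: abs_mult)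
  then have "npow t (poly p g) <= npow t (poly p 0 * (\<Prod>w\<leftarrow>ws. 1 - g * Re w))"
   by (rule npow_antimono[OF t(1)])
  also have "... = npow t (poly p 0) * (\<Prod>u\<leftarrow>?us g. npow t u)"
  proof -
   have "npow t (\<Prod>w\<leftarrow>ws. 1 - g * Re w) = (\<Prod>u\<leftarrow>?us g. npow t u)"
    by (induction ws) (auto simp: npow_mult)
   then show ?thesis by (simp add: npow_mult)
  qed
  also have "(\<Prod>u\<leftarrow>?us g. npow t u) <= 1 + (\<Sum>u\<leftarrow>?us g. npow (1/2) u)"
  proof (rule prod_list_npow_le)
   have "real (length ws) * t <= real k * t" using ws(1) t(1) by (intro mult_right_mono) auto
   then show "real (length (?us g)) * t <= 1/2" unfolding length_map using t(2) by (rule order_trans)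
  qed (use t in simp)
  finally show ?thesis by (simp add: mult_left_mono o_def)
 qed
 have le0: "(\<integral>\<^sup>+g. npow t (poly p g) \<partial>N01) <= npow t (poly p 0) * (\<integral>\<^sup>+g. 1 + (\<Sum>w\<leftarrow>ws. npow (1/2) (1 - g * Re w)) \<partial>N01)"
 proof -
 have "(\<integral>\<^sup>+g. npow t (poly p g) \<partial>N01) <= (\<integral>\<^sup>+g. npow t (poly p 0) * (1 + (\<Sum>w\<leftarrow>ws. npow (1/2) (1 - g * Re w))) \<partial>N01)"
  by (intro nn_integral_mono le)
 also have "... = npow t (poly p 0) * (\<integral>\<^sup>+g. 1 + (\<Sum>w\<leftarrow>ws. npow (1/2) (1 - g * Re w)) \<partial>N01)"
  by (rule nn_integral_cmult) (simp add: sum_list_sum_nth)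
 finally show ?thesis .
 qed
 have A1: "(\<integral>\<^sup>+g. 1 + (\<Sum>w\<leftarrow>ws. npow (1/2) (1 - g * Re w)) \<partial>N01) = 1 + (\<integral>\<^sup>+g. (\<Sum>w\<leftarrow>ws. npow (1/2) (1 - g * Re w)) \<partial>N01)"
  by (subst nn_integral_add) (auto simp: N01.emeasure_space_1[simplified] sum_list_sum_nth)
 have A2: "(\<integral>\<^sup>+g. (\<Sum>w\<leftarrow>ws. npow (1/2) (1 - g * Re w)) \<partial>N01) <= of_nat (length ws) * (2 + 2 * C1)"
 proof (induction ws)
  case (Cons w ws)
  have "(\<integral>\<^sup>+g. (\<Sum>w\<leftarrow>(w # ws). npow (1/2) (1 - g * Re w)) \<partial>N01) =
    (\<integral>\<^sup>+g. npow (1/2) (1 - g * Re w) \<partial>N01) + (\<integral>\<^sup>+g. (\<Sum>w\<leftarrow>ws. npow (1/2) (1 - g * Re w)) \<partial>N01)"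
   by (simp only: list.map sum_list.Cons, subst nn_integral_add) (simp_all add: sum_list_sum_nth)
  also have "... <= (2 + 2 * C1) + of_nat (length ws) * (2 + 2 * C1)"
   by (intro add_mono nn_integral_npow_root Cons)
  also have "... = of_nat (length (w # ws)) * (2 + 2 * C1)" by (simp only: list.size of_nat_add of_nat_Suc of_nat_0 add_0_right distrib_right mult_1_left plus_1_eq_Suc add.commute)
  finally show ?case .
 qed simp
 have A3: "of_nat (length ws) * (2 + 2 * C1) <= of_nat k * (2 + 2 * C1)"
  using ws(1) by (intro mult_right_mono) auto
 have "npow t (poly p 0) * (\<integral>\<^sup>+g. 1 + (\<Sum>w\<leftarrow>ws. npow (1/2) (1 - g * Re w)) \<partial>N01) <= npow t (poly p 0) * (1 + of_nat k * (2 + 2 * C1))"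
  unfolding A1 by (intro mult_left_mono add_left_mono order_trans[OF A2 A3]) simp
 from order_trans[OF le0 this] show ?thesis by (simp only: mult.commute)
qed

section \<open>Rotation invariance and iterated Gaussian integrals of determinants\<close>

type_synonym mvec = "nat \<times> nat => real"

abbreviation VM :: "mvec measure" where "VM \<equiv> \<Pi>\<^sub>M p\<in>UNIV. borel"

lemma shear_invariance:
 assumes [measurable]: "case_prod K \<in> borel_measurable (borel \<Otimes>\<^sub>M borel :: (real \<times> real) measure)"
 shows "(\<integral>\<^sup>+y. \<integral>\<^sup>+x. K (x + a * y) y \<partial>lborel \<partial>lborel) = (\<integral>\<^sup>+y. \<integral>\<^sup>+x. K x y \<partial>lborel \<partial>lborel)"
proof (rule nn_integral_cong)
 fix y :: real
 have "(%x. K x y) \<in> borel_measurable borel" by measurable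
 then show "(\<integral>\<^sup>+x. K (x + a * y) y \<partial>lborel) = (\<integral>\<^sup>+x. K x y \<partial>lborel)"
  by (subst (2) nn_integral_real_affine[where c=1 and t="a * y"]) (auto simp: add.commute)
qed

lemma lborel_swap:
 assumes [measurable]: "case_prod K \<in> borel_measurable (borel \<Otimes>\<^sub>M borel :: (real \<times> real) measure)"
 shows "(\<integral>\<^sup>+y. \<integral>\<^sup>+x. K x y \<partial>lborel \<partial>lborel) = (\<integral>\<^sup>+x. \<integral>\<^sup>+y. K x y \<partial>lborel \<partial>lborel)"
 by (rule lborel_pair.Fubini') (use assms in \<open>simp add: split_def\<close>)

text \<open>A rotation is a product of three shears.\<close>

lemma rotation_invariance_lborel:
 assumes K: "case_prod K \<in> borel_measurable (borel \<Otimes>\<^sub>M borel :: (real \<times> real) measure)"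
  and cs: "c\<^sup>2 + s\<^sup>2 = 1" "s \<noteq> 0"
 shows "(\<integral>\<^sup>+y. \<integral>\<^sup>+x. K (c * x - s * y) (s * x + c * y) \<partial>lborel \<partial>lborel) = (\<integral>\<^sup>+y. \<integral>\<^sup>+x. K x y \<partial>lborel \<partial>lborel)"
proof -
 note [measurable] = K
 define t where "t = (1 - c) / s"
 define K1 where "K1 x y = K (x + (- t) * y) y" for x y
 define K2 where "K2 x y = K1 x (y + s * x)" for x y
 have [measurable]: "case_prod K1 \<in> borel_measurable (borel \<Otimes>\<^sub>M borel)"
  unfolding K1_def split_def by measurable
 have [measurable]: "case_prod K2 \<in> borel_measurable (borel \<Otimes>\<^sub>M borel)"
  unfolding K2_def split_def by measurable
 have st: "1 - s * t = c" using cs(2) by (simp add: t_def)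
 have t1: "t * (1 + c) = s"
 proof -
  have "(1 - c) * (1 + c) = s * s" using cs(1) by (simp add: power2_eq_square algebra_simps)
  then show ?thesis using cs(2) by (simp add: t_def)
 qed
 have K2_rot: "K2 (x + (- t) * y) y = K (c * x - s * y) (s * x + c * y)" for x y
 proof -
  have y1: "y + s * (x + (- t) * y) = s * x + c * y"
  proof -
   have "y + s * (x + (- t) * y) = s * x + (1 - s * t) * y" by (simp add: algebra_simps)
   then show ?thesis using st by simp
  qed
  have "(x + (- t) * y) + (- t) * (s * x + c * y) = x * (1 - s * t) - y * (t * (1 + c))" by (simp add: algebra_simps)
  then have x1: "(x + (- t) * y) + (- t) * (s * x + c * y) = c * x - s * y" using st t1 by (simp add: mult.commute)
  show ?thesis unfolding K2_def K1_def y1 x1 ..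
 qed
 have "(\<integral>\<^sup>+y. \<integral>\<^sup>+x. K (c * x - s * y) (s * x + c * y) \<partial>lborel \<partial>lborel) = (\<integral>\<^sup>+y. \<integral>\<^sup>+x. K2 (x + (- t) * y) y \<partial>lborel \<partial>lborel)"
  unfolding K2_rot ..
 also have "... = (\<integral>\<^sup>+y. \<integral>\<^sup>+x. K2 x y \<partial>lborel \<partial>lborel)" by (rule shear_invariance[of K2 "- t"]) measurable
 also have "... = (\<integral>\<^sup>+x. \<integral>\<^sup>+y. K2 x y \<partial>lborel \<partial>lborel)" by (rule lborel_swap[of K2]) measurable
 also have "... = (\<integral>\<^sup>+x. \<integral>\<^sup>+y. K1 x (y + s * x) \<partial>lborel \<partial>lborel)" unfolding K2_def ..
 also have "... = (\<integral>\<^sup>+x. \<integral>\<^sup>+y. K1 x y \<partial>lborel \<partial>lborel)"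
  by (rule shear_invariance[of "%y x. K1 x y" s]) (simp add: split_def, measurable)
 also have "... = (\<integral>\<^sup>+y. \<integral>\<^sup>+x. K1 x y \<partial>lborel \<partial>lborel)" by (rule lborel_swap[of K1, symmetric]) measurable
 also have "... = (\<integral>\<^sup>+y. \<integral>\<^sup>+x. K x y \<partial>lborel \<partial>lborel)" unfolding K1_def by (rule shear_invariance[of K "- t"]) measurable
 finally show ?thesis .
qed

lemma rotation_invariance_N01:
 assumes K: "case_prod K \<in> borel_measurable (borel \<Otimes>\<^sub>M borel :: (real \<times> real) measure)"
  and cs: "c\<^sup>2 + s\<^sup>2 = 1" "s \<noteq> 0"
 shows "(\<integral>\<^sup>+y. \<integral>\<^sup>+x. K (c * x - s * y) (s * x + c * y) \<partial>N01 \<partial>N01) = (\<integral>\<^sup>+y. \<integral>\<^sup>+x. K x y \<partial>N01 \<partial>N01)"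
proof -
 note [measurable] = K
 define r where "r x y = ennreal (std_normal_density y) * (ennreal (std_normal_density x) * K x y)" for x y
 have [measurable]: "case_prod r \<in> borel_measurable (borel \<Otimes>\<^sub>M borel)"
  unfolding r_def split_def by measurable
 have int: "(\<integral>\<^sup>+y. \<integral>\<^sup>+x. L x y \<partial>N01 \<partial>N01) =
   (\<integral>\<^sup>+y. \<integral>\<^sup>+x. ennreal (std_normal_density y) * (ennreal (std_normal_density x) * L x y) \<partial>lborel \<partial>lborel)"
  if [measurable]: "case_prod L \<in> borel_measurable (borel \<Otimes>\<^sub>M borel)" for L :: "real => real => ennreal"
 proof -
  have "(\<integral>\<^sup>+y. \<integral>\<^sup>+x. L x y \<partial>N01 \<partial>N01) = (\<integral>\<^sup>+y. \<integral>\<^sup>+x. ennreal (std_normal_density x) * L x y \<partial>lborel \<partial>N01)"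
   by (intro nn_integral_cong nn_integral_N01) measurable
  also have "... = (\<integral>\<^sup>+y. ennreal (std_normal_density y) * (\<integral>\<^sup>+x. ennreal (std_normal_density x) * L x y \<partial>lborel) \<partial>lborel)"
   by (rule nn_integral_N01) measurable
  also have "... = (\<integral>\<^sup>+y. \<integral>\<^sup>+x. ennreal (std_normal_density y) * (ennreal (std_normal_density x) * L x y) \<partial>lborel \<partial>lborel)"
   by (intro nn_integral_cong nn_integral_cmult[symmetric]) measurable
  finally show ?thesis .
 qed
 have dens: "ennreal (std_normal_density y) * ennreal (std_normal_density x) =
   ennreal (std_normal_density (s * x + c * y)) * ennreal (std_normal_density (c * x - s * y))" for x y
 proof -
  have "(s * x + c * y)\<^sup>2 + (c * x - s * y)\<^sup>2 = (c\<^sup>2 + s\<^sup>2) * (x\<^sup>2 + y\<^sup>2)"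
   by (simp add: power2_eq_square algebra_simps)
  then have "y\<^sup>2 + x\<^sup>2 = (s * x + c * y)\<^sup>2 + (c * x - s * y)\<^sup>2" using cs(1) by simp
  then have "exp (- y\<^sup>2 / 2) * exp (- x\<^sup>2 / 2) = exp (- (s * x + c * y)\<^sup>2 / 2) * exp (- (c * x - s * y)\<^sup>2 / 2)"
   unfolding exp_add[symmetric] by (simp add: add_divide_distrib[symmetric])
  then have "std_normal_density y * std_normal_density x = std_normal_density (s * x + c * y) * std_normal_density (c * x - s * y)"
   unfolding normal_density_def by simp
  then show ?thesis by (simp add: ennreal_mult[symmetric])
 qed
 have "(\<integral>\<^sup>+y. \<integral>\<^sup>+x. K (c * x - s * y) (s * x + c * y) \<partial>N01 \<partial>N01) = (\<integral>\<^sup>+y. \<integral>\<^sup>+x. r (c * x - s * y) (s * x + c * y) \<partial>lborel \<partial>lborel)"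
 proof -
  have "(\<integral>\<^sup>+y. \<integral>\<^sup>+x. K (c * x - s * y) (s * x + c * y) \<partial>N01 \<partial>N01) =
   (\<integral>\<^sup>+y. \<integral>\<^sup>+x. ennreal (std_normal_density y) * (ennreal (std_normal_density x) * K (c * x - s * y) (s * x + c * y)) \<partial>lborel \<partial>lborel)"
   by (rule int[of "%x y. K (c * x - s * y) (s * x + c * y)"]) (simp add: split_def, measurable)
  also have "... = (\<integral>\<^sup>+y. \<integral>\<^sup>+x. r (c * x - s * y) (s * x + c * y) \<partial>lborel \<partial>lborel)"
  proof (intro nn_integral_cong)
   fix x y :: real
   show "ennreal (std_normal_density y) * (ennreal (std_normal_density x) * K (c * x - s * y) (s * x + c * y)) = r (c * x - s * y) (s * x + c * y)"
    unfolding r_def mult.assoc[symmetric] by (rule arg_cong2[where f="(*)", OF dens refl])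
  qed
  finally show ?thesis .
 qed
 also have "... = (\<integral>\<^sup>+y. \<integral>\<^sup>+x. r x y \<partial>lborel \<partial>lborel)" by (rule rotation_invariance_lborel[of r, OF _ cs]) measurable
 also have "... = (\<integral>\<^sup>+y. \<integral>\<^sup>+x. K x y \<partial>N01 \<partial>N01)" unfolding r_def by (rule int[OF K, symmetric])
 finally show ?thesis .
qed

text \<open>\<open>gint Cs F x\<close> is the expectation of \<open>F\<close> at \<open>x\<close> plus the combination of the \<open>Cs\<close> with
 independent standard normal coefficients.\<close>

fun gint :: "mvec list => (mvec => ennreal) => mvec => ennreal" where
 "gint [] F x = F x"
| "gint (C # Cs) F x = (\<integral>\<^sup>+g. gint Cs F (%p. x p + g * C p) \<partial>N01)"

lemma shift_measurable:
 "(%(x, g). (%p. x p + g * C p)) \<in> VM \<Otimes>\<^sub>M borel \<rightarrow>\<^sub>M VM" for C :: mvec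
 by (rule measurable_PiM_single') (auto simp: split_def)

lemma gint_measurable: "F \<in> borel_measurable VM ==> gint Cs F \<in> borel_measurable VM"
proof (induction Cs)
 case (Cons C Cs)
 have "(%(x, g). gint Cs F (%p. x p + g * C p)) \<in> borel_measurable (VM \<Otimes>\<^sub>M borel)"
  using measurable_compose[OF shift_measurable[of C] Cons.IH[OF Cons.prems]] by (simp add: split_def)
 then have "(%(x, g). gint Cs F (%p. x p + g * C p)) \<in> borel_measurable (VM \<Otimes>\<^sub>M N01)"
  by (simp cong: measurable_cong_sets add: sets_pair_measure_cong[OF refl sets_N01])
 from N01.borel_measurable_nn_integral[OF this] show ?case
  by (simp add: fun_eq_iff[abs_def])
qed (simp add: gint.simps[abs_def])

lemma gint_mono: "(\<And>x. F x <= G x) ==> gint Cs F x <= gint Cs G x"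
 by (induction Cs arbitrary: x) (auto intro: nn_integral_mono)

lemma gint_append: "gint (Cs @ Ds) F = gint Cs (gint Ds F)"
proof (rule ext)
 show "gint (Cs @ Ds) F x = gint Cs (gint Ds F) x" for x
  by (induction Cs arbitrary: x) auto
qed

lemma gint_le_const: "(\<And>x. F x <= K) ==> gint Cs F x <= K"
proof (induction Cs arbitrary: x)
 case (Cons C Cs)
 have "gint (C # Cs) F x <= (\<integral>\<^sup>+g. K \<partial>N01)"
  unfolding gint.simps by (intro nn_integral_mono Cons)
 also have "... = K" using N01.emeasure_space_1 by simp
 finally show ?case .
qed simp

text \<open>Rotating a pair of independent standard normals amounts to rotating the two directions
  they multiply.\<close>

lemma gint_rotate:
 assumes F: "F \<in> borel_measurable VM" and cs: "c\<^sup>2 + s\<^sup>2 = 1" "s \<noteq> 0"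
 shows "gint (C # D # Cs) F x = gint ((%p. c * C p + s * D p) # (%p. c * D p - s * C p) # Cs) F x"
proof -
 let ?G = "gint Cs F"
 define K where "K g h = ?G (%p. (x p + h * C p) + g * D p)" for g h
 have Gm: "?G \<in> borel_measurable VM" by (rule gint_measurable[OF F])
 have "(%z. (%p. (x p + snd z * C p) + fst z * D p)) \<in> (borel \<Otimes>\<^sub>M borel) \<rightarrow>\<^sub>M VM"
  by (rule measurable_PiM_single') auto
 from measurable_compose[OF this Gm]
 have Km: "case_prod K \<in> borel_measurable (borel \<Otimes>\<^sub>M borel)" by (simp add: K_def split_def)
 have cs': "c\<^sup>2 + (- s)\<^sup>2 = 1" "- s \<noteq> 0" using cs by auto
 have "gint (C # D # Cs) F x = (\<integral>\<^sup>+h. \<integral>\<^sup>+g. K g h \<partial>N01 \<partial>N01)"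
  by (simp add: K_def)
 also have "... = (\<integral>\<^sup>+h. \<integral>\<^sup>+g. K (c * g - (- s) * h) ((- s) * g + c * h) \<partial>N01 \<partial>N01)"
  by (rule rotation_invariance_N01[OF Km cs', symmetric])
 also have "... = gint ((%p. c * C p + s * D p) # (%p. c * D p - s * C p) # Cs) F x"
 proof -
  have "(%p. (x p + ((- s) * g + c * h) * C p) + (c * g - (- s) * h) * D p) =
    (%p. (x p + h * (c * C p + s * D p)) + g * (c * D p - s * C p))" for g h
   by (rule ext) (simp add: algebra_simps)
  then show ?thesis by (simp only: gint.simps K_def)
 qed
 finally show ?thesis .
qed

lemma gint_cong_tail:
 assumes "\<And>y. gint Cs F y = gint Ds F y"
 shows "gint (C # Cs) F x = gint (C # Ds) F x"
 by (simp only: gint.simps assms)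

lemma ball_set_Cons: "(\<forall>E\<in>set (D # Ds). Q E) \<longleftrightarrow> Q D \<and> (\<forall>E\<in>set Ds. Q E)"
 by simp

text \<open>Givens rotations move the coordinate \<open>p\<close> of all directions into the first
  one. The last clause records that coordinates already eliminated everywhere stay
  eliminated.\<close>

lemma gint_reduce:
 assumes F: "F \<in> borel_measurable VM"
 shows "\<exists>D Ds. (\<forall>x. gint (C # Cs) F x = gint (D # Ds) F x) \<and> (\<forall>E\<in>set Ds. E p = 0) \<and>
  (\<forall>q. (\<forall>E\<in>set (C # Cs). E q = 0) --> (\<forall>E\<in>set (D # Ds). E q = 0))"
proof (induction Cs arbitrary: C)
 case Nil
 then show ?case by (intro exI[of _ C] exI[of _ "[]"]) simp
next
 case (Cons C2 Cs)
 from Cons[of C2] obtain D Ds where D: "\<forall>x. gint (C2 # Cs) F x = gint (D # Ds) F x" "\<forall>E\<in>set Ds. E p = 0"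
  "\<forall>q. (\<forall>E\<in>set (C2 # Cs). E q = 0) --> (\<forall>E\<in>set (D # Ds). E q = 0)" by (elim exE conjE)
 have eq: "gint (C # C2 # Cs) F x = gint (C # D # Ds) F x" for x
  by (rule gint_cong_tail) (rule D(1)[rule_format])
 show ?case
 proof (cases "D p = 0")
  case True
  show ?thesis
  proof (intro exI[of _ C] exI[of _ "D # Ds"] conjI allI impI)
   show "gint (C # C2 # Cs) F x = gint (C # D # Ds) F x" for x by (rule eq)
   show "\<forall>E\<in>set (D # Ds). E p = 0" using True D(2) by simp
   show "\<forall>E\<in>set (C # D # Ds). E q = 0" if "\<forall>E\<in>set (C # C2 # Cs). E q = 0" for q
   proof -
    have c: "C q = 0" and d: "\<forall>E\<in>set (C2 # Cs). E q = 0" using that by (meson list.set_intros)+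
    have "\<forall>E\<in>set (D # Ds). E q = 0" by (rule D(3)[THEN spec, THEN mp, OF d])
    with c show ?thesis unfolding ball_set_Cons by (intro conjI) (elim conjE, assumption)+
   qed
  qed
 next
  case False
  define r where "r = sqrt ((C p)\<^sup>2 + (D p)\<^sup>2)"
  have r: "r\<^sup>2 = (C p)\<^sup>2 + (D p)\<^sup>2" "r \<noteq> 0" using False by (simp_all add: r_def add_nonneg_eq_0_iff)
  \<comment> \<open>Chosen so that the rotated second direction \<open>c * D p - s * C p\<close>
    vanishes at \<open>p\<close>.\<close>
  define c s where "c = C p / r" and "s = D p / r"
  have cs: "c\<^sup>2 + s\<^sup>2 = 1" "s \<noteq> 0"
   using r False by (simp_all add: c_def s_def power_divide add_divide_distrib[symmetric])
  show ?thesis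
  proof (intro exI[of _ "%p. c * C p + s * D p"] exI[of _ "(%p. c * D p - s * C p) # Ds"] conjI allI impI)
   show "gint (C # C2 # Cs) F x = gint ((%p. c * C p + s * D p) # (%p. c * D p - s * C p) # Ds) F x" for x
    unfolding eq by (rule gint_rotate[OF F cs])
   show "\<forall>E\<in>set ((%p. c * D p - s * C p) # Ds). E p = 0" using D(2) by (simp add: c_def s_def)
   show "\<forall>E\<in>set ((%p. c * C p + s * D p) # (%p. c * D p - s * C p) # Ds). E q = 0"
    if "\<forall>E\<in>set (C # C2 # Cs). E q = 0" for q
   proof -
    have Cq: "C q = 0" and "\<forall>E\<in>set (C2 # Cs). E q = 0" using that by (meson list.set_intros)+
    then have D: "\<forall>E\<in>set (D # Ds). E q = 0" by (intro D(3)[THEN spec, THEN mp, of q])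
    then have Dq: "D q = 0" by (meson list.set_intros)
    have 1: "c * C q + s * D q = 0" "c * D q - s * C q = 0" unfolding Cq Dq by simp_all
    from D show ?thesis unfolding ball_set_Cons by (elim conjE) (intro conjI 1)
   qed
  qed
 qed
qed

lemma gint_invariant:
 assumes dep: "\<And>x y. (\<And>p. p \<in> Q ==> x p = y p) ==> F x = F y" and van: "\<And>E p. E \<in> set Cs ==> p \<in> Q ==> E p = 0"
 shows "gint Cs F x = F x"
 using van
proof (induction Cs arbitrary: x)
 case (Cons C Cs)
 have "gint Cs F (%p. x p + g * C p) = F x" for g
 proof -
  have "gint Cs F (%p. x p + g * C p) = F (%p. x p + g * C p)" by (rule Cons.IH) (use Cons.prems in simp)
  also have "... = F x" by (rule dep) (use Cons.prems in simp)
  finally show ?thesis .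
 qed
 then show ?case using N01.emeasure_space_1 by simp
qed simp

text \<open>After \<open>gint_reduce\<close> a single direction carries the coordinate
  \<open>p\<close>, so the one-dimensional bound is spent once per coordinate that \<open>F\<close>
  reads. The exponent \<open>length ps\<close> is therefore independent of the number of directions,
  which allows infinitely many noise entries in the limit.\<close>

lemma gint_bound:
 assumes F: "F \<in> borel_measurable VM" and K: "1 <= K"
  and one: "\<And>x C. (\<integral>\<^sup>+g. F (%p. x p + g * C p) \<partial>N01) <= K * F x"
  and dep: "\<And>x y. (\<And>p. p \<in> Q \<union> set ps ==> x p = y p) ==> F x = F y"
  and van: "\<And>E p. E \<in> set Cs ==> p \<in> Q ==> E p = 0"
 shows "gint Cs F x <= K ^ length ps * F x"
 using dep van
proof (induction ps arbitrary: Q Cs x)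
 case Nil
 have "gint Cs F x = F x"
 proof (rule gint_invariant[of Q])
  show "F x = F y" if "\<And>p. p \<in> Q ==> x p = y p" for x y by (rule Nil.prems(1)) (use that in simp)
 qed (rule Nil.prems(2))
 then show ?case by simp
next
 case (Cons p ps)
 show ?case
 proof (cases Cs)
  case Nil
  have "1 * F x <= K ^ length (p # ps) * F x" by (intro mult_right_mono one_le_power K) simp
  then show ?thesis using Nil by simp
 next
  case C: (Cons C Cs')
  obtain D Ds where D: "\<forall>x. gint (C # Cs') F x = gint (D # Ds) F x" "\<forall>E\<in>set Ds. E p = 0"
   "\<forall>q. (\<forall>E\<in>set (C # Cs'). E q = 0) --> (\<forall>E\<in>set (D # Ds). E q = 0)"
   using gint_reduce[OF F, of C Cs' p] by (elim exE conjE)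
  have IH: "gint Ds F y <= K ^ length ps * F y" for y
  proof (rule Cons.IH[of "insert p Q"])
   show "F x = F y" if "\<And>q. q \<in> insert p Q \<union> set ps ==> x q = y q" for x y
    by (rule Cons.prems(1)) (use that in simp)
   fix E q assume E: "E \<in> set Ds" "q \<in> insert p Q"
   show "E q = 0"
   proof (cases "q = p")
    case True then show ?thesis using D(2) E by simp
   next
    case False
    then have "\<forall>E\<in>set (C # Cs'). E q = 0" using Cons.prems(2) C E by simp
    then have "\<forall>E\<in>set (D # Ds). E q = 0" by (rule D(3)[THEN spec, THEN mp])
    then show ?thesis using E by simp
   qed
  qed
  have Fm: "(%g. F (%p. x p + g * D p)) \<in> borel_measurable N01"
  proof -
   have "(%g. (%p. x p + g * D p)) \<in> N01 \<rightarrow>\<^sub>M VM" by (rule measurable_PiM_single') auto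
   then show ?thesis using F by (rule measurable_compose)
  qed
  have "gint Cs F x = (\<integral>\<^sup>+g. gint Ds F (%p. x p + g * D p) \<partial>N01)" using D(1) C by simp
  also have "... <= (\<integral>\<^sup>+g. K ^ length ps * F (%p. x p + g * D p) \<partial>N01)" by (intro nn_integral_mono IH)
  also have "... = K ^ length ps * (\<integral>\<^sup>+g. F (%p. x p + g * D p) \<partial>N01)" by (rule nn_integral_cmult[OF Fm])
  also have "... <= K ^ length ps * (K * F x)" by (intro mult_left_mono one) simp
  finally show ?thesis by (simp add: mult_ac)
 qed
qed

definition dtv :: "nat => mvec => real" where "dtv k x = dt k (%i j. x (i, j))"

lemma dtv_measurable [measurable]: "dtv k \<in> borel_measurable VM"
 unfolding dtv_def[abs_def] by (rule dt_measurable) simp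

lemma dtv_affine_poly: "\<exists>p. degree p <= k \<and> (\<forall>g. poly p g = dtv k (%q. x q + g * C q))"
proof -
 define p where "p = dt k (%i j. [:x (i, j), C (i, j):])"
 have "poly p g = dtv k (%q. x q + g * C q)" for g
 proof -
  have "poly (of_int (sign \<pi>) * (\<Prod>i = 0..<k. [:x (i, \<pi> i), C (i, \<pi> i):])) g = of_int (sign \<pi>) * (\<Prod>i = 0..<k. x (i, \<pi> i) + g * C (i, \<pi> i))" for \<pi> :: "nat => nat"
   by (simp only: poly_mult poly_of_int poly_prod poly_pCons poly_0 mult_zero_right add_0_right)
  then show ?thesis unfolding p_def dtv_def dt_leibniz by (simp only: poly_sum)
 qed
 moreover have "degree p <= k"
  unfolding p_def dt_leibniz
 proof (rule degree_sum_le)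
  fix \<pi> assume "\<pi> \<in> {\<pi>. \<pi> permutes {0..<k}}"
  have "degree (of_int (sign \<pi>) * (\<Prod>i = 0..<k. [:x (i, \<pi> i), C (i, \<pi> i):])) <=
    degree (of_int (sign \<pi>) :: real poly) + degree (\<Prod>i = 0..<k. [:x (i, \<pi> i), C (i, \<pi> i):])"
   by (rule degree_mult_le)
  also have "degree (of_int (sign \<pi>) :: real poly) = 0" by (simp add: of_int_poly)
  also have "degree (\<Prod>i = 0..<k. [:x (i, \<pi> i), C (i, \<pi> i):]) <= (\<Sum>i = 0..<k. degree [:x (i, \<pi> i), C (i, \<pi> i):])"
   using degree_prod_sum_le[of "{0..<k}" "%i. [:x (i, \<pi> i), C (i, \<pi> i):]"] by (simp add: o_def)
  also have "... <= (\<Sum>i = 0..<k. 1)" by (rule sum_mono) simp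
  finally show "degree (of_int (sign \<pi>) * (\<Prod>i = 0..<k. [:x (i, \<pi> i), C (i, \<pi> i):])) <= k" by simp
 qed (simp add: finite_permutations)
 ultimately show ?thesis by blast
qed

text \<open>One factor for each of the \<open>k * k\<close> coordinates that the determinant
  reads.\<close>

definition Knm :: "nat => ennreal" where "Knm k = (1 + of_nat k * (2 + 2 * C1)) ^ (k * k)"

lemma Knm_finite: "Knm k < \<infinity>"
 using C1_finite by (simp add: Knm_def ennreal_mult_less_top ennreal_add_less_top power_less_top_ennreal of_nat_less_top)

lemma gint_npow_dt:
 assumes t: "0 < t" "real k * t <= 1/2"
 shows "gint Cs (%x. npow t (dtv k x)) x <= Knm k * npow t (dtv k x)"
proof -
 let ?ps = "List.product [0..<k] [0..<k]"
 have "gint Cs (%x. npow t (dtv k x)) x <= (1 + of_nat k * (2 + 2 * C1)) ^ length ?ps * npow t (dtv k x)"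
 proof (rule gint_bound[where Q="{}"])
  show "(%x. npow t (dtv k x)) \<in> borel_measurable VM" by measurable
  show "(1::ennreal) <= 1 + of_nat k * (2 + 2 * C1)" by simp
  show "(\<integral>\<^sup>+g. npow t (dtv k (%p. x p + g * C p)) \<partial>N01) <= (1 + of_nat k * (2 + 2 * C1)) * npow t (dtv k x)" for x C
  proof -
   obtain p where p: "degree p <= k" "\<forall>g. poly p g = dtv k (%q. x q + g * C q)"
    using dtv_affine_poly[of k x C] by (elim exE conjE)
   show ?thesis using nn_integral_npow_poly[OF p(1) t] by (simp add: p(2))
  qed
  show "npow t (dtv k x) = npow t (dtv k y)" if "\<And>p. p \<in> {} \<union> set ?ps ==> x p = y p" for x y
   unfolding dtv_def by (rule arg_cong[where f="npow t"], rule dt_cong) (use that in simp)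
 qed simp
 then show ?thesis by (simp add: Knm_def)
qed

text \<open>The last diagonal direction is integrated first: by \<open>dt_add_last_diag\<close> the
  determinant is affine in it with slope \<open>s k\<close> times the smaller determinant, to which
  the induction applies. The bound does not depend on \<open>x\<close>.\<close>

lemma gint_npow_diag:
 assumes t: "0 <= t" "t <= 1/2" and s: "\<And>c. c < k ==> s c \<noteq> 0"
 shows "gint (map (%c (i, j). if i = c \<and> j = c then s c else 0) [0..<k]) (%x. npow t (dtv k x)) x
  <= (1 + C1) ^ k * npow t (\<Prod>c<k. s c)"
 using s
proof (induction k)
 case 0
 then show ?case by (simp add: dtv_def)
next
 case (Suc k)
 let ?E = "%c (i, j). if i = c \<and> j = c then s c else (0::real)"
 have inner: "(\<integral>\<^sup>+g. npow t (dtv (Suc k) (%p. y p + g * ?E k p)) \<partial>N01) <= (1 + C1) * (npow t (s k) * npow t (dtv k y))" for y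
 proof (cases "dtv k y = 0")
  case True
  then show ?thesis by (auto simp: npow_def ennreal_mult_top add_eq_0_iff_both_eq_0)
 next
  case False
  have "dtv (Suc k) (%p. y p + g * ?E k p) = dtv (Suc k) y + g * (s k * dtv k y)" for g
  proof -
   have "dtv (Suc k) (%p. y p + g * ?E k p) = dt (Suc k) (%i j. y (i, j) + (if i = k \<and> j = k then g * s k else 0))"
    unfolding dtv_def by (rule dt_cong) auto
   then show ?thesis unfolding dt_add_last_diag by (simp add: dtv_def mult.assoc)
  qed
  then have "(\<integral>\<^sup>+g. npow t (dtv (Suc k) (%p. y p + g * ?E k p)) \<partial>N01) = (\<integral>\<^sup>+g. npow t (dtv (Suc k) y + g * (s k * dtv k y)) \<partial>N01)"
   by simp
  also have "... <= (1 + C1) * npow t (s k * dtv k y)"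
   by (rule nn_integral_npow_affine) (use t False Suc.prems in auto)
  finally show ?thesis by (simp add: npow_mult)
 qed
 have scale: "gint Cs (%y. a * F y) x = a * gint Cs F x" if "F \<in> borel_measurable VM" for Cs F x and a :: ennreal
 proof (induction Cs arbitrary: x)
  case (Cons C Cs)
  have "(%g. gint Cs F (%p. x p + g * C p)) \<in> borel_measurable N01"
  proof -
   have "(%g. (%p. x p + g * C p)) \<in> N01 \<rightarrow>\<^sub>M VM" by (rule measurable_PiM_single') auto
   then show ?thesis using gint_measurable[OF that] by (rule measurable_compose)
  qed
  then show ?case by (simp add: Cons nn_integral_cmult)
 qed simp
 have "gint (map ?E [0..<Suc k]) (%x. npow t (dtv (Suc k) x)) x = gint (map ?E [0..<k]) (gint [?E k] (%x. npow t (dtv (Suc k) x))) x"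
  by (simp add: gint_append)
 also have "... <= gint (map ?E [0..<k]) (%y. ((1 + C1) * npow t (s k)) * npow t (dtv k y)) x"
  by (rule gint_mono) (use inner in \<open>simp add: mult.assoc\<close>)
 also have "... = ((1 + C1) * npow t (s k)) * gint (map ?E [0..<k]) (%y. npow t (dtv k y)) x"
  by (rule scale) measurable
 also have "... <= ((1 + C1) * npow t (s k)) * ((1 + C1) ^ k * npow t (\<Prod>c<k. s c))"
  by (intro mult_left_mono Suc) (use Suc.prems in auto)
 also have "... = (1 + C1) ^ Suc k * npow t (\<Prod>c<Suc k. s c)"
  by (simp add: npow_mult mult_ac)
 finally show ?case .
qed

lemma dt_inverse:
 fixes L :: "nat => nat => real"
 assumes "dt k L \<noteq> 0"
 shows "\<exists>J. (\<forall>i<k. \<forall>j<k. (\<Sum>l<k. L i l * J l j) = (if i = j then 1 else 0)) \<and>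
   (\<forall>i<k. \<forall>j<k. (\<Sum>l<k. J i l * L l j) = (if i = j then 1 else 0))"
proof -
 let ?A = "mat k k (%(i, j). L i j)"
 have "?A \<in> Units (ring_mat TYPE(real) k ())"
  by (rule det_non_zero_imp_unit) (use assms in \<open>auto simp: dt_def\<close>)
 then obtain B where B: "B \<in> carrier_mat k k" "B * ?A = 1\<^sub>m k" "?A * B = 1\<^sub>m k"
  unfolding Units_def by (auto simp: ring_mat_def)
 have sp: "(\<Sum>l<k. M $$ (i, l) * N $$ (l, j)) = (if i = j then 1 else 0)"
  if "M \<in> carrier_mat k k" "N \<in> carrier_mat k k" "M * N = 1\<^sub>m k" "i < k" "j < k" for M N :: "real mat" and i j
 proof -
  have "(M * N) $$ (i, j) = (\<Sum>l<k. M $$ (i, l) * N $$ (l, j))"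
   using that(1,2,4,5) by (simp add: scalar_prod_def lessThan_atLeast0)
  then show ?thesis using that(3,4,5) by simp
 qed
 show ?thesis
 proof (intro exI[of _ "%i j. B $$ (i, j)"] conjI allI impI)
  fix i j assume ij: "i < k" "j < k"
  show "(\<Sum>l<k. L i l * B $$ (l, j)) = (if i = j then 1 else 0)" using sp[OF _ B(1,3) ij] ij by simp
  show "(\<Sum>l<k. B $$ (i, l) * L l j) = (if i = j then 1 else 0)" using sp[OF B(1) _ B(2) ij] ij by simp
 qed
qed

text \<open>The directions add up to \<open>L\<close> times a diagonal noise times \<open>R\<close>;
  multiplication by the inverses of \<open>L\<close> and \<open>R\<close> reduces to the diagonal
  case. What matters is the leading coefficient of the determinant as a polynomial in the noise, so
  the offset \<open>x\<close> plays no part in the bound.\<close>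

lemma gint_npow_top:
 assumes t: "0 <= t" "t <= 1/2" and s: "\<And>c. c < k ==> s c \<noteq> 0" and L: "dt k L \<noteq> 0" and R: "dt k R \<noteq> 0"
 shows "gint (map (%c (i, j). s c * L i c * R c j) [0..<k]) (%x. npow t (dtv k x)) x
  <= (1 + C1) ^ k * npow t ((\<Prod>c<k. s c) * dt k L * dt k R)"
proof -
 let ?E = "%c (i, j). if i = c \<and> j = c then s c else (0::real)"
 let ?C = "%c (i, j). s c * L i c * R c j"
 obtain JL where JL: "\<forall>i<k. \<forall>j<k. (\<Sum>l<k. L i l * JL l j) = (if i = j then 1 else 0)"
   "\<forall>i<k. \<forall>j<k. (\<Sum>l<k. JL i l * L l j) = (if i = j then 1 else 0)"
  using dt_inverse[OF L] by (elim exE conjE)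
 obtain JR where JR: "\<forall>i<k. \<forall>j<k. (\<Sum>l<k. R i l * JR l j) = (if i = j then 1 else 0)"
   "\<forall>i<k. \<forall>j<k. (\<Sum>l<k. JR i l * R l j) = (if i = j then 1 else 0)"
  using dt_inverse[OF R] by (elim exE conjE)
 define h :: "mvec => mvec" where "h x = (%(i, j). if i < k \<and> j < k then \<Sum>l<k. (\<Sum>m<k. JL i m * x (m, l)) * JR l j else 0)" for x
 have hE: "h (?C c) = ?E c" if c: "c < k" for c
 proof (rule ext)
  fix p show "h (?C c) p = ?E c p"
  proof (cases p)
  case (Pair i j)
  have "h (?C c) (i, j) = ?E c (i, j)"
  proof (cases "i < k \<and> j < k")
   case True
   have "(\<Sum>l<k. (\<Sum>m<k. JL i m * (s c * L m c * R c l)) * JR l j) =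
     s c * (\<Sum>m<k. JL i m * L m c) * (\<Sum>l<k. R c l * JR l j)"
   proof -
    have 1: "(\<Sum>m<k. JL i m * (s c * L m c * R c l)) * JR l j = (s c * (\<Sum>m<k. JL i m * L m c)) * (R c l * JR l j)" for l
     by (simp add: sum_distrib_left sum_distrib_right mult_ac)
    show ?thesis unfolding 1 sum_distrib_left[symmetric] ..
   qed
   also have "... = (if i = c \<and> j = c then s c else 0)"
    using True c JL(2) JR(1) by auto
   finally show ?thesis using True by (simp add: h_def)
  next
   case False
   then show ?thesis using c by (auto simp: h_def)
  qed
  then show ?thesis using Pair by simp
  qed
 qed
 have lin: "h (%p. x p + g * y p) = (%p. h x p + g * h y p)" for x y g
 proof (rule ext)
  fix p show "h (%p. x p + g * y p) p = h x p + g * h y p"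
  proof (cases p)
   case (Pair i j)
   have 1: "JL i m * (x (m, l) + g * y (m, l)) = JL i m * x (m, l) + g * (JL i m * y (m, l))" for m l
    by (simp only: distrib_left mult.left_commute)
   have "(\<Sum>l<k. (\<Sum>m<k. JL i m * (x (m, l) + g * y (m, l))) * JR l j) =
     (\<Sum>l<k. (\<Sum>m<k. JL i m * x (m, l)) * JR l j) + g * (\<Sum>l<k. (\<Sum>m<k. JL i m * y (m, l)) * JR l j)"
    unfolding 1 sum.distrib sum_distrib_left[symmetric] distrib_right mult.assoc ..
   then show ?thesis by (simp only: Pair h_def split) simp
  qed
 qed
 have dtL: "dt k L * dt k JL = 1" and dtR: "dt k R * dt k JR = 1"
 proof -
  have "dt k L * dt k JL = dt k (%i j. if i = j then 1 else 0)"
   unfolding dt_mult[symmetric] by (rule dt_cong) (use JL in simp)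
  also have "... = 1" by (subst dt_diag[of k "%_. 1"]) simp
  finally show "dt k L * dt k JL = 1" .
  have "dt k R * dt k JR = dt k (%i j. if i = j then 1 else 0)"
   unfolding dt_mult[symmetric] by (rule dt_cong) (use JR in simp)
  also have "... = 1" by (subst dt_diag[of k "%_. 1"]) simp
  finally show "dt k R * dt k JR = 1" .
 qed
 have dth: "dtv k (h x) = dt k JL * dtv k x * dt k JR" for x
  unfolding dtv_def dt_mult[symmetric] by (rule dt_cong) (simp add: h_def)
 have dtx: "dtv k x = dt k L * dt k R * dtv k (h x)" for x
 proof -
  have "dt k L * dt k R * dtv k (h x) = (dt k L * dt k JL) * (dt k R * dt k JR) * dtv k x" unfolding dth by (simp only: mult_ac)
  then show ?thesis using dtL dtR by simp
 qed
 have "gint (map ?C [0..<k]) (%x. npow t (dtv k x)) x = gint (map ?C [0..<k]) (%x. (%y. npow t (dt k L * dt k R * dtv k y)) (h x)) x"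
  by (subst dtx) simp
 also have "... = gint (map ?E [0..<k]) (%y. npow t (dt k L * dt k R * dtv k y)) (h x)"
 proof -
  have "gint (map ?C cs) (%x. G (h x)) x = gint (map ?E cs) G (h x)" if "\<forall>c\<in>set cs. c < k" for cs G x
   using that by (induction cs arbitrary: x) (simp_all add: lin hE)
  from this[of "[0..<k]" "%y. npow t (dt k L * dt k R * dtv k y)" x] show ?thesis by simp
 qed
 also have "... = npow t (dt k L * dt k R) * gint (map ?E [0..<k]) (%y. npow t (dtv k y)) (h x)"
 proof -
  have scale: "gint Cs (%y. a * F y) x = a * gint Cs F x" if "F \<in> borel_measurable VM" for Cs F x and a :: ennreal
  proof (induction Cs arbitrary: x)
   case (Cons C Cs)
   have "(%g. gint Cs F (%p. x p + g * C p)) \<in> borel_measurable N01"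
   proof -
    have "(%g. (%p. x p + g * C p)) \<in> N01 \<rightarrow>\<^sub>M VM" by (rule measurable_PiM_single') auto
    then show ?thesis using gint_measurable[OF that] by (rule measurable_compose)
   qed
   then show ?case by (simp add: Cons nn_integral_cmult)
  qed simp
  show ?thesis unfolding npow_mult[of t "dt k L * dt k R"] by (rule scale) measurable
 qed
 also have "... <= npow t (dt k L * dt k R) * ((1 + C1) ^ k * npow t (\<Prod>c<k. s c))"
  by (intro mult_left_mono gint_npow_diag t s) auto
 also have "... = (1 + C1) ^ k * npow t ((\<Prod>c<k. s c) * dt k L * dt k R)"
  by (simp add: npow_mult mult_ac)
 finally show ?thesis .
qed

lemma npow_liminf:
 assumes t: "0 < t" and X: "X ----> (x::real)"
 shows "npow t x <= liminf (%n. npow t (X n))"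
proof (cases "x = 0")
 case False
 have ev: "EV n. X n \<noteq> 0" by (rule tendsto_imp_eventually_ne[OF X False])
 have "(%n. ennreal (\<bar>X n\<bar> powr (- t))) ----> ennreal (\<bar>x\<bar> powr (- t))"
  by (intro tendsto_ennrealI tendsto_powr tendsto_rabs X tendsto_const) (use False in simp)
 moreover have "EV n. ennreal (\<bar>X n\<bar> powr (- t)) = npow t (X n)"
  using ev by eventually_elim (simp add: npow_def)
 ultimately have "(%n. npow t (X n)) ----> npow t x"
  using False by (simp add: npow_def tendsto_cong)
 then show ?thesis by (simp add: lim_imp_Liminf)
next
 case True
 have "npow t x <= c" if c: "liminf (%n. npow t (X n)) < c" for c
 proof (rule ccontr)
  assume "\<not> npow t x <= c"
  then have cf: "c < \<infinity>" by (simp add: True npow_def less_top[symmetric])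
  then obtain r where r: "0 <= r" "c = ennreal r" by (cases c) auto
  have "EV n. \<bar>X n\<bar> < (r + 1) powr (- 1 / t)"
   using tendstoD[OF X, of "(r + 1) powr (- 1 / t)"] r(1) True by (simp add: dist_real_def)
  then have "EV n. c <= npow t (X n)"
  proof eventually_elim
   case (elim n)
   have "npow t ((r + 1) powr (- 1 / t)) <= npow t (X n)" by (rule npow_antimono[OF t]) (use elim in simp)
   moreover have "npow t ((r + 1) powr (- 1 / t)) = ennreal (r + 1)"
    using t r(1) by (simp add: npow_def powr_powr)
   moreover have "c <= ennreal (r + 1)" unfolding r(2) by (rule ennreal_leI) simp
   ultimately show ?case by simp
  qed
  then have "c <= liminf (%n. npow t (X n))" by (rule Liminf_bounded)
  then show False using c by simp
 qed
 then show ?thesis by (rule dense_ge)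
qed

section \<open>Negative moments of determinants under the Gaussian law\<close>

definition sd :: "nat \<times> nat => real" where "sd = (%(i, j). (1 / 3) ^ (Suc i + Suc j))"

lemma sd_pos: "0 < sd p" by (cases p) (simp add: sd_def)

lemma sd_nonzero: "sd p \<noteq> 0" using sd_pos[of p] by simp

lemma distributed_scaled_N01:
 assumes X: "distributed M lborel X (normal_density 0 s)" and s: "0 < s"
 shows "distr M borel X = distr N01 borel (%g. s * g)"
proof -
 have "distributed N01 lborel (%x. x) std_normal_density"
  unfolding distributed_def by (auto simp: N01_def distr_id2)
 from N01.normal_density_affine[OF this, of s 0] s
 have Y: "distributed N01 lborel (%x. s * x) (normal_density 0 s)" by simp
 have "distr M lborel X = density lborel (normal_density 0 s)" using X by (simp add: distributed_def)
 moreover have "distr N01 lborel (%x. s * x) = density lborel (normal_density 0 s)" using Y by (simp add: distributed_def)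
 ultimately have "distr M lborel X = distr N01 lborel (%x. s * x)" by simp
 moreover have "distr M borel X = distr M lborel X" by (rule distr_cong) auto
 moreover have "distr N01 lborel (%x. s * x) = distr N01 borel (%x. s * x)" by (rule distr_cong) auto
 ultimately show ?thesis by simp
qed

lemma nn_integral_PiM_gint:
 assumes F: "F \<in> borel_measurable VM" and "distinct ps"
 shows "(\<integral>\<^sup>+y. F (%q. x q + (\<Sum>p\<in>set ps. y p * C p q)) \<partial>(\<Pi>\<^sub>M p\<in>set ps. distr N01 borel (%g. s p * g)))
  = gint (map (%p q. s p * C p q) ps) F x"
 using assms(2)
proof (induction ps arbitrary: x)
 case Nil
 then show ?case by (simp add: PiM_empty nn_integral_count_space_finite)
next
 case (Cons p ps)
 let ?N = "%p. distr N01 borel (%g. s p * g)"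
 have ps: "prob_space (?N p)" for p by (rule N01.prob_space_distr) simp
 interpret product_prob_space ?N UNIV
  using ps by (simp add: product_prob_space_def product_prob_space_axioms_def product_sigma_finite_def prob_space_imp_sigma_finite)
 have m1: "(%y. F (%q. x q + (\<Sum>p\<in>I. y p * C p q))) \<in> borel_measurable (\<Pi>\<^sub>M p\<in>I. ?N p)" if "finite I" for I x
 proof -
  have "(%y q. x q + (\<Sum>p\<in>I. y p * C p q)) \<in> (\<Pi>\<^sub>M p\<in>I. ?N p) \<rightarrow>\<^sub>M VM"
  proof (rule measurable_PiM_single')
   fix q
   have "(%y. y p) \<in> borel_measurable (\<Pi>\<^sub>M p\<in>I. ?N p)" if "p \<in> I" for p
    using measurable_component_singleton[OF that, of ?N] by simp
   then show "(%y. x q + (\<Sum>p\<in>I. y p * C p q)) \<in> borel_measurable (\<Pi>\<^sub>M p\<in>I. ?N p)"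
    by (intro borel_measurable_add borel_measurable_sum borel_measurable_times borel_measurable_const)
  qed simp
  then show ?thesis using F by (rule measurable_compose)
 qed
 have "(\<integral>\<^sup>+y. F (%q. x q + (\<Sum>p\<in>set (p # ps). y p * C p q)) \<partial>(\<Pi>\<^sub>M p\<in>set (p # ps). ?N p)) =
   (\<integral>\<^sup>+z. (\<integral>\<^sup>+y. F (%q. x q + (\<Sum>r\<in>set (p # ps). (y(p := z)) r * C r q)) \<partial>(\<Pi>\<^sub>M p\<in>set ps. ?N p)) \<partial>?N p)"
  unfolding list.set by (rule product_nn_integral_insert_rev) (use Cons.prems m1[of "insert p (set ps)"] in auto)
 also have "... = (\<integral>\<^sup>+z. (\<integral>\<^sup>+y. F (%q. (x q + z * C p q) + (\<Sum>r\<in>set ps. y r * C r q)) \<partial>(\<Pi>\<^sub>M p\<in>set ps. ?N p)) \<partial>?N p)"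
 proof (intro nn_integral_cong arg_cong[where f=F] ext)
  fix z q y
  have "(\<Sum>r\<in>set ps. (y(p := z)) r * C r q) = (\<Sum>r\<in>set ps. y r * C r q)"
   by (rule sum.cong) (use Cons.prems in auto)
  then show "x q + (\<Sum>r\<in>set (p # ps). (y(p := z)) r * C r q) = (x q + z * C p q) + (\<Sum>r\<in>set ps. y r * C r q)"
   using Cons.prems by simp
 qed
 also have "... = (\<integral>\<^sup>+z. gint (map (%p q. s p * C p q) ps) F (%q. x q + z * C p q) \<partial>?N p)"
  using Cons by simp
 also have "... = (\<integral>\<^sup>+g. gint (map (%p q. s p * C p q) ps) F (%q. x q + (s p * g) * C p q) \<partial>N01)"
 proof -
  have "(%g. (%q. x q + g * C p q)) \<in> borel \<rightarrow>\<^sub>M VM" by (rule measurable_PiM_single') auto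
  then have "(%z. gint (map (%p q. s p * C p q) ps) F (%q. x q + z * C p q)) \<in> borel_measurable borel"
   using gint_measurable[OF F] by (rule measurable_compose)
  then show ?thesis by (subst nn_integral_distr) auto
 qed
 also have "... = gint (map (%p q. s p * C p q) (p # ps)) F x"
  by (simp add: mult_ac)
 finally show ?case .
qed

locale gauss = onb e for e :: "nat => 'h::{real_inner,complete_space}" +
 fixes \<gamma> :: "('h op) measure"
 assumes law: "gaussian_SHS_law e \<gamma>"
begin

sublocale \<gamma>: prob_space \<gamma> using law by (simp add: gaussian_SHS_law_def)

lemma space_\<gamma>: "space \<gamma> = SHS e" using law by (simp add: gaussian_SHS_law_def)

lemma sets_\<gamma> [measurable_cong]: "sets \<gamma> = sets (SHS_space e)" using law by (simp add: gaussian_SHS_law_def)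

lemma entry_measurable [measurable]: "matrix_entry e p \<in> borel_measurable \<gamma>"
 using law by (cases p) (auto simp: gaussian_SHS_law_def distributed_def)

lemma distr_entry: "distr \<gamma> borel (matrix_entry e p) = distr N01 borel (%g. sd p * g)"
proof (rule distributed_scaled_N01[OF _ sd_pos])
 show "distributed \<gamma> lborel (matrix_entry e p) (normal_density 0 (sd p))"
  using law unfolding gaussian_SHS_law_def sd_def by (cases p) (simp only: split)
qed

lemma nn_integral_entries:
 assumes F: "F \<in> borel_measurable VM" and ps: "distinct ps" and ne: "ps \<noteq> []"
 shows "(\<integral>\<^sup>+\<Delta>. F (%q. x q + (\<Sum>p\<in>set ps. matrix_entry e p \<Delta> * C p q)) \<partial>\<gamma>) = gint (map (%p q. sd p * C p q) ps) F x"
proof -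
 have ind: "\<gamma>.indep_vars (%_. borel) (matrix_entry e) (set ps)"
  by (rule \<gamma>.indep_vars_subset[of _ _ UNIV]) (use law in \<open>auto simp: gaussian_SHS_law_def\<close>)
 have j: "distr \<gamma> (\<Pi>\<^sub>M p\<in>set ps. borel) (%\<Delta>. \<lambda>p\<in>set ps. matrix_entry e p \<Delta>) = (\<Pi>\<^sub>M p\<in>set ps. distr \<gamma> borel (matrix_entry e p))"
  by (rule iffD1[OF \<gamma>.indep_vars_iff_distr_eq_PiM[OF _ entry_measurable] ind]) (use ne in simp)
 have Fm: "(%y. F (%q. x q + (\<Sum>p\<in>set ps. y p * C p q))) \<in> borel_measurable (\<Pi>\<^sub>M p\<in>set ps. borel)"
 proof -
  have "(%y q. x q + (\<Sum>p\<in>set ps. y p * C p q)) \<in> (\<Pi>\<^sub>M p\<in>set ps. borel) \<rightarrow>\<^sub>M VM"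
  proof (rule measurable_PiM_single')
   fix q
   have "(%y. y p) \<in> borel_measurable (\<Pi>\<^sub>M p\<in>set ps. borel)" if "p \<in> set ps" for p
    using measurable_component_singleton[OF that, of "%_. borel"] by simp
   then show "(%y. x q + (\<Sum>p\<in>set ps. y p * C p q)) \<in> borel_measurable (\<Pi>\<^sub>M p\<in>set ps. borel)"
    by (intro borel_measurable_add borel_measurable_sum borel_measurable_times borel_measurable_const)
  qed simp
  then show ?thesis using F by (rule measurable_compose)
 qed
 have "(\<integral>\<^sup>+\<Delta>. F (%q. x q + (\<Sum>p\<in>set ps. matrix_entry e p \<Delta> * C p q)) \<partial>\<gamma>) =
   (\<integral>\<^sup>+\<Delta>. F (%q. x q + (\<Sum>p\<in>set ps. (\<lambda>p\<in>set ps. matrix_entry e p \<Delta>) p * C p q)) \<partial>\<gamma>)"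
  by (intro nn_integral_cong arg_cong[where f=F] ext) simp
 also have "... = (\<integral>\<^sup>+y. F (%q. x q + (\<Sum>p\<in>set ps. y p * C p q)) \<partial>(distr \<gamma> (\<Pi>\<^sub>M p\<in>set ps. borel) (%\<Delta>. \<lambda>p\<in>set ps. matrix_entry e p \<Delta>)))"
 proof (rule nn_integral_distr[symmetric])
  show "(%\<Delta>. \<lambda>p\<in>set ps. matrix_entry e p \<Delta>) \<in> \<gamma> \<rightarrow>\<^sub>M (\<Pi>\<^sub>M p\<in>set ps. borel)"
   by (rule measurable_restrict) measurable
 qed (use Fm in simp)
 also have "... = (\<integral>\<^sup>+y. F (%q. x q + (\<Sum>p\<in>set ps. y p * C p q)) \<partial>(\<Pi>\<^sub>M p\<in>set ps. distr N01 borel (%g. sd p * g)))"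
  unfolding j distr_entry ..
 also have "... = gint (map (%p q. sd p * C p q) ps) F x" by (rule nn_integral_PiM_gint[OF F ps])
 finally show ?thesis .
qed

text \<open>The rank-one direction in which the noise entry \<open>(i, j)\<close> moves the matrix
  of the determinant.\<close>

definition cf :: "('h op) => ('h op) => (nat => 'h) => (nat => 'h) => nat \<times> nat => mvec" where
 "cf L R x y = (%(i, j) (a, b). inner (x a) (ap L (e j)) * inner (ap R (y b)) (e i))"

lemma truncated_inner:
 "inner (x a) (ap (L oL (proj m oL \<Delta> oL proj m) oL R) (y b)) =
  (\<Sum>p\<in>{..<m} \<times> {..<m}. matrix_entry e p \<Delta> * cf L R x y p (a, b))"
proof -
 have "inner (x a) (ap (L oL (proj m oL \<Delta> oL proj m) oL R) (y b)) =
   (\<Sum>j<m. (\<Sum>i<m. inner (ap R (y b)) (e i) * inner (ap \<Delta> (e i)) (e j)) * inner (x a) (ap L (e j)))"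
  by (simp add: proj_apply blinfun.sum_right blinfun.scaleR_right inner_sum_right inner_sum_left sum_distrib_left sum_distrib_right, subst sum.swap, simp add: mult_ac)
 also have "... = (\<Sum>i<m. \<Sum>j<m. matrix_entry e (i, j) \<Delta> * cf L R x y (i, j) (a, b))"
  unfolding sum_distrib_right by (subst sum.swap) (simp only: matrix_entry_def cf_def split mult_ac)
 finally show ?thesis by (simp add: sum.cartesian_product split_def)
qed

lemma truncated_tendsto:
 assumes D: "\<Delta> \<in> SHS e"
 shows "(%m. proj m oL \<Delta> oL proj m) ----> \<Delta>"
proof (rule LIM_zero_cancel, rule Lim_null_comparison[where g="%m. 2 * SHS_norm e \<Delta> * (1/2) ^ m"])
 show "EV m. norm ((proj m oL \<Delta> oL proj m) - \<Delta>) <= 2 * SHS_norm e \<Delta> * (1/2) ^ m"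
 proof (rule always_eventually, rule allI)
  fix m
  have "(proj m oL \<Delta> oL proj m) - \<Delta> = (((proj m oL \<Delta>) - \<Delta>) oL proj m) + ((\<Delta> oL proj m) - \<Delta>)"
   by (rule blinfun_eqI) (simp add: blinfun.diff_left blinfun.add_left)
  then have "norm ((proj m oL \<Delta> oL proj m) - \<Delta>) <= norm (((proj m oL \<Delta>) - \<Delta>) oL proj m) + norm ((\<Delta> oL proj m) - \<Delta>)"
   by (metis norm_triangle_ineq)
  also have "... <= norm ((proj m oL \<Delta>) - \<Delta>) * norm (proj m) + norm ((\<Delta> oL proj m) - \<Delta>)"
   by (intro add_right_mono norm_blinfun_compose)
  also have "... <= norm ((proj m oL \<Delta>) - \<Delta>) * 1 + norm ((\<Delta> oL proj m) - \<Delta>)"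
   by (intro add_mono mult_left_mono norm_proj) auto
  also have "... <= SHS_norm e \<Delta> / 2 ^ m + SHS_norm e \<Delta> / 2 ^ m"
   using SHS_tail_left[OF D, of m] SHS_tail_right[OF D, of m] by simp
  also have "... = 2 * SHS_norm e \<Delta> * (1/2) ^ m" unfolding power_one_over by simp
  finally show "norm ((proj m oL \<Delta> oL proj m) - \<Delta>) <= 2 * SHS_norm e \<Delta> * (1/2) ^ m" .
 qed
 show "(%m. 2 * SHS_norm e \<Delta> * (1/2) ^ m) ----> 0"
  by (rule tendsto_mult_right_zero, rule LIMSEQ_power_zero) simp
qed

text \<open>Truncated noise involves finitely many entries and converges on SHS; Fatou's lemma
  passes on a bound that is uniform in the truncation level. The list \<open>ps\<close> is left open
  so that each application can choose its order of integration.\<close>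

lemma nn_integral_npow_limit:
 fixes L R A :: "'h op" and x y :: "nat => 'h"
 assumes t: "0 < t"
  and bd: "\<And>m. m0 <= m ==> \<exists>ps. distinct ps \<and> set ps = {..<m} \<times> {..<m} \<and>
   gint (map (%p q. sd p * (eps * cf L R x y p q)) ps) (%v. npow t (dtv k v))
    (%(a, b). inner (x a) (ap (L oL A oL R) (y b))) <= c"
 shows "(\<integral>\<^sup>+\<Delta>. npow t (mdet k (L oL (A + eps *R \<Delta>) oL R) x y) \<partial>\<gamma>) <= c"
proof -
 let ?x0 = "%(a, b). inner (x a) (ap (L oL A oL R) (y b))"
 let ?M = "%m \<Delta>. dtv k (%q. ?x0 q + (\<Sum>p\<in>{..<m} \<times> {..<m}. matrix_entry e p \<Delta> * (eps * cf L R x y p q)))"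
 have lim: "(%m. ?M m \<Delta>) ----> mdet k (L oL (A + eps *R \<Delta>) oL R) x y" if D: "\<Delta> \<in> SHS e" for \<Delta>
  unfolding dtv_def mdet_def
 proof (rule tendsto_dt)
  fix a b
  have 1: "(%m. (L :: 'h op) oL (A + eps *R (proj m oL \<Delta> oL proj m)) oL R) ----> (L oL (A + eps *R \<Delta>) oL R)"
   by (intro bounded_bilinear.tendsto[OF bounded_bilinear_blinfun_compose] tendsto_intros truncated_tendsto[OF D])
  have 2: "(%m. inner (x a) (ap (L oL (A + eps *R (proj m oL \<Delta> oL proj m)) oL R) (y b))) ---->
    inner (x a) (ap (L oL (A + eps *R \<Delta>) oL R) (y b))"
   by (intro tendsto_inner tendsto_const blinfun.tendsto 1)
  have 3: "inner (x a) (ap (L oL (A + eps *R (proj m oL \<Delta> oL proj m)) oL R) (y b)) =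
   ?x0 (a, b) + (\<Sum>p\<in>{..<m} \<times> {..<m}. matrix_entry e p \<Delta> * (eps * cf L R x y p (a, b)))" for m
  proof -
   have "inner (x a) (ap (L oL (A + eps *R (proj m oL \<Delta> oL proj m)) oL R) (y b)) =
    inner (x a) (ap (L oL A oL R) (y b)) + eps * inner (x a) (ap (L oL (proj m oL \<Delta> oL proj m) oL R) (y b))"
    by (simp add: blinfun.add_left blinfun.add_right blinfun.scaleR_left blinfun.scaleR_right inner_add_right)
   also have "... = ?x0 (a, b) + (\<Sum>p\<in>{..<m} \<times> {..<m}. matrix_entry e p \<Delta> * (eps * cf L R x y p (a, b)))"
    unfolding truncated_inner sum_distrib_left split by (simp only: mult.left_commute)
   finally show ?thesis .
  qed
  show "(%m. ?x0 (a, b) + (\<Sum>p\<in>{..<m} \<times> {..<m}. matrix_entry e p \<Delta> * (eps * cf L R x y p (a, b)))) ---->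
    inner (x a) (ap (L oL (A + eps *R \<Delta>) oL R) (y b))"
   using 2 unfolding 3 .
 qed
 have meas: "(%\<Delta>. npow t (?M m \<Delta>)) \<in> borel_measurable \<gamma>" for m
 proof (rule measurable_compose[OF _ npow_measurable])
  show "?M m \<in> borel_measurable \<gamma>" unfolding dtv_def by (rule dt_measurable) measurable
 qed
 have "(\<integral>\<^sup>+\<Delta>. npow t (mdet k (L oL (A + eps *R \<Delta>) oL R) x y) \<partial>\<gamma>) <= (\<integral>\<^sup>+\<Delta>. liminf (%m. npow t (?M m \<Delta>)) \<partial>\<gamma>)"
  by (intro nn_integral_mono npow_liminf[OF t] lim) (simp add: space_\<gamma>)
 also have "... <= liminf (%m. \<integral>\<^sup>+\<Delta>. npow t (?M m \<Delta>) \<partial>\<gamma>)"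
  by (rule nn_integral_liminf) (rule meas)
 also have "... <= liminf (%m. c)"
 \<comment> \<open>Starting from \<open>Suc m0\<close> makes the square of indices nonempty, as
   \<open>nn_integral_entries\<close> requires.\<close>
 proof (rule Liminf_mono, rule eventually_sequentiallyI[of "Suc m0"])
  fix m assume m: "Suc m0 <= m"
  from bd[OF Suc_leD[OF m]] obtain ps where ps: "distinct ps" "set ps = {..<m} \<times> {..<m}"
   "gint (map (%p q. sd p * (eps * cf L R x y p q)) ps) (%v. npow t (dtv k v)) ?x0 <= c" by (elim exE conjE)
  have F: "(%v. npow t (dtv k v)) \<in> borel_measurable VM" by measurable
  have "(0, 0) \<in> set ps" unfolding ps(2) using m by simp
  then have ne: "ps \<noteq> []" by (metis list.set(1) empty_iff)
  note 4 = nn_integral_entries[OF F ps(1) ne, of ?x0 "%p q. eps * cf L R x y p q", unfolded ps(2)]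
  show "(\<integral>\<^sup>+\<Delta>. npow t (?M m \<Delta>) \<partial>\<gamma>) <= c" unfolding 4 by (rule ps(3))
 qed
 also have "... = c" by (rule Liminf_const[OF sequentially_bot])
 finally show ?thesis .
qed

lemma nn_integral_npow_mdet:
 fixes L R A :: "'h op" and x y :: "nat => 'h"
 assumes t: "0 < t" "real k * t <= 1/2"
 shows "(\<integral>\<^sup>+\<Delta>. npow t (mdet k (L oL (A + eps *R \<Delta>) oL R) x y) \<partial>\<gamma>) <= Knm k * npow t (mdet k (L oL A oL R) x y)"
proof (rule nn_integral_npow_limit[OF t(1), of 0])
 fix m :: nat
 let ?x = "%(a, b). inner (x a) (ap (L oL A oL R) (y b))" and ?ps = "List.product [0..<m] [0..<m]" and ?f = "%p q. sd p * (eps * cf L R x y p q)"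
 have "gint (map ?f ?ps) (%v. npow t (dtv k v))
   ?x <= Knm k * npow t (dtv k ?x)"
  by (rule gint_npow_dt[OF t])
 moreover have "dtv k ?x = mdet k (L oL A oL R) x y"
  by (simp only: dtv_def mdet_def split)
 ultimately have 1: "gint (map ?f ?ps) (%v. npow t (dtv k v))
   ?x <= Knm k * npow t (mdet k (L oL A oL R) x y)"
  by (simp only:)
 have 2: "distinct ?ps" by (simp add: distinct_product)
 have 3: "set ?ps = {..<m} \<times> {..<m}" by (auto simp: atLeast0LessThan)
 show "\<exists>ps. distinct ps \<and> set ps = {..<m} \<times> {..<m} \<and>
   gint (map ?f ps) (%v. npow t (dtv k v))
    ?x <= Knm k * npow t (mdet k (L oL A oL R) x y)"
  by (intro exI[of _ ?ps] conjI) (rule 2, rule 3, rule 1)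
qed

text \<open>Only the \<open>k\<close> entries \<open>(I c, J c)\<close> of the noise are exploited.
  With the others frozen they act as in \<open>gint_npow_top\<close>, with a bound that survives the
  remaining integrations because it is constant. If one of the two outer determinants vanishes, the
  right-hand side is infinite.\<close>

lemma nn_integral_npow_mdet_top:
 fixes L R A :: "'h op" and x y :: "nat => 'h"
 assumes t: "0 < t" "t <= 1/2" and eps: "eps \<noteq> 0" and inj: "inj_on (%c. (I c, J c)) {..<k}"
 shows "(\<integral>\<^sup>+\<Delta>. npow t (mdet k (L oL (A + eps *R \<Delta>) oL R) x y) \<partial>\<gamma>) <=
  (1 + C1) ^ k * npow t ((\<Prod>c<k. eps * sd (I c, J c)) * dt k (%a c. inner (x a) (ap L (e (J c)))) *
   dt k (%c b. inner (ap R (y b)) (e (I c))))" (is "_ <= ?c")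
proof (cases "dt k (%a c. inner (x a) (ap L (e (J c)))) = 0 \<or> dt k (%c b. inner (ap R (y b)) (e (I c))) = 0")
 case True
 have nz: "(1 + C1) ^ k \<noteq> 0" by (simp add: add_eq_0_iff_both_eq_0)
 have z: "(\<Prod>c<k. eps * sd (I c, J c)) * dt k (%a c. inner (x a) (ap L (e (J c)))) *
   dt k (%c b. inner (ap R (y b)) (e (I c))) = 0"
  using True by (elim disjE) (simp_all only: mult_zero_left mult_zero_right)
 have "?c = \<infinity>" unfolding z npow_def using nz by (simp add: ennreal_mult_top)
 then show ?thesis by (simp only: infinity_ennreal_def top_greatest)
next
 case False
 define m0 where "m0 = Suc (\<Sum>c<k. I c + J c)"
 have m0: "I c < m0" "J c < m0" if "c < k" for c
 proof -
  have "I c + J c <= (\<Sum>c<k. I c + J c)" by (rule member_le_sum[where f="%c. I c + J c"]) (use that in auto)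
  then show "I c < m0" "J c < m0" by (simp_all add: m0_def)
 qed
 show ?thesis
 proof (rule nn_integral_npow_limit[OF t(1), of m0])
  fix m assume m: "m0 <= m"
  let ?sp = "map (%c. (I c, J c)) [0..<k]"
  \<comment> \<open>The chosen entries are placed at the end of the list and so are the innermost
    integrals.\<close>
  define rest where "rest = filter (%p. p \<notin> set ?sp) (List.product [0..<m] [0..<m])"
  let ?f = "%p q. sd p * (eps * cf L R x y p q)"
  have "distinct (List.product [0..<m] [0..<m])" by (simp add: distinct_product)
  then have 1: "distinct (rest @ ?sp)" using inj by (auto simp: rest_def distinct_map atLeast0LessThan)
  have "set rest = {..<m} \<times> {..<m} - set ?sp" by (auto simp: rest_def atLeast0LessThan)
  moreover have "set ?sp \<subseteq> {..<m} \<times> {..<m}" using m0(1)[THEN less_le_trans, OF _ m] m0(2)[THEN less_le_trans, OF _ m] by auto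
  ultimately have 2: "set (rest @ ?sp) = {..<m} \<times> {..<m}" unfolding set_append by (simp only: Un_Diff_cancel2 Un_absorb2)
  have fin: "gint (map ?f (rest @ ?sp)) (%v. npow t (dtv k v)) v0 <= ?c" for v0
   unfolding map_append gint_append
  proof (rule gint_le_const)
   fix v
   have "map ?f ?sp = map (%c (a, b). (eps * sd (I c, J c)) * inner (x a) (ap L (e (J c))) * inner (ap R (y b)) (e (I c))) [0..<k]"
    unfolding map_map
   proof (rule map_cong[OF refl], rule ext)
    fix c q
    show "(?f \<circ> (%c. (I c, J c))) c q = (case q of (a, b) => (eps * sd (I c, J c)) * inner (x a) (ap L (e (J c))) * inner (ap R (y b)) (e (I c)))"
     by (cases q) (simp add: cf_def)
   qed
   then have eq: "gint (map ?f ?sp) (%v. npow t (dtv k v)) v = gint (map (%c (a, b). (eps * sd (I c, J c)) * inner (x a) (ap L (e (J c))) * inner (ap R (y b)) (e (I c))) [0..<k]) (%v. npow t (dtv k v)) v"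
    by (rule arg_cong)
   have s0: "eps * sd (I c, J c) \<noteq> 0" for c using eps sd_nonzero by simp
   have L0: "dt k (%a c. inner (x a) (ap L (e (J c)))) \<noteq> 0" and R0: "dt k (%c b. inner (ap R (y b)) (e (I c))) \<noteq> 0"
    using False by (rule_tac notI, simp)+
   show "gint (map ?f ?sp) (%v. npow t (dtv k v)) v <= ?c"
    unfolding eq by (rule gint_npow_top[OF less_imp_le[OF t(1)] t(2) s0 L0 R0])
  qed
  show "\<exists>ps. distinct ps \<and> set ps = {..<m} \<times> {..<m} \<and>
   gint (map ?f ps) (%v. npow t (dtv k v)) (%(a, b). inner (x a) (ap (L oL A oL R) (y b))) <= ?c"
   by (intro exI[of _ "rest @ ?sp"] conjI) (rule 1, rule 2, rule fin)
 qed
qed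

end

section \<open>Expected logarithms and resampling of one coordinate\<close>

lemma integrable_sandwich:
 fixes g :: "'a => real"
 assumes l: "integrable M l" and u: "integrable M u" and g: "g \<in> borel_measurable M"
  and le: "AE x in M. l x <= g x" "AE x in M. g x <= u x"
 shows "integrable M g"
proof (rule Bochner_Integration.integrable_bound)
 show "integrable M (%x. \<bar>l x\<bar> + \<bar>u x\<bar>)" using l u by simp
 show "AE x in M. norm (g x) <= norm (\<bar>l x\<bar> + \<bar>u x\<bar>)" using le by eventually_elim auto
qed (rule g)

context submult_process begin

text \<open>Blocks of length \<open>m0\<close> are bounded by the truncated block function, the
  remainder by \<open>Dh\<close>. The last clause says that \<open>W\<close> reads only the window
  of length \<open>n\<close>, so resampling noise outside the window leaves it unchanged.\<close>

lemma D_exp_bound: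
 assumes m0: "0 < m0" and c0: "1 <= c0" "\<And>x. D 0 x <= c0"
 shows "\<exists>W. integrable M W \<and> (\<forall>x. D n x <= c0 * exp (W x)) \<and>
  (\<integral>x. W x \<partial>M) <= real (n div m0) * (\<integral>x. Dtr m0 K x \<partial>M) + real m0 * (\<integral>x. Dh x \<partial>M) \<and>
  (\<forall>x y. (\<forall>j m. j + m <= n --> D m ((T ^^ j) x) = D m ((T ^^ j) y)) --> W x = W y)"
proof (induction n rule: less_induct)
 case (less n)
 show ?case
 proof (cases "n < m0")
  case True
  let ?W = "%x. \<Sum>j<n. Dh ((T ^^ j) x)"
  have i: "integrable M ?W" using Dh_int by (intro int_sum integrable_iter)
  have "D n x <= c0 * exp (?W x)" for x
  proof (cases "n = 0")
   case True then show ?thesis using c0(2) by simp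
  next
   case False
   have "D n x <= 1 * exp (?W x)" using D_le_Dh[of n x] False by simp
   also have "... <= c0 * exp (?W x)" using c0(1) by (intro mult_right_mono) auto
   finally show ?thesis .
  qed
  moreover have "(\<integral>x. ?W x \<partial>M) <= real m0 * (\<integral>x. Dh x \<partial>M)"
  proof -
   have "(\<integral>x. ?W x \<partial>M) = (\<Sum>j<n. \<integral>x. Dh x \<partial>M)"
    using Dh_int by (subst Bochner_Integration.integral_sum) (auto simp: integral_iter intro: integrable_iter)
   also have "... <= real m0 * (\<integral>x. Dh x \<partial>M)"
    using True Dh_nonneg by (simp add: mult_right_mono)
   finally show ?thesis .
  qed
  moreover have "?W x = ?W y" if "\<forall>j m. j + m <= n --> D m ((T ^^ j) x) = D m ((T ^^ j) y)" for x y
   unfolding Dh_def by (rule sum.cong) (use that in auto)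
  ultimately show ?thesis using i True by (intro exI[of _ ?W]) simp
 next
  case False
  have "n - m0 < n" using False m0 by simp
  from less.IH[OF this] obtain W where W: "integrable M W" "\<forall>x. D (n - m0) x <= c0 * exp (W x)"
   "(\<integral>x. W x \<partial>M) <= real ((n - m0) div m0) * (\<integral>x. Dtr m0 K x \<partial>M) + real m0 * (\<integral>x. Dh x \<partial>M)"
   "\<forall>x y. (\<forall>j m. j + m <= n - m0 --> D m ((T ^^ j) x) = D m ((T ^^ j) y)) --> W x = W y"
   by (elim exE conjE)
  let ?W = "%x. Dtr m0 K x + W ((T ^^ m0) x)"
  have i: "integrable M ?W" using Dtr_int[OF m0] W(1) by (intro int_add integrable_iter)
  have "D n x <= c0 * exp (?W x)" for x
  proof -
   have "D n x <= D m0 x * D (n - m0) ((T ^^ m0) x)" using D_submult[of m0 "n - m0" x] False by simp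
   also have "... <= exp (Dtr m0 K x) * (c0 * exp (W ((T ^^ m0) x)))"
    using W(2) by (intro mult_mono D_le_Dtr D_nonneg) auto
   finally show ?thesis by (simp add: exp_add mult_ac)
  qed
  moreover have "(\<integral>x. ?W x \<partial>M) = (\<integral>x. Dtr m0 K x \<partial>M) + (\<integral>x. W x \<partial>M)"
   using Dtr_int[OF m0] W(1) by (subst integ_add) (auto simp: integral_iter intro: integrable_iter)
  moreover have "?W x = ?W y" if xy: "\<forall>j m. j + m <= n --> D m ((T ^^ j) x) = D m ((T ^^ j) y)" for x y
  proof -
   have "D m0 ((T ^^ 0) x) = D m0 ((T ^^ 0) y)" by (rule xy[rule_format]) (use False in simp)
   then have 1: "Dtr m0 K x = Dtr m0 K y" by (simp add: Dtr_def)
   have "W ((T ^^ m0) x) = W ((T ^^ m0) y)"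
   proof (rule W(4)[rule_format])
    fix j m assume "j + m <= n - m0"
    then have "D m ((T ^^ (j + m0)) x) = D m ((T ^^ (j + m0)) y)" by (intro xy[rule_format]) (use False in simp)
    then show "D m ((T ^^ j) ((T ^^ m0) x)) = D m ((T ^^ j) ((T ^^ m0) y))" by (simp add: funpow_add)
   qed
   with 1 show ?thesis by simp
  qed
  moreover have "real (n div m0) = 1 + real ((n - m0) div m0)"
   using False m0 by (simp add: le_div_geq)
  ultimately show ?thesis using W(3) i by (intro exI[of _ ?W]) (simp add: distrib_right)
 qed
qed

end

text \<open>Since \<open>y <= exp y\<close>, a moment of order \<open>- \<theta>\<close> of
  \<open>b / a\<close> bounds the expected loss of logarithm. Its finiteness also excludes zeros of
  \<open>b\<close>, and \<open>w\<close> supplies integrability from above.\<close>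

lemma (in prob_space) expectation_ln_ge:
 fixes a b w :: "'a => real"
 assumes [measurable]: "a \<in> borel_measurable M" "b \<in> borel_measurable M"
  and a: "AE x in M. 0 < a x" "integrable M (%x. ln (a x))"
  and b: "AE x in M. 0 <= b x" and w: "integrable M w" "AE x in M. b x <= exp (w x)"
  and \<theta>: "0 < \<theta>" and C: "(\<integral>\<^sup>+x. npow \<theta> (b x / a x) \<partial>M) <= ennreal C" "0 <= C"
 shows "AE x in M. 0 < b x" "integrable M (%x. ln (b x))" "(\<integral>x. ln (a x) \<partial>M) - C / \<theta> <= (\<integral>x. ln (b x) \<partial>M)"
proof -
 define f where "f x = \<bar>b x / a x\<bar> powr (- \<theta>)" for x
 have fm [measurable]: "f \<in> borel_measurable M" unfolding f_def by measurable
 have "AE x in M. npow \<theta> (b x / a x) \<noteq> \<infinity>"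
  by (rule nn_integral_PInf_AE) (use C in \<open>auto simp: top_unique\<close>)
 then have fin: "AE x in M. npow \<theta> (b x / a x) = ennreal (f x) \<and> b x \<noteq> 0"
  by eventually_elim (auto simp: npow_def f_def split: if_splits)
 show pos: "AE x in M. 0 < b x" using fin b by eventually_elim auto
 have If: "(\<integral>\<^sup>+x. ennreal (f x) \<partial>M) = (\<integral>\<^sup>+x. npow \<theta> (b x / a x) \<partial>M)"
  by (rule nn_integral_cong_AE) (use fin in eventually_elim, auto)
 have f0: "0 <= f x" for x by (simp add: f_def)
 have fi: "integrable M f"
 proof (rule integrableI_nonneg)
  show "(\<integral>\<^sup>+x. ennreal (f x) \<partial>M) < \<infinity>" unfolding If using C(1) by (rule le_less_trans) simp
 qed (use f0 in auto)
 have "ennreal (\<integral>x. f x \<partial>M) = (\<integral>\<^sup>+x. ennreal (f x) \<partial>M)"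
  by (rule nn_integral_eq_integral[symmetric, OF fi]) (simp add: f0)
 then have "ennreal (\<integral>x. f x \<partial>M) <= ennreal C" using C(1) unfolding If by (simp only:)
 then have fC: "(\<integral>x. f x \<partial>M) <= C" unfolding ennreal_le_iff[OF C(2)] .
 have lower: "AE x in M. ln (a x) - f x / \<theta> <= ln (b x)"
  using a(1) pos
 proof eventually_elim
  case (elim x)
  have "f x = exp (\<theta> * (ln (a x) - ln (b x)))"
   using elim by (simp add: f_def powr_def ln_div algebra_simps)
  then have "\<theta> * (ln (a x) - ln (b x)) <= f x" using exp_ge_add_one_self[of "\<theta> * (ln (a x) - ln (b x))"] by linarith
  then show ?case using \<theta> by (simp add: field_simps)
 qed
 have upper: "AE x in M. ln (b x) <= w x"
  using pos w(2)
 proof eventually_elim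
  case (elim x)
  then have "ln (b x) <= ln (exp (w x))" by (subst ln_le_cancel_iff) auto
  then show ?case by simp
 qed
 have li: "integrable M (%x. ln (a x) - f x / \<theta>)" using a(2) fi by simp
 show int: "integrable M (%x. ln (b x))"
  by (rule integrable_sandwich[OF li w(1) _ lower upper]) measurable
 have "(\<integral>x. ln (a x) - f x / \<theta> \<partial>M) <= (\<integral>x. ln (b x) \<partial>M)"
  by (rule integral_mono_AE[OF li int lower])
 moreover have "(\<integral>x. ln (a x) - f x / \<theta> \<partial>M) = (\<integral>x. ln (a x) \<partial>M) - (\<integral>x. f x \<partial>M) / \<theta>"
  using a(2) fi by simp
 moreover have "(\<integral>x. f x \<partial>M) / \<theta> <= C / \<theta>" using fC \<theta> by (simp add: divide_right_mono)
 ultimately show "(\<integral>x. ln (a x) \<partial>M) - C / \<theta> <= (\<integral>x. ln (b x) \<partial>M)" by linarith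
qed

context bernoulli_shift begin

lemma upd_measurable: "(%(z, X). X(t := z)) \<in> \<gamma> \<Otimes>\<^sub>M (\<Pi>\<^sub>M n\<in>I. \<gamma>) \<rightarrow>\<^sub>M (\<Pi>\<^sub>M n\<in>insert t I. \<gamma>)" for t :: int
 by (rule measurable_fun_upd[where J=I, THEN measurable_cong[THEN iffD1, rotated]]) (auto simp: split_def)

text \<open>Fubini with coordinate \<open>t\<close> split off. Integrating an independent copy
  \<open>z\<close> in its place expresses the conditional expectation given the other
  coordinates.\<close>

lemma nn_integral_resample:
 assumes [measurable]: "F \<in> borel_measurable Q"
 shows "(\<integral>\<^sup>+d. F d \<partial>Q) = (\<integral>\<^sup>+d. (\<integral>\<^sup>+z. F (d(t := z)) \<partial>\<gamma>) \<partial>Q)"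
proof -
 let ?I = "UNIV - {t}"
 let ?R = "\<Pi>\<^sub>M n\<in>?I. \<gamma>"
 have ins: "insert t ?I = UNIV" by auto
 note ps = prob_space_axioms and es = emeasure_space_1 and bm = borel_measurable_nn_integral
 interpret R: prob_space ?R by (rule prob_space_PiM) (rule prob_space_axioms)
 interpret pair_prob_space \<gamma> ?R ..
 have upd [measurable]: "(%(z, X). X(t := z)) \<in> \<gamma> \<Otimes>\<^sub>M ?R \<rightarrow>\<^sub>M Q"
  using upd_measurable[of t ?I] unfolding ins Q_def .
 have Qd: "Q = distr (\<gamma> \<Otimes>\<^sub>M ?R) Q (%(z, X). X(t := z))"
  using distr_pair_PiM_eq_PiM[of ?I "%_. \<gamma>" t] ps unfolding ins Q_def by simp
 have Fm: "(%(z, X). F (X(t := z))) \<in> borel_measurable (\<gamma> \<Otimes>\<^sub>M ?R)"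
  using measurable_compose[OF upd assms] by (simp add: split_def)
 have swap: "(\<integral>\<^sup>+d. G d \<partial>Q) = (\<integral>\<^sup>+X. (\<integral>\<^sup>+z. G (X(t := z)) \<partial>\<gamma>) \<partial>?R)" if G: "G \<in> borel_measurable Q" for G
 proof -
  have Gm: "(%(z, X). G (X(t := z))) \<in> borel_measurable (\<gamma> \<Otimes>\<^sub>M ?R)"
   using measurable_compose[OF upd G] by (simp add: split_def)
  have "(\<integral>\<^sup>+d. G d \<partial>Q) = (\<integral>\<^sup>+d. G d \<partial>(distr (\<gamma> \<Otimes>\<^sub>M ?R) Q (%(z, X). X(t := z))))" using Qd by simp
  also have "... = (\<integral>\<^sup>+p. G (case p of (z, X) => X(t := z)) \<partial>(\<gamma> \<Otimes>\<^sub>M ?R))" by (rule nn_integral_distr[OF upd]) (use G in simp)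
  also have "... = (\<integral>\<^sup>+p. (case p of (z, X) => G (X(t := z))) \<partial>(\<gamma> \<Otimes>\<^sub>M ?R))" by (rule nn_integral_cong) (simp add: split_def)
  also have "... = (\<integral>\<^sup>+X. (\<integral>\<^sup>+z. G (X(t := z)) \<partial>\<gamma>) \<partial>?R)" using nn_integral_snd[OF Gm] by (simp add: split_def)
  finally show ?thesis .
 qed
 have "(%d. \<integral>\<^sup>+z. F (d(t := z)) \<partial>\<gamma>) \<in> borel_measurable Q"
 proof (rule bm)
  have "(%p. (fst p)(t := snd p)) \<in> Q \<Otimes>\<^sub>M \<gamma> \<rightarrow>\<^sub>M Q"
   unfolding Q_def by (rule measurable_fun_upd[where J=UNIV]) auto
  from measurable_compose[OF this assms]
  show "(%(d, z). F (d(t := z))) \<in> borel_measurable (Q \<Otimes>\<^sub>M \<gamma>)" by (simp add: split_def)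
 qed
 from swap[OF this] have "(\<integral>\<^sup>+d. (\<integral>\<^sup>+z. F (d(t := z)) \<partial>\<gamma>) \<partial>Q) = (\<integral>\<^sup>+X. (\<integral>\<^sup>+y. (\<integral>\<^sup>+z. F (X(t := z)) \<partial>\<gamma>) \<partial>\<gamma>) \<partial>?R)" by simp
 also have "... = (\<integral>\<^sup>+X. (\<integral>\<^sup>+z. F (X(t := z)) \<partial>\<gamma>) \<partial>?R)" by (simp add: es)
 also have "... = (\<integral>\<^sup>+d. F d \<partial>Q)" by (rule swap[OF assms, symmetric])
 finally show ?thesis ..
qed

end

context gauss begin

lemma nn_integral_square_N01: "(\<integral>\<^sup>+g. ennreal (g\<^sup>2) \<partial>N01) = 1"
proof -
 have h: "has_bochner_integral lborel (%x. std_normal_density x * x\<^sup>2) 1"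
  using std_normal_moment_even[of 1] by simp
 have "(\<integral>\<^sup>+g. ennreal (g\<^sup>2) \<partial>N01) = (\<integral>\<^sup>+g. ennreal (std_normal_density g * g\<^sup>2) \<partial>lborel)"
  by (subst nn_integral_N01) (auto simp: ennreal_mult)
 also have "... = ennreal 1"
  using h by (subst nn_integral_eq_integral) (auto simp: has_bochner_integral_iff)
 finally show ?thesis by simp
qed

lemma nn_integral_SHS_term: "(\<integral>\<^sup>+\<Delta>. ennreal (SHS_term e \<Delta> p) \<partial>\<gamma>) = ennreal ((wt p * sd p)\<^sup>2)"
proof -
 have "(\<integral>\<^sup>+\<Delta>. ennreal (SHS_term e \<Delta> p) \<partial>\<gamma>) = (\<integral>\<^sup>+y. ennreal ((wt p * y)\<^sup>2) \<partial>(distr \<gamma> borel (matrix_entry e p)))"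
  by (subst nn_integral_distr) (auto simp: SHS_term_eq)
 also have "... = (\<integral>\<^sup>+g. ennreal ((wt p * (sd p * g))\<^sup>2) \<partial>N01)"
  unfolding distr_entry by (subst nn_integral_distr) auto
 also have "... = (\<integral>\<^sup>+g. ennreal ((wt p * sd p)\<^sup>2) * ennreal (g\<^sup>2) \<partial>N01)"
  by (simp add: ennreal_mult[symmetric] power_mult_distrib mult.assoc)
 also have "... = ennreal ((wt p * sd p)\<^sup>2) * (\<integral>\<^sup>+g. ennreal (g\<^sup>2) \<partial>N01)"
  by (rule nn_integral_cmult) auto
 finally show ?thesis by (simp add: nn_integral_square_N01)
qed

text \<open>The term with indices \<open>i\<close>, \<open>j\<close> has mean
  \<open>(4/9) ^ (Suc i + Suc j)\<close>, so the partial sums factor into two geometric sums below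
  4/5.\<close>

lemma nn_integral_SHS_norm_sq: "(\<integral>\<^sup>+\<Delta>. ennreal ((SHS_norm e \<Delta>)\<^sup>2) \<partial>\<gamma>) <= 1"
proof -
 let ?r = "%n \<Delta>. ennreal (\<Sum>p\<in>{..<n} \<times> {..<n}. SHS_term e \<Delta> p)"
 have meas [measurable]: "(%\<Delta>. SHS_term e \<Delta> p) \<in> borel_measurable \<gamma>" for p
  unfolding SHS_term_eq by measurable
 have bd: "(\<integral>\<^sup>+\<Delta>. ?r n \<Delta> \<partial>\<gamma>) <= 1" for n
 proof -
  have geo: "(\<Sum>i<n. (4/9::real) ^ Suc i) = 4/5 * (1 - (4/9) ^ n)" by (induction n) (simp_all add: algebra_simps)
  have "(\<integral>\<^sup>+\<Delta>. ?r n \<Delta> \<partial>\<gamma>) = (\<integral>\<^sup>+\<Delta>. (\<Sum>p\<in>{..<n} \<times> {..<n}. ennreal (SHS_term e \<Delta> p)) \<partial>\<gamma>)"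
   by (intro nn_integral_cong sum_ennreal[symmetric]) (simp add: SHS_term_nonneg)
  also have "... = (\<Sum>p\<in>{..<n} \<times> {..<n}. ennreal ((wt p * sd p)\<^sup>2))"
   by (subst nn_integral_sum) (auto simp: nn_integral_SHS_term)
  also have "... = ennreal (\<Sum>p\<in>{..<n} \<times> {..<n}. (wt p * sd p)\<^sup>2)"
   by (rule sum_ennreal) simp
  also have "(\<Sum>p\<in>{..<n} \<times> {..<n}. (wt p * sd p)\<^sup>2) = (\<Sum>i<n. \<Sum>j<n. (4/9) ^ Suc i * (4/9) ^ Suc j)"
  proof -
   have "(wt (i, j) * sd (i, j))\<^sup>2 = (4/9) ^ Suc i * (4/9) ^ Suc j" for i j
   proof -
    have "wt (i, j) * sd (i, j) = (2/3) ^ (Suc i + Suc j)"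
     unfolding wt_def sd_def split power_mult_distrib[symmetric] by simp
    then have "(wt (i, j) * sd (i, j))\<^sup>2 = ((2/3)\<^sup>2) ^ (Suc i + Suc j)" by (simp only: power_mult[symmetric] mult.commute)
    also have "... = (4/9) ^ (Suc i + Suc j)" by (simp add: power2_eq_square)
    finally show ?thesis by (simp only: power_add)
   qed
   then have "(\<Sum>p\<in>{..<n} \<times> {..<n}. (wt p * sd p)\<^sup>2) = (\<Sum>(i, j)\<in>{..<n} \<times> {..<n}. (4/9) ^ Suc i * (4/9) ^ Suc j)"
    by (intro sum.cong) auto
   then show ?thesis by (simp only: sum.cartesian_product)
  qed
  also have "... = (\<Sum>i<n. (4/9::real) ^ Suc i) * (\<Sum>j<n. (4/9) ^ Suc j)"
   by (simp only: sum_product)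
  also have "... <= 1"
  proof -
   have "0 <= (\<Sum>i<n. (4/9::real) ^ Suc i)" by (rule sum_nonneg) simp
   moreover have "(\<Sum>i<n. (4/9::real) ^ Suc i) <= 1"
   proof -
    have g: "4/5 * (1 - x) <= 1" if "0 <= x" for x :: real using that by simp
    show ?thesis unfolding geo by (rule g) simp
   qed
   ultimately show ?thesis by (intro mult_le_one)
  qed
  finally show ?thesis by (simp add: ennreal_leI)
 qed
 have "(\<integral>\<^sup>+\<Delta>. ennreal ((SHS_norm e \<Delta>)\<^sup>2) \<partial>\<gamma>) <= (\<integral>\<^sup>+\<Delta>. (SUP n. ?r n \<Delta>) \<partial>\<gamma>)"
 proof (rule nn_integral_mono)
  fix \<Delta> assume "\<Delta> \<in> space \<gamma>"
  show "ennreal ((SHS_norm e \<Delta>)\<^sup>2) <= (SUP n. ?r n \<Delta>)"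
  proof (cases "(SUP n. ?r n \<Delta>) = \<infinity>")
   case True
   show ?thesis unfolding True by (simp only: infinity_ennreal_def top_greatest)
  next
   case False
   then obtain K where K: "0 <= K" "(SUP n. ?r n \<Delta>) = ennreal K" by (cases "SUP n. ?r n \<Delta>") auto
   have r: "(\<Sum>p\<in>{..<n} \<times> {..<n}. SHS_term e \<Delta> p) <= K" for n
   proof -
    have "?r n \<Delta> <= ennreal K" unfolding K(2)[symmetric] by (rule SUP_upper) simp
    then show ?thesis using K(1) by (simp add: ennreal_le_iff)
   qed
   have "SHS_norm e \<Delta> <= sqrt K"
   proof (rule SHS_I(2))
    fix F :: "(nat \<times> nat) set" assume F: "finite F"
    define n where "n = Suc (\<Sum>p\<in>F. fst p + snd p)"
    have "F \<subseteq> {..<n} \<times> {..<n}"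
    proof
     fix p assume "p \<in> F"
     then have "fst p + snd p <= (\<Sum>p\<in>F. fst p + snd p)" by (intro member_le_sum[where f="%p. fst p + snd p"] F) auto
     then show "p \<in> {..<n} \<times> {..<n}" by (cases p) (simp add: n_def)
    qed
    then have "(\<Sum>p\<in>F. SHS_term e \<Delta> p) <= (\<Sum>p\<in>{..<n} \<times> {..<n}. SHS_term e \<Delta> p)"
     by (intro sum_mono2) (auto simp: SHS_term_nonneg)
    also have "... <= (sqrt K)\<^sup>2" using r[of n] K(1) by simp
    finally show "(\<Sum>p\<in>F. SHS_term e \<Delta> p) <= (sqrt K)\<^sup>2" .
   qed (use K in simp)
   then have "(SHS_norm e \<Delta>)\<^sup>2 <= (sqrt K)\<^sup>2" by (intro power_mono SHS_norm_nonneg)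
   then show ?thesis unfolding K(2) using K(1) by (simp add: ennreal_leI)
  qed
 qed
 also have "... = (SUP n. \<integral>\<^sup>+\<Delta>. ?r n \<Delta> \<partial>\<gamma>)"
 proof (rule nn_integral_monotone_convergence_SUP)
  show "incseq ?r"
  proof (rule incseq_SucI, rule le_funI)
   fix n \<Delta>
   show "?r n \<Delta> <= ?r (Suc n) \<Delta>" by (intro ennreal_leI sum_mono2) (auto simp: SHS_term_nonneg)
  qed
 qed measurable
 also have "... <= 1" by (rule SUP_least) (rule bd)
 finally show ?thesis .
qed

lemma SHS_norm_meas_\<gamma> [measurable]: "SHS_norm e \<in> borel_measurable \<gamma>"
 using SHS_norm_measurable by (simp cong: measurable_cong_sets add: sets_\<gamma>)

lemma integrable_SHS_norm_sq: "integrable \<gamma> (%\<Delta>. (SHS_norm e \<Delta>)\<^sup>2)"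
 by (rule integrableI_nonneg) (use nn_integral_SHS_norm_sq in \<open>auto intro: le_less_trans\<close>)

lemma integrable_ln_SHS_norm: "integrable \<gamma> (%\<Delta>. ln (1 + SHS_norm e \<Delta>))"
proof (rule Bochner_Integration.integrable_bound)
 show "integrable \<gamma> (%\<Delta>. 1 + (SHS_norm e \<Delta>)\<^sup>2)" using integrable_SHS_norm_sq by simp
 have "\<bar>ln (1 + s)\<bar> <= 1 + s\<^sup>2" if "0 <= s" for s :: real
 proof -
  have "ln (1 + s) <= s" using that by (intro ln_add_one_self_le_self) auto
  also have "... <= 1 + s\<^sup>2" using zero_le_power2[of "s - 1"] that by (simp add: power2_diff)
  finally show ?thesis using that by simp
 qed
 then show "AE \<Delta> in \<gamma>. norm (ln (1 + SHS_norm e \<Delta>)) <= norm (1 + (SHS_norm e \<Delta>)\<^sup>2)"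
  by (simp add: SHS_norm_nonneg)
qed measurable

end

section \<open>The perturbed cocycle as a submultiplicative process\<close>

lemma cocycle_add: "cocycle T A (n + m) x = cocycle T A m ((T ^^ n) x) oL cocycle T A n x"
proof (induction m)
 case 0
 show ?case by (rule blinfun_eqI) simp
next
 case (Suc m)
 have "(T ^^ (n + m)) x = (T ^^ m) ((T ^^ n) x)" by (simp add: funpow_add add.commute[of n])
 then show ?case using Suc by (intro blinfun_eqI) simp
qed

lemma cocycle_1: "cocycle T A (Suc 0) x = A x"
 by (rule blinfun_eqI) simp

locale perturbation = gauss e \<gamma> for e :: "nat => 'h::{real_inner,complete_space}" and \<gamma> +
 fixes P :: "'w measure" and \<sigma> :: "'w => 'w" and A :: "'w => 'h op"
 assumes erg: "ergodic_invariant P \<sigma>"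
  and A_meas [measurable]: "A \<in> P \<rightarrow>\<^sub>M SHS_space e"
  and A_int: "integrable P (%\<omega>. ln (1 + SHS_norm e (A \<omega>)))"
begin

sublocale B: bernoulli_shift \<gamma> ..

abbreviation PB :: "('w \<times> (int => 'h op)) measure" where "PB \<equiv> perturbed_measure P \<gamma>"
abbreviation TB :: "'w \<times> (int => 'h op) => 'w \<times> (int => 'h op)" where "TB \<equiv> perturbed_shift \<sigma>"
abbreviation gen :: "real => 'w \<times> (int => 'h op) => 'h op" where "gen \<equiv> perturbed_generator A"
abbreviation qq :: "real => nat => 'w \<times> (int => 'h op) => 'h op" where "qq eps \<equiv> cocycle TB (gen eps)"

abbreviation (input) EE_PB (binder "EE " 10) where "EE_PB f \<equiv> integral\<^sup>L PB f"
abbreviation (input) NN_PB (binder "NN " 10) where "NN_PB f \<equiv> integral\<^sup>N PB f"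

sublocale PP: prob_space P using erg by (simp add: ergodic_invariant_def)

sublocale E: ergodic_system PB TB
proof -
 have "ergodic_invariant PB TB" by (rule B.perturbed_ergodic[OF erg])
 then show "ergodic_system PB TB"
  by (simp add: ergodic_system_def ergodic_system_axioms_def ergodic_invariant_def)
qed

lemma PB_eq: "PB = P \<Otimes>\<^sub>M B.Q" by (simp add: perturbed_measure_def B.Q_def)

lemma fst_meas [measurable]: "fst \<in> PB \<rightarrow>\<^sub>M P" unfolding PB_eq by measurable

lemma coord_meas [measurable]: "(%x. snd x n) \<in> PB \<rightarrow>\<^sub>M \<gamma>"
 unfolding perturbed_measure_def by measurable

lemma coord_meas_SHS: "(%x. snd x n) \<in> PB \<rightarrow>\<^sub>M SHS_space e"
 using coord_meas by (simp cong: measurable_cong_sets add: sets_\<gamma>)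

lemma A_SHS: "\<omega> \<in> space P ==> A \<omega> \<in> SHS e"
 using measurable_space[OF A_meas] by (simp add: space_SHS_space)

lemma coord_SHS: "x \<in> space PB ==> snd x n \<in> SHS e"
 using measurable_space[OF coord_meas] by (simp add: space_\<gamma>)

lemma fst_space: "x \<in> space PB ==> fst x \<in> space P"
 by (rule measurable_space[OF fst_meas])

lemma gen_eq: "gen eps x = A (fst x) + eps *R snd x 0"
 by (simp add: perturbed_generator_def split_def)

lemma TB_iter: "(TB ^^ m) x = ((\<sigma> ^^ m) (fst x), B.S m (snd x))"
 using B.perturbed_shift_iter[of m \<sigma> "fst x" "snd x"] by simp

lemma gen_iter: "gen eps ((TB ^^ i) x) = A ((\<sigma> ^^ i) (fst x)) + eps *R snd x (int i)"
 by (simp add: gen_eq TB_iter B.S_def)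

lemma gen_SHS: "x \<in> space PB ==> gen eps x \<in> SHS e"
 unfolding gen_eq by (intro SHS_add_mem SHS_scaleR A_SHS coord_SHS fst_space)

text \<open>One integrable majorant for the logarithm of the generator norms, valid for all
  \<open>eps\<close> between 0 and 1.\<close>

definition U :: "'w \<times> (int => 'h op) => real" where
 "U x = ln (1 + SHS_norm e (A (fst x))) + ln (1 + SHS_norm e (snd x 0))"

lemma U_nonneg: "0 <= U x" by (simp add: U_def SHS_norm_nonneg)

lemma exp_U: "exp (U x) = (1 + SHS_norm e (A (fst x))) * (1 + SHS_norm e (snd x 0))"
proof -
 have "0 < 1 + SHS_norm e B" for B :: "'h op" using SHS_norm_nonneg[of B] by simp
 then show ?thesis by (simp add: U_def exp_add)
qed

lemma gen_norm:
 assumes x: "x \<in> space PB" and eps: "0 <= eps" "eps <= 1"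
 shows "1 + SHS_norm e (gen eps x) <= exp (U x)"
proof -
 have "SHS_norm e (gen eps x) <= SHS_norm e (A (fst x)) + \<bar>eps\<bar> * SHS_norm e (snd x 0)"
  unfolding gen_eq SHS_norm_scaleR[symmetric] by (intro SHS_triangle SHS_scaleR A_SHS coord_SHS fst_space x)
 also have "\<bar>eps\<bar> * SHS_norm e (snd x 0) <= 1 * SHS_norm e (snd x 0)"
  using eps by (intro mult_right_mono SHS_norm_nonneg) auto
 finally show ?thesis
  unfolding exp_U using mult_nonneg_nonneg[OF SHS_norm_nonneg[of "A (fst x)"] SHS_norm_nonneg[of "snd x 0"]] by (simp add: algebra_simps)
qed

lemma gen_op_norm:
 assumes x: "x \<in> space PB" and eps: "0 <= eps" "eps <= 1"
 shows "norm (gen eps x) <= exp (U x)"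
 using norm_le_SHS_norm[OF gen_SHS[OF x, of eps]] gen_norm[OF assms] by simp

lemma SHS_norm_A_meas [measurable]: "(%\<omega>. SHS_norm e (A \<omega>)) \<in> borel_measurable P"
 by (rule measurable_compose[OF A_meas SHS_norm_measurable])

lemma SHS_norm_fst_meas [measurable]: "(%x. SHS_norm e (A (fst x))) \<in> borel_measurable PB"
 by (rule measurable_compose[OF fst_meas SHS_norm_A_meas])

lemma SHS_norm_coord_meas [measurable]: "(%x. SHS_norm e (snd x n)) \<in> borel_measurable PB"
 by (rule measurable_compose[OF coord_meas_SHS SHS_norm_measurable])

lemma distr_fst: "distr PB P fst = P"
 unfolding PB_eq
 by (subst B.Q.distr_pair_fst) simp

lemma distr_coord: "distr PB \<gamma> (%x. snd x n) = \<gamma>"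
proof -
 have "distr PB \<gamma> (%x. snd x n) = distr (distr PB B.Q snd) \<gamma> (%d. d n)"
  unfolding PB_eq B.Q_def by (subst distr_distr) (auto simp: o_def)
 also have "distr PB B.Q snd = B.Q"
 proof -
  interpret pair_prob_space P B.Q ..
  show ?thesis
  proof (rule measure_eqI)
   fix X assume "X \<in> sets (distr PB B.Q snd)"
   then have X: "X \<in> sets B.Q" by simp
   have "emeasure (distr PB B.Q snd) X = emeasure (P \<Otimes>\<^sub>M B.Q) (space P \<times> X)"
    unfolding PB_eq using X sets.sets_into_space[OF X] by (subst emeasure_distr) (auto simp: space_pair_measure intro!: arg_cong2[where f=emeasure])
   also have "... = emeasure B.Q X"
    using X by (subst B.Q.emeasure_pair_measure_Times) (auto simp: PP.emeasure_space_1)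
   finally show "emeasure (distr PB B.Q snd) X = emeasure B.Q X" .
  qed simp
 qed
 also have "distr B.Q \<gamma> (%d. d n) = \<gamma>"
  unfolding B.Q_def by (rule distr_PiM_component) (auto simp: \<gamma>.prob_space_axioms)
 finally show ?thesis .
qed

lemma U_meas [measurable]: "U \<in> borel_measurable PB"
 unfolding U_def[abs_def] by measurable

lemma SA_int: "integrable PB (%x. ln (1 + SHS_norm e (A (fst x))))"
 using integrable_distr[OF fst_meas, of "%\<omega>. ln (1 + SHS_norm e (A \<omega>))"] A_int by (simp add: distr_fst)

lemma U_int: "integrable PB U"
proof -
 have "integrable PB (%x. ln (1 + SHS_norm e (snd x 0)))"
  using integrable_distr[OF coord_meas, of 0 "%\<Delta>. ln (1 + SHS_norm e \<Delta>)"] integrable_ln_SHS_norm by (simp add: distr_coord)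
 then show ?thesis unfolding U_def[abs_def] using SA_int by simp
qed

lemma weakly_measurable_map:
 assumes "weakly_measurable M' F" "g \<in> M \<rightarrow>\<^sub>M M'"
 shows "weakly_measurable M (%x. F (g x))"
 unfolding weakly_measurable_def
 by (intro allI measurable_compose[OF assms(2) weakly_measurableD[OF assms(1)]])

lemma gen_weak: "weakly_measurable PB (gen eps)"
 unfolding gen_eq[abs_def]
 by (intro weakly_measurable_add weakly_measurable_scaleR weakly_measurable_SHS coord_meas_SHS measurable_compose[OF fst_meas A_meas])

lemma qq_weak: "weakly_measurable PB (%x. qq eps n x)"
proof (induction n)
 case 0
 then show ?case by (simp add: weakly_measurable_const)
next
 case (Suc n)
 have "weakly_measurable PB (%x. gen eps ((TB ^^ n) x))"
  by (rule weakly_measurable_map[OF gen_weak E.iter_measurable])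
 from weakly_measurable_comp[OF this Suc] show ?case by simp
qed

lemma vol_qq_meas [measurable]: "(%x. vol k (qq eps n x)) \<in> borel_measurable PB"
 by (rule vol_measurable[OF qq_weak])

lemma mdet_qq_meas [measurable]: "(%x. mdet k (qq eps n x) y z) \<in> borel_measurable PB"
 by (rule mdet_measurable[OF qq_weak])

lemma vol_le_exp:
 assumes B: "norm B <= exp u" shows "vol k B <= exp (ln (fact k) + real k * u)"
proof -
 have "vol k B <= fact k * norm B ^ k" by (rule vol_le)
 also have "... <= fact k * exp u ^ k" using B by (intro mult_left_mono power_mono) auto
 also have "... = exp (ln (fact k) + real k * u)" by (simp add: exp_add exp_of_nat_mult)
 finally show ?thesis .
qed

lemma ln_max_vol_gen_le:
 assumes g: "norm (gen eps x) <= exp u" and u: "0 <= u"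
 shows "ln (max 1 (vol k (qq eps 1 x))) <= ln (fact k) + real k * u"
proof -
 have v: "vol k (qq eps 1 x) <= exp (ln (fact k) + real k * u)"
  unfolding One_nat_def cocycle_1 by (rule vol_le_exp[OF g])
 have "0 <= ln (fact k) + real k * u" using u by (simp add: ln_ge_zero_iff fact_ge_1)
 then have "max 1 (vol k (qq eps 1 x)) <= exp (ln (fact k) + real k * u)" using v by simp
 then have "ln (max 1 (vol k (qq eps 1 x))) <= ln (exp (ln (fact k) + real k * u))"
  by (subst ln_le_cancel_iff) auto
 then show ?thesis by simp
qed

lemma ln_vol_gen_le:
 assumes x: "x \<in> space PB" and eps: "0 <= eps" "eps <= 1"
 shows "ln (max 1 (vol k (qq eps 1 x))) <= ln (fact k) + real k * U x"
 by (rule ln_max_vol_gen_le[OF gen_op_norm[OF x eps] U_nonneg])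

text \<open>Exponents must exist for every positive \<open>eps\<close>, so the majorant
  \<open>U\<close> is raised by \<open>ln (1 + eps)\<close>, which also covers \<open>eps\<close>
  above 1.\<close>

lemma process_all:
 assumes eps: "0 <= eps"
 shows "submult_process PB TB (%n x. vol k (qq eps n x))"
proof (unfold_locales)
 show "vol k (qq eps (n + m) x) <= vol k (qq eps n x) * vol k (qq eps m ((TB ^^ n) x))" for n m x
  unfolding cocycle_add by (subst mult.commute) (rule vol_mult)
 show "integrable PB (%x. ln (max 1 (vol k (qq eps 1 x))))"
 proof (rule integrable_sandwich)
  show "integrable PB (%x. 0 :: real)" by simp
  show "integrable PB (%x. ln (fact k) + real k * (ln (1 + eps) + U x))" using U_int by simp
  show "AE x in PB. ln (max 1 (vol k (qq eps 1 x))) <= ln (fact k) + real k * (ln (1 + eps) + U x)"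
  proof (rule AE_I2, rule ln_max_vol_gen_le)
   fix x assume x: "x \<in> space PB"
   let ?a = "SHS_norm e (A (fst x))" and ?d = "SHS_norm e (snd x 0)"
   have nn: "0 <= ?a" "0 <= ?d" by (simp_all add: SHS_norm_nonneg)
   have "norm (gen eps x) <= SHS_norm e (gen eps x)" by (rule norm_le_SHS_norm[OF gen_SHS[OF x]])
   also have "... <= ?a + \<bar>eps\<bar> * ?d"
    unfolding gen_eq SHS_norm_scaleR[symmetric] by (intro SHS_triangle SHS_scaleR A_SHS coord_SHS fst_space x)
   also have "... <= (1 + eps) * ((1 + ?a) * (1 + ?d))"
    using eps nn mult_nonneg_nonneg[OF eps nn(1)] mult_nonneg_nonneg[OF nn] mult_nonneg_nonneg[OF eps mult_nonneg_nonneg[OF nn]]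
    by (simp add: algebra_simps)
   also have "... = exp (ln (1 + eps) + U x)" using eps by (simp add: exp_add exp_U)
   finally show "norm (gen eps x) <= exp (ln (1 + eps) + U x)" .
   show "0 <= ln (1 + eps) + U x" using eps U_nonneg[of x] by simp
  qed
  show "AE x in PB. 0 <= ln (max 1 (vol k (qq eps 1 x)))" by simp
 qed measurable
qed (auto simp: vol_nonneg)

lemma process:
 assumes eps: "0 <= eps" "eps <= 1"
 shows "submult_process PB TB (%n x. vol k (qq eps n x))"
 by (rule process_all[OF eps(1)])

text \<open>Puts \<open>z\<close> in place of the noise of time \<open>t\<close>; integration over
  \<open>z\<close> then conditions on everything else.\<close>

definition rs :: "nat => ('h op) => 'w \<times> (int => 'h op) => 'w \<times> (int => 'h op)" where
 "rs t z x = (fst x, (snd x)(int t := z))"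

lemma gen_rs: "gen eps ((TB ^^ i) (rs t z x)) = (if i = t then A ((\<sigma> ^^ t) (fst x)) + eps *R z else gen eps ((TB ^^ i) x))"
 by (simp add: gen_iter rs_def)

lemma qq_rs:
 assumes "t < s \<or> s + n <= t"
 shows "qq eps n ((TB ^^ s) (rs t z x)) = qq eps n ((TB ^^ s) x)"
 using assms
proof (induction n)
 case (Suc n)
 have 1: "(TB ^^ n) ((TB ^^ s) y) = (TB ^^ (n + s)) y" for y by (simp add: funpow_add)
 have "gen eps ((TB ^^ (n + s)) (rs t z x)) = gen eps ((TB ^^ (n + s)) x)"
  unfolding gen_rs using Suc.prems by auto
 then show ?case using Suc by (auto simp: 1)
qed simp

lemma qq_rs0: "n <= t ==> qq eps n (rs t z x) = qq eps n x"
 using qq_rs[of t 0 n eps z x] by simp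

lemma resample_measurable:
 assumes F: "F \<in> borel_measurable PB"
 shows "(%x. \<integral>\<^sup>+z. F (rs t z x) \<partial>\<gamma>) \<in> borel_measurable PB"
proof (rule \<gamma>.borel_measurable_nn_integral)
 have Fm: "F \<in> borel_measurable (P \<Otimes>\<^sub>M B.Q)" using F by (simp add: PB_eq)
 have "(%p. (snd (fst p))(int t := snd p)) \<in> (P \<Otimes>\<^sub>M B.Q) \<Otimes>\<^sub>M \<gamma> \<rightarrow>\<^sub>M B.Q"
  unfolding B.Q_def by (rule measurable_fun_upd[where J=UNIV]) auto
 then have "(%p. rs t (snd p) (fst p)) \<in> (P \<Otimes>\<^sub>M B.Q) \<Otimes>\<^sub>M \<gamma> \<rightarrow>\<^sub>M P \<Otimes>\<^sub>M B.Q"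
  unfolding rs_def by (rule measurable_Pair[OF measurable_compose[OF measurable_fst measurable_fst]])
 from measurable_compose[OF this Fm]
 show "(%(x, z). F (rs t z x)) \<in> borel_measurable (PB \<Otimes>\<^sub>M \<gamma>)" unfolding PB_eq by (simp add: split_def)
qed

lemma resample:
 assumes F: "F \<in> borel_measurable PB"
 shows "(NN x. F x) = (NN x. (\<integral>\<^sup>+z. F (rs t z x) \<partial>\<gamma>))"
proof -
 have Fm: "F \<in> borel_measurable (P \<Otimes>\<^sub>M B.Q)" using F by (simp add: PB_eq)
 note Gm = resample_measurable[OF F, of t, unfolded PB_eq]
 have "(NN x. F x) = (\<integral>\<^sup>+\<omega>. (\<integral>\<^sup>+d. F (\<omega>, d) \<partial>B.Q) \<partial>P)"
  unfolding PB_eq by (rule B.Q.nn_integral_fst[symmetric, OF Fm])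
 also have "... = (\<integral>\<^sup>+\<omega>. (\<integral>\<^sup>+d. (\<integral>\<^sup>+z. F (\<omega>, d(int t := z)) \<partial>\<gamma>) \<partial>B.Q) \<partial>P)"
  by (intro nn_integral_cong B.nn_integral_resample) (use Fm in measurable)
 also have "... = (NN x. (\<integral>\<^sup>+z. F (rs t z x) \<partial>\<gamma>))"
  unfolding PB_eq using B.Q.nn_integral_fst[OF Gm] by (simp add: rs_def)
 finally show ?thesis .
qed

lemma resample_le:
 assumes F: "F \<in> borel_measurable PB" and le: "\<And>x. x \<in> space PB ==> (\<integral>\<^sup>+z. F (rs t z x) \<partial>\<gamma>) <= G x"
 shows "(NN x. F x) <= (NN x. G x)"
 unfolding resample[OF F, of t] by (rule nn_integral_mono) (rule le)

end

text \<open>One step of the replacement argument, with \<open>eps = q ^ 4\<close>: \<open>d\<close> measures how badly conditioned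
 the product is and \<open>s\<close> is the size of the noise. If both are moderate the determinant hardly
 changes; otherwise the loss is dominated by the negative moment \<open>(v' / v) powr (- \<theta>)\<close>.\<close>

lemma loss_pointwise:
 fixes q v v' \<theta> s d :: real
 assumes q: "0 < q" "q\<^sup>2 <= 1/2" and v: "0 < v" "0 < v'" and \<theta>: "0 < \<theta>" and sd: "0 <= s" "0 <= d"
  and pert: "s <= 1 / q ==> v <= v' + v * q ^ 4 * s * exp d"
 defines "f \<equiv> \<bar>v' / v\<bar> powr (- \<theta>)"
 shows "ln v - ln v' <= 2 * q\<^sup>2 + (q * f + q * s\<^sup>2) / \<theta> + d / (- ln q) * (f / \<theta>)"
proof -
 have q1: "q < 1"
 proof (rule ccontr)
  assume "\<not> q < 1"
  then have "1 * 1 <= q * q" by (intro mult_mono) auto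
  then show False using q(2) by (simp add: power2_eq_square)
 qed
 have lq: "0 < - ln q" using q(1) q1 by simp
 have f: "f = exp (\<theta> * (ln v - ln v'))"
  unfolding f_def using v by (simp add: powr_def ln_div algebra_simps)
 have f0: "0 < f" by (simp add: f)
 have lf: "\<theta> * (ln v - ln v') = ln f" by (simp add: f)
 have nn: "0 <= 2 * q\<^sup>2" "0 <= (q * f + q * s\<^sup>2) / \<theta>"
  using q(1) f0 \<theta> sd by (auto intro!: divide_nonneg_pos add_nonneg_nonneg mult_nonneg_nonneg)
 have nn3: "0 <= d / (- ln q) * (f / \<theta>)"
  by (intro mult_nonneg_nonneg divide_nonneg_pos[OF sd(2) lq] divide_nonneg_pos[OF less_imp_le[OF f0] \<theta>])
 note nn = nn nn3
 consider "- ln q < d" | "1 / q < s" | "d <= - ln q" "s <= 1 / q" by linarith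
 then show ?thesis
 proof cases
  case 1
  have "\<theta> * (ln v - ln v') <= f" unfolding lf using ln_le_minus_one[OF f0] by simp
  then have "ln v - ln v' <= f / \<theta>" using \<theta> by (simp add: field_simps)
  also have "... <= d / (- ln q) * (f / \<theta>)"
  proof -
   have "1 <= d / (- ln q)" using 1 lq by (subst le_divide_eq) simp
   then have "1 * (f / \<theta>) <= d / (- ln q) * (f / \<theta>)" using f0 \<theta> by (intro mult_right_mono) auto
   then show ?thesis by simp
  qed
  finally show ?thesis using nn by linarith
 next
  case 2
  \<comment> \<open>As \<open>s\<close> exceeds \<open>1 / q\<close>, the term \<open>1 / q\<close>
    is paid for by \<open>q * s^2\<close>, whose mean is small because the noise has a bounded
    second moment.\<close>
  have "ln f = ln (q * f) + ln (1 / q)" using q f0 by (simp add: ln_mult ln_div)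
  also have "... <= q * f + 1 / q"
   using ln_le_minus_one[of "q * f"] ln_le_minus_one[of "1 / q"] q f0 by simp
  also have "1 / q <= q * s\<^sup>2"
  proof -
   have "(1 / q)\<^sup>2 <= s\<^sup>2" using 2 q by (intro power_mono) auto
   then have "q * (1 / q)\<^sup>2 <= q * s\<^sup>2" using q by (intro mult_left_mono) auto
   then show ?thesis using q by (simp add: power2_eq_square)
  qed
  finally have "\<theta> * (ln v - ln v') <= q * f + q * s\<^sup>2" unfolding lf by simp
  then have "ln v - ln v' <= (q * f + q * s\<^sup>2) / \<theta>" using \<theta> by (simp add: field_simps)
  then show ?thesis using nn by linarith
 next
  case 3
  \<comment> \<open>Both \<open>s\<close> and \<open>exp d\<close> are at most \<open>1 / q\<close>,
    so two of the four powers in \<open>q ^ 4\<close> survive.\<close>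
  have "exp d <= exp (- ln q)" using 3 by simp
  then have ed: "exp d <= 1 / q" using q by (simp add: exp_minus inverse_eq_divide)
  have "s * exp d <= (1 / q) * (1 / q)" using 3 ed sd q by (intro mult_mono) auto
  then have "v * q ^ 4 * (s * exp d) <= v * q ^ 4 * ((1 / q) * (1 / q))" using v q by (intro mult_left_mono) auto
  also have "... = v * q\<^sup>2" using q by (simp add: field_simps power2_eq_square power4_eq_xxxx)
  finally have "v * (1 - q\<^sup>2) <= v'" using pert[OF 3(2)] by (simp add: algebra_simps)
  then have "ln (v * (1 - q\<^sup>2)) <= ln v'" using v q by (subst ln_le_cancel_iff) auto
  then have "ln v + ln (1 - q\<^sup>2) <= ln v'" using v q by (simp add: ln_mult)
  moreover have "- q\<^sup>2 - 2 * (q\<^sup>2)\<^sup>2 <= ln (1 - q\<^sup>2)"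
   by (rule ln_one_minus_pos_lower_bound) (use q in auto)
  moreover have "(q\<^sup>2)\<^sup>2 <= q\<^sup>2 * (1/2)" unfolding power2_eq_square[of "q\<^sup>2"] using q by (intro mult_left_mono) auto
  ultimately have "ln v - ln v' <= 2 * q\<^sup>2" by linarith
  then show ?thesis using nn by linarith
 qed
qed

lemma discrete_gronwall:
 fixes D :: "nat => real"
 assumes step: "\<And>t. t < n ==> D (Suc t) <= (1 + \<beta>) * D t + r" and nn: "0 <= \<beta>" "0 <= r"
 shows "t <= n ==> D t <= (1 + \<beta>) ^ t * (D 0 + real t * r)"
proof (induction t)
 case (Suc t)
 have "D (Suc t) <= (1 + \<beta>) * D t + r" using Suc by (intro step) simp
 also have "... <= (1 + \<beta>) * ((1 + \<beta>) ^ t * (D 0 + real t * r)) + (1 + \<beta>) ^ Suc t * r"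
 proof (rule add_mono)
  show "(1 + \<beta>) * D t <= (1 + \<beta>) * ((1 + \<beta>) ^ t * (D 0 + real t * r))" using Suc nn by (intro mult_left_mono) auto
  have "1 * r <= (1 + \<beta>) ^ Suc t * r" using nn by (intro mult_right_mono one_le_power) auto
  then show "r <= (1 + \<beta>) ^ Suc t * r" by simp
 qed
 also have "... = (1 + \<beta>) ^ Suc t * (D 0 + real (Suc t) * r)" by (simp add: algebra_simps)
 finally show ?case .
qed simp

section \<open>Upper semicontinuity and a priori upper bounds\<close>

context perturbation begin

definition lam :: "nat => real => ereal" where
 "lam k eps = submult_process.lyap PB (%n x. vol k (qq eps n x))"

definition tr :: "nat => real => nat => nat => 'w \<times> (int => 'h op) => real" where
 "tr k eps m K x = ln (max (vol k (qq eps m x)) (exp (- real K)))"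

lemma tr_eq: "0 <= eps ==> eps <= 1 ==> submult_process.Dtr (%n x. vol k (qq eps n x)) m K x = tr k eps m K x"
 by (simp add: submult_process.Dtr_def[OF process] tr_def)

lemma tr_bound:
 assumes eps: "0 <= eps" "eps <= 1" and m: "0 < m" and x: "x \<in> space PB"
 shows "\<bar>tr k eps m K x\<bar> <= real K + (\<Sum>j<m. ln (fact k) + real k * U ((TB ^^ j) x))"
proof -
 interpret D: submult_process PB TB "%n x. vol k (qq eps n x)" by (rule process[OF eps])
 have 1: "- real K <= tr k eps m K x" using D.Dtr_ge[of K m x] by (simp add: tr_eq[OF eps])
 have "tr k eps m K x <= (\<Sum>j<m. D.Dh ((TB ^^ j) x))" using D.Dtr_le[OF m, of K x] by (simp add: tr_eq[OF eps])
 also have "... <= (\<Sum>j<m. ln (fact k) + real k * U ((TB ^^ j) x))"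
  unfolding D.Dh_def by (intro sum_mono ln_vol_gen_le eps E.iter_space x)
 finally have 2: "tr k eps m K x <= (\<Sum>j<m. ln (fact k) + real k * U ((TB ^^ j) x))" .
 have "0 <= (\<Sum>j<m. ln (fact k :: real) + real k * U ((TB ^^ j) x))"
  by (intro sum_nonneg add_nonneg_nonneg mult_nonneg_nonneg U_nonneg) (auto simp: ln_ge_zero_iff fact_ge_1)
 with 1 2 show ?thesis by (simp add: abs_le_iff)
qed

lemma tr_meas [measurable]: "tr k eps m K \<in> borel_measurable PB"
 unfolding tr_def[abs_def] by measurable

lemma qq_tendsto: assumes X: "X ----> eps" shows "(%i. qq (X i) m x) ----> qq eps m x"
proof (induction m)
 case (Suc m)
 have "(%i. gen (X i) ((TB ^^ m) x)) ----> gen eps ((TB ^^ m) x)"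
  unfolding gen_eq by (intro tendsto_add tendsto_scaleR tendsto_const X)
 then show ?case using Suc by (simp add: bounded_bilinear.tendsto[OF bounded_bilinear_blinfun_compose])
qed simp

lemma integral_tr_tendsto:
 assumes m: "0 < m"
 shows "((%eps. \<integral>x. tr k eps m K x \<partial>PB) \<longlongrightarrow> (EE x. tr k 0 m K x)) (at_right 0)"
 unfolding tendsto_at_iff_sequentially
proof (intro allI impI)
 fix X :: "nat => real" assume X: "\<forall>i. X i \<in> {0<..} - {0}" "X ----> 0"
 have "EV i. X i < 1" using X(2) by (rule order_tendstoD) simp
 then obtain N where N: "\<And>i. N <= i ==> X i < 1" unfolding eventually_sequentially by (elim exE) (rule that, blast)
 have lim: "(%i. X (i + N)) ----> 0" using X(2) by (rule LIMSEQ_ignore_initial_segment)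
 have "(%i. \<integral>x. tr k (X (i + N)) m K x \<partial>PB) ----> (EE x. tr k 0 m K x)"
 proof (rule integral_dominated_convergence)
  have i: "integrable PB (%x. ln (fact k) + real k * U ((TB ^^ j) x))" for j
   using E.integrable_iter[OF U_int, of j] by simp
  show "integrable PB (%x. real K + (\<Sum>j<m. ln (fact k) + real k * U ((TB ^^ j) x)))"
   using int_sum[of "{..<m}" PB "%j x. ln (fact k) + real k * U ((TB ^^ j) x)"] i by simp
  show "AE x in PB. (%i. tr k (X (i + N)) m K x) ----> tr k 0 m K x"
  proof (rule AE_I2)
   fix x
   have "0 < max (vol k (qq 0 m x)) (exp (- real K))" by (simp add: less_max_iff_disj)
   then have nz: "max (vol k (qq 0 m x)) (exp (- real K)) \<noteq> 0" by (rule not_sym[OF less_imp_neq])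
   have "(%i. qq (X (i + N)) m x) ----> qq 0 m x" by (rule qq_tendsto[OF lim])
   then have "(%i. max (vol k (qq (X (i + N)) m x)) (exp (- real K))) ----> max (vol k (qq 0 m x)) (exp (- real K))"
    by (intro tendsto_max tendsto_vol tendsto_const)
   from tendsto_ln[OF this nz] show "(%i. tr k (X (i + N)) m K x) ----> tr k 0 m K x"
    unfolding tr_def .
  qed
  show "AE x in PB. norm (tr k (X (i + N)) m K x) <= real K + (\<Sum>j<m. ln (fact k) + real k * U ((TB ^^ j) x))" for i
  proof (rule AE_I2)
   fix x assume x: "x \<in> space PB"
   have "0 <= X (i + N)" "X (i + N) <= 1" using X(1)[rule_format, of "i + N"] N[of "i + N"] by auto
   from tr_bound[OF this m x] show "norm (tr k (X (i + N)) m K x) <= real K + (\<Sum>j<m. ln (fact k) + real k * U ((TB ^^ j) x))" by simp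
  qed
 qed measurable
 then show "((%eps. \<integral>x. tr k eps m K x \<partial>PB) \<circ> X) ----> (EE x. tr k 0 m K x)"
  unfolding o_def by (rule LIMSEQ_offset[of "%i. \<integral>x. tr k (X i) m K x \<partial>PB" N])
qed

lemma lam_less_iff:
 assumes eps: "0 <= eps" "eps <= 1"
 shows "lam k eps < c \<longleftrightarrow> (\<exists>m>0. \<exists>K. ereal ((EE x. tr k eps m K x) / real m) < c)"
 unfolding lam_def submult_process.lyap_less_iff[OF process[OF eps]] tr_eq[OF eps] ..

lemma lam_upper:
 assumes c: "lam k 0 < c"
 shows "ER eps. lam k eps < c"
proof -
 obtain m K where m: "0 < m" "ereal ((EE x. tr k 0 m K x) / real m) < c"
 proof -
  have "\<exists>m>0. \<exists>K. ereal ((EE x. tr k 0 m K x) / real m) < c"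
   using c lam_less_iff[of 0 k c] by simp
  then show ?thesis by (elim exE conjE) (rule that)
 qed
 have "((%eps. ereal ((EE x. tr k eps m K x) / real m)) \<longlongrightarrow> ereal ((EE x. tr k 0 m K x) / real m)) (at_right 0)"
  unfolding lim_ereal by (intro tendsto_divide integral_tr_tendsto m tendsto_const) (use m in simp)
 then have "ER eps. ereal ((EE x. tr k eps m K x) / real m) < c" by (rule order_tendstoD) (rule m)
 moreover have "ER eps::real. 0 <= eps \<and> eps <= 1" by (rule eventually_at_rightI[of 0 1]) auto
 ultimately show ?thesis
 proof eventually_elim
  case (elim eps)
  then show ?case unfolding lam_less_iff[OF conjunct1[OF elim(2)] conjunct2[OF elim(2)]]
   by (intro exI[of _ m] exI[of _ K] conjI m(1)) simp
 qed
qed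

text \<open>A bound whose mean grows at a rate just above that of the unperturbed cocycle, with
  \<open>C\<close> common to all small \<open>eps\<close>, including 0, and all \<open>n\<close>. It
  controls the noise-free and the noisy parts of the mixed products in \<open>hybrid_step\<close>,
  where its locality permits resampling.\<close>

lemma exp_bound:
 assumes c: "lam k 0 < ereal a"
 shows "\<exists>eps0>0. eps0 <= 1 \<and> (\<exists>C\<ge>0. \<forall>eps. 0 <= eps --> eps <= eps0 --> (\<forall>n. \<exists>W. integrable PB W \<and>
  (\<forall>x. vol k (qq eps n x) <= fact k * exp (W x)) \<and> (EE x. W x) <= a * real n + C \<and>
  (\<forall>x y. (\<forall>j m. j + m <= n --> qq eps m ((TB ^^ j) x) = qq eps m ((TB ^^ j) y)) --> W x = W y)))"
proof -
 obtain m K where m: "0 < m" "ereal ((EE x. tr k 0 m K x) / real m) < ereal a"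
 proof -
  have "\<exists>m>0. \<exists>K. ereal ((EE x. tr k 0 m K x) / real m) < ereal a"
   using c lam_less_iff[of 0 k "ereal a"] by simp
  then show ?thesis by (elim exE conjE) (rule that)
 qed
 then have m2: "(EE x. tr k 0 m K x) < a * real m" by (simp add: divide_less_eq)
 have "ER eps. (EE x. tr k eps m K x) < a * real m"
  by (rule order_tendstoD(2)[OF integral_tr_tendsto[OF m(1)] m2])
 then obtain b where b: "0 < b" "\<And>eps. 0 < eps ==> eps < b ==> (EE x. tr k eps m K x) < a * real m"
  unfolding eventually_at_right_field by (elim exE conjE) (rule that, assumption, blast)
 define eps0 where "eps0 = min 1 (b / 2)"
 \<comment> \<open>The first part pays for rounding \<open>n\<close> to a multiple of
   \<open>m\<close>, the second for the incomplete block.\<close>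
 define C where "C = \<bar>a\<bar> * real m + real m * (ln (fact k) + real k * (EE x. U x))"
 have U0: "0 <= (EE x. U x)" by (rule Bochner_Integration.integral_nonneg) (rule U_nonneg)
 have C0: "0 <= C" unfolding C_def using U0 by (simp add: ln_ge_zero_iff fact_ge_1)
 have main: "\<exists>W. integrable PB W \<and>
  (\<forall>x. vol k (qq eps n x) <= fact k * exp (W x)) \<and> (EE x. W x) <= a * real n + C \<and>
  (\<forall>x y. (\<forall>j m. j + m <= n --> qq eps m ((TB ^^ j) x) = qq eps m ((TB ^^ j) y)) --> W x = W y)"
  if eps: "0 <= eps" "eps <= eps0" for eps n
 proof -
  have eps1: "eps <= 1" and epsb: "eps < b" using eps(2) b(1) by (auto simp: eps0_def)
  interpret D: submult_process PB TB "%n x. vol k (qq eps n x)" by (rule process[OF eps(1) eps1])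
  have c0: "vol k (qq eps 0 x) <= fact k" for x
   using vol_id_le by simp
  obtain W where W: "integrable PB W" "\<forall>x. vol k (qq eps n x) <= fact k * exp (W x)"
   "(EE x. W x) <= real (n div m) * (EE x. tr k eps m K x) + real m * (EE x. D.Dh x)"
   "\<forall>x y. (\<forall>j m. j + m <= n --> vol k (qq eps m ((TB ^^ j) x)) = vol k (qq eps m ((TB ^^ j) y))) --> W x = W y"
   using D.D_exp_bound[OF m(1) fact_ge_1 c0, of n K] unfolding tr_eq[OF eps(1) eps1] by (elim exE conjE) (rule that)
  have "(EE x. D.Dh x) <= (EE x. ln (fact k) + real k * U x)"
   by (rule integral_mono[OF D.Dh_int]) (use U_int ln_vol_gen_le[OF _ eps(1) eps1] in \<open>auto simp: D.Dh_def\<close>)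
  also have "... = ln (fact k) + real k * (EE x. U x)" using U_int by (simp add: E.prob_space)
  finally have dh: "real m * (EE x. D.Dh x) <= real m * (ln (fact k) + real k * (EE x. U x))" by (intro mult_left_mono) auto
  have "(EE x. tr k eps m K x) <= a * real m"
   using b(2)[of eps] eps(1) epsb m2 by (cases "eps = 0") auto
  then have "real (n div m) * (EE x. tr k eps m K x) <= real (n div m) * (a * real m)" by (intro mult_left_mono) auto
  also have "... = a * real n - a * real (n mod m)"
  proof -
   have "real n = real (n div m) * real m + real (n mod m)" unfolding of_nat_mult[symmetric] of_nat_add[symmetric] by simp
   then show ?thesis by (simp add: algebra_simps)
  qed
  also have "... <= a * real n + \<bar>a\<bar> * real m"
  proof -
   have "- a * real (n mod m) <= \<bar>a\<bar> * real m"
    by (rule mult_mono) (use m(1) in \<open>auto simp: less_imp_le\<close>)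
   then show ?thesis by simp
  qed
  finally have i3: "(EE x. W x) <= a * real n + C" using W(3) dh unfolding C_def by linarith
  have i4: "W x = W y" if "\<forall>j m. j + m <= n --> qq eps m ((TB ^^ j) x) = qq eps m ((TB ^^ j) y)" for x y
   by (rule W(4)[rule_format]) (simp add: that[rule_format])
  show ?thesis by (rule exI[of _ W], rule conjI, rule W(1), rule conjI, rule W(2), rule conjI, rule i3, intro allI impI, rule i4)
 qed
 have e0: "0 < eps0" "eps0 <= 1" using b(1) by (auto simp: eps0_def)
 show ?thesis
  by (rule exI[of _ eps0], rule conjI, rule e0, rule conjI, rule e0, rule exI[of _ C], rule conjI, rule C0, intro allI impI, rule main)
qed

end

section \<open>Switching on the noise one factor at a time\<close>

context perturbation begin

text \<open>Small enough for the negative moments of a polynomial of degree \<open>k\<close>, which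
  need \<open>k * \<theta> k <= 1/2\<close>, and for those of an affine function; the summand 1
  covers \<open>k = 0\<close>.\<close>

definition \<theta> :: "nat => real" where "\<theta> k = 1 / (2 * (real k + 1))"

lemma \<theta>: "0 < \<theta> k" "\<theta> k <= 1/2" "real k * \<theta> k <= 1/2"
 by (auto simp: \<theta>_def field_simps)

text \<open>The factor 2 pays for a tuple that attains only half of the supremum in
  \<open>vol\<close>.\<close>

definition Cn :: "nat => real" where "Cn k = enn2real (2 * Knm k)"

lemma Cn: "ennreal (Cn k) = 2 * Knm k" "0 <= Cn k"
 using Knm_finite[of k] by (auto simp: Cn_def ennreal_mult_less_top)

lemma id_meas_weak: "weakly_measurable \<gamma> (%z. z)"
 by (rule weakly_measurable_SHS) (simp cong: measurable_cong_sets add: sets_\<gamma>)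

lemma comp_weak:
 fixes L R A0 :: "'h op"
 shows "weakly_measurable \<gamma> (%z. L oL (A0 + eps *R z) oL R)"
 by (intro weakly_measurable_comp weakly_measurable_add weakly_measurable_scaleR weakly_measurable_const id_meas_weak)

text \<open>The supremum is handled by one fixed tuple that attains at least half of the noise-free
  volume; the perturbed volume dominates its determinant for every \<open>z\<close>.\<close>

lemma nn_integral_npow_vol:
 fixes L R A0 :: "'h op"
 assumes v: "0 < vol k (L oL A0 oL R)"
 shows "(\<integral>\<^sup>+z. npow (\<theta> k) (vol k (L oL (A0 + eps *R z) oL R) / vol k (L oL A0 oL R)) \<partial>\<gamma>) <= ennreal (Cn k)"
proof -
 let ?B = "%z. L oL (A0 + eps *R z) oL R"
 let ?v = "vol k (L oL A0 oL R)"
 obtain x y where xy: "\<forall>a. norm (x a) <= 1" "\<forall>a. norm (y a) <= 1" "?v / 2 < \<bar>mdet k (L oL A0 oL R) x y\<bar>"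
 proof -
  have "?v / 2 < ?v" using v by simp
  from vol_approx[OF this] show ?thesis by (elim exE conjE) (rule that)
 qed
 have "(\<integral>\<^sup>+z. npow (\<theta> k) (vol k (?B z) / ?v) \<partial>\<gamma>) <=
   (\<integral>\<^sup>+z. npow (\<theta> k) (1 / ?v) * npow (\<theta> k) (mdet k (?B z) x y) \<partial>\<gamma>)"
 proof (rule nn_integral_mono)
  fix z
  have "npow (\<theta> k) (vol k (?B z)) <= npow (\<theta> k) (mdet k (?B z) x y)"
   by (rule npow_antimono[OF \<theta>(1)]) (use vol_upper[of k x y] xy in \<open>auto simp: vol_nonneg\<close>)
  then have "npow (\<theta> k) (1 / ?v) * npow (\<theta> k) (vol k (?B z)) <=
   npow (\<theta> k) (1 / ?v) * npow (\<theta> k) (mdet k (?B z) x y)" by (rule mult_left_mono) simp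
  then show "npow (\<theta> k) (vol k (?B z) / ?v) <=
   npow (\<theta> k) (1 / ?v) * npow (\<theta> k) (mdet k (?B z) x y)"
   unfolding npow_mult[symmetric] by (simp only: mult.commute[of "1 / ?v"] times_divide_eq_right mult_1_right)
 qed
 also have "... = npow (\<theta> k) (1 / ?v) * (\<integral>\<^sup>+z. npow (\<theta> k) (mdet k (?B z) x y) \<partial>\<gamma>)"
 proof (rule nn_integral_cmult)
  show "(%z. npow (\<theta> k) (mdet k (?B z) x y)) \<in> borel_measurable \<gamma>"
   by (rule measurable_compose[OF mdet_measurable[OF comp_weak] npow_measurable])
 qed
 also have "... <= npow (\<theta> k) (1 / ?v) * (Knm k * npow (\<theta> k) (mdet k (L oL A0 oL R) x y))"
  by (intro mult_left_mono nn_integral_npow_mdet \<theta>) simp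
 also have "... <= npow (\<theta> k) (1 / ?v) * (Knm k * npow (\<theta> k) (?v / 2))"
  by (intro mult_left_mono npow_antimono[OF \<theta>(1)]) (use xy(3) v in auto)
 also have "... = Knm k * npow (\<theta> k) (1 / ?v * (?v / 2))"
  by (simp only: npow_mult mult.left_commute)
 also have "1 / ?v * (?v / 2) = 1 / 2" using v by simp
 also have "Knm k * npow (\<theta> k) (1 / 2) <= Knm k * 2"
 proof (rule mult_left_mono)
  have "(1/2::real) powr (- \<theta> k) = 2 powr \<theta> k" by (simp add: powr_minus powr_divide inverse_eq_divide)
  also have "... <= 2 powr 1" using \<theta>(2)[of k] by (intro powr_mono) auto
  finally have "ennreal ((1/2) powr (- \<theta> k)) <= ennreal 2" by (intro ennreal_leI) simp
  then show "npow (\<theta> k) (1 / 2) <= 2" by (simp add: npow_def)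
 qed simp
 finally show ?thesis unfolding Cn(1) by (simp only: mult.commute)
qed

definition EA :: real where "EA = (EE x. ln (1 + SHS_norm e (A (fst x))))"

text \<open>Interpolates between the noise-free product at \<open>t = 0\<close> and the noisy one at
  \<open>t = n\<close>.\<close>

definition hyb :: "real => nat => nat => 'w \<times> (int => 'h op) => 'h op" where
 "hyb eps n t x = qq 0 (n - t) ((TB ^^ t) x) oL qq eps t x"

lemma hyb_weak: "weakly_measurable PB (hyb eps n t)"
 unfolding hyb_def[abs_def]
 by (rule weakly_measurable_comp[OF weakly_measurable_map[OF qq_weak E.iter_measurable] qq_weak])

lemma hyb_meas [measurable]: "(%x. vol k (hyb eps n t x)) \<in> borel_measurable PB"
 by (rule vol_measurable[OF hyb_weak])

lemma hyb_split:
 assumes "t < n"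
 shows "hyb eps n t x = qq 0 (n - Suc t) ((TB ^^ Suc t) x) oL A ((\<sigma> ^^ t) (fst x)) oL qq eps t x"
  and "hyb eps n (Suc t) x = qq 0 (n - Suc t) ((TB ^^ Suc t) x) oL (A ((\<sigma> ^^ t) (fst x)) + eps *R snd x (int t)) oL qq eps t x"
proof -
 have n: "n - t = Suc 0 + (n - Suc t)" using assms by simp
 have "qq 0 (n - t) ((TB ^^ t) x) = qq 0 (n - Suc t) ((TB ^^ Suc t) x) oL gen 0 ((TB ^^ t) x)"
  unfolding n cocycle_add cocycle_1 by (simp del: cocycle.simps)
 then show "hyb eps n t x = qq 0 (n - Suc t) ((TB ^^ Suc t) x) oL A ((\<sigma> ^^ t) (fst x)) oL qq eps t x"
  by (simp add: hyb_def gen_iter)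
 show "hyb eps n (Suc t) x = qq 0 (n - Suc t) ((TB ^^ Suc t) x) oL (A ((\<sigma> ^^ t) (fst x)) + eps *R snd x (int t)) oL qq eps t x"
  unfolding hyb_def cocycle.simps(2)[of TB "gen eps"] gen_iter by (rule blinfun_eqI) simp
qed

text \<open>Collects the factor from \<open>vol_perturb\<close> and the factorials of three volume
  bounds, so that \<open>d\<close> in \<open>hybrid_step\<close> is nonnegative.\<close>

definition dd :: "nat => real" where "dd k = ln (real k + 1) + 3 * ln (fact k)"

text \<open>\<open>loss_pointwise\<close> in the mean. The weight \<open>d\<close> ignores the noise
  being switched on and \<open>f\<close> has conditional mean at most \<open>Cn k\<close>, so the
  product \<open>d * f\<close> costs at most a multiple of the mean of \<open>d\<close> divided by
  \<open>- ln q\<close>. The other terms vanish with \<open>q\<close>.\<close>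

lemma hybrid_step:
 assumes q: "0 < q" "q\<^sup>2 <= 1/2" and t: "t < n"
  and v: "AE x in PB. 0 < vol k (hyb (q ^ 4) n t x)" "integrable PB (%x. ln (vol k (hyb (q ^ 4) n t x)))"
  and WL: "integrable PB WL" "\<And>x. vol k (qq 0 (n - Suc t) x) <= fact k * exp (WL x)"
   "\<And>x z. WL ((TB ^^ Suc t) (rs t z x)) = WL ((TB ^^ Suc t) x)"
  and WR: "integrable PB WR" "\<And>x. vol k (qq (q ^ 4) t x) <= fact k * exp (WR x)" "\<And>x z. WR (rs t z x) = WR x"
 shows "AE x in PB. 0 < vol k (hyb (q ^ 4) n (Suc t) x)" (is ?P)
  "integrable PB (%x. ln (vol k (hyb (q ^ 4) n (Suc t) x)))" (is ?I)
  "(EE x. ln (vol k (hyb (q ^ 4) n t x))) -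
   (2 * q\<^sup>2 + q * (Cn k + 1) / \<theta> k + Cn k / (\<theta> k * (- ln q)) *
    (dd k + (EE x. WL x) + (EE x. WR x) + real k * EA - (EE x. ln (vol k (hyb (q ^ 4) n t x)))))
   <= (EE x. ln (vol k (hyb (q ^ 4) n (Suc t) x)))" (is ?L)
proof -
 let ?eps = "q ^ 4"
 define L where "L x = qq 0 (n - Suc t) ((TB ^^ Suc t) x)" for x
 define R where "R x = qq ?eps t x" for x
 define At where "At x = A ((\<sigma> ^^ t) (fst x))" for x :: "'w \<times> (int => 'h op)"
 define v where "v x = vol k (hyb ?eps n t x)" for x
 define v' where "v' x = vol k (hyb ?eps n (Suc t) x)" for x
 define s where "s x = SHS_norm e (snd x (int t))" for x :: "'w \<times> (int => 'h op)"
 define WL' where "WL' x = WL ((TB ^^ Suc t) x)" for x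
 define la where "la x = ln (1 + SHS_norm e (At x))" for x
 \<comment> \<open>Defined so that \<open>v x * exp (d x)\<close> is the a priori bound for the
   whole product, up to constants; \<open>d\<close> is thus the logarithmic gap between that bound
   and the actual volume.\<close>
 define d where "d x = dd k + WL' x + WR x + real k * la x - ln (v x)" for x
 have q1: "q < 1"
 proof (rule ccontr)
  assume "\<not> q < 1"
  then have "1 * 1 <= q * q" by (intro mult_mono) auto
  then show False using q(2) by (simp add: power2_eq_square)
 qed
 have eps: "0 <= ?eps" "?eps <= 1" using q q1 by (auto intro: power_le_one)
 have lq: "0 < - ln q" using q q1 by simp
 have v_eq: "v x = vol k (L x oL At x oL R x)" and v'_eq: "v' x = vol k (L x oL (At x + ?eps *R snd x (int t)) oL R x)" for x
  using hyb_split[OF t] by (simp_all add: v_def v'_def L_def At_def R_def)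
 have L_rs: "L (rs t z x) = L x" for z x unfolding L_def by (rule qq_rs) simp
 have R_rs: "R (rs t z x) = R x" for z x unfolding R_def by (rule qq_rs0) simp
 have At_rs: "At (rs t z x) = At x" for z x by (simp add: At_def rs_def)
 have v_rs: "v (rs t z x) = v x" for z x unfolding v_eq L_rs R_rs At_rs ..
 have d_rs: "d (rs t z x) = d x" for z x
  unfolding d_def v_rs WL'_def la_def At_rs WL(3) WR(3) ..
 have vm [measurable]: "v \<in> borel_measurable PB" "v' \<in> borel_measurable PB" unfolding v_def[abs_def] v'_def[abs_def] by measurable
 have sm [measurable]: "s \<in> borel_measurable PB" unfolding s_def[abs_def] by measurable
 have At_fst: "At x = A (fst ((TB ^^ t) x))" for x by (simp add: At_def TB_iter)
 have la_int: "integrable PB la" unfolding la_def[abs_def] At_fst by (rule E.integrable_iter[OF SA_int])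
 have la_E: "(EE x. la x) = EA" unfolding la_def At_fst EA_def by (rule E.integral_iter[OF SA_int])
 have WL'_int: "integrable PB WL'" unfolding WL'_def[abs_def] by (rule E.integrable_iter[OF WL(1)])
 have WL'_E: "(EE x. WL' x) = (EE x. WL x)" unfolding WL'_def by (rule E.integral_iter[OF WL(1)])
 have vi: "integrable PB (%x. ln (v x))" using v(2) by (simp add: v_def)
 have d_int: "integrable PB d" unfolding d_def[abs_def] using WL'_int WR(1) la_int vi by simp
 have d_E: "(EE x. d x) = dd k + (EE x. WL x) + (EE x. WR x) + real k * EA - (EE x. ln (v x))"
  unfolding d_def using WL'_int WR(1) la_int vi by (simp add: E.prob_space WL'_E la_E)
 have At_SHS: "At x \<in> SHS e" if "x \<in> space PB" for x
  unfolding At_fst by (intro A_SHS fst_space E.iter_space that)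
 have volL: "vol k (L x) <= fact k * exp (WL' x)" for x unfolding L_def WL'_def by (rule WL(2))
 have volR: "vol k (R x) <= fact k * exp (WR x)" for x unfolding R_def by (rule WR(2))
 have nA: "norm (At x) <= 1 + SHS_norm e (At x)" if "x \<in> space PB" for x
  using norm_le_SHS_norm[OF At_SHS[OF that]] by simp
 have S0: "0 <= 1 + SHS_norm e B" for B :: "'h op" using SHS_norm_nonneg[of B] by simp
 have e_la: "exp (real k * la x) = (1 + SHS_norm e (At x)) ^ k" for x
 proof -
  have "0 < 1 + SHS_norm e (At x)" using SHS_norm_nonneg[of "At x"] by simp
  then show ?thesis by (simp add: la_def exp_of_nat_mult)
 qed
 have v_exp_d: "v x * exp (d x) = (real k + 1) * fact k ^ 3 * exp (WL' x) * exp (WR x) * (1 + SHS_norm e (At x)) ^ k" if "0 < v x" for x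
 proof -
  have "exp (d x) = exp (dd k) * exp (WL' x) * exp (WR x) * exp (real k * la x) / exp (ln (v x))"
   unfolding d_def by (simp add: exp_add exp_diff)
  moreover have "exp (dd k) = (real k + 1) * fact k ^ 3"
  proof -
   have "exp (3 * ln (fact k :: real)) = fact k ^ 3" using exp_of_nat_mult[of 3 "ln (fact k :: real)"] by simp
   then show ?thesis by (simp add: dd_def exp_add)
  qed
  ultimately show ?thesis using that e_la by simp
 qed
 have d0: "0 <= d x" if x: "x \<in> space PB" and vx: "0 < v x" for x
 proof -
  have "v x <= vol k (L x) * vol k (At x) * vol k (R x)"
   unfolding v_eq by (intro order_trans[OF vol_mult] mult_right_mono vol_mult vol_nonneg)
  also have "... <= (fact k * exp (WL' x)) * (fact k * (1 + SHS_norm e (At x)) ^ k) * (fact k * exp (WR x))"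
  proof -
   have vA: "vol k (At x) <= fact k * (1 + SHS_norm e (At x)) ^ k"
    by (rule order_trans[OF vol_le]) (intro mult_left_mono power_mono nA x, auto)
   show ?thesis by (intro mult_mono volL vA volR vol_nonneg mult_nonneg_nonneg zero_le_power S0) auto
  qed
  also have "... = 1 * (fact k ^ 3 * exp (WL' x) * exp (WR x) * (1 + SHS_norm e (At x)) ^ k)"
   by (simp only: power3_eq_cube mult_ac mult_1)
  also have "... <= (real k + 1) * (fact k ^ 3 * exp (WL' x) * exp (WR x) * (1 + SHS_norm e (At x)) ^ k)"
   by (intro mult_right_mono mult_nonneg_nonneg zero_le_power S0) auto
  also have "... = v x * exp (d x)" unfolding v_exp_d[OF vx] by (simp only: mult.assoc)
  finally have "v x * 1 <= v x * exp (d x)" by (simp only: mult_1_right)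
  then have "1 <= exp (d x)" using vx by (subst (asm) mult_le_cancel_left_pos)
  then show ?thesis by simp
 qed
 \<comment> \<open>\<open>vol_perturb\<close> with the noise-free factor as the perturbation of the
   noisy one. The assumption on \<open>s x\<close> gives \<open>q ^ 4 * s x <= 1\<close>, so both
   factors have norm at most \<open>1 + SHS_norm e (At x)\<close>.\<close>
 have pert: "v x <= v' x + v x * q ^ 4 * s x * exp (d x)"
  if x: "x \<in> space PB" and vx: "0 < v x" and sx: "s x <= 1 / q" for x
 proof -
  let ?S = "1 + SHS_norm e (At x)"
  have S1: "1 <= ?S" using SHS_norm_nonneg[of "At x"] by simp
  have nD: "norm (snd x (int t)) <= s x" unfolding s_def by (rule norm_le_SHS_norm[OF coord_SHS[OF x]])
  have s0: "0 <= s x" by (simp add: s_def SHS_norm_nonneg)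
  have "q ^ 4 * s x <= q ^ 4 * (1 / q)" using sx q by (intro mult_left_mono) auto
  also have "... = q ^ 3" using q by (simp add: power4_eq_xxxx power3_eq_cube)
  also have "... <= 1" using q q1 by (intro power_le_one) auto
  finally have qs: "q ^ 4 * s x <= 1" .
  have nE: "norm (q ^ 4 *R snd x (int t)) <= q ^ 4 * s x" using nD q by (simp add: mult_left_mono)
  have S2: "norm (At x + q ^ 4 *R snd x (int t)) <= ?S"
  proof -
   have "norm (At x + q ^ 4 *R snd x (int t)) <= norm (At x) + norm (q ^ 4 *R snd x (int t))" by (rule norm_triangle_ineq)
   also have "... <= SHS_norm e (At x) + 1" using nE qs norm_le_SHS_norm[OF At_SHS[OF x]] by linarith
   finally show ?thesis by simp
  qed
  have "v x <= v' x + real k * vol k (L x) * vol k (R x) * norm (At x - (At x + q ^ 4 *R snd x (int t))) * ?S ^ (k - 1)"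
   unfolding v_eq v'_eq by (rule vol_perturb[OF S2 nA[OF x]])
  also have "norm (At x - (At x + q ^ 4 *R snd x (int t))) = norm (q ^ 4 *R snd x (int t))" by (simp add: norm_minus_commute)
  also have "real k * vol k (L x) * vol k (R x) * norm (q ^ 4 *R snd x (int t)) * ?S ^ (k - 1) <=
    (real k + 1) * (fact k * exp (WL' x)) * (fact k * exp (WR x)) * (q ^ 4 * s x) * ?S ^ k"
  proof (intro mult_mono volL volR nE)
   show "?S ^ (k - 1) <= ?S ^ k" using S1 by (intro power_increasing) auto
  qed (use S1 s0 q in \<open>auto intro!: mult_nonneg_nonneg vol_nonneg\<close>)
  also have "... = (q ^ 4 * s x) * ((real k + 1) * fact k ^ 2 * exp (WL' x) * exp (WR x) * ?S ^ k)"
   by (simp add: power2_eq_square)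
  also have "... <= (q ^ 4 * s x) * (v x * exp (d x))"
   unfolding v_exp_d[OF vx]
  proof (intro mult_left_mono mult_right_mono)
   show "(fact k :: real) ^ 2 <= fact k ^ 3" by (intro power_increasing) (auto simp: fact_ge_1)
  qed (use q s0 S1 in auto)
  finally show ?thesis by (simp add: mult_ac)
 qed
 define f where "f x = \<bar>v' x / v x\<bar> powr (- \<theta> k)" for x
 have fm [measurable]: "f \<in> borel_measurable PB" unfolding f_def[abs_def] by measurable
 have f0: "0 <= f x" for x by (simp add: f_def)
 have v0: "AE x in PB. 0 < v x" using v(1) by (simp add: v_def)
 have NM: "(\<integral>\<^sup>+z. npow (\<theta> k) (v' (rs t z x) / v (rs t z x)) \<partial>\<gamma>) <= ennreal (Cn k)" if "0 < v x" for x
 proof -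
  have v1: "v' (rs t z x) / v (rs t z x) = vol k (L x oL (At x + ?eps *R z) oL R x) / vol k (L x oL At x oL R x)" for z
   unfolding v_rs unfolding v_eq v'_eq L_rs R_rs At_rs by (simp add: rs_def)
  show ?thesis unfolding v1 by (rule nn_integral_npow_vol) (use that in \<open>simp only: v_eq\<close>)
 qed
 \<comment> \<open>A weight that ignores the noise of time \<open>t\<close> comes out of the inner
   integral, which is then at most \<open>Cn k\<close>. It is applied to the constant 1 and to
   \<open>d\<close>.\<close>
 have bound: "(NN x. ennreal (g x) * npow (\<theta> k) (v' x / v x)) <= ennreal (Cn k * (EE x. g x))"
  if g: "integrable PB g" "AE x in PB. 0 <= g x" and g_rs: "\<And>x z. g (rs t z x) = g x" for g
 proof -
  have gm [measurable]: "g \<in> borel_measurable PB" using g(1) by simp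
  have "(NN x. ennreal (g x) * npow (\<theta> k) (v' x / v x)) <= (NN x. ennreal (g x) * (if 0 < v x then ennreal (Cn k) else \<infinity>))"
  proof (rule resample_le[of _ t])
   show "(%x. ennreal (g x) * npow (\<theta> k) (v' x / v x)) \<in> borel_measurable PB" by measurable
   fix x assume x: "x \<in> space PB"
   have "(\<integral>\<^sup>+z. ennreal (g (rs t z x)) * npow (\<theta> k) (v' (rs t z x) / v (rs t z x)) \<partial>\<gamma>) =
     (\<integral>\<^sup>+z. ennreal (g x) * npow (\<theta> k) (v' (rs t z x) / v (rs t z x)) \<partial>\<gamma>)" unfolding g_rs ..
   also have "... = ennreal (g x) * (\<integral>\<^sup>+z. npow (\<theta> k) (v' (rs t z x) / v (rs t z x)) \<partial>\<gamma>)"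
   proof (rule nn_integral_cmult)
    from vol_measurable[OF comp_weak, of k "L x" "At x" ?eps "R x"]
    have 1: "(%z. v' (rs t z x)) \<in> borel_measurable \<gamma>" unfolding v'_eq L_rs R_rs At_rs by (simp add: rs_def)
    show "(%z. npow (\<theta> k) (v' (rs t z x) / v (rs t z x))) \<in> borel_measurable \<gamma>"
     unfolding v_rs by (rule measurable_compose[OF borel_measurable_divide[OF 1 borel_measurable_const] npow_measurable])
   qed
   also have "... <= ennreal (g x) * (if 0 < v x then ennreal (Cn k) else \<infinity>)"
    by (intro mult_left_mono) (use NM in auto)
   finally show "(\<integral>\<^sup>+z. ennreal (g (rs t z x)) * npow (\<theta> k) (v' (rs t z x) / v (rs t z x)) \<partial>\<gamma>) <=
    ennreal (g x) * (if 0 < v x then ennreal (Cn k) else \<infinity>)" .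
  qed
  also have "... = (NN x. ennreal (Cn k) * ennreal (g x))"
   by (rule nn_integral_cong_AE) (use v0 in eventually_elim, simp add: mult.commute)
  also have "... = ennreal (Cn k) * (NN x. ennreal (g x))" by (rule nn_integral_cmult) measurable
  also have "(NN x. ennreal (g x)) = ennreal (EE x. g x)" by (rule nn_integral_eq_integral[OF g])
  finally show ?thesis using Cn(2) integral_nonneg_AE[OF g(2)] by (simp add: ennreal_mult)
 qed
 have d0_AE: "AE x in PB. 0 <= d x" using v0 AE_space by eventually_elim (rule d0)
 have I1: "(NN x. npow (\<theta> k) (v' x / v x)) <= ennreal (Cn k)"
  using bound[of "%_. 1"] by (simp add: E.prob_space)
 have fin: "AE x in PB. npow (\<theta> k) (v' x / v x) = ennreal (f x) \<and> v' x \<noteq> 0"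
 proof -
  have "AE x in PB. npow (\<theta> k) (v' x / v x) \<noteq> \<infinity>"
   by (rule nn_integral_PInf_AE) (use I1 in \<open>auto simp: top_unique\<close>)
  then show ?thesis by eventually_elim (auto simp: npow_def f_def split: if_splits)
 qed
 have v'0: "0 <= v' x" for x by (simp add: v'_def vol_nonneg)
 have pos: "AE x in PB. 0 < v' x" using fin by eventually_elim (use v'0 in \<open>auto simp: less_le\<close>)
 then show ?P by (simp add: v'_def)
 have int_bd: "integrable PB (%x. g x * f x) \<and> (EE x. g x * f x) <= Cn k * (EE x. g x)"
  if g: "integrable PB g" "AE x in PB. 0 <= g x" and g_rs: "\<And>x z. g (rs t z x) = g x" for g
 proof -
  have gm [measurable]: "g \<in> borel_measurable PB" using g(1) by simp
  have gf: "AE x in PB. 0 <= g x * f x" using g(2) by eventually_elim (simp add: f0)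
  have eq: "(NN x. ennreal (g x * f x)) = (NN x. ennreal (g x) * npow (\<theta> k) (v' x / v x))"
   by (rule nn_integral_cong_AE) (use fin g(2) in eventually_elim, simp add: ennreal_mult f0)
  have le: "(NN x. ennreal (g x * f x)) <= ennreal (Cn k * (EE x. g x))" unfolding eq by (rule bound[OF g g_rs])
  have int: "integrable PB (%x. g x * f x)"
  proof (rule integrableI_nonneg)
   show "(NN x. ennreal (g x * f x)) < \<infinity>" using le by (rule le_less_trans) simp
  qed (use gf in measurable)
  have "ennreal (EE x. g x * f x) <= ennreal (Cn k * (EE x. g x))"
   using le unfolding nn_integral_eq_integral[OF int gf] .
  moreover have "0 <= Cn k * (EE x. g x)" using Cn(2) integral_nonneg_AE[OF g(2)] by simp
  ultimately have "(EE x. g x * f x) <= Cn k * (EE x. g x)" by (simp only: ennreal_le_iff)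
  with int show ?thesis by simp
 qed
 have f_int: "integrable PB f" and f_E: "(EE x. f x) <= Cn k"
  using int_bd[of "%_. 1"] by (simp_all add: E.prob_space)
 have df_int: "integrable PB (%x. d x * f x)" and df_E: "(EE x. d x * f x) <= Cn k * (EE x. d x)"
  using int_bd[OF d_int d0_AE d_rs] by simp_all
 have s_int: "integrable PB (%x. (s x)\<^sup>2)"
  unfolding s_def using integrable_distr[OF coord_meas, of "int t" "%\<Delta>. (SHS_norm e \<Delta>)\<^sup>2"] integrable_SHS_norm_sq by (simp add: distr_coord)
 have s_E: "(EE x. (s x)\<^sup>2) <= 1"
 proof -
  have "(EE x. (s x)\<^sup>2) = (\<integral>\<Delta>. (SHS_norm e \<Delta>)\<^sup>2 \<partial>(distr PB \<gamma> (%x. snd x (int t))))"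
   unfolding s_def by (subst integral_distr) auto
  also have "... = (\<integral>\<Delta>. (SHS_norm e \<Delta>)\<^sup>2 \<partial>\<gamma>)" by (simp add: distr_coord)
  also have "... <= 1"
  proof -
   have "ennreal (\<integral>\<Delta>. (SHS_norm e \<Delta>)\<^sup>2 \<partial>\<gamma>) = (\<integral>\<^sup>+\<Delta>. ennreal ((SHS_norm e \<Delta>)\<^sup>2) \<partial>\<gamma>)"
    by (rule nn_integral_eq_integral[symmetric, OF integrable_SHS_norm_sq]) simp
   also have "... <= ennreal 1" using nn_integral_SHS_norm_sq by simp
   finally show ?thesis by (subst (asm) ennreal_le_iff) auto
  qed
  finally show ?thesis .
 qed
 define lo where "lo x = ln (v x) - (2 * q\<^sup>2 + (q * f x + q * (s x)\<^sup>2) / \<theta> k + 1 / (\<theta> k * (- ln q)) * (d x * f x))" for x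
 have lo_int: "integrable PB lo" unfolding lo_def[abs_def] using vi f_int s_int df_int by simp
 have lower: "AE x in PB. lo x <= ln (v' x)"
  using v0 pos AE_space
 proof eventually_elim
  case (elim x)
  have "ln (v x) - ln (v' x) <= 2 * q\<^sup>2 + (q * f x + q * (s x)\<^sup>2) / \<theta> k + d x / (- ln q) * (f x / \<theta> k)"
   unfolding f_def
  proof (rule loss_pointwise[OF q elim(1,2) \<theta>(1)])
   show "0 <= s x" by (simp add: s_def SHS_norm_nonneg)
   show "0 <= d x" by (rule d0[OF elim(3,1)])
   show "v x <= v' x + v x * q ^ 4 * s x * exp (d x)" if "s x <= 1 / q" by (rule pert[OF elim(3,1) that])
  qed
  moreover have "d x / (- ln q) * (f x / \<theta> k) = 1 / (\<theta> k * (- ln q)) * (d x * f x)" by simp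
  ultimately show ?case unfolding lo_def by linarith
 qed
 have upper: "AE x in PB. ln (v' x) <= 3 * ln (fact k) + WL' x + real k * U ((TB ^^ t) x) + WR x"
  using pos AE_space
 proof eventually_elim
  case (elim x)
  have g: "At x + ?eps *R snd x (int t) = gen ?eps ((TB ^^ t) x)" by (simp add: gen_iter At_def)
  have "v' x <= vol k (L x) * vol k (gen ?eps ((TB ^^ t) x)) * vol k (R x)"
   unfolding v'_eq g by (intro order_trans[OF vol_mult] mult_right_mono vol_mult vol_nonneg)
  also have "... <= (fact k * exp (WL' x)) * exp (ln (fact k) + real k * U ((TB ^^ t) x)) * (fact k * exp (WR x))"
   by (intro mult_mono volL volR vol_nonneg mult_nonneg_nonneg vol_le_exp gen_op_norm E.iter_space elim eps) auto
  also have "... = exp (3 * ln (fact k) + WL' x + real k * U ((TB ^^ t) x) + WR x)"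
  proof -
   have "exp (3 * ln (fact k :: real)) = fact k ^ 3" using exp_of_nat_mult[of 3 "ln (fact k :: real)"] by simp
   then show ?thesis by (simp add: exp_add power3_eq_cube)
  qed
  finally have "ln (v' x) <= ln (exp (3 * ln (fact k) + WL' x + real k * U ((TB ^^ t) x) + WR x))"
   using elim(1) by (subst ln_le_cancel_iff) auto
  then show ?case by simp
 qed
 have v'i: "integrable PB (%x. ln (v' x))"
 proof (rule integrable_sandwich[OF lo_int _ _ lower upper])
  show "integrable PB (%x. 3 * ln (fact k) + WL' x + real k * U ((TB ^^ t) x) + WR x)"
   using WL'_int WR(1) E.integrable_iter[OF U_int, of t] by simp
 qed measurable
 then show ?I by (simp add: v'_def)
 have "(EE x. lo x) <= (EE x. ln (v' x))" by (rule integral_mono_AE[OF lo_int v'i lower])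
 moreover have "(EE x. lo x) = (EE x. ln (v x)) - (2 * q\<^sup>2 + (q * (EE x. f x) + q * (EE x. (s x)\<^sup>2)) / \<theta> k + 1 / (\<theta> k * (- ln q)) * (EE x. d x * f x))"
  unfolding lo_def using vi f_int s_int df_int by (simp add: E.prob_space)
 moreover have "(q * (EE x. f x) + q * (EE x. (s x)\<^sup>2)) / \<theta> k <= q * (Cn k + 1) / \<theta> k"
  unfolding distrib_left[symmetric] using f_E s_E q \<theta>(1) by (intro divide_right_mono mult_left_mono add_mono) (auto simp: less_imp_le)
 moreover have "1 / (\<theta> k * (- ln q)) * (EE x. d x * f x) <= 1 / (\<theta> k * (- ln q)) * (Cn k * (EE x. d x))"
  using df_E lq \<theta>(1)[of k] by (intro mult_left_mono divide_nonneg_pos mult_pos_pos) auto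
 ultimately have "(EE x. ln (v x)) - (2 * q\<^sup>2 + q * (Cn k + 1) / \<theta> k + 1 / (\<theta> k * (- ln q)) * (Cn k * (EE x. d x))) <= (EE x. ln (v' x))"
  by linarith
 moreover have "1 / (\<theta> k * (- ln q)) * (Cn k * (EE x. d x)) = Cn k / (\<theta> k * (- ln q)) * (EE x. d x)" by simp
 ultimately have fin: "(EE x. ln (v x)) - (2 * q\<^sup>2 + q * (Cn k + 1) / \<theta> k + Cn k / (\<theta> k * (- ln q)) * (EE x. d x)) <= (EE x. ln (v' x))"
  by (simp only:)
 show ?L
  using fin unfolding d_E v_def v'_def .
qed

end

context perturbation begin

text \<open>By \<open>hybrid_step\<close> the gap \<open>B - h t\<close> grows by a factor
  \<open>1 + \<beta>\<close> per step, with \<open>\<beta>\<close> of order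
  \<open>1 / \<bar>ln eps\<bar>\<close>. Over a block of length about
  \<open>M * \<bar>ln eps\<bar>\<close> the total amplification is bounded independently of
  \<open>eps\<close>, and the initial gap per step can be made small.\<close>

lemma lower_qq:
 assumes fin: "lam k 0 = ereal L" and \<tau>: "0 < \<tau>" and M: "0 < M"
 shows "ER eps. \<forall>n. n = nat \<lceil>M * (- ln eps)\<rceil> --> 0 < n \<and> (AE x in PB. 0 < vol k (qq eps n x)) \<and>
  integrable PB (%x. ln (vol k (qq eps n x))) \<and> (L - \<tau>) * real n <= (EE x. ln (vol k (qq eps n x)))"
proof -
 \<comment> \<open>Bounds \<open>exp (\<beta> * real n)\<close>: the block has at most
   \<open>M * (- ln eps) + 1\<close> steps, and the extra step costs at most
   \<open>\<beta> <= 1\<close>.\<close>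
 define G where "G = exp (4 * Cn k * M / \<theta> k + 1)"
 have G1: "1 <= G" unfolding G_def using Cn(2)[of k] M \<theta>(1)[of k] by (simp add: add_nonneg_nonneg divide_nonneg_pos)
 \<comment> \<open>After amplification by \<open>G\<close> the initial gap may use a third of
   \<open>\<tau>\<close> per step; the other two thirds go to the remainders \<open>r eps\<close>
   and to the constants in \<open>K0\<close>.\<close>
 define \<delta> where "\<delta> = \<tau> / (3 * G)"
 have \<delta>: "0 < \<delta>" "G * \<delta> = \<tau> / 3" using \<tau> G1 by (auto simp: \<delta>_def)
 define a where "a = L + \<delta>"
 have "lam k 0 < ereal a" using fin \<delta> by (simp add: a_def)
 from exp_bound[OF this] obtain eps0 C where eps0: "0 < eps0" "eps0 <= 1" and C: "0 <= C"
  and W: "\<forall>eps. 0 <= eps --> eps <= eps0 --> (\<forall>n. \<exists>W. integrable PB W \<and>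
  (\<forall>x. vol k (qq eps n x) <= fact k * exp (W x)) \<and> (EE x. W x) <= a * real n + C \<and>
  (\<forall>x y. (\<forall>j m. j + m <= n --> qq eps m ((TB ^^ j) x) = qq eps m ((TB ^^ j) y)) --> W x = W y))"
  by (elim exE conjE) (rule that)
 define K0 where "K0 = dd k - a + 2 * C + real k * EA"
 define r where "r eps = 2 * (eps powr (1/4))\<^sup>2 + eps powr (1/4) * (Cn k + 1) / \<theta> k" for eps :: real
 have core: "0 < n \<and> (AE x in PB. 0 < vol k (qq eps n x)) \<and>
  integrable PB (%x. ln (vol k (qq eps n x))) \<and> (L - \<tau>) * real n <= (EE x. ln (vol k (qq eps n x)))"
  if eps: "0 < eps" "eps <= eps0" and sm: "(eps powr (1/4))\<^sup>2 <= 1/2" and r: "r eps <= \<tau> / (3 * G)"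
   and big: "6 * G * \<bar>K0\<bar> / \<tau> + 1 <= M * (- ln eps)" "4 * Cn k / \<theta> k + 1 <= - ln eps"
   and n: "n = nat \<lceil>M * (- ln eps)\<rceil>" for eps n
 proof -
  define q where "q = eps powr (1/4)"
  have q: "0 < q" "q\<^sup>2 <= 1/2" using eps(1) sm by (auto simp: q_def)
  have q4: "q ^ 4 = eps"
  proof -
   have "q ^ 4 = (eps powr (1/4)) powr real 4" unfolding q_def by (rule powr_realpow[symmetric]) (use eps in simp)
   then show ?thesis using eps(1) by (simp add: powr_powr)
  qed
  have lq: "- ln q = - ln eps / 4" using eps(1) by (simp add: q_def ln_powr)
  have le0: "0 < - ln eps" using big(2) Cn(2)[of k] \<theta>(1)[of k] by (smt (verit) divide_nonneg_pos mult_nonneg_nonneg)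
  have eps1: "eps <= 1" using eps(2) eps0(2) by simp
  have nge: "M * (- ln eps) <= real n" unfolding n by (rule real_nat_ceiling_ge)
  have nle: "real n <= M * (- ln eps) + 1"
  proof -
   have "0 <= M * (- ln eps)" using M le0 by (intro mult_nonneg_nonneg) auto
   then show ?thesis unfolding n by linarith
  qed
  have "0 <= 6 * G * \<bar>K0\<bar> / \<tau>" using G1 \<tau> by (intro divide_nonneg_pos mult_nonneg_nonneg) auto
  then have n0: "0 < n" and nK: "6 * G * \<bar>K0\<bar> / \<tau> <= real n" using big(1) nge by (auto simp: of_nat_0_less_iff[symmetric, where 'a=real] simp del: of_nat_0_less_iff)
  define \<beta> where "\<beta> = Cn k / (\<theta> k * (- ln q))"
  have \<beta>_eq: "\<beta> = (4 * Cn k / \<theta> k) / (- ln eps)" unfolding \<beta>_def lq by simp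
  have \<beta>0: "0 <= \<beta>" unfolding \<beta>_eq using Cn(2) \<theta>(1)[of k] le0 by (intro divide_nonneg_pos) auto
  have \<beta>1: "\<beta> <= 1" unfolding \<beta>_eq using big(2) le0 by (subst divide_le_eq_1) linarith
  have "\<beta> * real n <= \<beta> * (M * (- ln eps) + 1)" using nle \<beta>0 by (rule mult_left_mono)
  also have "... = 4 * Cn k * M / \<theta> k + \<beta>" unfolding distrib_left by (simp add: \<beta>_eq) (use le0 in simp)
  finally have \<beta>n: "\<beta> * real n <= 4 * Cn k * M / \<theta> k + 1" using \<beta>1 by linarith
  have pG: "(1 + \<beta>) ^ n <= G"
  proof -
   have "(1 + \<beta>) ^ n <= exp \<beta> ^ n" using \<beta>0 exp_ge_add_one_self[of \<beta>] by (intro power_mono) auto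
   also have "... = exp (\<beta> * real n)" by (rule exp_of_nat2_mult[symmetric])
   also have "... <= G" unfolding G_def using \<beta>n by simp
   finally show ?thesis .
  qed
  define h where "h t = (EE x. ln (vol k (hyb eps n t x)))" for t
  define rr where "rr = 2 * q\<^sup>2 + q * (Cn k + 1) / \<theta> k"
  have rr: "rr = r eps" by (simp add: rr_def r_def q_def)
  have rr0: "0 <= rr" unfolding rr_def using q Cn(2)[of k] \<theta>(1)[of k] by (intro add_nonneg_nonneg divide_nonneg_pos) auto
  \<comment> \<open>The two windows around time \<open>t\<close> together have \<open>n - 1\<close>
    factors, with a constant \<open>C\<close> for each window; the factor at time \<open>t\<close>
    itself contributes \<open>real k * EA\<close>.\<close>
  define B where "B = dd k + a * (real n - 1) + 2 * C + real k * EA"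
  define pi where "pi t \<longleftrightarrow> (AE x in PB. 0 < vol k (hyb eps n t x)) \<and> integrable PB (%x. ln (vol k (hyb eps n t x)))" for t
  have step: "pi (Suc t) \<and> B - h (Suc t) <= (1 + \<beta>) * (B - h t) + rr" if t: "t < n" and p: "pi t" for t
  proof -
   obtain WL where WL: "integrable PB WL" "\<forall>x. vol k (qq 0 (n - Suc t) x) <= fact k * exp (WL x)"
    "(EE x. WL x) <= a * real (n - Suc t) + C"
    "\<forall>x y. (\<forall>j m. j + m <= n - Suc t --> qq 0 m ((TB ^^ j) x) = qq 0 m ((TB ^^ j) y)) --> WL x = WL y"
    using W[THEN spec, THEN mp, THEN mp, THEN spec, of 0 "n - Suc t", OF order_refl less_imp_le[OF eps0(1)]] by (elim exE conjE) (rule that)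
   obtain WR where WR: "integrable PB WR" "\<forall>x. vol k (qq eps t x) <= fact k * exp (WR x)"
    "(EE x. WR x) <= a * real t + C"
    "\<forall>x y. (\<forall>j m. j + m <= t --> qq eps m ((TB ^^ j) x) = qq eps m ((TB ^^ j) y)) --> WR x = WR y"
    using W[THEN spec, THEN mp, THEN mp, THEN spec, of eps t, OF less_imp_le[OF eps(1)] eps(2)] by (elim exE conjE) (rule that)
   have i1: "WL ((TB ^^ Suc t) (rs t z x)) = WL ((TB ^^ Suc t) x)" for x z
   proof (rule WL(4)[rule_format])
    fix j m
    have "(TB ^^ j) ((TB ^^ Suc t) y) = (TB ^^ (j + Suc t)) y" for y by (simp only: funpow_add o_apply)
    note this[of "rs t z x"] this[of x]
    then show "qq 0 m ((TB ^^ j) ((TB ^^ Suc t) (rs t z x))) = qq 0 m ((TB ^^ j) ((TB ^^ Suc t) x))"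
     by (simp only:) (rule qq_rs, simp)
   qed
   have i2: "WR (rs t z x) = WR x" for x z
    by (rule WR(4)[rule_format]) (rule qq_rs, simp)
   have p1: "AE x in PB. 0 < vol k (hyb (q ^ 4) n t x)" "integrable PB (%x. ln (vol k (hyb (q ^ 4) n t x)))"
    using p unfolding pi_def q4 by simp_all
   note hs = hybrid_step[OF q t p1 WL(1) WL(2)[rule_format] i1 WR(1), unfolded q4, OF WR(2)[rule_format] i2]
   have pi: "pi (Suc t)" unfolding pi_def using hs(1,2) by simp
   have st: "h t - (rr + \<beta> * (dd k + (EE x. WL x) + (EE x. WR x) + real k * EA - h t)) <= h (Suc t)"
    using hs(3) unfolding h_def rr_def \<beta>_def .
   have "a * real (n - Suc t) + a * real t = a * (real n - 1)" using t by (simp add: of_nat_diff algebra_simps)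
   then have "dd k + (EE x. WL x) + (EE x. WR x) + real k * EA - h t <= B - h t"
    using WL(3) WR(3) unfolding B_def by linarith
   then have "\<beta> * (dd k + (EE x. WL x) + (EE x. WR x) + real k * EA - h t) <= \<beta> * (B - h t)" using \<beta>0 by (rule mult_left_mono)
   moreover have "B - b <= (1 + \<beta>) * (B - a) + r" if "z <= \<beta> * (B - a)" "a - (r + z) <= b" for z a b r :: real
    using that by (simp add: algebra_simps)
   ultimately have "B - h (Suc t) <= (1 + \<beta>) * (B - h t) + rr" using st by blast
   with pi show ?thesis by simp
  qed
  interpret D: submult_process PB TB "%n x. vol k (qq 0 n x)" by (rule process) auto
  have h0: "hyb eps n 0 x = qq 0 n x" for x unfolding hyb_def by (rule blinfun_eqI) simp
  have hn: "hyb eps n n x = qq eps n x" for x unfolding hyb_def by (rule blinfun_eqI) simp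
  have Lle: "ereal L <= D.lyap" using fin by (simp add: lam_def)
  note fl = D.finite_lyap[OF Lle n0]
  have p0: "pi 0" unfolding pi_def h0 using fl(1,2) by simp
  have pall: "t <= n ==> pi t" for t
  proof (induction t)
   case (Suc t)
   then show ?case using step[of t] by simp
  qed (rule p0)
  have gr: "B - h n <= (1 + \<beta>) ^ n * ((B - h 0) + real n * rr)"
  proof (rule discrete_gronwall[where D="%t. B - h t" and n=n, OF _ \<beta>0 rr0 order_refl])
   fix t assume t: "t < n"
   show "B - h (Suc t) <= (1 + \<beta>) * (B - h t) + rr" using step[OF t pall] t by simp
  qed
  have h0L: "real n * L <= h 0" unfolding h_def h0 by (rule fl(3))
  have B_eq: "B = K0 + (L + \<delta>) * real n" unfolding B_def K0_def a_def by (simp add: algebra_simps)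
  define Y where "Y = \<bar>K0\<bar> + (\<delta> + rr) * real n"
  have Y0: "0 <= Y" unfolding Y_def using \<delta> rr0 by (intro add_nonneg_nonneg mult_nonneg_nonneg) auto
  have "(B - h 0) + real n * rr <= Y" unfolding Y_def B_eq using h0L by (simp add: algebra_simps)
  then have "(1 + \<beta>) ^ n * ((B - h 0) + real n * rr) <= (1 + \<beta>) ^ n * Y" using \<beta>0 by (intro mult_left_mono) auto
  also have "... <= G * Y" using pG Y0 by (rule mult_right_mono)
  finally have hnB: "B - G * Y <= h n" using gr by linarith
  have "G * Y = G * \<bar>K0\<bar> + (G * \<delta> + G * rr) * real n" by (simp add: Y_def algebra_simps)
  moreover have "(G * \<delta> + G * rr) * real n <= (\<tau> / 3 + \<tau> / 3) * real n"
  proof (rule mult_right_mono)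
   have "G * rr <= G * (\<tau> / (3 * G))" using r G1 unfolding rr by (intro mult_left_mono) auto
   then show "G * \<delta> + G * rr <= \<tau> / 3 + \<tau> / 3" using \<delta>(2) G1 by simp
  qed simp
  moreover have "2 * (G * \<bar>K0\<bar>) <= \<tau> / 3 * real n" using nK \<tau> by (simp add: field_simps)
  moreover have "\<bar>K0\<bar> <= G * \<bar>K0\<bar>" using G1 mult_right_mono[of 1 G "\<bar>K0\<bar>"] by simp
  moreover have "0 <= \<delta> * real n" using \<delta> by simp
  ultimately have "L * real n - \<tau> * real n <= h n" using hnB unfolding B_eq distrib_right by linarith
  then have "(L - \<tau>) * real n <= h n" by (simp add: algebra_simps)
  then show ?thesis using pall[of n] n0 unfolding pi_def h_def hn by simp
 qed
 have e1: "ER eps. 0 < eps \<and> eps <= eps0" using eps0(1) by (intro eventually_at_rightI[of 0 eps0]) auto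
 have p: "((%eps::real. eps powr (1/4)) \<longlongrightarrow> 0) (at_right 0)" by real_asymp
 have "((%eps::real. (eps powr (1/4))\<^sup>2) \<longlongrightarrow> 0\<^sup>2) (at_right 0)" by (intro tendsto_power p)
 then have e2: "ER eps. (eps powr (1/4))\<^sup>2 < (1/2::real)" by (rule order_tendstoD) simp
 have "(r \<longlongrightarrow> 2 * 0\<^sup>2 + 0 * (Cn k + 1) / \<theta> k) (at_right 0)"
  unfolding r_def by (intro tendsto_intros p) (use \<theta>(1)[of k] in simp)
 then have e3: "ER eps. r eps < \<tau> / (3 * G)" by (rule order_tendstoD) (use \<tau> G1 in simp)
 have lt: "filterlim (%eps::real. - ln eps) at_top (at_right 0)" by real_asymp
 have e4: "ER eps::real. (6 * G * \<bar>K0\<bar> / \<tau> + 1) / M <= - ln eps" using lt unfolding filterlim_at_top by (rule spec)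
 have e5: "ER eps::real. 4 * Cn k / \<theta> k + 1 <= - ln eps" using lt unfolding filterlim_at_top by (rule spec)
 show ?thesis
  using e1 e2 e3 e4 e5
 proof eventually_elim
  case (elim eps)
  have w: "6 * G * \<bar>K0\<bar> / \<tau> + 1 <= M * (- ln eps)" using elim(4) M by (simp add: pos_divide_le_eq mult.commute)
  show ?case
   by (intro allI impI, rule core[OF conjunct1[OF elim(1)] conjunct2[OF elim(1)] less_imp_le[OF elim(2)] less_imp_le[OF elim(3)] w elim(5)])
 qed
qed

end

section \<open>Large coordinate minors\<close>

lemma ex_power2_between:
 assumes "1 <= (X::real)" shows "\<exists>m. X <= 2 ^ m \<and> 2 ^ m <= 2 * X"
proof -
 define m where "m = (LEAST m. X <= 2 ^ m)"
 have ex: "\<exists>m. X <= 2 ^ m" using real_arch_pow[of 2 X] by (auto intro: less_imp_le)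
 have 1: "X <= 2 ^ m" unfolding m_def by (rule LeastI_ex[OF ex])
 have "2 ^ m <= 2 * X"
 proof (cases m)
  case 0
  then show ?thesis using assms by simp
 next
  case (Suc i)
  then have "\<not> X <= 2 ^ i" unfolding m_def by (intro not_less_Least) simp
  then show ?thesis using Suc by simp
 qed
 with 1 show ?thesis by blast
qed

context onb begin

lemma inner_proj: "inner (ap (proj m) x) y = (\<Sum>s<m. inner x (e s) * inner (e s) y)"
 by (simp add: proj_apply inner_sum_left)

text \<open>Rows are expanded one after another in the first \<open>m\<close> basis vectors, each
  expansion costing a factor \<open>m\<close>.\<close>

lemma dt_proj_expand:
 fixes \<phi> :: "nat => 'h => real"
 assumes lin: "\<And>b u. \<phi> b (ap (proj m) u) = (\<Sum>s<m. inner u (e s) * \<phi> b (e s))"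
  and B: "\<And>I. (\<And>a. I a < m) ==> \<bar>dt k (%a b. \<phi> b (e (I a)))\<bar> <= B"
  and x: "\<And>a. norm (x a) <= 1" and m: "0 < m"
 shows "\<bar>dt k (%a b. \<phi> b (ap (proj m) (x a)))\<bar> <= real m ^ k * B"
proof -
 have claim: "r <= k ==> (\<And>a. I a < m) ==>
  \<bar>dt k (%a b. if a < r then \<phi> b (ap (proj m) (x a)) else \<phi> b (e (I a)))\<bar> <= real m ^ r * B" for r I
 proof (induction r arbitrary: I)
  case 0
  then show ?case using B by simp
 next
  case (Suc r)
  let ?M = "%a b. if a < r then \<phi> b (ap (proj m) (x a)) else \<phi> b (e (I a))"
  have "dt k (%a b. if a < Suc r then \<phi> b (ap (proj m) (x a)) else \<phi> b (e (I a))) =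
   dt k (%a b. if a = r then \<Sum>s<m. inner (x r) (e s) * \<phi> b (e s) else ?M a b)"
   by (rule dt_cong) (auto simp: lin less_Suc_eq)
  also have "... = (\<Sum>s<m. inner (x r) (e s) * dt k (%a b. if a = r then \<phi> b (e s) else ?M a b))"
   by (rule dt_row_sum) (use Suc.prems in simp)
  also have "\<bar>...\<bar> <= (\<Sum>s<m. real m ^ r * B)"
  proof (rule order_trans[OF sum_abs], rule sum_mono)
   fix s assume s: "s \<in> {..<m}"
   have "dt k (%a b. if a = r then \<phi> b (e s) else ?M a b) =
    dt k (%a b. if a < r then \<phi> b (ap (proj m) (x a)) else \<phi> b (e ((I(r := s)) a)))"
    by (rule dt_cong) auto
   also have "\<bar>...\<bar> <= real m ^ r * B" by (rule Suc.IH) (use Suc.prems s in auto)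
   finally have d: "\<bar>dt k (%a b. if a = r then \<phi> b (e s) else ?M a b)\<bar> <= real m ^ r * B" .
   have "\<bar>inner (x r) (e s)\<bar> <= norm (x r) * norm (e s)" by (rule Cauchy_Schwarz_ineq2)
   also have "... <= 1" using x[of r] by simp
   finally have "\<bar>inner (x r) (e s)\<bar> * \<bar>dt k (%a b. if a = r then \<phi> b (e s) else ?M a b)\<bar> <= 1 * (real m ^ r * B)"
    using d by (intro mult_mono) auto
   then show "\<bar>inner (x r) (e s) * dt k (%a b. if a = r then \<phi> b (e s) else ?M a b)\<bar> <= real m ^ r * B"
    by (simp add: abs_mult)
  qed
  also have "... = real m ^ Suc r * B" by simp
  finally show ?case .
 qed
 have "dt k (%a b. \<phi> b (ap (proj m) (x a))) = dt k (%a b. if a < k then \<phi> b (ap (proj m) (x a)) else \<phi> b (e 0))"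
  by (rule dt_cong) simp
 then show ?thesis using claim[of k "%_. 0"] m by simp
qed

text \<open>The expansion is applied to the rows and then, after transposition, to the
  columns.\<close>

lemma vol_proj_le:
 assumes B: "\<And>I J. (\<And>a. I a < m) ==> (\<And>a. J a < m) ==> \<bar>mdet k Z (%a. e (I a)) (%b. e (J b))\<bar> <= B" and m: "0 < m"
 shows "vol k (proj m oL Z oL proj m) <= real m ^ (2 * k) * B"
proof (rule vol_least)
 fix x y :: "nat => 'h"
 assume x: "\<And>a. norm (x a) <= 1" and y: "\<And>a. norm (y a) <= 1"
 have sa: "inner u (ap (proj m) w) = inner (ap (proj m) u) w" for u w
  unfolding inner_proj by (simp add: proj_apply inner_sum_right inner_commute mult.commute)
 have "mdet k (proj m oL Z oL proj m) x y = dt k (%a b. inner (ap (proj m) (x a)) (ap Z (ap (proj m) (y b))))"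
  by (simp add: mdet_def sa)
 also have "\<bar>...\<bar> <= real m ^ k * (real m ^ k * B)"
 proof (rule dt_proj_expand[where \<phi>="%b u. inner u (ap Z (ap (proj m) (y b)))", OF _ _ x m])
  show "inner (ap (proj m) u) (ap Z (ap (proj m) (y b))) =
   (\<Sum>s<m. inner u (e s) * inner (e s) (ap Z (ap (proj m) (y b))))" for b u by (rule inner_proj)
  fix I :: "nat => nat" assume I: "\<And>a. I a < m"
  have "dt k (%a b. inner (e (I a)) (ap Z (ap (proj m) (y b)))) =
    dt k (%b a. inner (e (I a)) (ap Z (ap (proj m) (y b))))"
   by (rule dt_transpose[symmetric])
  also have "\<bar>...\<bar> <= real m ^ k * B"
  proof (rule dt_proj_expand[where \<phi>="%a u. inner (e (I a)) (ap Z u)", OF _ _ y m])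
   show "inner (e (I b)) (ap Z (ap (proj m) u)) = (\<Sum>s<m. inner u (e s) * inner (e (I b)) (ap Z (e s)))" for b u
    by (simp add: proj_apply blinfun.sum_right blinfun.scaleR_right inner_sum_right)
   fix J :: "nat => nat" assume J: "\<And>a. J a < m"
   have "dt k (%b a. inner (e (I a)) (ap Z (e (J b)))) = mdet k Z (%a. e (I a)) (%b. e (J b))"
    unfolding mdet_def by (rule dt_transpose)
   then show "\<bar>dt k (%a b. inner (e (I b)) (ap Z (e (J a))))\<bar> <= B" using B[OF I J] by simp
  qed
  finally show "\<bar>dt k (%a b. inner (e (I a)) (ap Z (ap (proj m) (y b))))\<bar> <= real m ^ k * B" .
 qed
 also have "... = real m ^ (2 * k) * B" by (simp add: mult_2 power_add)
 finally show "\<bar>mdet k (proj m oL Z oL proj m) x y\<bar> <= real m ^ (2 * k) * B" .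
qed

text \<open>Only the outer factors are truncated, as their SHS norms give tails of size
  \<open>2 ^ - m\<close>; the inner product enters solely through its volume.\<close>

lemma vol_truncate:
 assumes A: "A \<in> SHS e" "SHS_norm e A <= S" and A': "A' \<in> SHS e" "SHS_norm e A' <= S'" and V: "vol k Z' <= V"
 shows "vol k (A oL Z' oL A') <= vol k (proj m oL (A oL Z' oL A') oL proj m) + 2 * (real k * (fact k)\<^sup>2 * S ^ k * S' ^ k * V) / 2 ^ m"
proof -
 have S0: "0 <= S" "0 <= S'" using A(2) A'(2) SHS_norm_nonneg order_trans by blast+
 have V0: "0 <= V" using V vol_nonneg order_trans by blast
 have nA: "norm A <= S" and nA': "norm A' <= S'" using norm_le_SHS_norm A A' by (auto intro: order_trans)
 have nPA: "norm (proj m oL A) <= S"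
 proof -
  have "norm (proj m oL A) <= norm (proj m) * norm A" by (rule norm_blinfun_compose)
  also have "... <= 1 * S" using S0 by (intro mult_mono norm_proj nA) auto
  finally show ?thesis by simp
 qed
 have nAP: "norm (A' oL proj m) <= S'"
 proof -
  have "norm (A' oL proj m) <= norm A' * norm (proj m)" by (rule norm_blinfun_compose)
  also have "... <= S' * 1" using S0 by (intro mult_mono norm_proj nA') auto
  finally show ?thesis by simp
 qed
 note vid = vol_id_le and vB = vol_le_power
 have kS: "real k * (s / 2 ^ m) * s ^ (k - 1) = real k * s ^ k / 2 ^ m" for s :: real
  by (cases k) simp_all
 have "vol k (id_blinfun oL A oL (Z' oL A')) <= vol k (id_blinfun oL (proj m oL A) oL (Z' oL A')) +
   real k * vol k (id_blinfun :: 'h op) * vol k (Z' oL A') * norm (A - (proj m oL A)) * S ^ (k - 1)"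
  by (rule vol_perturb[OF nPA nA])
 also have "real k * vol k (id_blinfun :: 'h op) * vol k (Z' oL A') * norm (A - (proj m oL A)) * S ^ (k - 1) <=
   real k * fact k * (V * (fact k * S' ^ k)) * (S / 2 ^ m) * S ^ (k - 1)"
 proof (intro mult_mono vid)
  show "vol k (Z' oL A') <= V * (fact k * S' ^ k)"
   by (rule order_trans[OF vol_mult]) (intro mult_mono V vB nA' V0 vol_nonneg)
  show "norm (A - (proj m oL A)) <= S / 2 ^ m"
   using SHS_tail_left[OF A(1), of m] A(2) by (simp add: norm_minus_commute) (meson divide_right_mono order_trans zero_le_numeral zero_le_power)
 qed (use S0 V0 in \<open>auto intro!: mult_nonneg_nonneg vol_nonneg\<close>)
 also have "... = (fact k)\<^sup>2 * V * S' ^ k * (real k * (S / 2 ^ m) * S ^ (k - 1))" by (simp only: power2_eq_square mult_ac)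
 also have "... = (real k * (fact k)\<^sup>2 * S ^ k * S' ^ k * V) / 2 ^ m" unfolding kS by simp
 finally have 1: "vol k (id_blinfun oL A oL (Z' oL A')) <= vol k (id_blinfun oL (proj m oL A) oL (Z' oL A')) + (real k * (fact k)\<^sup>2 * S ^ k * S' ^ k * V) / 2 ^ m" by simp
 let ?L = "(proj m oL A) oL Z'"
 have "vol k (?L oL A' oL id_blinfun) <= vol k (?L oL (A' oL proj m) oL id_blinfun) +
   real k * vol k ?L * vol k (id_blinfun :: 'h op) * norm (A' - (A' oL proj m)) * S' ^ (k - 1)"
  by (rule vol_perturb[OF nAP nA'])
 also have "real k * vol k ?L * vol k (id_blinfun :: 'h op) * norm (A' - (A' oL proj m)) * S' ^ (k - 1) <=
   real k * ((fact k * S ^ k) * V) * fact k * (S' / 2 ^ m) * S' ^ (k - 1)"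
 proof (intro mult_mono vid)
  show "vol k ?L <= (fact k * S ^ k) * V"
   by (rule order_trans[OF vol_mult]) (intro mult_mono V vB nPA V0 vol_nonneg, use S0 in auto)
  show "norm (A' - (A' oL proj m)) <= S' / 2 ^ m"
   using SHS_tail_right[OF A'(1), of m] A'(2) by (simp add: norm_minus_commute) (meson divide_right_mono order_trans zero_le_numeral zero_le_power)
 qed (use S0 V0 in \<open>auto intro!: mult_nonneg_nonneg vol_nonneg\<close>)
 also have "... = (fact k)\<^sup>2 * V * S ^ k * (real k * (S' / 2 ^ m) * S' ^ (k - 1))" by (simp only: power2_eq_square mult_ac)
 also have "... = (real k * (fact k)\<^sup>2 * S ^ k * S' ^ k * V) / 2 ^ m" unfolding kS by simp
 finally have 2: "vol k (?L oL A' oL id_blinfun) <= vol k (?L oL (A' oL proj m) oL id_blinfun) + (real k * (fact k)\<^sup>2 * S ^ k * S' ^ k * V) / 2 ^ m" by simp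
 have "id_blinfun oL A oL (Z' oL A') = A oL Z' oL A'" "id_blinfun oL (proj m oL A) oL (Z' oL A') = ?L oL A' oL id_blinfun"
  "?L oL (A' oL proj m) oL id_blinfun = proj m oL (A oL Z' oL A') oL proj m"
  by (auto intro!: blinfun_eqI)
 note 3 = this
 have 4: "2 * x / 2 ^ m = x / 2 ^ m + x / 2 ^ m" for x :: real by simp
 have 5: "a <= c + (d + d)" if "a <= b + d" "b <= c + d" for a b c d :: real using that by linarith
 show ?thesis unfolding 4 by (rule 5[OF 1[unfolded 3] 2[unfolded 3]])
qed

text \<open>A truncation level with \<open>2 ^ m\<close> comparable to \<open>E / v\<close> keeps
  half of the volume, so some minor with indices below \<open>m\<close> is at least
  \<open>v / (4 * m ^ (2 * k))\<close>. The noise entries that connect these indices with the first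
  \<open>k\<close> coordinates have size at least \<open>(1/3) ^ (k + m)\<close>. Up to constants,
  everything lost is a power of \<open>v / E\<close>.\<close>

lemma minor_lower:
 assumes A: "A \<in> SHS e" "SHS_norm e A <= S" and A': "A' \<in> SHS e" "SHS_norm e A' <= S'" and V: "vol k Z' <= V"
  and pos: "0 < vol k (A oL Z' oL A')"
 defines "v \<equiv> vol k (A oL Z' oL A')" and "E \<equiv> (real k + 1) * (fact k)\<^sup>2 * S ^ k * S' ^ k * V"
 shows "\<exists>I J. v / 4 * (1 / 9) ^ (k * k + k) * (v / (8 * E)) ^ (8 * k) <=
  (\<Prod>c<k. sd (c, J c)) * (\<Prod>c<k. sd (I c, c)) * \<bar>mdet k (A oL Z' oL A') (%a. e (I a)) (%b. e (J b))\<bar>"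
proof -
 let ?Z = "A oL Z' oL A'"
 have S0: "0 <= S" "0 <= S'" using A(2) A'(2) SHS_norm_nonneg order_trans by blast+
 have V0: "0 <= V" using V vol_nonneg order_trans by blast
 have v0: "0 < v" using pos by (simp add: v_def)
 have vE: "v <= E"
 proof -
  note vB = vol_le_power
  have "v <= vol k A * vol k Z' * vol k A'"
   unfolding v_def by (intro order_trans[OF vol_mult] mult_right_mono vol_mult vol_nonneg)
  also have "... <= (fact k * S ^ k) * V * (fact k * S' ^ k)"
   using norm_le_SHS_norm A A' S0 V0 by (intro mult_mono vB V vol_nonneg mult_nonneg_nonneg) (auto intro: order_trans)
  also have "... = 1 * ((fact k)\<^sup>2 * S ^ k * S' ^ k * V)" by (simp add: power2_eq_square)
  also have "... <= (real k + 1) * ((fact k)\<^sup>2 * S ^ k * S' ^ k * V)"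
   using S0 V0 by (intro mult_right_mono mult_nonneg_nonneg) auto
  finally show ?thesis by (simp add: E_def mult.assoc)
 qed
 have E0: "0 < E" using v0 vE by linarith
 have "1 <= 4 * E / v" using vE v0 E0 by (simp add: le_divide_eq)
 from ex_power2_between[OF this] obtain m' where m': "4 * E / v <= 2 ^ m'" "2 ^ m' <= 2 * (4 * E / v)" by (elim exE conjE)
 \<comment> \<open>One level more than \<open>m'\<close> absorbs the factor 2 in the error of
   \<open>vol_truncate\<close>.\<close>
 define m where "m = Suc m'"
 have vP: "v / 2 <= vol k (proj m oL ?Z oL proj m)"
 proof -
  have "2 * (real k * (fact k)\<^sup>2 * S ^ k * S' ^ k * V) / 2 ^ m <= 2 * E / 2 ^ m"
   unfolding E_def using S0 V0 by (intro divide_right_mono mult_left_mono mult_right_mono) auto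
  also have "... = E / 2 ^ m'" by (simp add: m_def)
  also have "... <= v / 4"
  proof -
   have "4 * E <= v * 2 ^ m'" using m'(1) v0 by (simp add: pos_divide_le_eq mult.commute)
   then show ?thesis by (simp add: pos_divide_le_eq)
  qed
  finally show ?thesis using vol_truncate[OF A A' V, of m] v0 unfolding v_def[symmetric] by linarith
 qed
 \<comment> \<open>If all minors were at most \<open>b\<close>, \<open>vol_proj_le\<close> would
   bound the truncated volume by \<open>v / 4\<close>, but it is at least
   \<open>v / 2\<close>.\<close>
 define b where "b = v / (4 * real m ^ (2 * k))"
 have m0: "0 < m" by (simp add: m_def)
 have "\<exists>I J. (\<forall>a. I a < m) \<and> (\<forall>a. J a < m) \<and> b < \<bar>mdet k ?Z (%a. e (I a)) (%b. e (J b))\<bar>"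
 proof (rule ccontr)
  assume "\<not> ?thesis"
  then have "\<And>I J. (\<And>a. I a < m) ==> (\<And>a. J a < m) ==> \<bar>mdet k ?Z (%a. e (I a)) (%b. e (J b))\<bar> <= b" by (meson not_less)
  from vol_proj_le[OF this m0] have "vol k (proj m oL ?Z oL proj m) <= real m ^ (2 * k) * b" .
  also have "... = v / 4" using m0 by (simp add: b_def)
  finally show False using vP v0 by linarith
 qed
 then obtain I J where IJ: "\<forall>a. I a < m" "\<forall>a. J a < m" "b < \<bar>mdet k ?Z (%a. e (I a)) (%b. e (J b))\<bar>" by (elim exE conjE)
 have sd_ge: "(1/3) ^ (k + m) <= sd (i, j)" if "i + j + 2 <= k + m" for i j
  unfolding sd_def split by (rule power_decreasing) (use that in auto)
 have pr: "((1/3) ^ (k + m)) ^ k <= (\<Prod>c<k. sd (f c))" if "\<And>c. c < k ==> (1/3) ^ (k + m) <= sd (f c)" for f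
 proof -
  have "(\<Prod>c<k. (1/3) ^ (k + m)) <= (\<Prod>c<k. sd (f c))" by (rule prod_mono) (use that in auto)
  then show ?thesis by simp
 qed
 have p1: "((1/3) ^ (k + m)) ^ k <= (\<Prod>c<k. sd (c, J c))"
 proof (rule pr, rule sd_ge)
  fix c assume "c < k" then show "c + J c + 2 <= k + m" using IJ(2)[rule_format, of c] by linarith
 qed
 have p2: "((1/3) ^ (k + m)) ^ k <= (\<Prod>c<k. sd (I c, c))"
 proof (rule pr, rule sd_ge)
  fix c assume "c < k" then show "I c + c + 2 <= k + m" using IJ(1)[rule_format, of c] by linarith
 qed
 have m3: "real m <= 3 ^ m'"
 proof -
  have "Suc m' <= 3 ^ m'" by (induction m') auto
  then have "real (Suc m') <= real (3 ^ m')" by (simp only: of_nat_le_iff)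
  then show ?thesis by (simp add: m_def)
 qed
 have pow3: "(3::real) ^ m' <= (8 * E / v)\<^sup>2"
 proof -
  have "(3::real) ^ m' <= 4 ^ m'" by (rule power_mono) auto
  also have "... = (2 ^ m')\<^sup>2" by (simp add: power_mult_distrib[symmetric] power2_eq_square)
  also have "... <= (8 * E / v)\<^sup>2" using m'(2) by (intro power_mono) auto
  finally show ?thesis .
 qed
 define X where "X = v / (8 * E)"
 have X: "0 < X" "X <= 1" using v0 E0 vE by (auto simp: X_def)
 have X3: "X\<^sup>2 <= (1/3) ^ m'"
 proof -
  have "X\<^sup>2 * 3 ^ m' <= X\<^sup>2 * (8 * E / v)\<^sup>2" by (intro mult_left_mono pow3) simp
  also have "... = 1" using v0 E0 by (simp add: X_def power_mult_distrib[symmetric])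
  finally show ?thesis by (simp add: power_one_over pos_le_divide_eq)
 qed
 let ?D = "((1/3::real) ^ (k + m)) ^ k"
 \<comment> \<open>The exponent: the two noise products cost \<open>2 * k\<close> powers of
   \<open>(1/3) ^ m'\<close> and the number of minors another \<open>2 * k\<close>; each such power
   is at least \<open>X\<close> squared.\<close>
 have main: "(1/9) ^ (k * k + k) * X ^ (8 * k) <= ?D * ?D * (1 / real m ^ (2 * k))"
 proof -
  have e1: "?D * ?D = (1/9) ^ (k * k + k) * ((1/3) ^ m') ^ (2 * k)"
  proof -
   have "?D * ?D = (((1/3) * (1/3)) ^ (k + m)) ^ k" by (simp only: power_mult_distrib)
   also have "(1/3::real) * (1/3) = 1/9" by simp
   also have "((1/9::real) ^ (k + m)) ^ k = (1/9) ^ (k * k + k) * ((1/9) ^ m') ^ k"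
    by (simp only: power_mult[symmetric] power_add[symmetric]) (simp add: m_def algebra_simps)
   also have "((1/9::real) ^ m') ^ k = ((1/3) ^ m') ^ (2 * k)"
   proof -
    have "(1/9::real) = (1/3)\<^sup>2" by (simp add: power2_eq_square)
    then show ?thesis by (simp only: power_mult[symmetric]) (simp add: mult_ac)
   qed
   finally show ?thesis .
  qed
  have e2: "((1/3) ^ m') ^ (2 * k) <= 1 / real m ^ (2 * k)"
  proof -
   have "real m ^ (2 * k) <= (3 ^ m') ^ (2 * k)" using m3 by (intro power_mono) auto
   then have "1 / (3 ^ m') ^ (2 * k) <= 1 / real m ^ (2 * k)" using m0 by (intro divide_left_mono) auto
   then show ?thesis by (simp add: power_one_over)
  qed
  have "X ^ (8 * k) = (X\<^sup>2) ^ (4 * k)" by (simp add: power_mult[symmetric])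
  also have "... <= ((1/3) ^ m') ^ (4 * k)" by (rule power_mono[OF X3]) simp
  also have "... = ((1/3) ^ m') ^ (2 * k) * ((1/3) ^ m') ^ (2 * k)" by (simp add: power_add[symmetric])
  also have "... <= ((1/3) ^ m') ^ (2 * k) * (1 / real m ^ (2 * k))" by (rule mult_left_mono[OF e2]) simp
  finally have "(1/9) ^ (k * k + k) * X ^ (8 * k) <= (1/9) ^ (k * k + k) * (((1/3) ^ m') ^ (2 * k) * (1 / real m ^ (2 * k)))" by (rule mult_left_mono) simp
  then show ?thesis unfolding e1 by (simp only: mult.assoc)
 qed
 have "v / 4 * (1 / 9) ^ (k * k + k) * X ^ (8 * k) = v / 4 * ((1 / 9) ^ (k * k + k) * X ^ (8 * k))" by (simp only: mult.assoc)
 also have "... <= v / 4 * (?D * ?D * (1 / real m ^ (2 * k)))" using v0 by (intro mult_left_mono main) auto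
 also have "... = ?D * ?D * b" by (simp add: b_def)
 also have "... <= (\<Prod>c<k. sd (c, J c)) * (\<Prod>c<k. sd (I c, c)) * \<bar>mdet k ?Z (%a. e (I a)) (%b. e (J b))\<bar>"
  using IJ(3) v0 by (intro mult_mono p1 p2 mult_nonneg_nonneg prod_nonneg) (auto simp: b_def less_imp_le[OF sd_pos])
 finally show ?thesis unfolding X_def by (intro exI)
qed

end

section \<open>Gluing blocks along leading coordinate minors\<close>

context perturbation begin

definition C2 :: "nat => real" where "C2 k = enn2real ((1 + C1) ^ k)"

lemma C2: "ennreal (C2 k) = (1 + C1) ^ k" "0 <= C2 k"
 using C1_finite by (auto simp: C2_def power_less_top_ennreal)

text \<open>The minor on the first \<open>k\<close> coordinates on both sides. Unlike that of
  \<open>vol\<close>, the mean of its logarithm is superadditive, up to \<open>kap\<close> for each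
  gluing factor.\<close>

definition mm :: "nat => real => nat => 'w \<times> (int => 'h op) => real" where
 "mm k eps n x = mdet k (qq eps n x) e e"

definition mE :: "nat => real => nat => real" where "mE k eps n = (EE x. ln \<bar>mm k eps n x\<bar>)"

text \<open>The mean gain of one gluing factor, which is \<open>k * ln eps\<close> up to a constant
  and so is a cost for small \<open>eps\<close>: the sizes of its \<open>k\<close> diagonal noise
  entries, minus the loss from the negative moment.\<close>

definition kap :: "nat => real => real" where
 "kap k eps = ln (\<Prod>c<k. eps * sd (c, c)) - C2 k / \<theta> k"

lemma mm_meas [measurable]: "mm k eps n \<in> borel_measurable PB"
 unfolding mm_def[abs_def] by (rule mdet_qq_meas)

lemma mdet_id_e: "mdet k id_blinfun e e = 1"
 using dt_diag[of k "%_. 1 :: real"] by (simp add: mdet_def inner_e)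

lemma dt_inner_flip: "dt k (%c b. inner (ap R (y b)) (e (I c))) = mdet k R (%a. e (I a)) y"
 by (simp add: mdet_def inner_commute)

lemma npow_mdet_top:
 fixes L R A0 :: "'h op"
 assumes "eps \<noteq> 0" "inj_on (%c. (I c, J c)) {..<k}"
 shows "(\<integral>\<^sup>+z. npow (\<theta> k) (mdet k (L oL (A0 + eps *R z) oL R) x y) \<partial>\<gamma>) <=
  ennreal (C2 k) * npow (\<theta> k) ((\<Prod>c<k. eps * sd (I c, J c)) * mdet k L x (%c. e (J c)) * mdet k R (%a. e (I a)) y)"
proof -
 have "dt k (%a c. inner (x a) (ap L (e (J c)))) = mdet k L x (%c. e (J c))" by (simp only: mdet_def)
 then show ?thesis using nn_integral_npow_mdet_top[OF \<theta>(1) \<theta>(2) assms, of k L A0 R x y] by (simp only: dt_inner_flip C2)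
qed

lemma mm_le: assumes eps: "0 <= eps" "eps <= 1" and n: "0 < n"
 shows "\<exists>w. integrable PB w \<and> (\<forall>x. \<bar>mm k eps n x\<bar> <= exp (w x))"
proof -
 interpret D: submult_process PB TB "%n x. vol k (qq eps n x)" by (rule process[OF eps])
 let ?w = "%x. \<Sum>j<n. D.Dh ((TB ^^ j) x)"
 have "integrable PB ?w" by (rule int_sum) (rule E.integrable_iter[OF D.Dh_int])
 moreover have "\<bar>mm k eps n x\<bar> <= exp (?w x)" for x
  unfolding mm_def by (rule order_trans[OF vol_upper D.D_le_Dh[OF n]]) simp_all
 ultimately show ?thesis by (intro exI[of _ ?w]) simp
qed

lemma qq_split3: "qq eps (Suc n + m) x = qq eps m ((TB ^^ Suc n) x) oL (A ((\<sigma> ^^ n) (fst x)) + eps *R snd x (int n)) oL qq eps n x"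
 unfolding cocycle_add cocycle.simps(2) gen_iter[symmetric] by (rule blinfun_eqI) simp

lemma comp_meas:
 fixes L R A0 :: "'h op"
 shows "(%z. npow t (mdet k (L oL (A0 + eps *R z) oL R) x y)) \<in> borel_measurable \<gamma>"
 by (rule measurable_compose[OF mdet_measurable[OF comp_weak] npow_measurable])

text \<open>The noise of the factor between the blocks is resampled. In its diagonal entries the
  minor of the product has as leading coefficient the two block minors times the noise sizes, which
  is what \<open>nn_integral_npow_mdet_top\<close> needs.\<close>

lemma minor_step:
 assumes eps: "0 < eps" "eps <= 1"
  and n: "AE x in PB. mm k eps n x \<noteq> 0" "integrable PB (%x. ln \<bar>mm k eps n x\<bar>)"
  and m: "AE x in PB. mm k eps m x \<noteq> 0" "integrable PB (%x. ln \<bar>mm k eps m x\<bar>)"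
 shows "AE x in PB. mm k eps (Suc n + m) x \<noteq> 0" "integrable PB (%x. ln \<bar>mm k eps (Suc n + m) x\<bar>)"
  "mE k eps n + mE k eps m + kap k eps <= mE k eps (Suc n + m)"
proof -
 define c where "c = (\<Prod>c<k. eps * sd (c, c))"
 have c0: "0 < c" unfolding c_def by (rule prod_pos) (use eps sd_pos in simp)
 let ?T = "TB ^^ Suc n"
 define a where "a x = c * \<bar>mm k eps m (?T x)\<bar> * \<bar>mm k eps n x\<bar>" for x
 define b where "b x = \<bar>mm k eps (Suc n + m) x\<bar>" for x
 have mT: "(%x. mm k eps m (?T x)) \<in> borel_measurable PB" by (rule measurable_compose[OF E.iter_measurable mm_meas])
 have am [measurable]: "a \<in> borel_measurable PB" unfolding a_def[abs_def] by (intro borel_measurable_times borel_measurable_abs mT mm_meas borel_measurable_const)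
 have bm [measurable]: "b \<in> borel_measurable PB" unfolding b_def[abs_def] by (intro borel_measurable_abs mm_meas)
 have mTne: "AE x in PB. mm k eps m (?T x) \<noteq> 0" using E.AE_iter[OF m(1)] by eventually_elim (rule spec)
 have a0: "AE x in PB. 0 < a x" using mTne n(1) by eventually_elim (simp add: a_def c0)
 have mTi: "integrable PB (%x. ln \<bar>mm k eps m (?T x)\<bar>)" and mTE: "(EE x. ln \<bar>mm k eps m (?T x)\<bar>) = mE k eps m"
  using E.integrable_iter[OF m(2), of "Suc n"] E.integral_iter[OF m(2), of "Suc n"] by (simp_all only: mE_def)
 have lna: "AE x in PB. ln (a x) = ln c + ln \<bar>mm k eps m (?T x)\<bar> + ln \<bar>mm k eps n x\<bar>"
  using mTne n(1) by eventually_elim (use c0 in \<open>simp add: a_def ln_mult\<close>)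
 have li: "integrable PB (%x. ln c + ln \<bar>mm k eps m (?T x)\<bar> + ln \<bar>mm k eps n x\<bar>)"
  by (intro int_add mTi n(2)) simp
 have ai: "integrable PB (%x. ln (a x))"
  by (rule integrable_cong_AE_imp[OF li _ AE_symmetric[OF lna]]) measurable
 have aE: "(EE x. ln (a x)) = ln c + mE k eps m + mE k eps n"
 proof -
  have "(EE x. ln (a x)) = (EE x. ln c + ln \<bar>mm k eps m (?T x)\<bar> + ln \<bar>mm k eps n x\<bar>)"
   by (rule integral_cong_AE[OF _ _ lna]) (use borel_measurable_integrable[OF li] in measurable)
  also have "... = (EE x. ln c) + (EE x. ln \<bar>mm k eps m (?T x)\<bar>) + (EE x. ln \<bar>mm k eps n x\<bar>)"
   using mTi n(2) by (subst integ_add; simp)+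
  finally show ?thesis unfolding mTE mE_def[symmetric] by (simp add: E.prob_space)
 qed
 obtain w where w: "integrable PB w" "\<forall>x. \<bar>mm k eps (Suc n + m) x\<bar> <= exp (w x)"
  using mm_le[OF less_imp_le[OF eps(1)] eps(2) add_pos_nonneg[OF zero_less_Suc le0], of k n m] by (elim exE conjE) (rule that)
 have L_rs: "qq eps m (?T (rs n z x)) = qq eps m (?T x)" for z x by (rule qq_rs) simp
 have R_rs: "qq eps n (rs n z x) = qq eps n x" for z x by (rule qq_rs0) simp
 have a_rs: "a (rs n z x) = a x" for z x unfolding a_def mm_def L_rs R_rs ..
 have "(NN x. npow (\<theta> k) (b x / a x)) <= (NN x. (if 0 < a x then ennreal (C2 k) else \<infinity>))"
 proof (rule resample_le[of _ n])
  show "(%x. npow (\<theta> k) (b x / a x)) \<in> borel_measurable PB" by measurable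
  fix x assume "x \<in> space PB"
  show "(\<integral>\<^sup>+z. npow (\<theta> k) (b (rs n z x) / a (rs n z x)) \<partial>\<gamma>) <= (if 0 < a x then ennreal (C2 k) else \<infinity>)"
  proof (cases "0 < a x")
   case True
   let ?L = "qq eps m (?T x)" and ?A0 = "A ((\<sigma> ^^ n) (fst x))" and ?R = "qq eps n x"
   have eq: "npow (\<theta> k) (b (rs n z x) / a (rs n z x)) = npow (\<theta> k) (1 / a x) * npow (\<theta> k) (mdet k (?L oL (?A0 + eps *R z) oL ?R) e e)" for z
   proof -
    have "mm k eps (Suc n + m) (rs n z x) = mdet k (?L oL (?A0 + eps *R z) oL ?R) e e"
     unfolding mm_def qq_split3 L_rs R_rs by (simp add: rs_def)
    then show ?thesis unfolding a_rs b_def npow_mult[symmetric] by (simp add: npow_def)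
   qed
   have "(\<integral>\<^sup>+z. npow (\<theta> k) (b (rs n z x) / a (rs n z x)) \<partial>\<gamma>) =
    npow (\<theta> k) (1 / a x) * (\<integral>\<^sup>+z. npow (\<theta> k) (mdet k (?L oL (?A0 + eps *R z) oL ?R) e e) \<partial>\<gamma>)"
    unfolding eq by (rule nn_integral_cmult) (rule comp_meas)
   also have "... <= npow (\<theta> k) (1 / a x) * (ennreal (C2 k) * npow (\<theta> k) (c * mdet k ?L e e * mdet k ?R e e))"
    using npow_mdet_top[of eps "%c. c" "%c. c" k ?L ?A0 ?R e e] eps unfolding c_def by (intro mult_left_mono) (auto simp: inj_on_def)
   also have "npow (\<theta> k) (c * mdet k ?L e e * mdet k ?R e e) = npow (\<theta> k) (a x)"
    using c0 by (simp add: npow_def a_def mm_def abs_mult)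
   also have "npow (\<theta> k) (1 / a x) * (ennreal (C2 k) * npow (\<theta> k) (a x)) = ennreal (C2 k) * npow (\<theta> k) (1 / a x * a x)"
    by (simp only: npow_mult mult.left_commute)
   also have "1 / a x * a x = 1" using True by simp
   finally show ?thesis using True by simp
  qed simp
 qed
 also have "... = (NN x. ennreal (C2 k))" by (rule nn_integral_cong_AE) (use a0 in eventually_elim, simp)
 also have "... = ennreal (C2 k)" by (simp add: E.emeasure_space_1)
 finally have C: "(NN x. npow (\<theta> k) (b x / a x)) <= ennreal (C2 k)" .
 note res = E.expectation_ln_ge[OF am bm a0 ai _ w(1) _ \<theta>(1) C C2(2)]
 have b0: "AE x in PB. 0 <= b x" by (simp add: b_def)
 have bw: "AE x in PB. b x <= exp (w x)" unfolding b_def by (rule AE_I2) (rule w(2)[rule_format])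
 show "AE x in PB. mm k eps (Suc n + m) x \<noteq> 0" using res(1)[OF b0 bw] by eventually_elim (simp add: b_def)
 show "integrable PB (%x. ln \<bar>mm k eps (Suc n + m) x\<bar>)" using res(2)[OF b0 bw] by (simp only: b_def)
 show "mE k eps n + mE k eps m + kap k eps <= mE k eps (Suc n + m)"
  using res(3)[OF b0 bw] unfolding aE b_def mE_def[symmetric] by (simp add: kap_def c_def)
qed

text \<open>Induction by \<open>minor_step\<close> with an empty second block, whose minor is
  1.\<close>

lemma minor_all:
 assumes eps: "0 < eps" "eps <= 1"
 shows "(AE x in PB. mm k eps n x \<noteq> 0) \<and> integrable PB (%x. ln \<bar>mm k eps n x\<bar>)"
proof (induction n)
 case 0
 have 1: "mm k eps 0 x = 1" for x by (simp add: mm_def mdet_id_e)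
 show ?case unfolding 1 by simp
next
 case (Suc n)
 have 1: "mm k eps 0 x = 1" for x by (simp add: mm_def mdet_id_e)
 have 0: "AE x in PB. mm k eps 0 x \<noteq> 0" "integrable PB (%x. ln \<bar>mm k eps 0 x\<bar>)" unfolding 1 by simp_all
 show ?case using minor_step(1,2)[OF eps conjunct1[OF Suc] conjunct2[OF Suc] 0] by simp
qed

lemma minor_add:
 assumes eps: "0 < eps" "eps <= 1"
 shows "mE k eps n + mE k eps m + kap k eps <= mE k eps (Suc n + m)"
 by (rule minor_step(3)[OF eps conjunct1[OF minor_all[OF eps]] conjunct2[OF minor_all[OF eps]] conjunct1[OF minor_all[OF eps]] conjunct2[OF minor_all[OF eps]]])

text \<open>The period is \<open>Suc n\<close> because each block brings its own gluing
  factor.\<close>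

lemma minor_multiple:
 assumes eps: "0 < eps" "eps <= 1"
 shows "real i * (mE k eps n + kap k eps) <= mE k eps (i * Suc n)"
proof (induction i)
 case 0
 have 1: "mm k eps 0 x = 1" for x by (simp add: mm_def mdet_id_e)
 show ?case by (simp add: mE_def 1)
next
 case (Suc i)
 have "real (Suc i) * (mE k eps n + kap k eps) = real i * (mE k eps n + kap k eps) + (mE k eps n + kap k eps)" by (simp add: algebra_simps)
 also have "... <= mE k eps (i * Suc n) + (mE k eps n + kap k eps)" using Suc by simp
 also have "... <= mE k eps (Suc n + i * Suc n)" using minor_add[OF eps, of k n "i * Suc n"] by simp
 finally show ?case unfolding mult_Suc .
qed

lemma vol_ge_minor:
 assumes eps: "0 < eps" "eps <= 1" and n: "0 < n"
 shows "AE x in PB. 0 < vol k (qq eps n x)" "integrable PB (%x. ln (vol k (qq eps n x)))"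
  "mE k eps n <= (EE x. ln (vol k (qq eps n x)))"
proof -
 interpret D: submult_process PB TB "%n x. vol k (qq eps n x)" by (rule process) (use eps in auto)
 have le: "\<bar>mm k eps n x\<bar> <= vol k (qq eps n x)" for x unfolding mm_def by (rule vol_upper) simp_all
 have ne: "AE x in PB. mm k eps n x \<noteq> 0" and mi: "integrable PB (%x. ln \<bar>mm k eps n x\<bar>)" using minor_all[OF eps] by auto
 show pos: "AE x in PB. 0 < vol k (qq eps n x)" using ne by eventually_elim (rule less_le_trans[OF _ le], simp)
 have lo: "AE x in PB. ln \<bar>mm k eps n x\<bar> <= ln (vol k (qq eps n x))"
  using ne pos by eventually_elim (use le in simp)
 have up: "AE x in PB. ln (vol k (qq eps n x)) <= (\<Sum>j<n. D.Dh ((TB ^^ j) x))"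
  using pos
 proof eventually_elim
  case (elim x)
  have "ln (vol k (qq eps n x)) <= ln (exp (\<Sum>j<n. D.Dh ((TB ^^ j) x)))" using D.D_le_Dh[OF n, of x] elim by (subst ln_le_cancel_iff) auto
  then show ?case by simp
 qed
 show vi: "integrable PB (%x. ln (vol k (qq eps n x)))"
 proof (rule integrable_sandwich[OF mi _ _ lo up])
  show "integrable PB (%x. \<Sum>j<n. D.Dh ((TB ^^ j) x))" by (rule int_sum) (rule E.integrable_iter[OF D.Dh_int])
 qed measurable
 show "mE k eps n <= (EE x. ln (vol k (qq eps n x)))" unfolding mE_def by (rule integral_mono_AE[OF mi vi lo])
qed

text \<open>Superadditivity of the minors and submultiplicativity of the volumes meet at the common
  length \<open>m * Suc n\<close>, which gives the bound for every \<open>m\<close> without a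
  limit.\<close>

lemma lam_ge_minor:
 assumes eps: "0 < eps" "eps <= 1"
 shows "ereal ((mE k eps n + kap k eps) / real (Suc n)) <= lam k eps"
proof -
 interpret D: submult_process PB TB "%n x. vol k (qq eps n x)" by (rule process) (use eps in auto)
 let ?v = "%m. \<integral>x. ln (vol k (qq eps m x)) \<partial>PB"
 note vg = vol_ge_minor[OF eps, where k=k]
 have sub: "?v (Suc i * m) <= real (Suc i) * ?v m" if m: "0 < m" for i m
 proof (induction i)
  case (Suc i)
  let ?w = "%x. vol k (qq eps (Suc i * m) ((TB ^^ m) x))"
  have p: "0 < Suc i * m" "0 < Suc (Suc i) * m" using m by auto
  have i2: "integrable PB (%x. ln (?w x))" by (rule E.integrable_iter[OF vg(2)[OF p(1)]])
  have "AE x in PB. 0 < ?w x" using E.AE_iter[OF vg(1)[OF p(1)]] by eventually_elim (rule spec)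
  then have ae: "AE x in PB. ln (vol k (qq eps (Suc (Suc i) * m) x)) <= ln (vol k (qq eps m x)) + ln (?w x)"
   using vg(1)[OF p(2)] vg(1)[OF m]
  proof eventually_elim
   case (elim x)
   have "vol k (qq eps (Suc (Suc i) * m) x) <= vol k (qq eps m x) * ?w x"
    using D.D_submult[of m "Suc i * m" x] unfolding mult_Suc .
   then have "ln (vol k (qq eps (Suc (Suc i) * m) x)) <= ln (vol k (qq eps m x) * ?w x)"
    using elim(2) by (rule ln_mono)
   also have "... = ln (vol k (qq eps m x)) + ln (?w x)" by (rule ln_mult_pos[OF elim(3,1)])
   finally show ?case .
  qed
  have "?v (Suc (Suc i) * m) <= (EE x. ln (vol k (qq eps m x)) + ln (?w x))"
   by (rule integral_mono_AE[OF vg(2)[OF p(2)] int_add[OF vg(2)[OF m] i2] ae])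
  also have "... = ?v m + (EE x. ln (?w x))"
   by (rule integ_add[OF vg(2)[OF m] i2])
  also have "(EE x. ln (?w x)) = ?v (Suc i * m)" by (rule E.integral_iter[OF vg(2)[OF p(1)]])
  also have "?v m + ?v (Suc i * m) <= real (Suc (Suc i)) * ?v m" using Suc by (simp add: algebra_simps)
  finally show ?case .
 qed simp
 have main: "real m * ((mE k eps n + kap k eps) / real (Suc n)) <= ?v m" if m: "0 < m" for m
 proof -
  have "real m * (mE k eps n + kap k eps) <= mE k eps (m * Suc n)" by (rule minor_multiple[OF eps])
  also have "... <= ?v (m * Suc n)" by (rule vg(3)) (use m in simp)
  also have "... <= real (Suc n) * ?v m" using sub[OF m, of n] by (simp only: mult.commute)
  finally show ?thesis by (simp add: pos_divide_le_eq mult.commute del: of_nat_Suc)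
 qed
 show ?thesis unfolding lam_def by (rule D.lyap_ge[OF vg(1,2) main])
qed

end

section \<open>Lower bound for the sums of exponents\<close>

context perturbation begin

lemma U_rs: "i \<noteq> t ==> U ((TB ^^ i) (rs t z x)) = U ((TB ^^ i) x)"
 by (simp add: U_def TB_iter rs_def B.S_def)

lemma qq_split_ends: "qq eps (Suc (Suc N)) x = gen eps ((TB ^^ Suc N) x) oL qq eps N ((TB ^^ 1) x) oL gen eps x"
proof -
 have "qq eps (1 + N) x = qq eps N ((TB ^^ 1) x) oL qq eps 1 x" by (rule cocycle_add)
 then have 1: "qq eps (Suc N) x = qq eps N ((TB ^^ 1) x) oL gen eps x" by (simp only: One_nat_def cocycle_1 plus_nat.add_Suc plus_nat.add_0)
 show ?thesis unfolding cocycle.simps(2)[of TB "gen eps" "Suc N"] 1 by (rule blinfun_eqI) simp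
qed

text \<open>The constant part of the logarithm of the lower bound in
  \<open>minor_lower\<close>.\<close>

definition cc :: "nat => real" where
 "cc k = - ln 4 - real (k * k + k) * ln 9 - 8 * real k * (ln 8 + ln ((real k + 1) * fact k ^ 3))"

text \<open>A block of \<open>n + 2\<close> factors with large volume has some large minor, at rows
  \<open>I\<close> and columns \<open>J\<close> given by \<open>minor_lower\<close>, whose outer
  factors serve the truncation. One more noisy factor at each end connects \<open>I\<close> and
  \<open>J\<close> with the first \<open>k\<close> coordinates, so the leading minor of
  \<open>n + 4\<close> factors is large too. \<open>I\<close> and \<open>J\<close> are found from
  the middle block alone, hence stay fixed while the noise at both ends is resampled.\<close>

lemma ends_lower:
 assumes eps: "0 < eps" "eps <= 1"
  and W: "integrable PB W" "\<And>x. vol k (qq eps n x) <= fact k * exp (W x)"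
   "\<And>t z x. t < 2 \<or> n + 2 <= t ==> W ((TB ^^ 2) (rs t z x)) = W ((TB ^^ 2) x)"
 shows "2 * real k * ln eps + cc k + (1 + 8 * real k) * (EE x. ln (vol k (qq eps (n + 2) x)))
  - 8 * real k * (2 * real k * (EE x. U x) + (EE x. W x)) - (C2 k)\<^sup>2 / \<theta> k <= mE k eps (n + 4)"
proof -
 have eps': "0 <= eps" using eps by simp
 define Z where "Z x = qq eps (n + 2) ((TB ^^ 1) x)" for x
 define v where "v x = vol k (Z x)" for x
 define la where "la x = 2 * real k * ln eps + cc k + (1 + 8 * real k) * ln (v x)
  - 8 * real k * (real k * U ((TB ^^ (n + 2)) x) + real k * U ((TB ^^ 1) x) + W ((TB ^^ 2) x))" for x
 define a where "a x = exp (la x)" for x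
 define b where "b x = \<bar>mm k eps (n + 4) x\<bar>" for x
 have N0: "0 < n + 2" by simp
 note vg = vol_ge_minor[OF eps N0, where k=k]
 have Zw: "weakly_measurable PB Z" unfolding Z_def[abs_def] by (rule weakly_measurable_map[OF qq_weak E.iter_measurable])
 have vm [measurable]: "v \<in> borel_measurable PB" unfolding v_def[abs_def] by (rule vol_measurable[OF Zw])
 have v0: "AE x in PB. 0 < v x"
  using E.AE_iter[OF vg(1)] unfolding v_def Z_def by eventually_elim (rule spec)
 have vi: "integrable PB (%x. ln (v x))" unfolding v_def Z_def by (rule E.integrable_iter[OF vg(2)])
 have vE: "(EE x. ln (v x)) = (EE x. ln (vol k (qq eps (n + 2) x)))" unfolding v_def Z_def by (rule E.integral_iter[OF vg(2)])
 have Ui: "integrable PB (%x. U ((TB ^^ i) x))" and UE: "(EE x. U ((TB ^^ i) x)) = (EE x. U x)" for i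
  by (rule E.integrable_iter[OF U_int], rule E.integral_iter[OF U_int])
 have Wi: "integrable PB (%x. W ((TB ^^ 2) x))" and WE: "(EE x. W ((TB ^^ 2) x)) = (EE x. W x)"
  by (rule E.integrable_iter[OF W(1)], rule E.integral_iter[OF W(1)])
 have lai: "integrable PB la"
  unfolding la_def[abs_def]
  by (intro int_diff int_add integrable_mult_right vi Ui Wi) simp_all
 have laE: "(EE x. la x) = 2 * real k * ln eps + cc k + (1 + 8 * real k) * (EE x. ln (vol k (qq eps (n + 2) x)))
  - 8 * real k * (2 * real k * (EE x. U x) + (EE x. W x))"
 proof -
  have i3: "integrable PB (%x. real k * U ((TB ^^ (n + 2)) x) + real k * U ((TB ^^ 1) x) + W ((TB ^^ 2) x))"
   by (intro int_add integrable_mult_right Ui Wi)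
  have e3: "(EE x. real k * U ((TB ^^ (n + 2)) x) + real k * U ((TB ^^ 1) x) + W ((TB ^^ 2) x)) = 2 * real k * (EE x. U x) + (EE x. W x)"
  proof -
   have "(EE x. real k * U ((TB ^^ (n + 2)) x) + real k * U ((TB ^^ 1) x) + W ((TB ^^ 2) x)) =
    (EE x. real k * U ((TB ^^ (n + 2)) x)) + (EE x. real k * U ((TB ^^ 1) x)) + (EE x. W ((TB ^^ 2) x))"
    by (subst integ_add, intro int_add integrable_mult_right Ui, rule Wi,
     subst integ_add, intro integrable_mult_right Ui, intro integrable_mult_right Ui, rule refl)
   then show ?thesis unfolding integral_mult_right_zero UE WE by (simp only: mult_2 distrib_right)
  qed
  have i2: "integrable PB (%x. 2 * real k * ln eps + cc k + (1 + 8 * real k) * ln (v x))"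
   by (intro int_add integrable_mult_right vi) simp_all
  have e2: "(EE x. 2 * real k * ln eps + cc k + (1 + 8 * real k) * ln (v x)) = 2 * real k * ln eps + cc k + (1 + 8 * real k) * (EE x. ln (vol k (qq eps (n + 2) x)))"
   using vi by (simp add: E.prob_space vE)
  show ?thesis unfolding la_def
   by (subst Bochner_Integration.integral_diff[OF i2 integrable_mult_right[OF i3]], unfold e2 integral_mult_right_zero e3, rule refl)
 qed
 have am [measurable]: "a \<in> borel_measurable PB" unfolding a_def[abs_def] using borel_measurable_integrable[OF lai] by measurable
 have bm [measurable]: "b \<in> borel_measurable PB" unfolding b_def[abs_def] by (intro borel_measurable_abs mm_meas)
 have v_rs: "v (rs t z x) = v x" if "t < 1 \<or> n + 3 <= t" for t z x
  unfolding v_def Z_def by (subst qq_rs) (use that in auto)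
 have Z_rs: "Z (rs t z x) = Z x" if "t < 1 \<or> n + 3 <= t" for t z x
  unfolding Z_def by (subst qq_rs) (use that in auto)
 have a_rs: "a (rs t z x) = a x" if "t < 1 \<or> n + 3 <= t" for t z x
 proof -
  have "n + 2 \<noteq> t" "1 \<noteq> t" "t < 2 \<or> n + 2 <= t" using that by auto
  then show ?thesis unfolding a_def la_def v_rs[OF that] by (simp only: U_rs W(3) simp_thms)
 qed
 \<comment> \<open>\<open>a x\<close> is designed to lie below the middle minor times the noise
   sizes at both ends, whatever indices \<open>I\<close> and \<open>J\<close> occur; this makes
   \<open>a\<close> measurable without a measurable choice of indices.\<close>
 have minor: "\<exists>I J. a x <= (\<Prod>c<k. eps * sd (c, J c)) * (\<Prod>c<k. eps * sd (I c, c)) * \<bar>mdet k (Z x) (%a. e (I a)) (%b. e (J b))\<bar>"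
  if x: "x \<in> space PB" and vx: "0 < v x" for x
 proof -
  let ?A = "gen eps ((TB ^^ (n + 2)) x)" and ?A' = "gen eps ((TB ^^ 1) x)" and ?Z' = "qq eps n ((TB ^^ 2) x)"
  have Zx: "Z x = ?A oL ?Z' oL ?A'"
  proof -
   have "(TB ^^ Suc n) ((TB ^^ 1) x) = (TB ^^ (n + 2)) x" "(TB ^^ 1) ((TB ^^ 1) x) = (TB ^^ 2) x"
    by (simp_all add: funpow_swap1 numeral_2_eq_2)
   then show ?thesis unfolding Z_def using qq_split_ends[of eps n "(TB ^^ 1) x"] by (simp only: add_2_eq_Suc')
  qed
  have S1: "SHS_norm e ?A <= exp (U ((TB ^^ (n + 2)) x))" and S2: "SHS_norm e ?A' <= exp (U ((TB ^^ 1) x))"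
   using gen_norm[OF E.iter_space[OF x] eps' eps(2), of "n + 2"] gen_norm[OF E.iter_space[OF x] eps' eps(2), of 1] by linarith+
  have p: "0 < vol k (?A oL ?Z' oL ?A')" using vx unfolding v_def Zx .
  let ?E = "(real k + 1) * (fact k)\<^sup>2 * exp (U ((TB ^^ (n + 2)) x)) ^ k * exp (U ((TB ^^ 1) x)) ^ k * (fact k * exp (W ((TB ^^ 2) x)))"
  obtain I J where IJ: "v x / 4 * (1 / 9) ^ (k * k + k) * (v x / (8 * ?E)) ^ (8 * k) <=
   (\<Prod>c<k. sd (c, J c)) * (\<Prod>c<k. sd (I c, c)) * \<bar>mdet k (Z x) (%a. e (I a)) (%b. e (J b))\<bar>"
   using minor_lower[OF gen_SHS[OF E.iter_space[OF x]] S1 gen_SHS[OF E.iter_space[OF x]] S2 W(2) p] unfolding Zx[symmetric] v_def[symmetric]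
   by (elim exE) (rule that)
  have E_eq: "?E = exp (ln ((real k + 1) * fact k ^ 3) + (real k * U ((TB ^^ (n + 2)) x) + real k * U ((TB ^^ 1) x) + W ((TB ^^ 2) x)))"
  proof -
   have 1: "exp (ln ((real k + 1) * fact k ^ 3)) = (real k + 1) * fact k ^ 3" by (rule exp_ln) (simp add: add_nonneg_pos)
   show ?thesis unfolding exp_add 1 exp_of_nat_mult by (simp add: power2_eq_square power3_eq_cube)
  qed
  have "ln (v x / 4 * (1 / 9) ^ (k * k + k) * (v x / (8 * ?E)) ^ (8 * k)) = la x - 2 * real k * ln eps"
  proof -
   have 1: "ln (v x / 4 * (1 / 9) ^ (k * k + k) * (v x / (8 * ?E)) ^ (8 * k)) =
     ln (v x) - ln 4 + real (k * k + k) * ln (1 / 9) + real (8 * k) * (ln (v x) - ln (8 * ?E))"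
    using vx unfolding E_eq by (simp add: ln_mult ln_div ln_realpow)
   have 2: "ln (8 * ?E) = ln 8 + (ln ((real k + 1) * fact k ^ 3) + (real k * U ((TB ^^ (n + 2)) x) + real k * U ((TB ^^ 1) x) + W ((TB ^^ 2) x)))"
    unfolding E_eq by (subst ln_mult_pos) auto
   have 3: "ln (1 / 9 :: real) = - ln 9" by (simp add: ln_div)
   show ?thesis unfolding 1 2 3 la_def cc_def by (simp add: algebra_simps)
  qed
  moreover have E0: "0 < v x / 4 * (1 / 9) ^ (k * k + k) * (v x / (8 * ?E)) ^ (8 * k)"
   unfolding E_eq using vx by simp
  ultimately have "exp (la x - 2 * real k * ln eps) = v x / 4 * (1 / 9) ^ (k * k + k) * (v x / (8 * ?E)) ^ (8 * k)"
   by (metis exp_ln)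
  moreover have "a x = eps ^ k * eps ^ k * exp (la x - 2 * real k * ln eps)"
  proof -
   have "eps ^ k = exp (real k * ln eps)" using eps(1) by (simp add: exp_of_nat_mult)
   then show ?thesis unfolding a_def by (simp add: exp_add[symmetric])
  qed
  ultimately have "a x <= eps ^ k * eps ^ k * ((\<Prod>c<k. sd (c, J c)) * (\<Prod>c<k. sd (I c, c)) * \<bar>mdet k (Z x) (%a. e (I a)) (%b. e (J b))\<bar>)"
   using IJ eps(1) by (simp only:) (rule mult_left_mono, auto)
  also have "... = (\<Prod>c<k. eps * sd (c, J c)) * (\<Prod>c<k. eps * sd (I c, c)) * \<bar>mdet k (Z x) (%a. e (I a)) (%b. e (J b))\<bar>"
   by (simp add: prod.distrib)
  finally show ?thesis by (intro exI)
 qed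
 let ?t = "n + 3"
 \<comment> \<open>The integral over the noise of time 0, kept as a function of \<open>x\<close> so
   that the noise of time \<open>n + 3\<close> can be resampled next.\<close>
 define G where "G x = (\<integral>\<^sup>+z. npow (\<theta> k) (b (rs 0 z x) / a (rs 0 z x)) \<partial>\<gamma>)" for x
 have Fm: "(%x. npow (\<theta> k) (b x / a x)) \<in> borel_measurable PB" by measurable
 have Gm: "G \<in> borel_measurable PB" unfolding G_def[abs_def] by (rule resample_measurable[OF Fm])
 have inner: "(\<integral>\<^sup>+z'. G (rs ?t z' x) \<partial>\<gamma>) <= (if 0 < v x then ennreal ((C2 k)\<^sup>2) else \<infinity>)" if x: "x \<in> space PB" for x
 proof (cases "0 < v x")
  case True
  obtain I J where IJ: "a x <= (\<Prod>c<k. eps * sd (c, J c)) * (\<Prod>c<k. eps * sd (I c, c)) * \<bar>mdet k (Z x) (%a. e (I a)) (%b. e (J b))\<bar>"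
   using minor[OF x True] by (elim exE) (rule that)
  let ?A1 = "A ((\<sigma> ^^ ?t) (fst x))" and ?A0 = "A (fst x)"
  let ?p = "\<Prod>c<k. eps * sd (c, J c)" and ?p' = "\<Prod>c<k. eps * sd (I c, c)"
  have Gle: "G (rs ?t z' x) <= npow (\<theta> k) (1 / a x) * (ennreal (C2 k) * npow (\<theta> k) ?p) * npow (\<theta> k) (mdet k (id_blinfun oL (?A1 + eps *R z') oL Z x) e (%c. e (J c)))" for z'
  proof -
   let ?y = "%z. rs 0 z (rs ?t z' x)"
   let ?L = "(?A1 + eps *R z') oL Z x"
   have qy: "qq eps (n + 4) (?y z) = ?L oL (?A0 + eps *R z) oL id_blinfun" for z
   proof -
    have 1: "qq eps (n + 2) ((TB ^^ 1) (?y z)) = Z x" using Z_rs[of 0 z "rs ?t z' x"] Z_rs[of ?t z' x] unfolding Z_def by simp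
    have 2: "gen eps ((TB ^^ Suc (n + 2)) (?y z)) = ?A1 + eps *R z'"
     unfolding gen_iter by (simp add: rs_def numeral_3_eq_3)
    have 3: "gen eps (?y z) = ?A0 + eps *R z" by (simp add: gen_eq rs_def)
    have n4: "n + 4 = Suc (Suc (n + 2))" by simp
    show ?thesis unfolding n4 qq_split_ends 1 2 3 by (rule blinfun_eqI) simp
   qed
   have eq: "npow (\<theta> k) (b (?y z) / a (?y z)) = npow (\<theta> k) (1 / a x) * npow (\<theta> k) (mdet k (?L oL (?A0 + eps *R z) oL id_blinfun) e e)" for z
   proof -
    have "a (?y z) = a x" by (simp add: a_rs)
    then show ?thesis unfolding b_def mm_def qy npow_mult[symmetric] by (simp add: npow_def)
   qed
   have "G (rs ?t z' x) = npow (\<theta> k) (1 / a x) * (\<integral>\<^sup>+z. npow (\<theta> k) (mdet k (?L oL (?A0 + eps *R z) oL id_blinfun) e e) \<partial>\<gamma>)"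
    unfolding G_def eq by (rule nn_integral_cmult) (rule comp_meas)
   also have "... <= npow (\<theta> k) (1 / a x) * (ennreal (C2 k) * npow (\<theta> k) (?p * mdet k ?L e (%c. e (J c)) * mdet k id_blinfun (%a. e a) e))"
    using eps(1) by (intro mult_left_mono npow_mdet_top) (auto simp: inj_on_def)
   also have "... = npow (\<theta> k) (1 / a x) * (ennreal (C2 k) * npow (\<theta> k) ?p) * npow (\<theta> k) (mdet k ?L e (%c. e (J c)))"
    by (simp add: mdet_id_e npow_mult mult.assoc)
   also have "?L = id_blinfun oL (?A1 + eps *R z') oL Z x" by (rule blinfun_eqI) simp
   finally show ?thesis .
  qed
  have "(\<integral>\<^sup>+z'. G (rs ?t z' x) \<partial>\<gamma>) <=
   (\<integral>\<^sup>+z'. npow (\<theta> k) (1 / a x) * (ennreal (C2 k) * npow (\<theta> k) ?p) * npow (\<theta> k) (mdet k (id_blinfun oL (?A1 + eps *R z') oL Z x) e (%c. e (J c))) \<partial>\<gamma>)"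
   by (rule nn_integral_mono) (rule Gle)
  also have "... = npow (\<theta> k) (1 / a x) * (ennreal (C2 k) * npow (\<theta> k) ?p) *
    (\<integral>\<^sup>+z'. npow (\<theta> k) (mdet k (id_blinfun oL (?A1 + eps *R z') oL Z x) e (%c. e (J c))) \<partial>\<gamma>)"
   by (rule nn_integral_cmult) (rule comp_meas)
  also have "... <= npow (\<theta> k) (1 / a x) * (ennreal (C2 k) * npow (\<theta> k) ?p) *
    (ennreal (C2 k) * npow (\<theta> k) (?p' * mdet k id_blinfun e (%c. e c) * mdet k (Z x) (%a. e (I a)) (%c. e (J c))))"
   using eps(1) by (intro mult_left_mono npow_mdet_top) (auto simp: inj_on_def)
  also have "... = ennreal ((C2 k)\<^sup>2) * npow (\<theta> k) (1 / a x * (?p * ?p' * mdet k (Z x) (%a. e (I a)) (%c. e (J c))))"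
   unfolding power2_eq_square ennreal_mult[OF C2(2) C2(2)] npow_mult mdet_id_e npow_1 by (simp only: mult_ac mult_1)
  also have "... <= ennreal ((C2 k)\<^sup>2) * npow (\<theta> k) 1"
  proof (intro mult_left_mono npow_antimono[OF \<theta>(1)])
   have a0: "0 < a x" by (simp add: a_def)
   have p0: "0 <= ?p" "0 <= ?p'" by (rule prod_nonneg, use eps(1) sd_pos in \<open>simp add: less_imp_le\<close>)+
   have "\<bar>1 / a x * (?p * ?p' * mdet k (Z x) (%a. e (I a)) (%c. e (J c)))\<bar> = (?p * ?p' * \<bar>mdet k (Z x) (%a. e (I a)) (%c. e (J c))\<bar>) / a x"
    using a0 p0 by (simp add: abs_mult)
   then show "\<bar>1\<bar> <= \<bar>1 / a x * (?p * ?p' * mdet k (Z x) (%a. e (I a)) (%c. e (J c)))\<bar>" using IJ a0 by (simp only: le_divide_eq_1_pos abs_one)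
  qed simp
  finally show ?thesis using True by simp
 qed simp
 have "(NN x. npow (\<theta> k) (b x / a x)) = (NN x. G x)" unfolding G_def by (rule resample[OF Fm])
 also have "... <= (NN x. (if 0 < v x then ennreal ((C2 k)\<^sup>2) else \<infinity>))" by (rule resample_le[OF Gm, of ?t]) (rule inner)
 also have "... = (NN x. ennreal ((C2 k)\<^sup>2))" by (rule nn_integral_cong_AE) (use v0 in eventually_elim, simp)
 also have "... = ennreal ((C2 k)\<^sup>2)" by (simp add: E.emeasure_space_1)
 finally have C: "(NN x. npow (\<theta> k) (b x / a x)) <= ennreal ((C2 k)\<^sup>2)" .
 have p4: "0 < n + 4" by simp
 obtain w where w: "integrable PB w" "\<forall>x. \<bar>mm k eps (n + 4) x\<bar> <= exp (w x)"
  using mm_le[OF eps' eps(2) p4, of k] by (elim exE conjE) (rule that)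
 have ai: "integrable PB (%x. ln (a x))" unfolding a_def ln_exp by (rule lai)
 have aE: "(EE x. ln (a x)) = (EE x. la x)" unfolding a_def ln_exp ..
 have a0: "AE x in PB. 0 < a x" by (simp add: a_def)
 have b0: "AE x in PB. 0 <= b x" by (simp add: b_def)
 have bw: "AE x in PB. b x <= exp (w x)" unfolding b_def by (rule AE_I2) (rule w(2)[rule_format])
 from E.expectation_ln_ge(3)[OF am bm a0 ai b0 w(1) bw \<theta>(1) C zero_le_power2]
 show ?thesis unfolding aE laE b_def mE_def[symmetric] .
qed

text \<open>\<open>lower_qq\<close> makes the volume of one long block large,
  \<open>ends_lower\<close> turns it into a leading minor, and \<open>lam_ge_minor\<close> repeats
  it periodically. The constants are fixed in the order \<open>\<delta>\<close>, \<open>M\<close>,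
  \<open>eps\<close>.\<close>

lemma lam_lower:
 assumes fin: "lam k 0 = ereal L" and \<tau>: "0 < \<tau>"
 shows "ER eps. ereal (L - \<tau>) <= lam k eps"
proof -
 \<comment> \<open>The lower bound for the volume enters \<open>1 + 8 * k\<close> times and the a
   priori upper bound \<open>8 * k\<close> times, each with an error \<open>\<delta>\<close> per
   step.\<close>
 define \<delta> where "\<delta> = \<tau> / (4 * (1 + 16 * real k))"
 have k16: "0 < 1 + 16 * real k" by (simp add: add_pos_nonneg)
 have \<delta>: "0 < \<delta>" "(1 + 16 * real k) * \<delta> = \<tau> / 4" 
 proof -
  show "0 < \<delta>" unfolding \<delta>_def using \<tau> k16 by simp
  have "d * (\<tau> / (4 * d)) = \<tau> / 4" if "0 < d" for d :: real using that by simp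
  from this[OF k16] show "(1 + 16 * real k) * \<delta> = \<tau> / 4" unfolding \<delta>_def .
 qed
 \<comment> \<open>The two ends and the gluing factor cost \<open>3 * k\<close> powers of
   \<open>eps\<close>; this \<open>M\<close> spreads their logarithm so that it takes at most a
   quarter of \<open>\<tau>\<close> per step.\<close>
 define M where "M = 12 * real k / \<tau> + 1"
 have M: "0 < M" "3 * real k / M <= \<tau> / 4"
 proof -
  have "0 <= 12 * real k / \<tau>" using \<tau> by simp
  then show M0: "0 < M" unfolding M_def by linarith
  have "12 * real k = 12 * real k / \<tau> * \<tau>" using \<tau> by simp
  also have "... <= M * \<tau>" using \<tau> unfolding M_def by (intro mult_right_mono) auto
  finally show "3 * real k / M <= \<tau> / 4" using M0 by (simp add: field_simps)
 qed
 define a where "a = L + \<delta>"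
 have "lam k 0 < ereal a" using fin \<delta> by (simp add: a_def)
 from exp_bound[OF this] obtain eps0 C where eps0: "0 < eps0" "eps0 <= 1" and C: "0 <= C"
  and W: "\<forall>eps. 0 <= eps --> eps <= eps0 --> (\<forall>n. \<exists>W. integrable PB W \<and>
  (\<forall>x. vol k (qq eps n x) <= fact k * exp (W x)) \<and> (EE x. W x) <= a * real n + C \<and>
  (\<forall>x y. (\<forall>j m. j + m <= n --> qq eps m ((TB ^^ j) x) = qq eps m ((TB ^^ j) y)) --> W x = W y))"
  by (elim exE conjE) (rule that)
 define pr where "pr = ln (\<Prod>c<k. sd (c, c))"
 define K1 where "K1 = - cc k + 8 * real k * (2 * real k * (EE x. U x) + C) + (C2 k)\<^sup>2 / \<theta> k - pr + C2 k / \<theta> k"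
 \<comment> \<open>The term \<open>3 * L\<close> accounts for the three factors, two ends and one
   for gluing, that extend a block of length \<open>N\<close> to a full period.\<close>
 define K2 where "K2 = \<bar>K1\<bar> + \<bar>16 * real k * (L + \<delta>)\<bar> + \<bar>3 * L\<bar>"
 have core: "ereal (L - \<tau>) <= lam k eps"
  if eps: "0 < eps" "eps <= eps0" and big: "2 * K2 / \<tau> + 2 <= M * (- ln eps)"
   and v: "\<forall>n. n = nat \<lceil>M * (- ln eps)\<rceil> --> 0 < n \<and> (AE x in PB. 0 < vol k (qq eps n x)) \<and>
  integrable PB (%x. ln (vol k (qq eps n x))) \<and> (L - \<delta>) * real n <= (EE x. ln (vol k (qq eps n x)))" for eps
 proof -
  define N where "N = nat \<lceil>M * (- ln eps)\<rceil>"
  have eps1: "eps <= 1" using eps(2) eps0(2) by simp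
  have vN: "(L - \<delta>) * real N <= (EE x. ln (vol k (qq eps N x)))" using v[THEN spec, THEN mp, OF N_def] by (elim conjE)
  have Nge: "M * (- ln eps) <= real N" unfolding N_def by (rule real_nat_ceiling_ge)
  have "0 <= 2 * K2 / \<tau>" using \<tau> by (simp add: K2_def)
  then have "2 <= real N" and K2N: "2 * K2 / \<tau> <= real N" using big Nge by linarith+
  then have "2 <= N" by simp
  then obtain n where n: "N = n + 2" by (metis add.commute le_Suc_ex)
  obtain W' where W': "integrable PB W'" "\<forall>x. vol k (qq eps n x) <= fact k * exp (W' x)"
   "(EE x. W' x) <= a * real n + C"
   "\<forall>x y. (\<forall>j m. j + m <= n --> qq eps m ((TB ^^ j) x) = qq eps m ((TB ^^ j) y)) --> W' x = W' y"
   using W[THEN spec, THEN mp, THEN mp, THEN spec, of eps n, OF less_imp_le[OF eps(1)] eps(2)] by (elim exE conjE) (rule that)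
  have Winv: "W' ((TB ^^ 2) (rs t z x)) = W' ((TB ^^ 2) x)" if t: "t < 2 \<or> n + 2 <= t" for t z x
  proof (rule W'(4)[rule_format])
   fix j m assume jm: "j + m <= n"
   have "(TB ^^ j) ((TB ^^ 2) y) = (TB ^^ (j + 2)) y" for y by (simp only: funpow_add o_apply)
   note this[of "rs t z x"] this[of x]
   then show "qq eps m ((TB ^^ j) ((TB ^^ 2) (rs t z x))) = qq eps m ((TB ^^ j) ((TB ^^ 2) x))"
    by (simp only:) (rule qq_rs, use t jm in auto)
  qed
  note el = ends_lower[OF eps(1) eps1 W'(1) W'(2)[rule_format] Winv]
  have kp: "kap k eps = real k * ln eps + pr - C2 k / \<theta> k"
  proof -
   have "0 < (\<Prod>c<k. sd (c, c))" by (rule prod_pos) (simp add: sd_pos)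
   then show ?thesis using eps(1) by (simp add: kap_def pr_def prod.distrib ln_mult ln_realpow sd_nonzero)
  qed
  define vn where "vn = (EE x. ln (vol k (qq eps N x)))"
  have e1: "2 * real k * ln eps + cc k + (1 + 8 * real k) * vn - 8 * real k * (2 * real k * (EE x. U x) + (EE x. W' x)) - (C2 k)\<^sup>2 / \<theta> k <= mE k eps (n + 4)"
   using el unfolding vn_def n .
  have e2: "(1 + 8 * real k) * ((L - \<delta>) * real N) <= (1 + 8 * real k) * vn"
   using vN unfolding vn_def by (intro mult_left_mono) auto
  have e3: "8 * real k * (2 * real k * (EE x. U x) + (EE x. W' x)) <= 8 * real k * (2 * real k * (EE x. U x) + (a * real n + C))"
   using W'(3) by (intro mult_left_mono add_left_mono) auto
  have e4: "- (\<tau> / 4) * real N <= 3 * real k * ln eps"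
  proof -
   have "3 * real k * (- ln eps) = 3 * real k / M * (M * (- ln eps))" using M(1) by simp
   also have "... <= 3 * real k / M * real N" using M(1) by (intro mult_left_mono Nge) auto
   also have "... <= \<tau> / 4 * real N" by (intro mult_right_mono M(2)) simp
   finally show ?thesis by simp
  qed
  have e5: "K2 <= \<tau> / 2 * real N" using K2N \<tau> by (simp add: pos_divide_le_eq mult_ac)
  have e6: "(1 + 8 * real k) * ((L - \<delta>) * real N) - 8 * real k * (a * real n) = L * real N - \<tau> / 4 * real N + 16 * real k * (L + \<delta>)"
  proof -
   have rn: "real N = real n + 2" by (simp add: n)
   have "(1 + 8 * real k) * ((L - \<delta>) * real N) - 8 * real k * (a * real n) = L * real N - ((1 + 16 * real k) * \<delta>) * real N + 16 * real k * (L + \<delta>)"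
    unfolding rn by (simp add: a_def algebra_simps)
   then show ?thesis unfolding \<delta>(2) .
  qed
  have "L * real N - \<tau> / 4 * real N + 16 * real k * (L + \<delta>) + 3 * real k * ln eps - K1 <= mE k eps (n + 4) + kap k eps"
  proof -
   have d: "8 * real k * (2 * real k * (EE x. U x) + (a * real n + C)) = 8 * real k * (2 * real k * (EE x. U x) + C) + 8 * real k * (a * real n)"
    by (simp add: algebra_simps)
   show ?thesis using e1 e2 e3 e6 unfolding kp K1_def d by linarith
  qed
  then have e7: "L * real N - \<tau> / 2 * real N - (\<bar>K1\<bar> + \<bar>16 * real k * (L + \<delta>)\<bar>) <= mE k eps (n + 4) + kap k eps"
   using e4 by linarith
  have "(L - \<tau>) * real (Suc (n + 4)) <= mE k eps (n + 4) + kap k eps"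
  proof -
   have "(L - \<tau>) * real (Suc (n + 4)) = L * real N - \<tau> * real N + 3 * L - 3 * \<tau>" by (simp add: n algebra_simps)
   then show ?thesis using e7 e5 \<tau> unfolding K2_def by linarith
  qed
  then have "L - \<tau> <= (mE k eps (n + 4) + kap k eps) / real (Suc (n + 4))" by (subst pos_le_divide_eq) auto
  then have "ereal (L - \<tau>) <= ereal ((mE k eps (n + 4) + kap k eps) / real (Suc (n + 4)))" by simp
  also have "... <= lam k eps" by (rule lam_ge_minor[OF eps(1) eps1])
  finally show ?thesis .
 qed
 have e1: "ER eps. 0 < eps \<and> eps <= eps0" using eps0(1) by (intro eventually_at_rightI[of 0 eps0]) auto
 have lt: "filterlim (%eps::real. - ln eps) at_top (at_right 0)" by real_asymp
 have e2: "ER eps::real. (2 * K2 / \<tau> + 2) / M <= - ln eps" using lt unfolding filterlim_at_top by (rule spec)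
 show ?thesis
  using e1 e2 lower_qq[OF fin \<delta>(1) M(1)]
 proof eventually_elim
  case (elim eps)
  have w: "2 * K2 / \<tau> + 2 <= M * (- ln eps)" using elim(2) M(1) by (simp add: pos_divide_le_eq mult.commute)
  show ?case by (rule core[OF conjunct1[OF elim(1)] conjunct2[OF elim(1)] w elim(3)])
 qed
qed

end

section \<open>From sums of exponents to single exponents\<close>

definition rate :: "nat => real => ereal" where "rate n x = ereal (1 / real n) * log_ext x"

lemma rate_eq: "0 < n ==> rate n x = (if x = 0 then - \<infinity> else ereal (ln x / real n))"
 by (simp add: rate_def log_ext_def)

lemma rate_mono: "0 < n ==> 0 <= x ==> x <= y ==> rate n x <= rate n y"
 by (auto simp: rate_eq divide_right_mono)

text \<open>In \<open>ereal\<close> the difference of \<open>- \<infinity>\<close> with itself is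
  \<open>\<infinity>\<close>; once a sum is \<open>- \<infinity>\<close>, all later exponents are
  \<open>- \<infinity>\<close>.\<close>

definition mu :: "(nat => ereal) => nat => ereal" where
 "mu \<Lambda> j = (if \<Lambda> j = - \<infinity> then - \<infinity> else \<Lambda> (Suc j) - \<Lambda> j)"

lemma last_finite:
 fixes \<Lambda> :: "nat => ereal"
 assumes "\<Lambda> 0 \<noteq> - \<infinity>" "\<Lambda> j = - \<infinity>"
 shows "\<exists>i<j. \<Lambda> i \<noteq> - \<infinity> \<and> \<Lambda> (Suc i) = - \<infinity>"
 using assms(2)
proof (induction j)
 case (Suc j)
 show ?case
 proof (cases "\<Lambda> j = - \<infinity>")
  case True
  from Suc.IH[OF this] obtain i where "i < j" "\<Lambda> i \<noteq> - \<infinity>" "\<Lambda> (Suc i) = - \<infinity>" by (elim exE conjE)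
  then show ?thesis by (intro exI[of _ i]) simp
 next
  case False
  then show ?thesis using Suc.prems by (intro exI[of _ j]) simp
 qed
qed (use assms(1) in simp)

text \<open>The factor \<open>(fact k)^2\<close> disappears at rate \<open>1 / n\<close>, so
  \<open>p k\<close> and the products of the \<open>s\<close> have the same limits, and
  \<open>s n j\<close> is a quotient of consecutive products. Where the sum is already
  \<open>- \<infinity>\<close>, monotonicity compares \<open>s n j\<close> with the last index
  \<open>i\<close> whose sum is finite: there the difference of the sums is
  \<open>- \<infinity>\<close>.\<close>

lemma rate_factor_tendsto:
 fixes s :: "nat => nat => real" and p :: "nat => nat => real"
 assumes s: "\<And>n i. 0 < n ==> 0 <= s n i" "\<And>n i j. 0 < n ==> i <= j ==> s n j <= s n i"
  and p: "\<And>n k. 0 < n ==> (\<Prod>i<k. s n i) <= p k n" "\<And>n k. 0 < n ==> p k n <= (fact k)\<^sup>2 * (\<Prod>i<k. s n i)"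
  and lim: "\<And>k. (%n. rate n (p k n)) ----> \<Lambda> k" and fin: "\<And>k. \<Lambda> k < \<infinity>"
 shows "(%n. rate n (s n j)) ----> mu \<Lambda> j" and "\<Lambda> 0 = 0"
proof -
 define P where "P k n = (\<Prod>i<k. s n i)" for k n
 have P0: "0 <= P k n" if "0 < n" for k n unfolding P_def by (rule prod_nonneg) (use s(1)[OF that] in simp)
 have ev: "\<forall>\<^sub>F n::nat in sequentially. 0 < n" by (rule eventually_gt_at_top)
 have limP: "(%n. rate n (P k n)) ----> \<Lambda> k" for k
 proof (rule tendsto_sandwich[where h="%n. rate n (p k n)" and f="%n. rate n (p k n) - ereal (ln ((fact k)\<^sup>2) / real n)"])
  have "(%n. ln ((fact k)\<^sup>2 :: real) / real n) ----> 0" by (rule lim_const_over_n)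
  then have "(%n. ereal (ln ((fact k)\<^sup>2 :: real) / real n)) ----> ereal 0" by (subst lim_ereal)
  from tendsto_diff_ereal_general[OF lim this] show "(%n. rate n (p k n) - ereal (ln ((fact k)\<^sup>2) / real n)) ----> \<Lambda> k" by (simp add: zero_ereal_def[symmetric])
  show "EV n. rate n (p k n) - ereal (ln ((fact k)\<^sup>2) / real n) <= rate n (P k n)"
   using ev
  proof eventually_elim
   case (elim n)
   show ?case
   proof (cases "P k n = 0")
    case True
    then have "p k n = 0" using p(1)[OF elim, of k, folded P_def] p(2)[OF elim, of k, folded P_def] by simp
    then show ?thesis using elim by (simp add: rate_eq)
   next
    case False
    then have Pp: "0 < P k n" using P0[OF elim, of k] by simp
    then have pp: "0 < p k n" using p(1)[OF elim, of k] by (simp add: P_def)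
    have "ln (p k n) <= ln ((fact k)\<^sup>2 * P k n)" using p(2)[OF elim, of k] pp by (intro ln_mono) (simp_all add: P_def)
    also have "... = ln ((fact k)\<^sup>2) + ln (P k n)" using Pp by (intro ln_mult_pos) simp_all
    finally have "ln (p k n) / real n <= (ln ((fact k)\<^sup>2) + ln (P k n)) / real n" by (rule divide_right_mono) simp
    then have "ln (p k n) / real n - ln ((fact k)\<^sup>2) / real n <= ln (P k n) / real n" by (simp add: add_divide_distrib)
    then show ?thesis using elim pp Pp by (simp add: rate_eq)
   qed
  qed
  show "EV n. rate n (P k n) <= rate n (p k n)"
   using ev
  proof eventually_elim
   case (elim n)
   show ?case by (rule rate_mono[OF elim P0[OF elim] p(1)[OF elim, of k, folded P_def]])
  qed
 qed (rule lim)
 show L0: "\<Lambda> 0 = 0"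
 proof (rule LIMSEQ_unique[OF limP])
  have "EV n. (0::ereal) = rate n (P 0 n)" using ev by eventually_elim (simp add: P_def rate_eq)
  then show "(%n. rate n (P 0 n)) ----> 0" by (rule Lim_transform_eventually[OF tendsto_const])
 qed
 have fin_case: "(%n. rate n (s n j)) ----> \<Lambda> (Suc j) - \<Lambda> j" if nf: "\<Lambda> j \<noteq> - \<infinity>" for j
 proof (rule Lim_transform_eventually)
  show "(%n. rate n (P (Suc j) n) - rate n (P j n)) ----> \<Lambda> (Suc j) - \<Lambda> j"
   by (rule tendsto_diff_ereal_general[OF limP limP]) (use nf fin[of j] in auto)
  have "EV n. - \<infinity> < rate n (P j n)" by (rule order_tendstoD(1)[OF limP]) (use nf in auto)
  then show "EV n. rate n (P (Suc j) n) - rate n (P j n) = rate n (s n j)"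
   using ev
  proof eventually_elim
   case (elim n)
   then have "P j n \<noteq> 0" by (auto simp: rate_eq)
   then have Pp: "0 < P j n" using P0[OF elim(2), of j] by simp
   have PS: "P (Suc j) n = P j n * s n j" by (simp add: P_def)
   show ?case
   proof (cases "s n j = 0")
    case True
    then show ?thesis using elim(2) Pp by (simp add: rate_eq PS)
   next
    case False
    then have "0 < s n j" using s(1)[OF elim(2), of j] by simp
    then show ?thesis using elim(2) Pp by (simp add: rate_eq PS ln_mult_pos add_divide_distrib)
   qed
  qed
 qed
 show "(%n. rate n (s n j)) ----> mu \<Lambda> j"
 proof (cases "\<Lambda> j = - \<infinity>")
  case False
  then show ?thesis using fin_case[OF False] by (simp add: mu_def)
 next
  case True
  obtain i where i: "i < j" "\<Lambda> i \<noteq> - \<infinity>" "\<Lambda> (Suc i) = - \<infinity>"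
  proof -
   have "\<Lambda> 0 \<noteq> - \<infinity>" using L0 by simp
   from last_finite[of \<Lambda> j, OF this True] show ?thesis by (elim exE conjE) (rule that)
  qed
  have "\<Lambda> (Suc i) - \<Lambda> i = - \<infinity>" using i fin[of i] by (cases "\<Lambda> i") auto
  then have si: "(%n. rate n (s n i)) ----> - \<infinity>" using fin_case[OF i(2)] by simp
  have le: "EV n. rate n (s n j) <= rate n (s n i)"
   using ev
  proof eventually_elim
   case (elim n)
   show ?case by (rule rate_mono[OF elim s(1)[OF elim] s(2)[OF elim less_imp_le[OF i(1)]]])
  qed
  have "(%n. rate n (s n j)) ----> - \<infinity>"
   by (rule tendsto_sandwich[OF _ le tendsto_const si]) simp
  then show ?thesis using True by (simp add: mu_def)
 qed
qed

lemma mu_less_top: "(\<And>k. \<Lambda> k < \<infinity>) ==> mu \<Lambda> j < \<infinity>"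
 unfolding mu_def by (cases "\<Lambda> j"; cases "\<Lambda> (Suc j)") (auto simp: less_le)

lemma has_lyapunov_exponent_unique:
 assumes M: "prob_space M" and 1: "has_lyapunov_exponent M T A j \<mu>"
 shows "lyapunov_exponent M T A j = \<mu>"
 unfolding lyapunov_exponent_def
proof (rule the_equality[where P="has_lyapunov_exponent M T A j"])
 show "has_lyapunov_exponent M T A j \<mu>" by (rule 1)
next
 fix \<nu> assume 2: "has_lyapunov_exponent M T A j \<nu>"
 have "AE x in M. \<nu> = \<mu>"
  using conjunct2[OF 1[unfolded has_lyapunov_exponent_def]] conjunct2[OF 2[unfolded has_lyapunov_exponent_def]]
  by eventually_elim (rule LIMSEQ_unique)
 then show "\<nu> = \<mu>" unfolding prob_space.AE_const[OF M] .
qed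

context perturbation begin

lemma qq_nuclear:
 assumes x: "x \<in> space PB" and n: "0 < n"
 shows "nuclear (qq eps n x)"
proof -
 obtain m where m: "n = 1 + m" using n by (metis Suc_eq_plus1_left gr0_implies_Suc)
 have "qq eps n x = qq eps m ((TB ^^ 1) x) oL gen eps x"
  unfolding m cocycle_add One_nat_def cocycle_1 ..
 then show ?thesis using nuclear_comp[OF nuclear_SHS[OF gen_SHS[OF x]]] by simp
qed

lemma lam_less_top: "0 <= eps ==> lam k eps < \<infinity>"
 unfolding lam_def by (rule submult_process.lyap_less_top[OF process_all])

lemma AE_rate:
 assumes eps: "0 <= eps"
 shows "AE x in PB. x \<in> space PB \<and> (\<forall>j. (%n. rate n (sval (qq eps n x) j)) ----> mu (%k. lam k eps) j) \<and> lam 0 eps = 0"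
proof -
 have "AE x in PB. \<forall>k. (%n. rate n (vol k (qq eps n x))) ----> lam k eps"
  unfolding AE_all_countable rate_def lam_def by (intro allI submult_process.kingman[OF process_all[OF eps]])
 then show ?thesis
  using AE_space
 proof eventually_elim
  case (elim x)
  note nuc = qq_nuclear[OF elim(2)]
  note r = rate_factor_tendsto[where s="%n. sval (qq eps n x)" and p="%k n. vol k (qq eps n x)" and \<Lambda>="%k. lam k eps",
   OF sval_nonneg sval_antimono[OF nuc] prod_sval_le_vol[OF nuc] vol_le_prod_sval[OF nuc] elim(1)[rule_format] lam_less_top[OF eps]]
  show ?case using elim(2) r by (intro conjI allI)
 qed
qed

lemma has_exponent:
 assumes eps: "0 <= eps"
 shows "has_lyapunov_exponent PB TB (gen eps) (Suc j) (mu (%k. lam k eps) j)"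
 unfolding has_lyapunov_exponent_def
proof
 show "mu (%k. lam k eps) j < \<infinity>" by (rule mu_less_top) (rule lam_less_top[OF eps])
 show "AE x in PB. (%n. ereal (1 / real n) * log_ext (singular_value (Suc j) (qq eps n x))) ----> mu (%k. lam k eps) j"
  using AE_rate[OF eps]
 proof eventually_elim
  case (elim x)
  have x: "x \<in> space PB" and l: "(%n. rate n (sval (qq eps n x) j)) ----> mu (%k. lam k eps) j" using elim by auto
  have "\<forall>\<^sub>F n::nat in sequentially. 0 < n" by (rule eventually_gt_at_top)
  then have "EV n. rate n (sval (qq eps n x) j) = ereal (1 / real n) * log_ext (singular_value (Suc j) (qq eps n x))"
   by eventually_elim (simp add: rate_def singular_value_eq[OF qq_nuclear[OF x]])
  from Lim_transform_eventually[OF l this] show ?case .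
 qed
qed

text \<open>With \<open>eps = 0\<close> the noise is multiplied by 0, so a limit valid for almost
  every pair is valid for almost every base point.\<close>

lemma has_exponent_base: "has_lyapunov_exponent P \<sigma> A (Suc j) (mu (%k. lam k 0) j)"
proof -
 have "(TB ^^ n) x = ((\<sigma> ^^ n) (fst x), snd ((TB ^^ n) x))" for n x by (simp add: TB_iter)
 then have coc: "qq 0 n (\<omega>, d) = cocycle \<sigma> A n \<omega>" for n \<omega> d
  by (induction n) (simp_all add: gen_iter)
 have pp: "pair_sigma_finite P B.Q"
  by (intro pair_sigma_finite.intro prob_space_imp_sigma_finite PP.prob_space_axioms B.Q.prob_space_axioms)
 have "AE x in P \<Otimes>\<^sub>M B.Q. (%n. ereal (1 / real n) * log_ext (singular_value (Suc j) (qq 0 n x))) ----> mu (%k. lam k 0) j"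
  using has_exponent[of 0 j] by (simp add: has_lyapunov_exponent_def PB_eq)
 from pair_sigma_finite.AE_pair[OF pp this]
 have "AE \<omega> in P. AE d in B.Q. (%n. ereal (1 / real n) * log_ext (singular_value (Suc j) (cocycle \<sigma> A n \<omega>))) ----> mu (%k. lam k 0) j"
  unfolding coc .
 then have "AE \<omega> in P. (%n. ereal (1 / real n) * log_ext (singular_value (Suc j) (cocycle \<sigma> A n \<omega>))) ----> mu (%k. lam k 0) j"
  by (simp only: B.Q.AE_const)
 then show ?thesis using has_exponent[of 0 j] by (simp add: has_lyapunov_exponent_def)
qed

text \<open>The lower half is needed only for a finite limit; at \<open>- \<infinity>\<close> the
  upper half is the whole statement.\<close>

lemma lam_tendsto: "((%eps. lam k eps) \<longlongrightarrow> lam k 0) (at_right 0)"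
proof (rule order_tendstoI)
 fix c assume c: "c < lam k 0"
 have "lam k 0 \<noteq> \<infinity>" "lam k 0 \<noteq> - \<infinity>" using lam_less_top[of 0 k] c by auto
 then obtain L where L: "lam k 0 = ereal L" by (cases "lam k 0") auto
 obtain z where z: "c < ereal z" "ereal z < ereal L" using ereal_dense2[of c "ereal L"] c L by auto
 have "ER eps. ereal (L - (L - z)) <= lam k eps" by (rule lam_lower[OF L]) (use z in simp)
 then show "ER eps. c < lam k eps"
  by eventually_elim (use z(1) in \<open>auto intro: less_le_trans\<close>)
qed (rule lam_upper)

text \<open>Inherited from the ordering of the singular values through their almost sure
  rates.\<close>

lemma mu_mono:
 assumes eps: "0 <= eps" and ij: "i <= j"
 shows "mu (%k. lam k eps) j <= mu (%k. lam k eps) i"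
proof -
 have "AE x in PB. mu (%k. lam k eps) j <= mu (%k. lam k eps) i"
  using AE_rate[OF eps]
 proof eventually_elim
  case (elim x)
  have x: "x \<in> space PB" using elim by simp
  have "\<forall>n\<ge>1. rate n (sval (qq eps n x) j) <= rate n (sval (qq eps n x) i)"
  proof (intro allI impI rate_mono sval_nonneg sval_antimono ij)
   fix n :: nat assume "1 <= n"
   then show "0 < n" "nuclear (qq eps n x)" using qq_nuclear[OF x, of n] by auto
  qed
  then show ?case using elim by (intro LIMSEQ_le[of "%n. rate n (sval (qq eps n x) j)" _ "%n. rate n (sval (qq eps n x) i)"]) auto
 qed
 then show ?thesis by (simp only: E.AE_const)
qed

text \<open>The same division as in \<open>rate_factor_tendsto\<close>: differences of convergent
  sums as long as the limit sum is finite, and beyond that a squeeze below the exponent at the last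
  finite index, which already tends to \<open>- \<infinity>\<close>.\<close>

lemma mu_tendsto: "((%eps. mu (%k. lam k eps) j) \<longlongrightarrow> mu (%k. lam k 0) j) (at_right 0)"
proof -
 have fin_case: "((%eps. mu (%k. lam k eps) j) \<longlongrightarrow> lam (Suc j) 0 - lam j 0) (at_right 0)" if nf: "lam j 0 \<noteq> - \<infinity>" for j
 proof (rule Lim_transform_eventually)
  show "((%eps. lam (Suc j) eps - lam j eps) \<longlongrightarrow> lam (Suc j) 0 - lam j 0) (at_right 0)"
   by (rule tendsto_diff_ereal_general[OF lam_tendsto lam_tendsto]) (use nf lam_less_top[of 0 j] in auto)
  have "ER eps. - \<infinity> < lam j eps" by (rule order_tendstoD(1)[OF lam_tendsto]) (use nf in auto)
  then show "ER eps. lam (Suc j) eps - lam j eps = mu (%k. lam k eps) j"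
   by eventually_elim (auto simp: mu_def)
 qed
 show ?thesis
 proof (cases "lam j 0 = - \<infinity>")
  case False
  then show ?thesis using fin_case[OF False] by (simp add: mu_def)
 next
  case True
  have "AE x in PB. lam 0 0 = 0" using AE_rate[of 0] by (auto elim: eventually_mono)
  then have "lam 0 0 = 0" by (simp only: E.AE_const)
  then obtain i where i: "i < j" "lam i 0 \<noteq> - \<infinity>" "lam (Suc i) 0 = - \<infinity>"
  proof -
   assume "lam 0 0 = 0"
   then have "lam 0 0 \<noteq> - \<infinity>" by simp
   from last_finite[of "%k. lam k 0" j, OF this True] show ?thesis by (elim exE conjE) (rule that)
  qed
  have "lam (Suc i) 0 - lam i 0 = - \<infinity>" using i lam_less_top[of 0 i] by (cases "lam i 0") auto
  then have si: "((%eps. mu (%k. lam k eps) i) \<longlongrightarrow> - \<infinity>) (at_right 0)" using fin_case[OF i(2)] by simp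
  have "ER eps::real. 0 < eps" by (rule eventually_at_right_less)
  then have le: "ER eps. mu (%k. lam k eps) j <= mu (%k. lam k eps) i"
   by eventually_elim (rule mu_mono[OF less_imp_le less_imp_le[OF i(1)]])
  have "((%eps. mu (%k. lam k eps) j) \<longlongrightarrow> - \<infinity>) (at_right 0)"
   by (rule tendsto_sandwich[OF _ le tendsto_const si]) simp
  then show ?thesis using True by (simp add: mu_def)
 qed
qed

end

text \<open>A value of \<open>integral_ext\<close> below \<open>\<infinity>\<close> bounds the
  positive part of the logarithm only. That is enough, because \<open>ln (1 + S)\<close> is at most
  \<open>ln 2\<close> plus this positive part.\<close>

lemma integrable_ln_one_plus:
 assumes S [measurable]: "S \<in> borel_measurable M" and S0: "\<And>x. 0 <= S x" and M: "finite_measure M"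
  and int: "integral_ext M (%x. log_ext (S x)) < \<infinity>"
 shows "integrable M (%x. ln (1 + S x :: real))"
proof (rule integrableI_nonneg)
 have lm [measurable]: "(%x. log_ext (S x)) \<in> borel_measurable M" unfolding log_ext_def by measurable
 have fin: "(\<integral>\<^sup>+x. e2ennreal (log_ext (S x)) \<partial>M) < \<infinity>"
 proof (rule ccontr)
  assume "\<not> ?thesis"
  then have "(\<integral>\<^sup>+x. e2ennreal (log_ext (S x)) \<partial>M) = \<infinity>" by (simp add: less_top[symmetric])
  then show False using int unfolding integral_ext_def by simp
 qed
 have "(\<integral>\<^sup>+x. ennreal (ln (1 + S x)) \<partial>M) <= (\<integral>\<^sup>+x. ennreal (ln 2) + e2ennreal (log_ext (S x)) \<partial>M)"
 proof (rule nn_integral_mono)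
  fix x
  show "ennreal (ln (1 + S x)) <= ennreal (ln 2) + e2ennreal (log_ext (S x))"
  proof (cases "S x <= 1")
   case True
   then have "ennreal (ln (1 + S x)) <= ennreal (ln 2)" using S0[of x] by (intro ennreal_leI ln_mono) auto
   then show ?thesis by (rule order_trans) simp
  next
   case False
   have "ln (1 + S x) <= ln (2 * S x)" using False by (intro ln_mono) auto
   also have "... = ln 2 + ln (S x)" using False by (intro ln_mult_pos) auto
   finally have "ennreal (ln (1 + S x)) <= ennreal (ln 2 + ln (S x))" by (rule ennreal_leI)
   also have "... = ennreal (ln 2) + ennreal (ln (S x))" using False by (intro ennreal_plus) auto
   also have "ennreal (ln (S x)) = e2ennreal (log_ext (S x))" using False by (simp add: log_ext_def)
   finally show ?thesis .
  qed
 qed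
 also have "... = ennreal (ln 2) * emeasure M (space M) + (\<integral>\<^sup>+x. e2ennreal (log_ext (S x)) \<partial>M)"
  by (subst nn_integral_add) auto
 also have "... < \<infinity>"
 proof -
  have "emeasure M (space M) < \<infinity>"
   using finite_measure.emeasure_finite[OF M, of "space M"] by (simp add: less_top[symmetric])
  then show ?thesis using fin by (simp add: ennreal_add_less_top ennreal_mult_less_top)
 qed
 finally show "(\<integral>\<^sup>+x. ennreal (ln (1 + S x)) \<partial>M) < \<infinity>" .
qed (use S0 in auto)

theorem theorem1:
 fixes e :: "nat \<Rightarrow> 'h::{real_inner,complete_space}"
  and P :: "'w measure"
  and \<sigma> :: "'w \<Rightarrow> 'w"
  and A :: "'w \<Rightarrow> 'h \<Rightarrow>\<^sub>L 'h"
  and \<gamma> :: "('h \<Rightarrow>\<^sub>L 'h) measure"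
  and j :: nat
 assumes "orthonormal_basis e"
  and "gaussian_SHS_law e \<gamma>"
  and "invertible_measurable P \<sigma>"
  and "ergodic_invariant P \<sigma>"
  and "A \<in> P \<rightarrow>\<^sub>M SHS_space e"
  and "integral_ext P (\<lambda>\<omega>. log_ext (SHS_norm e (A \<omega>))) < \<infinity>"
  and "j \<ge> 1"
 shows "has_lyapunov_exponent P \<sigma> A j (lyapunov_exponent P \<sigma> A j)
  \<and> (\<forall>\<epsilon>>0. has_lyapunov_exponent (perturbed_measure P \<gamma>) (perturbed_shift \<sigma>)
     (perturbed_generator A \<epsilon>) j
     (lyapunov_exponent (perturbed_measure P \<gamma>) (perturbed_shift \<sigma>) (perturbed_generator A \<epsilon>) j))
  \<and> ((\<lambda>\<epsilon>. lyapunov_exponent (perturbed_measure P \<gamma>) (perturbed_shift \<sigma>) (perturbed_generator A \<epsilon>) j)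
     \<longlongrightarrow> lyapunov_exponent P \<sigma> A j) (at_right 0)"
proof -
 have P: "prob_space P" using assms(4) by (simp add: ergodic_invariant_def)
 interpret onb e by unfold_locales (rule assms(1))
 have "(%\<omega>. SHS_norm e (A \<omega>)) \<in> borel_measurable P" by (rule measurable_compose[OF assms(5) SHS_norm_measurable])
 from integrable_ln_one_plus[OF this SHS_norm_nonneg prob_space.finite_measure[OF P] assms(6)]
 interpret perturbation e \<gamma> P \<sigma> A using assms(2,4,5) by unfold_locales
 obtain i where i: "j = Suc i" using assms(7) by (cases j) auto
 have base: "lyapunov_exponent P \<sigma> A j = mu (%k. lam k 0) i"
  unfolding i by (rule has_lyapunov_exponent_unique[OF P has_exponent_base])
 have pert: "lyapunov_exponent PB TB (gen eps) j = mu (%k. lam k eps) i" if "0 < eps" for eps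
  unfolding i by (rule has_lyapunov_exponent_unique[OF E.prob_space_axioms has_exponent]) (use that in simp)
 have "ER eps::real. 0 < eps" by (rule eventually_at_right_less)
 then have "ER eps. mu (%k. lam k eps) i = lyapunov_exponent PB TB (gen eps) j"
  by eventually_elim (simp add: pert)
 from Lim_transform_eventually[OF mu_tendsto this]
 have lim: "((%eps. lyapunov_exponent PB TB (gen eps) j) \<longlongrightarrow> lyapunov_exponent P \<sigma> A j) (at_right 0)" unfolding base .
 have ex: "has_lyapunov_exponent PB TB (gen eps) j (lyapunov_exponent PB TB (gen eps) j)" if "0 < eps" for eps
  unfolding pert[OF that] unfolding i by (rule has_exponent) (use that in simp)
 have "has_lyapunov_exponent P \<sigma> A j (lyapunov_exponent P \<sigma> A j)"
  unfolding base unfolding i by (rule has_exponent_base)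
 then show ?thesis using lim ex by (intro conjI allI impI)
qed

end
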